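(* Let $n\ge1$ and $d\geq0$. Let $\mathbf a=(i,\alpha)$ and $\mathbf b=(j,\beta)$ be elements of $\mathcal{P}_{n,d}^\Phi$ with $q=\mathrm{rank}\,\alpha$, $r=\mathrm{rank}\,\beta$, where $q\geq r$, and $i\leq j$ if $q=r$. Then the principal congruences on $\mathcal{P}_{n,d}^\Phi$ are as follows. (All matrix entries not explicitly specified are equal to $\Delta$; column indices $l$ range over $\{0,\dots,d\}$.) (i) If $\mathbf a=\mathbf b$, then $(\mathbf a,\mathbf b)^\sharp=\Delta_{\mathcal{P}_{n,d}^\Phi}$. Also $(\mathbf 0,\mathbf 0)^\sharp=\Delta_{\mathcal{P}_{n,d}^\Phi}$. (ii) If [$q\geq2$ and $(\mathbf a,\mathbf b)\notin\mathscr H$], or if [$q=r\leq1$ and ($i\neq j$ or $\widehat\alpha\neq\widehat\beta$)], or if [$q=1$, $r=0$ and ($j\geq i$ or $\widehat\alpha\neq\beta$)], then $(\mathbf a,\mathbf b)^\sharp=R_{I_{qi}\cup I_{rj}}$. Also $(\mathbf a,\mathbf 0)^\sharp=R_{I_{qi}}$. (iii) If $q\geq3$, $(\mathbf a,\mathbf b)\in\mathscr H$ and $\mathbf a\neq\mathbf b$, then with $N$ the normal closure of $\partial(\alpha,\beta)$ in $\mathcal S_q$, $(\mathbf a,\mathbf b)^\sharp=\mathrm{cg}(M)$, where $M_{ql}=N$ for $l\ge i$ and $M_{sl}=R$ for $0\le s<q$, $l\geq i$. (iv) If $q=2$, $(\mathbf a,\mathbf b)\in\mathscr H$ and $\mathbf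 a\neq\mathbf b$, then $(\mathbf a,\mathbf b)^\sharp=\mathrm{cg}(M)$, where $M_{2l}=\mathcal S_2$ and $M_{1l}=\mu$ for $i\le l\le d$, $M_{0l}=\mu$ for $i\le l\leq d-1$, and $M_{0d}=R$. (v) If $q=r=1$ and $i=j$, and if $(\alpha,\beta)$ belongs to $\mu_1\setminus(\mu^\uparrow\cup\mu^\downarrow)$, $\mu^\uparrow\setminus\Delta_{D_1}$ or $\mu^\downarrow\setminus\Delta_{D_1}$, then with $\zeta=\mu$, $\mu^\uparrow$ or $\mu^\downarrow$ respectively, $(\mathbf a,\mathbf b)^\sharp=\mathrm{cg}(M)$, where $M_{1i}=\zeta$, $M_{1l}=\mu$ for $i<l\le d$, $M_{0l}=\mu$ for $i\le l\le d-1$, and $M_{0d}=R$. (vi) If $q=1$, $r=0$, $i=j+1$ and $\widehat\alpha=\beta$, then $(\mathbf a,\mathbf b)^\sharp=\mathrm{cg}(M)$, where $M_{1l}=\mu$ for $i\le l\le d$, $M_{0l}=\mu$ for $j\le l\le d-1$, and $M_{0d}=R$. (vii) If $q=1$, $r=0$, $i>j+1$ and $\widehat\alpha=\beta$, then $(\mathbf a,\mathbf b)^\sharp=\mathrm{cg}(M)$, where $M_{1i}=\mu$, $M_{1l}=R$ for $i<l\le d$, $M_{0j}=\mu$, and $M_{0l}=R$ for $j<l\le d$. The congruences described in items (i)–(vii) exhaust all principal congruences on $\mathcal{P}_{n,d}^\Phi$.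
   Context: **Monoids.** Let $[n]=\{1,\dots,n\}$, with disjoint copies $[n]'$, $[n]''$. The partition monoid $\mathcal{P}_n$ consists of all set partitions of $[n]\cup[n]'$. For $\alpha,\beta\in\mathcal{P}_n$ the product graph $\Gamma(\alpha,\beta)$ has vertex set $[n]\cup[n]''\cup[n]'$; two vertices of $[n]\cup[n]''$ are joined when they lie in a common block of $\alpha$ after renaming each $x'$ of $\alpha$ to $x''$, and two vertices of $[n]''\cup[n]'$ are joined when they lie in a common block of $\beta$ after renaming each $x$ of $\beta$ to $x''$. In $\alpha\beta$, $x,y\in[n]\cup[n]'$ are in the same block iff they are in the same component of $\Gamma(\alpha,\beta)$; $\Phi(\alpha,\beta)$ is the number of components of $\Gamma(\alpha,\beta)$ contained in $[n]''$. The $d$-twisted partition monoid is $\mathcal{P}_{n,d}^\Phi=(\{0,\dots,d\}\times\mathcal{P}_n)\cup\{\mathbf 0\}$, where $\mathbf 0$ is a zero element and $(i,\alpha)\cdot(j,\beta)=(i+j+\Phi(\alpha,\beta),\alpha\beta)$ if $i+j+\Phi(\alpha,\beta)\le d$, and $\mathbf 0$ otherwise. **Notation.** A transversal of $\alpha\in\mathcal P_n$ is a block meeting both $[n]$ and $[n]'$; $\mathrm{rank}\,\alpha$ is the number of transversals. $\mathscr L,\mathscr R,\mathscr H$ are Green's relations (on $\mathcal{P}_n$ or $\mathcal{P}_{n,d}^\Phi$ as appropriate; $(i,\alpha)\mathrel{\mathscr H}(j,\beta)$ in $\mathcal{P}_{n,d}^\Phi$ iff $i=j$ and $\alpha\mathrel{\mathscr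 H}\beta$ in $\mathcal{P}_n$). $D_q=\{\alpha\in\mathcal{P}_n:\mathrm{rank}\,\alpha=q\}$, and in $\mathcal{P}_{n,d}^\Phi$, $D_{qi}=\{i\}\times D_q$ and $I_{qi}=\bigcup\{D_{rj}:0\le r\le q,\ i\le j\le d\}\cup\{\mathbf 0\}$. $\widehat\alpha\in D_0$ is obtained from $\alpha$ by splitting each transversal $A\cup B'$ into the two blocks $A$ and $B'$. If $\alpha\mathrel{\mathscr H}\beta$ have rank $q\ge2$ and $\alpha$ has transversals $A_k\cup B_k'$ ($1\le k\le q$), then $\beta$ has transversals $A_k\cup B_{k\pi}'$ for some $\pi\in\mathcal S_q$ and otherwise the same blocks; put $\partial(\alpha,\beta)=\pi$ (well defined up to conjugacy in the symmetric group $\mathcal S_q$). $\Delta_X$ is the equality relation on $X$; for an ideal $I$ of a monoid $S$, $R_I=\Delta_S\cup(I\times I)$; $(x,y)^\sharp$ is the congruence generated by the pair $(x,y)$ (a principal congruence). $\mu_1=\{(\alpha,\beta):\mathrm{rank}\,\alpha,\mathrm{rank}\,\beta\le1,\ \widehat\alpha=\widehat\beta\}\cup\Delta_{\mathcal P_n}$, $\mu^\uparrow=\{(\alpha,\beta)\in D_1\times D_1:\widehat\alpha=\widehat\beta,\ \alpha\mathrel{\mathscr R}\beta\}$, $\mu^\downarrow=\{(\alpha,\beta)\in D_1\times D_1:\widehat\alpha=\widehat\beta,\ \alpha\mathrel{\mathscr L}\beta\}$. **Congruence of a matrix.** Let $M=(M_{qi})_{0\le q\le n,\,0\le i\le d}$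 be one of the matrices in the theorem, whose entries are symbols from $\{\Delta,\mu^\uparrow,\mu^\downarrow,\mu,R\}$ or, in rows $q\geq2$, non-trivial normal subgroups $N$ of $\mathcal S_q$. For $q\in\{0,1\}$ let $\min_q(M)$ be the least $i$ with $M_{qi}=R$ if it exists, and $d+1$ otherwise. Then $\mathrm{cg}(M)$ is the set of pairs $((i,\alpha),(j,\beta))$ such that, with $q=\mathrm{rank}\,\alpha$ and $r=\mathrm{rank}\,\beta$, one of the following holds: (1) $M_{qi}=M_{rj}=\Delta$, $i=j$, $\alpha=\beta$; (2) $M_{qi}=M_{rj}=R$; (3) $M_{qi}=M_{rj}=N$ (a normal subgroup), $i=j$, $\alpha\mathrel{\mathscr H}\beta$, $\partial(\alpha,\beta)\in N$; (4) $M_{qi}=M_{rj}=\mu^\downarrow$, $\widehat\alpha=\widehat\beta$, $\alpha\mathrel{\mathscr L}\beta$; (5) $M_{qi}=M_{rj}=\mu^\uparrow$, $\widehat\alpha=\widehat\beta$, $\alpha\mathrel{\mathscr R}\beta$; (6) $M_{qi}=M_{rj}=\mu$, $\widehat\alpha=\widehat\beta$, and either $(q,i)=(r,j)$ or $i-j=\min_q(M)-\min_r(M)$; together with the pairs (7) $((i,\alpha),\mathbf 0)$ and $(\mathbf 0,(i,\alpha))$ with $M_{qi}=R$; and (8) $(\mathbf 0,\mathbf 0)$. *)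

theory Defs
  imports "HOL-Algebra.Sym_Groups" "HOL-Library.Disjoint_Sets"
begin

definition congruence_on :: "('a, 'b) monoid_scheme \<Rightarrow> ('a \<times> 'a) set \<Rightarrow> bool" where
  "congruence_on S \<theta> \<longleftrightarrow> equiv (carrier S) \<theta> \<and>
     (\<forall>(x, y) \<in> \<theta>. \<forall>s \<in> carrier S.
        (s \<otimes>\<^bsub>S\<^esub> x, s \<otimes>\<^bsub>S\<^esub> y) \<in> \<theta> \<and> (x \<otimes>\<^bsub>S\<^esub> s, y \<otimes>\<^bsub>S\<^esub> s) \<in> \<theta>)"

definition cong_gen :: "('a, 'b) monoid_scheme \<Rightarrow> 'a \<Rightarrow> 'a \<Rightarrow> ('a \<times> 'a) set" where
  "cong_gen S x y = \<Inter>{\<theta>. congruence_on S \<theta> \<and> (x, y) \<in> \<theta>}"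

definition rees_cong :: "('a, 'b) monoid_scheme \<Rightarrow> 'a set \<Rightarrow> ('a \<times> 'a) set" where
  "rees_cong S I = Id_on (carrier S) \<union> I \<times> I"

definition green_L :: "('a, 'b) monoid_scheme \<Rightarrow> ('a \<times> 'a) set" where
  "green_L S = {(x, y) \<in> carrier S \<times> carrier S.
     (\<lambda>s. s \<otimes>\<^bsub>S\<^esub> x) ` carrier S = (\<lambda>s. s \<otimes>\<^bsub>S\<^esub> y) ` carrier S}"

definition green_R :: "('a, 'b) monoid_scheme \<Rightarrow> ('a \<times> 'a) set" where
  "green_R S = {(x, y) \<in> carrier S \<times> carrier S.
     (\<lambda>s. x \<otimes>\<^bsub>S\<^esub> s) ` carrier S = (\<lambda>s. y \<otimes>\<^bsub>S\<^esub> s) ` carrier S}"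

definition green_H :: "('a, 'b) monoid_scheme \<Rightarrow> ('a \<times> 'a) set" where
  "green_H S = green_L S \<inter> green_R S"

definition normal_closure :: "('a, 'b) monoid_scheme \<Rightarrow> 'a \<Rightarrow> 'a set" where
  "normal_closure G x = \<Inter>{N. N \<lhd> G \<and> x \<in> N}"

text \<open>\<open>Up x\<close>, \<open>Mid x\<close> and \<open>Low x\<close> stand for $x$, $x''$ and $x'$. Partitions involve only
  \<open>Up\<close> and \<open>Low\<close>; the \<open>Mid\<close> vertices occur in product graphs only.\<close>

datatype vertex = Up nat | Mid nat | Low nat

type_synonym vpart = "vertex set set"

definition verts :: "nat \<Rightarrow> vertex set" where
  "verts n = Up ` {1..n} \<union> Low ` {1..n}"

fun low_to_mid :: "vertex \<Rightarrow> vertex" where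
  "low_to_mid (Up x) = Up x"
| "low_to_mid (Mid x) = Mid x"
| "low_to_mid (Low x) = Mid x"

fun up_to_mid :: "vertex \<Rightarrow> vertex" where
  "up_to_mid (Up x) = Mid x"
| "up_to_mid (Mid x) = Mid x"
| "up_to_mid (Low x) = Low x"

definition pg_verts :: "nat \<Rightarrow> vertex set" where
  "pg_verts n = Up ` {1..n} \<union> Mid ` {1..n} \<union> Low ` {1..n}"

text \<open>The edge relation is symmetric, so that its reflexive-transitive closure is connectedness.\<close>

definition pg_edges :: "vpart \<Rightarrow> vpart \<Rightarrow> (vertex \<times> vertex) set" where
  "pg_edges \<alpha> \<beta> =
     (\<Union>B \<in> \<alpha>. (low_to_mid ` B) \<times> (low_to_mid ` B)) \<union> (\<Union>B \<in> \<beta>. (up_to_mid ` B) \<times> (up_to_mid ` B))"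

definition pg_components :: "nat \<Rightarrow> vpart \<Rightarrow> vpart \<Rightarrow> vertex set set" where
  "pg_components n \<alpha> \<beta> = pg_verts n // ((pg_edges \<alpha> \<beta>)\<^sup>* \<inter> pg_verts n \<times> pg_verts n)"

definition pprod :: "nat \<Rightarrow> vpart \<Rightarrow> vpart \<Rightarrow> vpart" where
  "pprod n \<alpha> \<beta> = {C \<inter> verts n | C. C \<in> pg_components n \<alpha> \<beta> \<and> C \<inter> verts n \<noteq> {}}"

definition floating :: "nat \<Rightarrow> vpart \<Rightarrow> vpart \<Rightarrow> nat" where
  "floating n \<alpha> \<beta> = card {C \<in> pg_components n \<alpha> \<beta>. C \<subseteq> Mid ` {1..n}}"

definition PM :: "nat \<Rightarrow> vpart monoid" where
  "PM n = \<lparr>carrier = {\<alpha>. partition_on (verts n) \<alpha>},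
           mult = pprod n,
           one = (\<lambda>x. {Up x, Low x}) ` {1..n}\<rparr>"

text \<open>The zero element is \<open>None\<close>, and \<open>Some (i, \<alpha>)\<close> is the pair $(i,\alpha)$.\<close>

type_synonym telem = "(nat \<times> vpart) option"

fun tmult :: "nat \<Rightarrow> nat \<Rightarrow> telem \<Rightarrow> telem \<Rightarrow> telem" where
  "tmult n d (Some (i, \<alpha>)) (Some (j, \<beta>)) =
     (if i + j + floating n \<alpha> \<beta> \<le> d
      then Some (i + j + floating n \<alpha> \<beta>, pprod n \<alpha> \<beta>) else None)"
| "tmult n d None _ = None"
| "tmult n d _ None = None"

definition TPM :: "nat \<Rightarrow> nat \<Rightarrow> telem monoid" where
  "TPM n d = \<lparr>carrier = Some ` ({0..d} \<times> carrier (PM n)) \<union> {None},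
              mult = tmult n d,
              one = Some (0, \<one>\<^bsub>PM n\<^esub>)\<rparr>"

definition transversals :: "vpart \<Rightarrow> vpart" where
  "transversals \<alpha> = {B \<in> \<alpha>. B \<inter> range Up \<noteq> {} \<and> B \<inter> range Low \<noteq> {}}"

definition rank :: "vpart \<Rightarrow> nat" where
  "rank \<alpha> = card (transversals \<alpha>)"

definition hat :: "vpart \<Rightarrow> vpart" where
  "hat \<alpha> = (\<alpha> - transversals \<alpha>) \<union> (\<lambda>B. B \<inter> range Up) ` transversals \<alpha>
                                \<union> (\<lambda>B. B \<inter> range Low) ` transversals \<alpha>"

definition Dcl :: "nat \<Rightarrow> nat \<Rightarrow> vpart set" where
  "Dcl n q = {\<alpha> \<in> carrier (PM n). rank \<alpha> = q}"

definition Dtw :: "nat \<Rightarrow> nat \<Rightarrow> nat \<Rightarrow> telem set" where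
  "Dtw n q i = Some ` ({i} \<times> Dcl n q)"

definition Itw :: "nat \<Rightarrow> nat \<Rightarrow> nat \<Rightarrow> nat \<Rightarrow> telem set" where
  "Itw n d q i = (\<Union>r \<in> {0..q}. \<Union>j \<in> {i..d}. Dtw n r j) \<union> {None}"

text \<open>\<open>perm_diff \<alpha> \<beta> \<pi>\<close> says that $\pi$ is the value of $\partial(\alpha,\beta)$ for some numbering
  $A_k\cup B_k'$ of the transversals of $\alpha$. Changing the numbering conjugates $\pi$, so that the
  possible values form a conjugacy class of the symmetric group.\<close>

definition perm_diff :: "vpart \<Rightarrow> vpart \<Rightarrow> (nat \<Rightarrow> nat) \<Rightarrow> bool" where
  "perm_diff \<alpha> \<beta> \<pi> \<longleftrightarrow> (\<exists>A B :: nat \<Rightarrow> nat set.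
     \<pi> \<in> carrier (sym_group (rank \<alpha>)) \<and>
     bij_betw (\<lambda>k. Up ` A k \<union> Low ` B k) {1..rank \<alpha>} (transversals \<alpha>) \<and>
     transversals \<beta> = (\<lambda>k. Up ` A k \<union> Low ` B (\<pi> k)) ` {1..rank \<alpha>} \<and>
     \<beta> - transversals \<beta> = \<alpha> - transversals \<alpha>)"

definition mu_one :: "nat \<Rightarrow> (vpart \<times> vpart) set" where
  "mu_one n = {(\<alpha>, \<beta>) \<in> carrier (PM n) \<times> carrier (PM n).
                 rank \<alpha> \<le> 1 \<and> rank \<beta> \<le> 1 \<and> hat \<alpha> = hat \<beta>} \<union> Id_on (carrier (PM n))"

definition mu_up :: "nat \<Rightarrow> (vpart \<times> vpart) set" where
  "mu_up n = {(\<alpha>, \<beta>) \<in> Dcl n 1 \<times> Dcl n 1. hat \<alpha> = hat \<beta> \<and> (\<alpha>, \<beta>) \<in> green_R (PM n)}"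

definition mu_down :: "nat \<Rightarrow> (vpart \<times> vpart) set" where
  "mu_down n = {(\<alpha>, \<beta>) \<in> Dcl n 1 \<times> Dcl n 1. hat \<alpha> = hat \<beta> \<and> (\<alpha>, \<beta>) \<in> green_L (PM n)}"

datatype entry = EDelta | EMuUp | EMuDown | EMu | ER | EN "(nat \<Rightarrow> nat) set"

text \<open>\<open>EN N\<close> is a normal subgroup entry of row \<open>q \<ge> 2\<close>. Only the entries \<open>M q i\<close> with \<open>q \<le> n\<close> and \<open>i \<le> d\<close> are meaningful.\<close>

type_synonym cmatrix = "nat \<Rightarrow> nat \<Rightarrow> entry"

definition min_row :: "nat \<Rightarrow> cmatrix \<Rightarrow> nat \<Rightarrow> nat" where
  "min_row d M q = (if \<exists>i \<le> d. M q i = ER then LEAST i. M q i = ER else d + 1)"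

definition cg_pair :: "nat \<Rightarrow> nat \<Rightarrow> cmatrix \<Rightarrow> nat \<Rightarrow> vpart \<Rightarrow> nat \<Rightarrow> vpart \<Rightarrow> bool" where
  "cg_pair n d M i \<alpha> j \<beta> \<longleftrightarrow> (let q = rank \<alpha>; r = rank \<beta> in
     (M q i = EDelta \<and> M r j = EDelta \<and> i = j \<and> \<alpha> = \<beta>) \<or>
     (M q i = ER \<and> M r j = ER) \<or>
     (\<exists>N. M q i = EN N \<and> M r j = EN N \<and> i = j \<and> (\<alpha>, \<beta>) \<in> green_H (PM n) \<and>
          (\<exists>\<pi> \<in> N. perm_diff \<alpha> \<beta> \<pi>)) \<or>
     (M q i = EMuDown \<and> M r j = EMuDown \<and> hat \<alpha> = hat \<beta> \<and> (\<alpha>, \<beta>) \<in> green_L (PM n)) \<or>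
     (M q i = EMuUp \<and> M r j = EMuUp \<and> hat \<alpha> = hat \<beta> \<and> (\<alpha>, \<beta>) \<in> green_R (PM n)) \<or>
     (M q i = EMu \<and> M r j = EMu \<and> hat \<alpha> = hat \<beta> \<and>
        ((q, i) = (r, j) \<or> int i - int j = int (min_row d M q) - int (min_row d M r))))"

definition cg :: "nat \<Rightarrow> nat \<Rightarrow> cmatrix \<Rightarrow> (telem \<times> telem) set" where
  "cg n d M =
     {(Some (i, \<alpha>), Some (j, \<beta>)) | i \<alpha> j \<beta>.
        i \<le> d \<and> j \<le> d \<and> \<alpha> \<in> carrier (PM n) \<and> \<beta> \<in> carrier (PM n) \<and> cg_pair n d M i \<alpha> j \<beta>} \<union>
     {(Some (i, \<alpha>), None) | i \<alpha>. i \<le> d \<and> \<alpha> \<in> carrier (PM n) \<and> M (rank \<alpha>) i = ER} \<union>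
     {(None, Some (i, \<alpha>)) | i \<alpha>. i \<le> d \<and> \<alpha> \<in> carrier (PM n) \<and> M (rank \<alpha>) i = ER} \<union>
     {(None, None)}"

definition mat_iii :: "nat \<Rightarrow> nat \<Rightarrow> nat \<Rightarrow> (nat \<Rightarrow> nat) set \<Rightarrow> cmatrix" where
  "mat_iii d q i N = (\<lambda>s l.
     if s = q \<and> i \<le> l \<and> l \<le> d then EN N
     else if s < q \<and> i \<le> l \<and> l \<le> d then ER
     else EDelta)"

definition mat_iv :: "nat \<Rightarrow> nat \<Rightarrow> cmatrix" where
  "mat_iv d i = (\<lambda>s l.
     if s = 2 \<and> i \<le> l \<and> l \<le> d then EN (carrier (sym_group 2))
     else if s = 1 \<and> i \<le> l \<and> l \<le> d then EMu
     else if s = 0 \<and> i \<le> l \<and> l < d then EMu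
     else if s = 0 \<and> l = d then ER
     else EDelta)"

definition mat_v :: "nat \<Rightarrow> nat \<Rightarrow> entry \<Rightarrow> cmatrix" where
  "mat_v d i \<zeta> = (\<lambda>s l.
     if s = 1 \<and> l = i then \<zeta>
     else if s = 1 \<and> i < l \<and> l \<le> d then EMu
     else if s = 0 \<and> i \<le> l \<and> l < d then EMu
     else if s = 0 \<and> l = d then ER
     else EDelta)"

definition mat_vi :: "nat \<Rightarrow> nat \<Rightarrow> nat \<Rightarrow> cmatrix" where
  "mat_vi d i j = (\<lambda>s l.
     if s = 1 \<and> i \<le> l \<and> l \<le> d then EMu
     else if s = 0 \<and> j \<le> l \<and> l < d then EMu
     else if s = 0 \<and> l = d then ER
     else EDelta)"

definition mat_vii :: "nat \<Rightarrow> nat \<Rightarrow> nat \<Rightarrow> cmatrix" where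
  "mat_vii d i j = (\<lambda>s l.
     if s = 1 \<and> l = i then EMu
     else if s = 1 \<and> i < l \<and> l \<le> d then ER
     else if s = 0 \<and> l = j then EMu
     else if s = 0 \<and> j < l \<and> l \<le> d then ER
     else EDelta)"

definition std_pair :: "nat \<Rightarrow> nat \<Rightarrow> nat \<Rightarrow> vpart \<Rightarrow> nat \<Rightarrow> vpart \<Rightarrow> bool" where
  "std_pair n d i \<alpha> j \<beta> \<longleftrightarrow>
     Some (i, \<alpha>) \<in> carrier (TPM n d) \<and> Some (j, \<beta>) \<in> carrier (TPM n d) \<and>
     rank \<alpha> \<ge> rank \<beta> \<and> (rank \<alpha> = rank \<beta> \<longrightarrow> i \<le> j)"

definition case_ii :: "nat \<Rightarrow> nat \<Rightarrow> nat \<Rightarrow> vpart \<Rightarrow> nat \<Rightarrow> vpart \<Rightarrow> bool" where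
  "case_ii n d i \<alpha> j \<beta> \<longleftrightarrow> (let q = rank \<alpha>; r = rank \<beta> in
     (q \<ge> 2 \<and> (Some (i, \<alpha>), Some (j, \<beta>)) \<notin> green_H (TPM n d)) \<or>
     (q = r \<and> r \<le> 1 \<and> (i \<noteq> j \<or> hat \<alpha> \<noteq> hat \<beta>)) \<or>
     (q = 1 \<and> r = 0 \<and> (j \<ge> i \<or> hat \<alpha> \<noteq> \<beta>)))"

definition case_iii :: "nat \<Rightarrow> nat \<Rightarrow> nat \<Rightarrow> vpart \<Rightarrow> nat \<Rightarrow> vpart \<Rightarrow> bool" where
  "case_iii n d i \<alpha> j \<beta> \<longleftrightarrow>
     rank \<alpha> \<ge> 3 \<and> (Some (i, \<alpha>), Some (j, \<beta>)) \<in> green_H (TPM n d) \<and> (i, \<alpha>) \<noteq> (j, \<beta>)"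

definition case_iv :: "nat \<Rightarrow> nat \<Rightarrow> nat \<Rightarrow> vpart \<Rightarrow> nat \<Rightarrow> vpart \<Rightarrow> bool" where
  "case_iv n d i \<alpha> j \<beta> \<longleftrightarrow>
     rank \<alpha> = 2 \<and> (Some (i, \<alpha>), Some (j, \<beta>)) \<in> green_H (TPM n d) \<and> (i, \<alpha>) \<noteq> (j, \<beta>)"

definition case_v :: "nat \<Rightarrow> nat \<Rightarrow> vpart \<Rightarrow> nat \<Rightarrow> vpart \<Rightarrow> entry \<Rightarrow> bool" where
  "case_v n i \<alpha> j \<beta> \<zeta> \<longleftrightarrow> rank \<alpha> = 1 \<and> rank \<beta> = 1 \<and> i = j \<and>
     ((\<zeta> = EMu \<and> (\<alpha>, \<beta>) \<in> mu_one n - (mu_up n \<union> mu_down n)) \<or>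
      (\<zeta> = EMuUp \<and> (\<alpha>, \<beta>) \<in> mu_up n - Id_on (Dcl n 1)) \<or>
      (\<zeta> = EMuDown \<and> (\<alpha>, \<beta>) \<in> mu_down n - Id_on (Dcl n 1)))"

definition case_vi :: "nat \<Rightarrow> vpart \<Rightarrow> nat \<Rightarrow> vpart \<Rightarrow> bool" where
  "case_vi i \<alpha> j \<beta> \<longleftrightarrow> rank \<alpha> = 1 \<and> rank \<beta> = 0 \<and> i = j + 1 \<and> hat \<alpha> = \<beta>"

definition case_vii :: "nat \<Rightarrow> vpart \<Rightarrow> nat \<Rightarrow> vpart \<Rightarrow> bool" where
  "case_vii i \<alpha> j \<beta> \<longleftrightarrow> rank \<alpha> = 1 \<and> rank \<beta> = 0 \<and> i > j + 1 \<and> hat \<alpha> = \<beta>"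

end

theory Submission
  imports Defs
begin

text \<open>For a congruence $\theta$, call $(q,i)$ a zero position if all elements of rank at most $q$ and
  index at least $i$ are related to $\mathbf 0$. As $D_q$ is reached from any of its elements by
  multiplications without floating components, one pair $((i,\alpha),\mathbf 0)$ makes a zero position. A
  related pair whose second component has the larger index can be chained with multiples of itself until the
  index exceeds $d$, so that it yields zero positions; and a pair of partitions that differ in their upper (or
  lower) pattern can be multiplied in such a way that only one of the products acquires a floating component
  or loses a transversal, which reduces it to such a pair. This settles (ii).

  For $\mathscr H$-related pairs of rank $q$ the permutations realised by $\theta$ at one element are realised
  at all elements of rank $q$ and all larger indices, and form a normal subgroup. Lowering the rank of such a
  pair gives a pair that is not $\mathscr H$-related, and hence zero positions, if $q\ge3$, but only pairs of
  rank one with equal hats if $q=2$. A multiplication that splits the transversal of one element of such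
  a pair, and not that of the other, gives the other one a floating component; this connects $(i+1,\alpha)$ to
  $(i,\widehat\alpha)$. Conversely, each matrix relation is verified to be a congruence; the anti-involution
  reduces this to multiplication from the left.\<close>

text \<open>The \<mu>-entries rest on one identity, \<open>pprod_hat\<close>. If \<alpha> has rank
  1, the component of the product graph through its transversal either reaches the far row, and the
  transversal survives, or it does not, and then it becomes floating once \<alpha> is replaced by
  its hat. So multiplication changes the weight, index minus rank, by an amount that depends only on
  the hat: pairs with equal hats and equal weights are carried to such pairs. With the values d+1
  and d of \<open>min_row\<close> in rows 1 and 0, clause (6) says just this. At the edge,
  (d+1,\<alpha>) is zero and has the weight of (d,hat \<alpha>); hence the entry R at (0,d). Rank 2
  is special because merging two transversals merges all of them, so that the product forgets how
  they were permuted. From rank 3 on, two can be merged, and the lower pattern shows which two.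
  Floating components are controlled by multipliers given by labels: if the labels next to the other
  factor are constant on its blocks, the middle components are the level sets of the labels.\<close>

abbreviation PP :: "nat \<Rightarrow> vpart set" where
  "PP n \<equiv> carrier (PM n)"

lemma PP_iff: "\<alpha> \<in> PP n \<longleftrightarrow> partition_on (verts n) \<alpha>"
  by (simp add: PM_def)

text \<open>A partition is encoded by the relations \<open>uu\<close>, \<open>ll\<close> and \<open>ul\<close> which it induces on the upper points, on
  the lower points and between the two; \<open>dm\<close> and \<open>cd\<close> are its domain and codomain.\<close>

definition joined :: "vpart \<Rightarrow> vertex \<Rightarrow> vertex \<Rightarrow> bool" where
  "joined \<alpha> v w \<longleftrightarrow> (\<exists>B\<in>\<alpha>. v \<in> B \<and> w \<in> B)"

definition uu :: "vpart \<Rightarrow> nat \<Rightarrow> nat \<Rightarrow> bool" where "uu \<alpha> x y \<longleftrightarrow> joined \<alpha> (Up x) (Up y)"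
definition ll :: "vpart \<Rightarrow> nat \<Rightarrow> nat \<Rightarrow> bool" where "ll \<alpha> x y \<longleftrightarrow> joined \<alpha> (Low x) (Low y)"
definition ul :: "vpart \<Rightarrow> nat \<Rightarrow> nat \<Rightarrow> bool" where "ul \<alpha> x y \<longleftrightarrow> joined \<alpha> (Up x) (Low y)"
definition dm :: "vpart \<Rightarrow> nat \<Rightarrow> bool" where "dm \<alpha> x \<longleftrightarrow> (\<exists>y. ul \<alpha> x y)"
definition cd :: "vpart \<Rightarrow> nat \<Rightarrow> bool" where "cd \<alpha> y \<longleftrightarrow> (\<exists>x. ul \<alpha> x y)"

section \<open>Elementary laws of the relations induced by a partition\<close>

lemma verts_simps [simp]:
  "Up x \<in> verts n \<longleftrightarrow> x \<in> {1..n}" "Low x \<in> verts n \<longleftrightarrow> x \<in> {1..n}" "Mid x \<notin> verts n"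
  by (auto simp: verts_def)

lemma pg_verts_simps [simp]:
  "Up x \<in> pg_verts n \<longleftrightarrow> x \<in> {1..n}" "Low x \<in> pg_verts n \<longleftrightarrow> x \<in> {1..n}"
  "Mid x \<in> pg_verts n \<longleftrightarrow> x \<in> {1..n}"
  by (auto simp: pg_verts_def)

lemma joined_verts:
  assumes "\<alpha> \<in> PP n" "joined \<alpha> v w" shows "v \<in> verts n" "w \<in> verts n"
  using assms by (auto simp: PP_iff joined_def partition_on_def)

lemma joined_refl: "\<alpha> \<in> PP n \<Longrightarrow> v \<in> verts n \<Longrightarrow> joined \<alpha> v v"
  by (auto simp: PP_iff joined_def partition_on_def)

lemma joined_sym: "joined \<alpha> v w \<Longrightarrow> joined \<alpha> w v"
  by (auto simp: joined_def)

lemma joined_trans: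
  assumes "\<alpha> \<in> PP n" "joined \<alpha> v w" "joined \<alpha> w z" shows "joined \<alpha> v z"
proof -
  from assms obtain B C where *: "B \<in> \<alpha>" "C \<in> \<alpha>" "v \<in> B" "w \<in> B" "w \<in> C" "z \<in> C"
    by (auto simp: joined_def)
  with assms(1) have "B = C"
    unfolding PP_iff partition_on_def disjoint_def by blast
  with * show ?thesis by (auto simp: joined_def)
qed

lemma block_eq:
  assumes "\<alpha> \<in> PP n" "B \<in> \<alpha>" "v \<in> B" shows "B = {w. joined \<alpha> v w}"
proof -
  have "C = B" if "C \<in> \<alpha>" "v \<in> C" for C
    using assms that unfolding PP_iff partition_on_def disjoint_def by blast
  with assms(2,3) show ?thesis unfolding joined_def by blast
qed

lemma PP_blocks:
  assumes "\<alpha> \<in> PP n" shows "\<alpha> = (\<lambda>v. {w. joined \<alpha> v w}) ` verts n"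
proof (intro equalityI subsetI)
  fix B assume B: "B \<in> \<alpha>"
  with assms have "B \<noteq> {}" "B \<subseteq> verts n" by (auto simp: PP_iff partition_on_def)
  then obtain v where "v \<in> B" "v \<in> verts n" by auto
  with block_eq[OF assms B] show "B \<in> (\<lambda>v. {w. joined \<alpha> v w}) ` verts n" by blast
next
  fix B assume "B \<in> (\<lambda>v. {w. joined \<alpha> v w}) ` verts n"
  then obtain v where v: "v \<in> verts n" "B = {w. joined \<alpha> v w}" by auto
  from joined_refl[OF assms v(1)] obtain C where "C \<in> \<alpha>" "v \<in> C" by (auto simp: joined_def)
  with block_eq[OF assms this] v show "B \<in> \<alpha>" by simp
qed

lemma PP_eq_joined:
  assumes "\<alpha> \<in> PP n" "\<beta> \<in> PP n" "\<And>v w. joined \<alpha> v w = joined \<beta> v w" shows "\<alpha> = \<beta>"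
proof -
  have "joined \<alpha> = joined \<beta>" by (intro ext) (rule assms(3))
  then show ?thesis using PP_blocks[OF assms(1)] PP_blocks[OF assms(2)] by metis
qed

text \<open>No block contains a \<open>Mid\<close> vertex, and the relation from lower to upper
  points is the converse of \<open>ul\<close>; so the three relations leave no information
  out.\<close>

lemma PP_eqI:
  assumes "\<alpha> \<in> PP n" "\<beta> \<in> PP n" "uu \<alpha> = uu \<beta>" "ll \<alpha> = ll \<beta>" "ul \<alpha> = ul \<beta>"
  shows "\<alpha> = \<beta>"
proof (rule PP_eq_joined[OF assms(1,2)])
  fix v w
  have *: "joined \<alpha> (Mid x) w = joined \<beta> (Mid x) w" "joined \<alpha> w (Mid x) = joined \<beta> w (Mid x)" for x w
    by (metis assms(1,2) joined_verts verts_simps(3))+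
  have 1: "joined \<alpha> (Up x) (Up y) = joined \<beta> (Up x) (Up y)" for x y
    using assms(3) by (metis uu_def)
  have 2: "joined \<alpha> (Low x) (Low y) = joined \<beta> (Low x) (Low y)" for x y
    using assms(4) by (metis ll_def)
  have 3: "joined \<alpha> (Up x) (Low y) = joined \<beta> (Up x) (Low y)" for x y
    using assms(5) by (metis ul_def)
  have 4: "joined \<alpha> (Low x) (Up y) = joined \<beta> (Low x) (Up y)" for x y
    using 3[of y x] joined_sym by blast
  show "joined \<alpha> v w = joined \<beta> v w"
    by (cases v; cases w) (auto simp: 1 2 3 4 *)
qed

context
  fixes \<alpha> n assumes A: "\<alpha> \<in> PP n"
begin

lemma uu_range: "uu \<alpha> x y \<Longrightarrow> x \<in> {1..n} \<and> y \<in> {1..n}"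
  using joined_verts[OF A] by (metis uu_def verts_simps(1))
lemma ll_range: "ll \<alpha> x y \<Longrightarrow> x \<in> {1..n} \<and> y \<in> {1..n}"
  using joined_verts[OF A] by (metis ll_def verts_simps(2))
lemma ul_range: "ul \<alpha> x y \<Longrightarrow> x \<in> {1..n} \<and> y \<in> {1..n}"
  using joined_verts[OF A] by (metis ul_def verts_simps(1,2))
lemma dm_range: "dm \<alpha> x \<Longrightarrow> x \<in> {1..n}"
  using ul_range by (auto simp: dm_def)
lemma uu_refl: "x \<in> {1..n} \<Longrightarrow> uu \<alpha> x x"
  using joined_refl[OF A] by (auto simp: uu_def)
lemma ll_refl: "x \<in> {1..n} \<Longrightarrow> ll \<alpha> x x"
  using joined_refl[OF A] by (auto simp: ll_def)
lemma uu_trans: "uu \<alpha> x y \<Longrightarrow> uu \<alpha> y z \<Longrightarrow> uu \<alpha> x z"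
  using joined_trans[OF A] by (auto simp: uu_def)
lemma ll_trans: "ll \<alpha> x y \<Longrightarrow> ll \<alpha> y z \<Longrightarrow> ll \<alpha> x z"
  using joined_trans[OF A] by (auto simp: ll_def)
lemma uu_ul: "uu \<alpha> x y \<Longrightarrow> ul \<alpha> y z \<Longrightarrow> ul \<alpha> x z"
  using joined_trans[OF A] by (auto simp: uu_def ul_def)
lemma ul_ll: "ul \<alpha> x y \<Longrightarrow> ll \<alpha> y z \<Longrightarrow> ul \<alpha> x z"
  using joined_trans[OF A] by (auto simp: ll_def ul_def)
lemma ul_ul_uu: "ul \<alpha> x z \<Longrightarrow> ul \<alpha> y z \<Longrightarrow> uu \<alpha> x y"
  using joined_trans[OF A] joined_sym by (metis uu_def ul_def)
lemma ul_ul_ll: "ul \<alpha> z x \<Longrightarrow> ul \<alpha> z y \<Longrightarrow> ll \<alpha> x y"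
  using joined_trans[OF A] joined_sym by (metis ll_def ul_def)
lemma uu_dm: "uu \<alpha> x y \<Longrightarrow> dm \<alpha> y \<Longrightarrow> dm \<alpha> x"
  using uu_ul by (auto simp: dm_def)
lemma ll_cd: "ll \<alpha> x y \<Longrightarrow> cd \<alpha> x \<Longrightarrow> cd \<alpha> y"
  using ul_ll by (auto simp: cd_def)

end

lemma uu_sym: "uu \<alpha> x y \<Longrightarrow> uu \<alpha> y x" by (auto simp: uu_def intro: joined_sym)
lemma ll_sym: "ll \<alpha> x y \<Longrightarrow> ll \<alpha> y x" by (auto simp: ll_def intro: joined_sym)
lemma ul_dm: "ul \<alpha> x y \<Longrightarrow> dm \<alpha> x" by (auto simp: dm_def)
lemma ul_cd: "ul \<alpha> x y \<Longrightarrow> cd \<alpha> y" by (auto simp: cd_def)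

section \<open>Partitions given by labels\<close>

fun vlabel :: "(nat \<Rightarrow> 'c) \<Rightarrow> (nat \<Rightarrow> 'c) \<Rightarrow> vertex \<Rightarrow> 'c" where
  "vlabel u l (Up x) = u x"
| "vlabel u l (Low x) = l x"
| "vlabel u l (Mid x) = u x"

text \<open>The label type is arbitrary, so that blocks of another partition or tagged values can
  serve as labels; prescribing a multiplier then amounts to choosing two functions. The value of
  \<open>vlabel\<close> at \<open>Mid\<close> is a dummy.\<close>

definition label_part :: "nat \<Rightarrow> (nat \<Rightarrow> 'c) \<Rightarrow> (nat \<Rightarrow> 'c) \<Rightarrow> vpart" where
  "label_part n u l = verts n // {(v, w). v \<in> verts n \<and> w \<in> verts n \<and> vlabel u l v = vlabel u l w}"

lemma joined_quotient:
  assumes "equiv V r" shows "joined (V // r) v w \<longleftrightarrow> (v, w) \<in> r"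
proof
  assume "joined (V // r) v w"
  then show "(v, w) \<in> r"
    using assms by (auto simp: joined_def elim!: quotientE)
      (meson equivE symD transD)
next
  assume "(v, w) \<in> r"
  moreover from this have "v \<in> V" using assms by (auto simp: equiv_def)
  ultimately show "joined (V // r) v w"
    unfolding joined_def using assms
    by (intro bexI[of _ "r `` {v}"]) (auto intro: quotientI simp: equiv_class_eq_iff)
qed

lemma label_part_equiv: "equiv (verts n) {(v, w). v \<in> verts n \<and> w \<in> verts n \<and> vlabel u l v = vlabel u l w}"
  by (rule equivI) (auto simp: refl_on_def sym_def trans_def)

lemma label_part_PP [simp, intro]: "label_part n u l \<in> PP n"
  unfolding label_part_def PP_iff by (rule partition_on_quotient[OF label_part_equiv])

lemma label_part_simps [simp]:
  "uu (label_part n u l) x y \<longleftrightarrow> x \<in> {1..n} \<and> y \<in> {1..n} \<and> u x = u y"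
  "ll (label_part n u l) x y \<longleftrightarrow> x \<in> {1..n} \<and> y \<in> {1..n} \<and> l x = l y"
  "ul (label_part n u l) x y \<longleftrightarrow> x \<in> {1..n} \<and> y \<in> {1..n} \<and> u x = l y"
  unfolding label_part_def uu_def ll_def ul_def joined_quotient[OF label_part_equiv] by auto

text \<open>Connectedness within the middle row of the product graph. A path that leaves the middle row can be
  cut short by transitivity of the two factors, hence the table for \<open>pg_joined\<close>.\<close>

definition mid_joined :: "nat \<Rightarrow> vpart \<Rightarrow> vpart \<Rightarrow> nat \<Rightarrow> nat \<Rightarrow> bool" where
  "mid_joined n \<gamma> \<alpha> x y \<longleftrightarrow> x \<in> {1..n} \<and> y \<in> {1..n} \<and> (\<lambda>x y. ll \<gamma> x y \<or> uu \<alpha> x y)\<^sup>*\<^sup>* x y"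

lemma mid_joined_refl: "x \<in> {1..n} \<Longrightarrow> mid_joined n \<gamma> \<alpha> x x" by (simp add: mid_joined_def)
lemma mid_joined_range: "mid_joined n \<gamma> \<alpha> x y \<Longrightarrow> x \<in> {1..n} \<and> y \<in> {1..n}" by (simp add: mid_joined_def)
lemma mid_joined_trans: "mid_joined n \<gamma> \<alpha> x y \<Longrightarrow> mid_joined n \<gamma> \<alpha> y z \<Longrightarrow> mid_joined n \<gamma> \<alpha> x z" by (auto simp: mid_joined_def)
lemma mid_joined_sym: "mid_joined n \<gamma> \<alpha> x y \<Longrightarrow> mid_joined n \<gamma> \<alpha> y x"
  unfolding mid_joined_def by (metis (no_types, lifting) sympD sympI symp_rtranclp uu_sym ll_sym)
lemma mid_joined_ll: "\<gamma> \<in> PP n \<Longrightarrow> ll \<gamma> x y \<Longrightarrow> mid_joined n \<gamma> \<alpha> x y"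
  using ll_range[of \<gamma> n x y] by (auto simp: mid_joined_def)
lemma mid_joined_uu: "\<alpha> \<in> PP n \<Longrightarrow> uu \<alpha> x y \<Longrightarrow> mid_joined n \<gamma> \<alpha> x y"
  using uu_range[of \<alpha> n x y] by (auto simp: mid_joined_def)

text \<open>The means of proving that two middle points are not connected: a function that is
  constant along every edge of the middle row separates them.\<close>

lemma mid_joined_invariant:
  assumes "mid_joined n \<gamma> \<alpha> x y" "\<And>x y. ll \<gamma> x y \<Longrightarrow> g x = g y" "\<And>x y. uu \<alpha> x y \<Longrightarrow> g x = g y"
  shows "g x = g y"
proof -
  have "(\<lambda>x y. ll \<gamma> x y \<or> uu \<alpha> x y)\<^sup>*\<^sup>* x y" using assms by (simp add: mid_joined_def)
  then show ?thesis
    by (induction rule: rtranclp_induct) (use assms in auto)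
qed

section \<open>Connectivity in the whole product graph\<close>

fun pg_joined :: "nat \<Rightarrow> vpart \<Rightarrow> vpart \<Rightarrow> vertex \<Rightarrow> vertex \<Rightarrow> bool" where
  "pg_joined n \<gamma> \<alpha> (Up x) (Up y) \<longleftrightarrow> uu \<gamma> x y \<or> (\<exists>v w. ul \<gamma> x v \<and> mid_joined n \<gamma> \<alpha> v w \<and> ul \<gamma> y w)"
| "pg_joined n \<gamma> \<alpha> (Up x) (Mid y) \<longleftrightarrow> (\<exists>v. ul \<gamma> x v \<and> mid_joined n \<gamma> \<alpha> v y)"
| "pg_joined n \<gamma> \<alpha> (Up x) (Low y) \<longleftrightarrow> (\<exists>v w. ul \<gamma> x v \<and> mid_joined n \<gamma> \<alpha> v w \<and> ul \<alpha> w y)"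
| "pg_joined n \<gamma> \<alpha> (Mid x) (Up y) \<longleftrightarrow> (\<exists>v. ul \<gamma> y v \<and> mid_joined n \<gamma> \<alpha> x v)"
| "pg_joined n \<gamma> \<alpha> (Mid x) (Mid y) \<longleftrightarrow> mid_joined n \<gamma> \<alpha> x y"
| "pg_joined n \<gamma> \<alpha> (Mid x) (Low y) \<longleftrightarrow> (\<exists>w. mid_joined n \<gamma> \<alpha> x w \<and> ul \<alpha> w y)"
| "pg_joined n \<gamma> \<alpha> (Low x) (Up y) \<longleftrightarrow> (\<exists>v w. ul \<gamma> y v \<and> mid_joined n \<gamma> \<alpha> w v \<and> ul \<alpha> w x)"
| "pg_joined n \<gamma> \<alpha> (Low x) (Mid y) \<longleftrightarrow> (\<exists>w. mid_joined n \<gamma> \<alpha> w y \<and> ul \<alpha> w x)"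
| "pg_joined n \<gamma> \<alpha> (Low x) (Low y) \<longleftrightarrow> ll \<alpha> x y \<or> (\<exists>v w. ul \<alpha> v x \<and> mid_joined n \<gamma> \<alpha> v w \<and> ul \<alpha> w y)"

text \<open>The floating components, as sets of numbers: a component of the middle row can be left
  only through the codomain of the left factor or the domain of the right one.\<close>

definition float_sets :: "nat \<Rightarrow> vpart \<Rightarrow> vpart \<Rightarrow> nat set set" where
  "float_sets n \<gamma> \<alpha> = {{y. mid_joined n \<gamma> \<alpha> x y} | x. x \<in> {1..n} \<and> (\<forall>v. mid_joined n \<gamma> \<alpha> x v \<longrightarrow> \<not> cd \<gamma> v \<and> \<not> dm \<alpha> v)}"

context
  fixes \<gamma> \<alpha> n assumes C: "\<gamma> \<in> PP n" and A: "\<alpha> \<in> PP n"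
begin

lemma pg_edge_cases:
  assumes "(v, w) \<in> pg_edges \<gamma> \<alpha>"
  obtains (uu) x y where "v = Up x" "w = Up y" "uu \<gamma> x y"
  | (um) x y where "v = Up x" "w = Mid y" "ul \<gamma> x y"
  | (mu) x y where "v = Mid y" "w = Up x" "ul \<gamma> x y"
  | (mm) x y where "v = Mid x" "w = Mid y" "ll \<gamma> x y \<or> uu \<alpha> x y"
  | (ml) x y where "v = Mid x" "w = Low y" "ul \<alpha> x y"
  | (lm) x y where "v = Low y" "w = Mid x" "ul \<alpha> x y"
  | (ll) x y where "v = Low x" "w = Low y" "ll \<alpha> x y"
proof -
  from assms consider
      v' w' where "joined \<gamma> v' w'" "v = low_to_mid v'" "w = low_to_mid w'"
    | v' w' where "joined \<alpha> v' w'" "v = up_to_mid v'" "w = up_to_mid w'"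
    unfolding pg_edges_def joined_def by blast
  then show thesis
  proof cases
    case 1
    with joined_verts[OF C 1(1)] show ?thesis
      using joined_sym[OF 1(1)]
      by (cases v'; cases w') (auto intro: that simp: uu_def ul_def ll_def)
  next
    case 2
    with joined_verts[OF A 2(1)] show ?thesis
      using joined_sym[OF 2(1)]
      by (cases v'; cases w') (auto intro: that simp: uu_def ul_def ll_def)
  qed
qed

lemma pg_edgeI:
  "uu \<gamma> x y \<Longrightarrow> (Up x, Up y) \<in> pg_edges \<gamma> \<alpha>"
  "ul \<gamma> x y \<Longrightarrow> (Up x, Mid y) \<in> pg_edges \<gamma> \<alpha>"
  "ul \<gamma> x y \<Longrightarrow> (Mid y, Up x) \<in> pg_edges \<gamma> \<alpha>"
  "ll \<gamma> x y \<Longrightarrow> (Mid x, Mid y) \<in> pg_edges \<gamma> \<alpha>"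
  "uu \<alpha> x y \<Longrightarrow> (Mid x, Mid y) \<in> pg_edges \<gamma> \<alpha>"
  "ul \<alpha> x y \<Longrightarrow> (Mid x, Low y) \<in> pg_edges \<gamma> \<alpha>"
  "ul \<alpha> x y \<Longrightarrow> (Low y, Mid x) \<in> pg_edges \<gamma> \<alpha>"
  "ll \<alpha> x y \<Longrightarrow> (Low x, Low y) \<in> pg_edges \<gamma> \<alpha>"
  unfolding pg_edges_def uu_def ul_def ll_def joined_def
  by (force intro: rev_image_eqI)+

lemma pg_joined_refl: "v \<in> pg_verts n \<Longrightarrow> pg_joined n \<gamma> \<alpha> v v"
  by (cases v) (auto intro: uu_refl[OF C] ll_refl[OF A] mid_joined_refl)

text \<open>An edge appended inside the outer row of a factor is absorbed by transitivity of that
  factor, so that the table needs no new clause; only the stretch in the middle row grows. This is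
  the induction step for reachability.\<close>

lemma pg_joined_step:
  assumes "pg_joined n \<gamma> \<alpha> v w" "(w, z) \<in> pg_edges \<gamma> \<alpha>"
  shows "pg_joined n \<gamma> \<alpha> v z"
  using assms(2)
proof (cases rule: pg_edge_cases)
  case (uu x y)
  have "uu \<gamma> a y" if "uu \<gamma> a x" for a using that uu uu_trans[OF C] by blast
  moreover have "ul \<gamma> y a" if "ul \<gamma> x a" for a using that uu uu_ul[OF C] uu_sym by blast
  ultimately show ?thesis
    using uu(1,2) assms(1) by (cases v) (simp_all, blast+)
next
  case (um x y)
  have "mid_joined n \<gamma> \<alpha> y y" using mid_joined_refl ul_range[OF C um(3)] by blast
  moreover have "ul \<gamma> a y" if "uu \<gamma> a x" for a using that um uu_ul[OF C] by blast
  moreover have "mid_joined n \<gamma> \<alpha> a y" if "mid_joined n \<gamma> \<alpha> a b" "ul \<gamma> x b" for a b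
    by (rule mid_joined_trans[OF that(1) mid_joined_ll[OF C ul_ul_ll[OF C that(2) um(3)]]])
  moreover have "mid_joined n \<gamma> \<alpha> a y" if "mid_joined n \<gamma> \<alpha> b a" "ul \<gamma> x b" for a b
    by (rule mid_joined_trans[OF mid_joined_sym[OF that(1)] mid_joined_ll[OF C ul_ul_ll[OF C that(2) um(3)]]])
  ultimately show ?thesis
    using um(1,2) assms(1) by (cases v) (simp_all, blast+)
next
  case (mu x y)
  have "mid_joined n \<gamma> \<alpha> y a" if "mid_joined n \<gamma> \<alpha> a y" for a using that by (rule mid_joined_sym)
  with mu assms(1) show ?thesis
    by (cases v) (simp_all, blast+)
next
  case (mm x y)
  then have "mid_joined n \<gamma> \<alpha> x y" using mid_joined_ll[OF C] mid_joined_uu[OF A] by blast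
  then have "mid_joined n \<gamma> \<alpha> a y" if "mid_joined n \<gamma> \<alpha> a x" for a using that by (meson mid_joined_trans)
  moreover have "mid_joined n \<gamma> \<alpha> y a" if "mid_joined n \<gamma> \<alpha> x a" for a using that \<open>mid_joined n \<gamma> \<alpha> x y\<close> by (meson mid_joined_trans mid_joined_sym)
  ultimately show ?thesis
    using mm(1,2) assms(1) by (cases v) (simp_all, blast+)
next
  case (ml x y)
  with assms(1) show ?thesis
    by (cases v) (simp_all, blast+)
next
  case (lm x y)
  have "mid_joined n \<gamma> \<alpha> x x" using mid_joined_refl ul_range[OF A lm(3)] by blast
  moreover have "ul \<alpha> x a" if "ll \<alpha> a y" for a using that lm ul_ll[OF A] ll_sym by blast
  moreover have "mid_joined n \<gamma> \<alpha> a x" if "mid_joined n \<gamma> \<alpha> a b" "ul \<alpha> b y" for a b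
    by (rule mid_joined_trans[OF that(1) mid_joined_uu[OF A ul_ul_uu[OF A that(2) lm(3)]]])
  moreover have "mid_joined n \<gamma> \<alpha> a x" if "mid_joined n \<gamma> \<alpha> b a" "ul \<alpha> b y" for a b
    by (rule mid_joined_trans[OF mid_joined_sym[OF that(1)] mid_joined_uu[OF A ul_ul_uu[OF A that(2) lm(3)]]])
  ultimately show ?thesis
    using lm(1,2) assms(1) by (cases v) (simp_all, blast+)
next
  case (ll x y)
  have "ll \<alpha> a y" if "ll \<alpha> a x" for a using that ll ll_trans[OF A] by blast
  moreover have "ul \<alpha> a y" if "ul \<alpha> a x" for a using that ll ul_ll[OF A] by blast
  ultimately show ?thesis
    using ll(1,2) assms(1) by (cases v) (simp_all, blast+)
qed

lemma mid_joined_pg_edges: "mid_joined n \<gamma> \<alpha> x y \<Longrightarrow> (Mid x, Mid y) \<in> (pg_edges \<gamma> \<alpha>)\<^sup>*"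
proof -
  assume "mid_joined n \<gamma> \<alpha> x y"
  then have "(\<lambda>x y. ll \<gamma> x y \<or> uu \<alpha> x y)\<^sup>*\<^sup>* x y" by (simp add: mid_joined_def)
  then show ?thesis
    by (induction rule: rtranclp_induct) (auto intro: pg_edgeI rtrancl_into_rtrancl)
qed

lemma pg_joined_sound: "pg_joined n \<gamma> \<alpha> v w \<Longrightarrow> (v, w) \<in> (pg_edges \<gamma> \<alpha>)\<^sup>*"
proof (cases v; cases w)
  note [intro] = mid_joined_pg_edges mid_joined_pg_edges[OF mid_joined_sym] r_into_rtrancl[OF pg_edgeI(1)] r_into_rtrancl[OF pg_edgeI(2)]
    r_into_rtrancl[OF pg_edgeI(3)] r_into_rtrancl[OF pg_edgeI(4)] r_into_rtrancl[OF pg_edgeI(5)]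
    r_into_rtrancl[OF pg_edgeI(6)] r_into_rtrancl[OF pg_edgeI(7)] r_into_rtrancl[OF pg_edgeI(8)] 
  assume pg: "pg_joined n \<gamma> \<alpha> v w"
  show ?thesis if "v = Up x1" "w = Up x1a" for x1 x1a
    using pg that by simp (blast intro: rtrancl_trans)
  show ?thesis if "v = Up x1" "w = Mid x2" for x1 x2 using pg that by simp (blast intro: rtrancl_trans)
  show ?thesis if "v = Up x1" "w = Low x2" for x1 x2 using pg that by simp (blast intro: rtrancl_trans)
  show ?thesis if "v = Mid x1" "w = Up x2" for x1 x2 using pg that by simp (blast intro: rtrancl_trans)
  show ?thesis if "v = Mid x1" "w = Mid x2" for x1 x2 using pg that by simp (blast intro: rtrancl_trans)
  show ?thesis if "v = Mid x1" "w = Low x2" for x1 x2 using pg that by simp (blast intro: rtrancl_trans)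
  show ?thesis if "v = Low x1" "w = Up x2" for x1 x2 using pg that by simp (blast intro: rtrancl_trans)
  show ?thesis if "v = Low x1" "w = Mid x2" for x1 x2 using pg that by simp (blast intro: rtrancl_trans)
  show ?thesis if "v = Low x1" "w = Low x2" for x1 x2 using pg that by simp (blast intro: rtrancl_trans)
qed

lemma pg_reach_iff: "v \<in> pg_verts n \<Longrightarrow> (v, w) \<in> (pg_edges \<gamma> \<alpha>)\<^sup>* \<longleftrightarrow> pg_joined n \<gamma> \<alpha> v w"
proof
  assume v: "v \<in> pg_verts n" and "(v, w) \<in> (pg_edges \<gamma> \<alpha>)\<^sup>*"
  from this(2) show "pg_joined n \<gamma> \<alpha> v w"
    by (induction rule: rtrancl_induct) (auto intro: pg_joined_refl[OF v] pg_joined_step)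
qed (rule pg_joined_sound)

lemma pg_joined_verts: 
  assumes "pg_joined n \<gamma> \<alpha> v w" shows "v \<in> pg_verts n \<and> w \<in> pg_verts n"
proof -
  note r = uu_range[OF C] ul_range[OF C] ul_range[OF A] ll_range[OF A] mid_joined_range
  show ?thesis
  proof (cases v)
    case (Up x)
    with assms show ?thesis
      by (cases w; simp only: pg_joined.simps pg_verts_simps) (metis r)+
  next
    case (Mid x)
    with assms show ?thesis
      by (cases w; simp only: pg_joined.simps pg_verts_simps) (metis r)+
  next
    case (Low x)
    with assms show ?thesis
      by (cases w; simp only: pg_joined.simps pg_verts_simps) (metis r)+
  qed
qed

lemma pg_joined_equiv: "equiv (pg_verts n) {(v, w). pg_joined n \<gamma> \<alpha> v w}"
proof (rule equivI)
  show "{(v, w). pg_joined n \<gamma> \<alpha> v w} \<subseteq> pg_verts n \<times> pg_verts n" using pg_joined_verts by auto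
  show "refl_on (pg_verts n) {(v, w). pg_joined n \<gamma> \<alpha> v w}"
    using pg_joined_refl by (auto intro: refl_onI)
  \<comment> \<open>Symmetry and transitivity are read off reachability, which avoids checking them
    clause by clause in the table.\<close>
  have "sym (pg_edges \<gamma> \<alpha>)" by (auto simp: pg_edges_def sym_def)
  then have s: "sym ((pg_edges \<gamma> \<alpha>)\<^sup>*)" by (rule sym_rtrancl)
  show "sym {(v, w). pg_joined n \<gamma> \<alpha> v w}"
  proof (rule symI, clarsimp)
    fix v w assume a: "pg_joined n \<gamma> \<alpha> v w"
    then show "pg_joined n \<gamma> \<alpha> w v"
      using pg_joined_verts[OF a] pg_reach_iff symD[OF s pg_joined_sound[OF a]] by blast
  qed
  show "trans {(v, w). pg_joined n \<gamma> \<alpha> v w}"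
  proof (rule transI, clarsimp)
    fix x y z assume a: "pg_joined n \<gamma> \<alpha> x y" "pg_joined n \<gamma> \<alpha> y z"
    then show "pg_joined n \<gamma> \<alpha> x z"
      using pg_joined_verts[OF a(1)] pg_reach_iff rtrancl_trans[OF pg_joined_sound[OF a(1)] pg_joined_sound[OF a(2)]] by blast
  qed
qed

lemma pg_components_eq: "pg_components n \<gamma> \<alpha> = pg_verts n // {(v, w). pg_joined n \<gamma> \<alpha> v w}"
proof -
  have "(pg_edges \<gamma> \<alpha>)\<^sup>* \<inter> pg_verts n \<times> pg_verts n = {(v, w). pg_joined n \<gamma> \<alpha> v w}"
    using pg_reach_iff pg_joined_verts by auto
  then show ?thesis by (simp add: pg_components_def)
qed

lemma verts_subset: "verts n \<subseteq> pg_verts n" by (auto simp: verts_def pg_verts_def)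

lemma joined_pprod: "joined (pprod n \<gamma> \<alpha>) v w \<longleftrightarrow> v \<in> verts n \<and> w \<in> verts n \<and> pg_joined n \<gamma> \<alpha> v w"
proof -
  have "joined (pprod n \<gamma> \<alpha>) v w \<longleftrightarrow> v \<in> verts n \<and> w \<in> verts n \<and> joined (pg_components n \<gamma> \<alpha>) v w"
    unfolding pprod_def joined_def by blast
  then show ?thesis using joined_quotient[OF pg_joined_equiv] by (simp add: pg_components_eq)
qed

lemma pprod_PP: "pprod n \<gamma> \<alpha> \<in> PP n"
proof -
  have p: "partition_on (pg_verts n) (pg_components n \<gamma> \<alpha>)"
    unfolding pg_components_eq by (rule partition_on_quotient[OF pg_joined_equiv])
  show ?thesis
    unfolding PP_iff
  proof (rule partition_onI)
    show "\<Union>(pprod n \<gamma> \<alpha>) = verts n"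
      using p verts_subset unfolding partition_on_def pprod_def by blast
    fix X Y assume "X \<in> pprod n \<gamma> \<alpha>" "Y \<in> pprod n \<gamma> \<alpha>" "X \<noteq> Y"
    then show "disjnt X Y"
      using p unfolding partition_on_def pprod_def disjoint_def disjnt_def by blast
  next
    show "{} \<notin> pprod n \<gamma> \<alpha>" by (auto simp: pprod_def)
  qed
qed

lemma uu_pprod: "uu (pprod n \<gamma> \<alpha>) x y \<longleftrightarrow> uu \<gamma> x y \<or> (\<exists>v w. ul \<gamma> x v \<and> mid_joined n \<gamma> \<alpha> v w \<and> ul \<gamma> y w)"
  unfolding uu_def[of "pprod n \<gamma> \<alpha>"] joined_pprod using uu_range[OF C] ul_range[OF C] by auto
lemma ul_pprod: "ul (pprod n \<gamma> \<alpha>) x y \<longleftrightarrow> (\<exists>v w. ul \<gamma> x v \<and> mid_joined n \<gamma> \<alpha> v w \<and> ul \<alpha> w y)"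
  unfolding ul_def[of "pprod n \<gamma> \<alpha>"] joined_pprod using ul_range[OF A] ul_range[OF C] by auto
lemma ll_pprod: "ll (pprod n \<gamma> \<alpha>) x y \<longleftrightarrow> ll \<alpha> x y \<or> (\<exists>v w. ul \<alpha> v x \<and> mid_joined n \<gamma> \<alpha> v w \<and> ul \<alpha> w y)"
  unfolding ll_def[of "pprod n \<gamma> \<alpha>"] joined_pprod using ll_range[OF A] ul_range[OF A] by auto

lemma floating_float_sets: "floating n \<gamma> \<alpha> = card (float_sets n \<gamma> \<alpha>)"
proof -
  have "{C \<in> pg_components n \<gamma> \<alpha>. C \<subseteq> Mid ` {1..n}} = (`) Mid ` float_sets n \<gamma> \<alpha>"
  proof (intro equalityI subsetI)
    fix K assume "K \<in> {C \<in> pg_components n \<gamma> \<alpha>. C \<subseteq> Mid ` {1..n}}"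
    then have K: "K \<in> pg_verts n // {(v, w). pg_joined n \<gamma> \<alpha> v w}" "K \<subseteq> Mid ` {1..n}"
      by (auto simp: pg_components_eq)
    then obtain v where v: "v \<in> pg_verts n" "K = {w. pg_joined n \<gamma> \<alpha> v w}"
      by (auto elim!: quotientE)
    then have "v \<in> K" using pg_joined_refl by auto
    with K obtain x where x: "v = Mid x" "x \<in> {1..n}" by auto
    have up: "\<not> pg_joined n \<gamma> \<alpha> v (Up y)" and low: "\<not> pg_joined n \<gamma> \<alpha> v (Low y)" for y
      using K(2) v by auto
    have "K = Mid ` {y. mid_joined n \<gamma> \<alpha> x y}"
      using K(2) v x mid_joined_range by auto
    moreover have "\<not> cd \<gamma> w" "\<not> dm \<alpha> w" if "mid_joined n \<gamma> \<alpha> x w" for w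
      using up low that x by (auto simp: cd_def dm_def)
    ultimately show "K \<in> (`) Mid ` float_sets n \<gamma> \<alpha>" using x unfolding float_sets_def by blast
  next
    fix K assume "K \<in> (`) Mid ` float_sets n \<gamma> \<alpha>"
    then obtain x where x: "x \<in> {1..n}" "K = Mid ` {y. mid_joined n \<gamma> \<alpha> x y}"
      "\<forall>v. mid_joined n \<gamma> \<alpha> x v \<longrightarrow> \<not> cd \<gamma> v \<and> \<not> dm \<alpha> v" by (auto simp: float_sets_def)
    have "pg_joined n \<gamma> \<alpha> (Mid x) w \<longleftrightarrow> w \<in> K" for w
      by (cases w) (use x in \<open>auto simp: cd_def dm_def\<close>)
    then have "K = {(v, w). pg_joined n \<gamma> \<alpha> v w} `` {Mid x}" by auto
    then have "K \<in> pg_components n \<gamma> \<alpha>"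
      using x(1) quotientI[of "Mid x" "pg_verts n" "{(v, w). pg_joined n \<gamma> \<alpha> v w}"]
      by (simp only: pg_components_eq pg_verts_simps)
    with x mid_joined_range show "K \<in> {C \<in> pg_components n \<gamma> \<alpha>. C \<subseteq> Mid ` {1..n}}" by auto
  qed
  moreover have "inj_on ((`) Mid) (float_sets n \<gamma> \<alpha>)" by (simp add: inj_on_def inj_image_eq_iff inj_def)
  ultimately show ?thesis by (simp add: floating_def card_image)
qed

end

lemma mid_joined_cong: "ll \<gamma> = ll \<gamma>' \<Longrightarrow> uu \<alpha> = uu \<alpha>' \<Longrightarrow> mid_joined n \<gamma> \<alpha> = mid_joined n \<gamma>' \<alpha>'"
  by (intro ext) (simp add: mid_joined_def)

lemma dm_cd_iff: "(\<exists>x. dm \<alpha> x) \<longleftrightarrow> (\<exists>y. cd \<alpha> y)"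
  by (auto simp: dm_def cd_def)

lemma finite_float_sets: "finite (float_sets n \<gamma> \<alpha>)"
  by (simp add: float_sets_def setcompr_eq_image)

lemma floating_0_iff:
  assumes "\<gamma> \<in> PP n" "\<alpha> \<in> PP n"
  shows "floating n \<gamma> \<alpha> = 0 \<longleftrightarrow> (\<forall>x\<in>{1..n}. \<exists>v. mid_joined n \<gamma> \<alpha> x v \<and> (cd \<gamma> v \<or> dm \<alpha> v))"
  using finite_float_sets[of n \<gamma> \<alpha>] by (auto simp: floating_float_sets[OF assms] card_eq_0_iff float_sets_def)

lemma dm_pprod:
  assumes "\<gamma> \<in> PP n" "\<alpha> \<in> PP n"
  shows "dm (pprod n \<gamma> \<alpha>) x \<longleftrightarrow> (\<exists>v w. ul \<gamma> x v \<and> mid_joined n \<gamma> \<alpha> v w \<and> dm \<alpha> w)"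
  unfolding dm_def ul_pprod[OF assms] by blast

lemma cd_pprod:
  assumes "\<gamma> \<in> PP n" "\<alpha> \<in> PP n"
  shows "cd (pprod n \<gamma> \<alpha>) y \<longleftrightarrow> (\<exists>v w. cd \<gamma> v \<and> mid_joined n \<gamma> \<alpha> v w \<and> ul \<alpha> w y)"
  unfolding cd_def ul_pprod[OF assms] by blast

subsection \<open>The anti-involution\<close>

fun flip :: "vertex \<Rightarrow> vertex" where
  "flip (Up x) = Low x"
| "flip (Low x) = Up x"
| "flip (Mid x) = Mid x"

lemma flip_flip [simp]: "flip (flip v) = v"
  by (cases v) auto

lemma inj_flip: "inj flip"
  by (metis flip_flip injI)

text \<open>Reflection exchanges the two rows. It reverses products and preserves the number of
  floating components, so every statement about upper patterns or left multiplication has a mirror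
  image.\<close>

definition star :: "vpart \<Rightarrow> vpart" where
  "star \<alpha> = (`) flip ` \<alpha>"

lemma star_star [simp]: "star (star \<alpha>) = \<alpha>"
  by (simp add: star_def image_image)

lemma flip_verts: "flip ` verts n = verts n"
  by (auto simp: verts_def image_Un image_image)

lemma joined_star: "joined (star \<alpha>) v w \<longleftrightarrow> joined \<alpha> (flip v) (flip w)"
proof -
  have "v \<in> flip ` B \<longleftrightarrow> flip v \<in> B" for v B
    by (metis flip_flip image_eqI image_iff)
  then show ?thesis by (simp add: joined_def star_def)
qed

lemma star_PP [simp]: "star \<alpha> \<in> PP n \<longleftrightarrow> \<alpha> \<in> PP n"
proof -
  have "star \<alpha> \<in> PP n" if "\<alpha> \<in> PP n" for \<alpha>
  proof -
    from that have p: "\<Union>\<alpha> = verts n" "{} \<notin> \<alpha>" "disjoint \<alpha>" by (auto simp: PP_iff partition_on_def)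
    have "\<Union>(star \<alpha>) = flip ` \<Union>\<alpha>" by (auto simp: star_def)
    then have "\<Union>(star \<alpha>) = verts n" by (simp only: p flip_verts)
    moreover have "{} \<notin> star \<alpha>" using p by (auto simp: star_def)
    moreover have "disjoint (star \<alpha>)"
    proof (rule disjointI)
      fix A B assume "A \<in> star \<alpha>" "B \<in> star \<alpha>" "A \<noteq> B"
      then obtain A' B' where *: "A' \<in> \<alpha>" "B' \<in> \<alpha>" "A = flip ` A'" "B = flip ` B'" "A' \<noteq> B'"
        by (auto simp: star_def)
      then have "A' \<inter> B' = {}" using p(3) by (auto dest: disjointD)
      then show "A \<inter> B = {}" unfolding * by (simp add: image_Int[OF inj_flip, symmetric])
    qed
    ultimately show ?thesis by (simp add: PP_iff partition_on_def)
  qed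
  from this[of \<alpha>] this[of "star \<alpha>"] show ?thesis by auto
qed

lemma star_simps [simp]:
  "uu (star \<alpha>) = ll \<alpha>" "ll (star \<alpha>) = uu \<alpha>" "ul (star \<alpha>) x y = ul \<alpha> y x"
  "dm (star \<alpha>) = cd \<alpha>" "cd (star \<alpha>) = dm \<alpha>"
proof -
  show 1: "uu (star \<alpha>) = ll \<alpha>" "ll (star \<alpha>) = uu \<alpha>"
    by (auto simp: fun_eq_iff uu_def ll_def joined_star)
  show 2: "ul (star \<alpha>) x y = ul \<alpha> y x" for x y
    using joined_sym by (auto simp: ul_def joined_star)
  show "dm (star \<alpha>) = cd \<alpha>" "cd (star \<alpha>) = dm \<alpha>"
    by (auto simp: fun_eq_iff dm_def cd_def 2)
qed

lemma mid_joined_star [simp]: "mid_joined n (star \<alpha>) (star \<gamma>) = mid_joined n \<gamma> \<alpha>"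
proof -
  have "(\<lambda>x y. uu \<alpha> x y \<or> ll \<gamma> x y) = (\<lambda>x y. ll \<gamma> x y \<or> uu \<alpha> x y)" by blast
  then show ?thesis by (intro ext) (simp add: mid_joined_def)
qed

lemma star_pprod:
  assumes "\<gamma> \<in> PP n" "\<alpha> \<in> PP n"
  shows "star (pprod n \<gamma> \<alpha>) = pprod n (star \<alpha>) (star \<gamma>)"
proof -
  have s: "star \<alpha> \<in> PP n" "star \<gamma> \<in> PP n" using assms by auto
  have mid_joined: "mid_joined n \<gamma> \<alpha> x y \<longleftrightarrow> mid_joined n \<gamma> \<alpha> y x" for x y using mid_joined_sym by blast
  show ?thesis
  proof (rule PP_eqI[of _ n])
    show "uu (star (pprod n \<gamma> \<alpha>)) = uu (pprod n (star \<alpha>) (star \<gamma>))"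
      using assms by (simp add: fun_eq_iff uu_pprod[OF s] ll_pprod[OF assms])
    show "ll (star (pprod n \<gamma> \<alpha>)) = ll (pprod n (star \<alpha>) (star \<gamma>))"
      using assms by (simp add: fun_eq_iff ll_pprod[OF s] uu_pprod[OF assms])
    show "ul (star (pprod n \<gamma> \<alpha>)) = ul (pprod n (star \<alpha>) (star \<gamma>))"
      using assms mid_joined by (simp add: fun_eq_iff ul_pprod[OF s] ul_pprod[OF assms]) blast
  qed (use assms s in \<open>simp_all add: pprod_PP\<close>)
qed

lemma floating_star:
  assumes "\<gamma> \<in> PP n" "\<alpha> \<in> PP n"
  shows "floating n (star \<alpha>) (star \<gamma>) = floating n \<gamma> \<alpha>"
proof -
  have "float_sets n (star \<alpha>) (star \<gamma>) = float_sets n \<gamma> \<alpha>" unfolding float_sets_def by (simp add: conj_commute)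
  then show ?thesis using assms by (simp add: floating_float_sets)
qed

lemma star_label_part: "star (label_part n u l) = label_part n l u"
  by (rule PP_eqI[of _ n]) (auto simp: fun_eq_iff)

subsection \<open>Rank and hat\<close>

text \<open>A transversal is determined by its upper part, so the rank can be counted on these
  classes, where \<open>uu\<close> and \<open>dm\<close> alone decide.\<close>

definition upper_classes :: "vpart \<Rightarrow> nat set set" where
  "upper_classes \<alpha> = {{y. uu \<alpha> x y} | x. dm \<alpha> x}"

lemma transversalD:
  assumes "\<alpha> \<in> PP n" "B \<in> transversals \<alpha>"
  obtains x y where "Up x \<in> B" "Low y \<in> B" "ul \<alpha> x y"
  using assms by (auto simp: transversals_def ul_def joined_def)

lemma Up_block: "\<alpha> \<in> PP n \<Longrightarrow> B \<in> \<alpha> \<Longrightarrow> Up x \<in> B \<Longrightarrow> {y. Up y \<in> B} = {y. uu \<alpha> x y}"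
  using block_eq[of \<alpha> n B "Up x"] by (auto simp: uu_def)

lemma rank_upper_classes:
  assumes "\<alpha> \<in> PP n" shows "rank \<alpha> = card (upper_classes \<alpha>)"
proof -
  have "bij_betw (\<lambda>B. {y. Up y \<in> B}) (transversals \<alpha>) (upper_classes \<alpha>)"
  proof (rule bij_betw_imageI)
    show "inj_on (\<lambda>B. {y. Up y \<in> B}) (transversals \<alpha>)"
    proof (rule inj_onI)
      fix B C assume BC: "B \<in> transversals \<alpha>" "C \<in> transversals \<alpha>" "{y. Up y \<in> B} = {y. Up y \<in> C}"
      then obtain x where "Up x \<in> B" using transversalD[OF assms] by metis
      moreover from this BC have "Up x \<in> C" by auto
      ultimately show "B = C"
        using block_eq[OF assms, of B "Up x"] block_eq[OF assms, of C "Up x"] BC(1,2)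
        by (auto simp: transversals_def)
    qed
    show "(\<lambda>B. {y. Up y \<in> B}) ` transversals \<alpha> = upper_classes \<alpha>"
    proof (intro equalityI subsetI)
      fix c assume "c \<in> (\<lambda>B. {y. Up y \<in> B}) ` transversals \<alpha>"
      then obtain B where B: "B \<in> transversals \<alpha>" "c = {y. Up y \<in> B}" by auto
      obtain x y where "Up x \<in> B" "ul \<alpha> x y" using transversalD[OF assms B(1)] by metis
      then show "c \<in> upper_classes \<alpha>"
        using B Up_block[OF assms, of B x] ul_dm unfolding upper_classes_def transversals_def by blast
    next
      fix c assume "c \<in> upper_classes \<alpha>"
      then obtain x where x: "dm \<alpha> x" "c = {y. uu \<alpha> x y}" by (auto simp: upper_classes_def)
      then obtain y B where B: "B \<in> \<alpha>" "Up x \<in> B" "Low y \<in> B" by (auto simp: dm_def ul_def joined_def)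
      then have "B \<in> transversals \<alpha>" by (auto simp: transversals_def)
      then show "c \<in> (\<lambda>B. {y. Up y \<in> B}) ` transversals \<alpha>"
        using B x Up_block[OF assms B(1,2)] by auto
    qed
  qed
  then show ?thesis by (simp add: rank_def bij_betw_same_card)
qed

lemma finite_upper_classes:
  assumes "\<alpha> \<in> PP n" shows "finite (upper_classes \<alpha>)"
proof -
  have "upper_classes \<alpha> \<subseteq> (\<lambda>x. {y. uu \<alpha> x y}) ` {1..n}"
    using dm_range[OF assms] unfolding upper_classes_def by blast
  then show ?thesis by (rule finite_subset) auto
qed

lemma uclass_eq:
  assumes "\<alpha> \<in> PP n" "x \<in> {1..n}"
  shows "{z. uu \<alpha> x z} = {z. uu \<alpha> y z} \<longleftrightarrow> uu \<alpha> x y"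
  using uu_trans[OF assms(1)] uu_sym uu_refl[OF assms] by blast

lemma rank_star [simp]: "rank (star \<alpha>) = rank \<alpha>"
proof -
  have 1: "flip ` B \<inter> range Up = flip ` (B \<inter> range Low)" "flip ` B \<inter> range Low = flip ` (B \<inter> range Up)" for B
  proof -
    have "flip ` range Low = range Up" "flip ` range Up = range Low" by (auto simp: image_image)
    then show "flip ` B \<inter> range Up = flip ` (B \<inter> range Low)" "flip ` B \<inter> range Low = flip ` (B \<inter> range Up)"
      by (auto simp: image_Int[OF inj_flip])
  qed
  have "transversals (star \<alpha>) = (`) flip ` transversals \<alpha>"
  proof (intro equalityI subsetI)
    fix B assume "B \<in> transversals (star \<alpha>)"
    then obtain B' where "B' \<in> \<alpha>" and B: "B = flip ` B'"
      and "flip ` B' \<inter> range Up \<noteq> {}" "flip ` B' \<inter> range Low \<noteq> {}"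
      unfolding transversals_def star_def by blast
    then have "B' \<in> \<alpha>" "B' \<inter> range Up \<noteq> {}" "B' \<inter> range Low \<noteq> {}"
      by (simp_all only: 1 image_is_empty not_False_eq_True)
    with B show "B \<in> (`) flip ` transversals \<alpha>" unfolding transversals_def by blast
  next
    fix B assume "B \<in> (`) flip ` transversals \<alpha>"
    then obtain B' where "B' \<in> \<alpha>" "B = flip ` B'" "B' \<inter> range Up \<noteq> {}" "B' \<inter> range Low \<noteq> {}"
      unfolding transversals_def by blast
    then show "B \<in> transversals (star \<alpha>)"
      unfolding transversals_def star_def by (simp only: 1 mem_Collect_eq image_is_empty) blast
  qed
  moreover have "inj_on ((`) flip) (transversals \<alpha>)"
    using inj_flip by (simp add: inj_on_def inj_image_eq_iff)
  ultimately show ?thesis by (simp add: rank_def card_image)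
qed

lemma rank_label:
  assumes "\<alpha> \<in> PP n" "\<And>x y. dm \<alpha> x \<Longrightarrow> dm \<alpha> y \<Longrightarrow> uu \<alpha> x y \<longleftrightarrow> a x = a y"
  shows "rank \<alpha> = card (a ` {x. dm \<alpha> x})"
proof -
  \<comment> \<open>By hypothesis the domain points of one class carry a single label, and different
    classes carry different ones; the map picks out this label.\<close>
  have "bij_betw (\<lambda>c. the_elem (a ` (c \<inter> {x. dm \<alpha> x}))) (upper_classes \<alpha>) (a ` {x. dm \<alpha> x})"
  proof -
    have *: "the_elem (a ` ({y. uu \<alpha> x y} \<inter> {x. dm \<alpha> x})) = a x" if "dm \<alpha> x" for x
    proof -
      have "a ` ({y. uu \<alpha> x y} \<inter> {x. dm \<alpha> x}) = {a x}"
        using that assms(2) uu_refl[OF assms(1) dm_range[OF assms(1)]] by (auto simp: image_iff)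
      then show ?thesis by simp
    qed
    show ?thesis
    proof (rule bij_betw_imageI)
      show "inj_on (\<lambda>c. the_elem (a ` (c \<inter> {x. dm \<alpha> x}))) (upper_classes \<alpha>)"
      proof (rule inj_onI)
        fix c c' assume cc: "c \<in> upper_classes \<alpha>" "c' \<in> upper_classes \<alpha>"
          and e: "the_elem (a ` (c \<inter> {x. dm \<alpha> x})) = the_elem (a ` (c' \<inter> {x. dm \<alpha> x}))"
        then obtain x y where "dm \<alpha> x" "c = {y. uu \<alpha> x y}" "dm \<alpha> y" "c' = {z. uu \<alpha> y z}"
          by (auto simp: upper_classes_def)
        with e * assms(2) show "c = c'"
          by (simp only: uclass_eq[OF assms(1) dm_range[OF assms(1)]])
      qed
      show "(\<lambda>c. the_elem (a ` (c \<inter> {x. dm \<alpha> x}))) ` upper_classes \<alpha> = a ` {x. dm \<alpha> x}"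
        by (auto simp: upper_classes_def * image_iff) (metis *)
    qed
  qed
  then show ?thesis by (simp add: rank_upper_classes[OF assms(1)] bij_betw_same_card)
qed

lemma rank_0_iff:
  assumes "\<alpha> \<in> PP n" shows "rank \<alpha> = 0 \<longleftrightarrow> (\<forall>x. \<not> dm \<alpha> x)"
  using finite_upper_classes[OF assms] by (auto simp: rank_upper_classes[OF assms] upper_classes_def)

lemma rank_le_1_iff:
  assumes "\<alpha> \<in> PP n" shows "rank \<alpha> \<le> 1 \<longleftrightarrow> (\<forall>x y. dm \<alpha> x \<longrightarrow> dm \<alpha> y \<longrightarrow> uu \<alpha> x y)"
proof -
  have "rank \<alpha> \<le> 1 \<longleftrightarrow> (\<forall>c\<in>upper_classes \<alpha>. \<forall>c'\<in>upper_classes \<alpha>. c = c')"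
    using card_le_Suc0_iff_eq[OF finite_upper_classes[OF assms]] by (simp add: rank_upper_classes[OF assms])
  also have "\<dots> \<longleftrightarrow> (\<forall>x y. dm \<alpha> x \<longrightarrow> dm \<alpha> y \<longrightarrow> uu \<alpha> x y)"
  proof (intro iffI allI impI ballI)
    fix x y assume *: "\<forall>c\<in>upper_classes \<alpha>. \<forall>c'\<in>upper_classes \<alpha>. c = c'" "dm \<alpha> x" "dm \<alpha> y"
    have m: "{z. uu \<alpha> w z} \<in> upper_classes \<alpha>" if "dm \<alpha> w" for w using that by (auto simp: upper_classes_def)
    have "{z. uu \<alpha> x z} = {z. uu \<alpha> y z}" by (rule bspec[OF bspec[OF *(1) m[OF *(2)]] m[OF *(3)]])
    then show "uu \<alpha> x y" by (rule iffD1[OF uclass_eq[OF assms dm_range[OF assms *(2)]]])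
  next
    fix c c' assume *: "\<forall>x y. dm \<alpha> x \<longrightarrow> dm \<alpha> y \<longrightarrow> uu \<alpha> x y" "c \<in> upper_classes \<alpha>" "c' \<in> upper_classes \<alpha>"
    then obtain x y where xy: "dm \<alpha> x" "c = {z. uu \<alpha> x z}" "dm \<alpha> y" "c' = {z. uu \<alpha> y z}"
      unfolding upper_classes_def by blast
    have "{z. uu \<alpha> x z} = {z. uu \<alpha> y z}"
      by (rule iffD2[OF uclass_eq[OF assms dm_range[OF assms xy(1)]]]) (use *(1) xy in blast)
    then show "c = c'" by (simp only: xy)
  qed
  finally show ?thesis .
qed

lemma rank_le_1_cd:
  assumes "\<alpha> \<in> PP n" "rank \<alpha> \<le> 1" "cd \<alpha> x" "cd \<alpha> y" shows "ll \<alpha> x y"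
proof -
  have "star \<alpha> \<in> PP n" "rank (star \<alpha>) \<le> 1" using assms by simp_all
  then show ?thesis using rank_le_1_iff[of "star \<alpha>" n] assms(3,4) by simp
qed

text \<open>With at most one transversal the cross relation is a rectangle. An element of rank at
  most 1 is therefore given by its two patterns together with its domain and codomain.\<close>

lemma rank_le_1_ul:
  assumes "\<alpha> \<in> PP n" "rank \<alpha> \<le> 1" shows "ul \<alpha> x y \<longleftrightarrow> dm \<alpha> x \<and> cd \<alpha> y"
proof
  assume "dm \<alpha> x \<and> cd \<alpha> y"
  then obtain y' where y': "ul \<alpha> x y'" "cd \<alpha> y" by (auto simp: dm_def)
  then show "ul \<alpha> x y" using ul_ll[OF assms(1) y'(1) rank_le_1_cd[OF assms ul_cd[OF y'(1)] y'(2)]] by simp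
qed (auto intro: ul_dm ul_cd)

text \<open>A class of \<beta> inside its domain is a union of classes of \<alpha>, so sending each
  class of \<alpha> inside the domain of \<beta> to the class of \<beta> around it is onto. If the
  ranks agree, these are all the transversal classes of \<alpha> and the map is injective; this
  gives the two rigidity statements. They are applied to \<gamma> and a product
  \<gamma>\<alpha>.\<close>

lemma rank_mono:
  assumes A: "\<alpha> \<in> PP n" and B: "\<beta> \<in> PP n"
    and d: "\<And>x. dm \<beta> x \<Longrightarrow> dm \<alpha> x" and u: "\<And>x y. uu \<alpha> x y \<Longrightarrow> uu \<beta> x y"
  shows "rank \<beta> \<le> rank \<alpha>"
    and "rank \<beta> = rank \<alpha> \<Longrightarrow> dm \<beta> = dm \<alpha>"
    and "rank \<beta> = rank \<alpha> \<Longrightarrow> dm \<beta> x \<Longrightarrow> uu \<beta> x y \<Longrightarrow> uu \<alpha> x y"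
proof -
  define K where "K = {{y. uu \<alpha> x y} | x. dm \<beta> x}"
  define \<phi> where "\<phi> c = {y. \<exists>x\<in>c. uu \<beta> x y}" for c
  have K: "K \<subseteq> upper_classes \<alpha>" unfolding K_def upper_classes_def using d by blast
  have \<phi>: "\<phi> {y. uu \<alpha> x y} = {y. uu \<beta> x y}" if "dm \<beta> x" for x
    unfolding \<phi>_def using u uu_trans[OF B] uu_refl[OF A dm_range[OF B that]] by blast
  have im: "\<phi> ` K = upper_classes \<beta>"
    unfolding K_def upper_classes_def using \<phi> by (auto simp: image_iff)
  have fK: "finite K" using K finite_upper_classes[OF A] by (rule finite_subset)
  have 1: "card (upper_classes \<beta>) \<le> card K" using card_image_le[OF fK, of \<phi>] im by simp
  have 2: "card K \<le> card (upper_classes \<alpha>)" using card_mono[OF finite_upper_classes[OF A] K] .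
  show "rank \<beta> \<le> rank \<alpha>" using 1 2 by (simp add: rank_upper_classes[OF A] rank_upper_classes[OF B])
  {
    assume "rank \<beta> = rank \<alpha>"
    then have "card K = card (upper_classes \<alpha>)" "card (\<phi> ` K) = card K"
      using 1 2 im by (simp_all add: rank_upper_classes[OF A] rank_upper_classes[OF B])
    then have KA: "K = upper_classes \<alpha>" and inj: "inj_on \<phi> K"
      using card_subset_eq[OF finite_upper_classes[OF A] K] eq_card_imp_inj_on[OF fK] by auto
    have "dm \<beta> x" if "dm \<alpha> x" for x
    proof -
      have "{y. uu \<alpha> x y} \<in> K" unfolding KA upper_classes_def using that by blast
      then obtain x' where "dm \<beta> x'" "{y. uu \<alpha> x y} = {y. uu \<alpha> x' y}" by (auto simp: K_def)
      then show ?thesis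
        using uclass_eq[OF A dm_range[OF A that], of x'] u uu_dm[OF B] by blast
    qed
    with d show "dm \<beta> = dm \<alpha>" by blast
    assume x: "dm \<beta> x" and xy: "uu \<beta> x y"
    then have y: "dm \<beta> y" using uu_dm[OF B] uu_sym by blast
    have "\<phi> {z. uu \<alpha> x z} = \<phi> {z. uu \<alpha> y z}"
      using xy \<phi>[OF x] \<phi>[OF y] uclass_eq[OF B dm_range[OF B x]] by simp
    then have "{z. uu \<alpha> x z} = {z. uu \<alpha> y z}"
      by (rule inj_onD[OF inj]) (use x y in \<open>auto simp: K_def\<close>)
    then show "uu \<alpha> x y" using uclass_eq[OF A dm_range[OF B x]] by simp
  }
qed

section \<open>Rank, domain and patterns of a product\<close>

context
  fixes \<gamma> \<alpha> n assumes C: "\<gamma> \<in> PP n" and A: "\<alpha> \<in> PP n"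
begin

lemma dm_pprod_le: "dm (pprod n \<gamma> \<alpha>) x \<Longrightarrow> dm \<gamma> x"
  using dm_pprod[OF C A] ul_dm by blast
lemma cd_pprod_le: "cd (pprod n \<gamma> \<alpha>) x \<Longrightarrow> cd \<alpha> x"
  using cd_pprod[OF C A] ul_cd by blast
lemma uu_pprod_ge: "uu \<gamma> x y \<Longrightarrow> uu (pprod n \<gamma> \<alpha>) x y"
  by (simp add: uu_pprod[OF C A])
lemma ll_pprod_ge: "ll \<alpha> x y \<Longrightarrow> ll (pprod n \<gamma> \<alpha>) x y"
  by (simp add: ll_pprod[OF C A])

lemma rank_pprod_left: "rank (pprod n \<gamma> \<alpha>) \<le> rank \<gamma>"
  using rank_mono(1)[OF C pprod_PP[OF C A]] dm_pprod_le uu_pprod_ge by blast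

end

lemma rank_pprod_right:
  assumes "\<gamma> \<in> PP n" "\<alpha> \<in> PP n" shows "rank (pprod n \<gamma> \<alpha>) \<le> rank \<alpha>"
  using rank_pprod_left[of "star \<alpha>" n "star \<gamma>"] assms star_pprod[OF assms]
  by (metis rank_star star_PP)

text \<open>This is stability: a product that keeps the rank of its left factor is Green-R-related
  to it. Upper points of \<gamma> can be merged only through its domain, and there
  \<open>rank_mono\<close> forbids it.\<close>

lemma rank_pprod_left_eq:
  assumes C: "\<gamma> \<in> PP n" and A: "\<alpha> \<in> PP n" and r: "rank (pprod n \<gamma> \<alpha>) = rank \<gamma>"
  shows "dm (pprod n \<gamma> \<alpha>) = dm \<gamma>" "uu (pprod n \<gamma> \<alpha>) = uu \<gamma>"
proof -
  show d: "dm (pprod n \<gamma> \<alpha>) = dm \<gamma>"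
    by (rule rank_mono(2)[OF C pprod_PP[OF C A] dm_pprod_le[OF C A] uu_pprod_ge[OF C A] r])
  have m: "uu \<gamma> x y" if "dm (pprod n \<gamma> \<alpha>) x" "uu (pprod n \<gamma> \<alpha>) x y" for x y
    by (rule rank_mono(3)[OF C pprod_PP[OF C A] dm_pprod_le[OF C A] uu_pprod_ge[OF C A] r that])
  have "uu \<gamma> x y" if xy: "uu (pprod n \<gamma> \<alpha>) x y" for x y
    using xy[unfolded uu_pprod[OF C A]]
  proof
    assume "\<exists>v w. ul \<gamma> x v \<and> mid_joined n \<gamma> \<alpha> v w \<and> ul \<gamma> y w"
    then have "dm \<gamma> x" using ul_dm by blast
    then show ?thesis using m xy d by simp
  qed
  then show "uu (pprod n \<gamma> \<alpha>) = uu \<gamma>" using uu_pprod_ge[OF C A] by blast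
qed

lemma rank_pprod_right_eq:
  assumes "\<gamma> \<in> PP n" "\<alpha> \<in> PP n" "rank (pprod n \<gamma> \<alpha>) = rank \<alpha>"
  shows "cd (pprod n \<gamma> \<alpha>) = cd \<alpha>" "ll (pprod n \<gamma> \<alpha>) = ll \<alpha>"
proof -
  have r: "rank (pprod n (star \<alpha>) (star \<gamma>)) = rank (star \<alpha>)"
    by (metis assms rank_star star_pprod)
  have s: "star \<alpha> \<in> PP n" "star \<gamma> \<in> PP n" using assms by auto
  show "cd (pprod n \<gamma> \<alpha>) = cd \<alpha>" "ll (pprod n \<gamma> \<alpha>) = ll \<alpha>"
    using rank_pprod_left_eq[OF s r] unfolding star_pprod[OF assms(1,2), symmetric] by simp_all
qed

lemma rank_cong:
  assumes "\<alpha> \<in> PP n" "\<beta> \<in> PP n" "uu \<alpha> = uu \<beta>" "dm \<alpha> = dm \<beta>" shows "rank \<alpha> = rank \<beta>"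
  using assms by (simp add: rank_upper_classes upper_classes_def)

lemma rank_cong':
  assumes "\<alpha> \<in> PP n" "\<beta> \<in> PP n" "ll \<alpha> = ll \<beta>" "cd \<alpha> = cd \<beta>" shows "rank \<alpha> = rank \<beta>"
  using rank_cong[of "star \<alpha>" n "star \<beta>"] assms by simp

section \<open>Splitting the transversals\<close>

lemma hat_PP_joined:
  assumes "\<alpha> \<in> PP n"
  shows "hat \<alpha> \<in> PP n" and "joined (hat \<alpha>) v w \<longleftrightarrow> joined \<alpha> v w \<and> (v \<in> range Up \<longleftrightarrow> w \<in> range Up)"
proof -
  define V where "V = verts n"
  define U where "U = range Up"
  define L where "L = range Low"
  have VUL: "V \<subseteq> U \<union> L" and UL: "U \<inter> L = {}" by (auto simp: V_def U_def L_def verts_def)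
  have p: "\<Union>\<alpha> = V" "{} \<notin> \<alpha>" "\<And>B C. B \<in> \<alpha> \<Longrightarrow> C \<in> \<alpha> \<Longrightarrow> B \<noteq> C \<Longrightarrow> B \<inter> C = {}"
    using assms unfolding PP_iff partition_on_def V_def by (auto dest: disjointD)
  have sub: "B \<subseteq> U \<union> L" if "B \<in> \<alpha>" for B using that p(1) VUL by blast
  \<comment> \<open>Cutting every block into its traces on the two rows gives the same result, since
    a block that is no transversal has only one nonempty trace. This removes the case distinction in
    the definition of \<open>hat\<close>.\<close>
  have mem: "X \<in> hat \<alpha> \<longleftrightarrow> (\<exists>B\<in>\<alpha>. X \<noteq> {} \<and> (X = B \<inter> U \<or> X = B \<inter> L))" for X
  proof
    assume "X \<in> hat \<alpha>"
    then consider "X \<in> \<alpha>" "X \<inter> U = {} \<or> X \<inter> L = {}"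
      | B where "B \<in> \<alpha>" "X = B \<inter> U" "X \<noteq> {}" | B where "B \<in> \<alpha>" "X = B \<inter> L" "X \<noteq> {}"
      unfolding hat_def transversals_def U_def L_def by blast
    then show "\<exists>B\<in>\<alpha>. X \<noteq> {} \<and> (X = B \<inter> U \<or> X = B \<inter> L)"
    proof cases
      case 1
      then have "X = X \<inter> L \<or> X = X \<inter> U" using sub[OF 1(1)] by blast
      with 1 p(2) show ?thesis by blast
    qed blast+
  next
    assume "\<exists>B\<in>\<alpha>. X \<noteq> {} \<and> (X = B \<inter> U \<or> X = B \<inter> L)"
    then obtain B where B: "B \<in> \<alpha>" "X \<noteq> {}" "X = B \<inter> U \<or> X = B \<inter> L" by blast
    show "X \<in> hat \<alpha>"
    proof (cases "B \<in> transversals \<alpha>")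
      case True
      with B show ?thesis unfolding hat_def U_def L_def by blast
    next
      case False
      with B(1) have "B \<inter> U = {} \<or> B \<inter> L = {}" unfolding transversals_def U_def L_def by blast
      then consider "B \<inter> U = {}" "B \<subseteq> L" | "B \<inter> L = {}" "B \<subseteq> U" using sub[OF B(1)] by blast
      then have "X = B" using B(2,3) by cases blast+
      then show ?thesis using False B(1) by (simp add: hat_def)
    qed
  qed
  have IU: "B \<inter> U \<in> hat \<alpha>" if "B \<in> \<alpha>" "v \<in> B" "v \<in> U" for B v
    by (rule mem[THEN iffD2]) (use that in blast)
  have IL: "B \<inter> L \<in> hat \<alpha>" if "B \<in> \<alpha>" "v \<in> B" "v \<in> L" for B v
    by (rule mem[THEN iffD2]) (use that in blast)
  have E: "\<exists>B\<in>\<alpha>. X = B \<inter> U \<or> X = B \<inter> L" if "X \<in> hat \<alpha>" for X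
    using mem[THEN iffD1, OF that] by blast
  have un: "\<Union>(hat \<alpha>) = V"
  proof (intro equalityI subsetI)
    fix v assume "v \<in> V"
    then obtain B where "B \<in> \<alpha>" "v \<in> B" using p(1) by blast
    with sub[OF this(1)] IU IL have "B \<inter> U \<in> hat \<alpha> \<and> v \<in> B \<inter> U \<or> B \<inter> L \<in> hat \<alpha> \<and> v \<in> B \<inter> L"
      by blast
    then show "v \<in> \<Union>(hat \<alpha>)" by blast
  next
    fix v assume "v \<in> \<Union>(hat \<alpha>)"
    then obtain X where "X \<in> hat \<alpha>" "v \<in> X" by blast
    with E[of X] obtain B where "B \<in> \<alpha>" "v \<in> B" by blast
    then show "v \<in> V" using p(1) by blast
  qed
  have ne: "{} \<notin> hat \<alpha>" using mem[of "{}"] by blast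
  have dis: "X \<inter> Y = {}" if "X \<in> hat \<alpha>" "Y \<in> hat \<alpha>" "X \<noteq> Y" for X Y
  proof -
    obtain B C where BC: "B \<in> \<alpha>" "C \<in> \<alpha>" "X = B \<inter> U \<or> X = B \<inter> L" "Y = C \<inter> U \<or> Y = C \<inter> L"
      using E[OF \<open>X \<in> hat \<alpha>\<close>] E[OF \<open>Y \<in> hat \<alpha>\<close>] by blast
    show ?thesis
    proof (cases "B = C")
      case True
      with BC(3,4) that(3) UL show ?thesis by blast
    next
      case False
      from p(3)[OF BC(1,2) this] BC(3,4) show ?thesis by blast
    qed
  qed
  show "hat \<alpha> \<in> PP n"
    unfolding PP_iff partition_on_def V_def[symmetric] using un ne dis disjointI by metis
  show "joined (hat \<alpha>) v w \<longleftrightarrow> joined \<alpha> v w \<and> (v \<in> range Up \<longleftrightarrow> w \<in> range Up)"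
  proof
    assume "joined (hat \<alpha>) v w"
    then obtain X where "X \<in> hat \<alpha>" "v \<in> X" "w \<in> X" unfolding joined_def by blast
    then obtain B where "B \<in> \<alpha>" "v \<in> B" "w \<in> B" "v \<in> U \<and> w \<in> U \<or> v \<in> L \<and> w \<in> L"
      using E[of X] by blast
    with UL show "joined \<alpha> v w \<and> (v \<in> range Up \<longleftrightarrow> w \<in> range Up)"
      unfolding joined_def U_def[symmetric] by blast
  next
    assume "joined \<alpha> v w \<and> (v \<in> range Up \<longleftrightarrow> w \<in> range Up)"
    then obtain B where B: "B \<in> \<alpha>" "v \<in> B" "w \<in> B" "v \<in> U \<longleftrightarrow> w \<in> U"
      unfolding joined_def U_def[symmetric] by blast
    show "joined (hat \<alpha>) v w"
    proof (cases "v \<in> U")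
      case True
      with B IU[OF B(1,2)] show ?thesis unfolding joined_def by (intro bexI[of _ "B \<inter> U"]) simp_all
    next
      case False
      then have "v \<in> L" "w \<in> L" using B sub[OF B(1)] by blast+
      with B IL[OF B(1,2)] show ?thesis unfolding joined_def by (intro bexI[of _ "B \<inter> L"]) simp_all
    qed
  qed
qed

lemma hat_simps:
  assumes "\<alpha> \<in> PP n"
  shows "uu (hat \<alpha>) = uu \<alpha>" "ll (hat \<alpha>) = ll \<alpha>" "\<not> ul (hat \<alpha>) x y" "\<not> dm (hat \<alpha>) x" "\<not> cd (hat \<alpha>) x"
  by (auto simp: fun_eq_iff uu_def ll_def ul_def dm_def cd_def hat_PP_joined(2)[OF assms])

lemma rank_hat: "\<alpha> \<in> PP n \<Longrightarrow> rank (hat \<alpha>) = 0"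
  by (simp add: rank_0_iff[OF hat_PP_joined(1)] hat_simps)

lemma hat_eq_iff:
  assumes "\<alpha> \<in> PP n" "\<beta> \<in> PP n"
  shows "hat \<alpha> = hat \<beta> \<longleftrightarrow> uu \<alpha> = uu \<beta> \<and> ll \<alpha> = ll \<beta>"
proof
  assume "hat \<alpha> = hat \<beta>"
  then have "uu (hat \<alpha>) = uu (hat \<beta>)" "ll (hat \<alpha>) = ll (hat \<beta>)" by simp_all
  then show "uu \<alpha> = uu \<beta> \<and> ll \<alpha> = ll \<beta>" using assms by (simp only: hat_simps(1,2) simp_thms)
next
  assume *: "uu \<alpha> = uu \<beta> \<and> ll \<alpha> = ll \<beta>"
  have "ul (hat \<alpha>) = ul (hat \<beta>)" by (simp add: fun_eq_iff hat_simps(3)[OF assms(1)] hat_simps(3)[OF assms(2)])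
  with * show "hat \<alpha> = hat \<beta>"
    using assms by (intro PP_eqI[of _ n]) (simp_all add: hat_simps hat_PP_joined(1))
qed

lemma hat_rank_0: "\<alpha> \<in> PP n \<Longrightarrow> rank \<alpha> = 0 \<Longrightarrow> hat \<alpha> = \<alpha>"
proof -
  assume A: "\<alpha> \<in> PP n" and "rank \<alpha> = 0"
  then have "\<not> ul \<alpha> x y" for x y using rank_0_iff[OF A] ul_dm by blast
  then have "ul (hat \<alpha>) = ul \<alpha>" by (simp add: fun_eq_iff hat_simps(3)[OF A])
  with A show ?thesis by (intro PP_eqI[of _ n]) (simp_all add: hat_simps hat_PP_joined(1))
qed

lemma star_hat: "\<alpha> \<in> PP n \<Longrightarrow> star (hat \<alpha>) = hat (star \<alpha>)"
proof -
  assume A: "\<alpha> \<in> PP n"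
  then have S: "star \<alpha> \<in> PP n" by simp
  have "ul (star (hat \<alpha>)) = ul (hat (star \<alpha>))"
    using hat_simps(3)[OF A] hat_simps(3)[OF S] by (auto simp: fun_eq_iff)
  then show ?thesis
    using A S by (intro PP_eqI[of _ n]) (simp_all add: hat_simps[OF A] hat_simps[OF S] hat_PP_joined(1))
qed

subsection \<open>Multiplying by labelled partitions\<close>

context
  fixes \<alpha> n and g :: "nat \<Rightarrow> 'c" and u :: "nat \<Rightarrow> 'c"
  assumes A: "\<alpha> \<in> PP n" and g: "\<forall>x y. uu \<alpha> x y \<longrightarrow> g x = g y"
begin

text \<open>As \<open>g\<close> is constant on the upper blocks of \<alpha>, no edge of \<alpha>
  leaves a level set of \<open>g\<close>, and the lower row of the multiplier joins each level set
  completely. The middle components are thus known, and the remaining lemmas of this context read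
  off the product from them.\<close>

lemma mid_joined_label_part: "mid_joined n (label_part n u g) \<alpha> x y \<longleftrightarrow> x \<in> {1..n} \<and> y \<in> {1..n} \<and> g x = g y"
proof
  assume j: "mid_joined n (label_part n u g) \<alpha> x y"
  have "g x = g y" by (rule mid_joined_invariant[OF j], simp, use g in blast)
  with mid_joined_range[OF j] show "x \<in> {1..n} \<and> y \<in> {1..n} \<and> g x = g y" by blast
next
  assume "x \<in> {1..n} \<and> y \<in> {1..n} \<and> g x = g y"
  then show "mid_joined n (label_part n u g) \<alpha> x y" by (intro mid_joined_ll) simp_all
qed

lemma uu_label_part_pprod: "uu (pprod n (label_part n u g) \<alpha>) x y \<longleftrightarrow> x \<in> {1..n} \<and> y \<in> {1..n} \<and> u x = u y"
  unfolding uu_pprod[OF label_part_PP A] mid_joined_label_part label_part_simps by metis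

lemma ul_label_part_pprod: "ul (pprod n (label_part n u g) \<alpha>) x y \<longleftrightarrow> x \<in> {1..n} \<and> (\<exists>v. u x = g v \<and> ul \<alpha> v y)"
  unfolding ul_pprod[OF label_part_PP A] mid_joined_label_part label_part_simps using ul_range[OF A] by metis

lemma ll_label_part_pprod:
  "ll (pprod n (label_part n u g) \<alpha>) x y \<longleftrightarrow> ll \<alpha> x y \<or> (\<exists>v w. ul \<alpha> v x \<and> g v = g w \<and> ul \<alpha> w y)"
  unfolding ll_pprod[OF label_part_PP A] mid_joined_label_part label_part_simps using ul_range[OF A] by metis

lemma dm_label_part_pprod: "dm (pprod n (label_part n u g) \<alpha>) x \<longleftrightarrow> x \<in> {1..n} \<and> (\<exists>v. u x = g v \<and> dm \<alpha> v)"
  unfolding dm_def ul_label_part_pprod by metis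

lemma cd_label_part_pprod: "cd (pprod n (label_part n u g) \<alpha>) y \<longleftrightarrow> (\<exists>x\<in>{1..n}. \<exists>v. u x = g v \<and> ul \<alpha> v y)"
  unfolding cd_def ul_label_part_pprod by metis

lemma floating_label_part:
  "floating n (label_part n u g) \<alpha> = 0 \<longleftrightarrow> (\<forall>v\<in>{1..n}. (\<exists>x\<in>{1..n}. u x = g v) \<or> (\<exists>w. g w = g v \<and> dm \<alpha> w))"
  unfolding floating_0_iff[OF label_part_PP A] mid_joined_label_part cd_def label_part_simps using dm_range[OF A] by metis

end

text \<open>The partition with a single block. Left multiplication by it lowers the rank to at most
  1 and yields no floating component, since the whole middle row hangs together with the upper row.
  What it retains is the codomain and, with the codomain merged, the lower pattern.\<close>

definition \<omega> :: "nat \<Rightarrow> vpart" where "\<omega> n = label_part n (\<lambda>_. True) (\<lambda>_. True)"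

lemma \<omega>_PP [simp]: "\<omega> n \<in> PP n" by (simp add: \<omega>_def)
lemma star_\<omega> [simp]: "star (\<omega> n) = \<omega> n" by (simp add: \<omega>_def star_label_part)

lemma \<omega>_pprod:
  assumes "\<alpha> \<in> PP n"
  shows "uu (pprod n (\<omega> n) \<alpha>) x y \<longleftrightarrow> x \<in> {1..n} \<and> y \<in> {1..n}"
    "ul (pprod n (\<omega> n) \<alpha>) x y \<longleftrightarrow> x \<in> {1..n} \<and> cd \<alpha> y"
    "ll (pprod n (\<omega> n) \<alpha>) x y \<longleftrightarrow> ll \<alpha> x y \<or> cd \<alpha> x \<and> cd \<alpha> y"
    "floating n (\<omega> n) \<alpha> = 0"
proof -
  have g: "\<forall>x y. uu \<alpha> x y \<longrightarrow> True = True" by simp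
  show "uu (pprod n (\<omega> n) \<alpha>) x y \<longleftrightarrow> x \<in> {1..n} \<and> y \<in> {1..n}"
    unfolding \<omega>_def uu_label_part_pprod[where g="\<lambda>_. True", OF assms g] by blast
  show "ul (pprod n (\<omega> n) \<alpha>) x y \<longleftrightarrow> x \<in> {1..n} \<and> cd \<alpha> y"
    unfolding \<omega>_def ul_label_part_pprod[where g="\<lambda>_. True", OF assms g] cd_def by blast
  show "ll (pprod n (\<omega> n) \<alpha>) x y \<longleftrightarrow> ll \<alpha> x y \<or> cd \<alpha> x \<and> cd \<alpha> y"
    unfolding \<omega>_def ll_label_part_pprod[where g="\<lambda>_. True", OF assms g] cd_def by blast
  show "floating n (\<omega> n) \<alpha> = 0"
    unfolding \<omega>_def floating_label_part[where g="\<lambda>_. True", OF assms g] by blast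
qed

text \<open>The multiplier splits the middle row into two halves, only one of which is tied to the
  upper row. One upper block of \<alpha> across the halves reconnects them, and the multiplier acts
  like \<open>\<omega> n\<close>.\<close>

lemma two_class_connected:
  assumes A: "\<alpha> \<in> PP n" and c: "uu \<alpha> x y" "P x" "\<not> P y"
  shows "pprod n (label_part n (\<lambda>_. True) P) \<alpha> = pprod n (\<omega> n) \<alpha>" "floating n (label_part n (\<lambda>_. True) P) \<alpha> = 0"
proof -
  let ?\<gamma> = "label_part n (\<lambda>_. True) P"
  have xy: "x \<in> {1..n}" "y \<in> {1..n}" using uu_range[OF A c(1)] by auto
  have jx: "mid_joined n ?\<gamma> \<alpha> v x" if "v \<in> {1..n}" for v
  proof (cases "P v")
    case True
    then show ?thesis using that xy c by (intro mid_joined_ll) simp_all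
  next
    case False
    then have "mid_joined n ?\<gamma> \<alpha> v y" using that xy c by (intro mid_joined_ll) simp_all
    then show ?thesis using mid_joined_trans mid_joined_sym[OF mid_joined_uu[OF A c(1)]] by metis
  qed
  have j: "mid_joined n ?\<gamma> \<alpha> v w \<longleftrightarrow> v \<in> {1..n} \<and> w \<in> {1..n}" for v w
    using jx mid_joined_trans mid_joined_sym mid_joined_range by metis
  show "pprod n ?\<gamma> \<alpha> = pprod n (\<omega> n) \<alpha>"
  proof (rule PP_eqI[of _ n])
    show "uu (pprod n ?\<gamma> \<alpha>) = uu (pprod n (\<omega> n) \<alpha>)"
      unfolding fun_eq_iff \<omega>_pprod[OF A] uu_pprod[OF label_part_PP A] by auto
    show "ul (pprod n ?\<gamma> \<alpha>) = ul (pprod n (\<omega> n) \<alpha>)"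
      unfolding fun_eq_iff \<omega>_pprod[OF A] ul_pprod[OF label_part_PP A] j label_part_simps cd_def
      using c xy ul_range[OF A] by metis
    show "ll (pprod n ?\<gamma> \<alpha>) = ll (pprod n (\<omega> n) \<alpha>)"
      unfolding fun_eq_iff \<omega>_pprod[OF A] ll_pprod[OF label_part_PP A] j label_part_simps cd_def
      using ul_range[OF A] by metis
  qed (simp_all add: pprod_PP A)
  show "floating n ?\<gamma> \<alpha> = 0"
    unfolding floating_0_iff[OF label_part_PP A] j cd_def label_part_simps using c xy by metis
qed

text \<open>Two partitions whose upper patterns differ are told apart by left multiplication: one of the
  products has a floating component and the other has not.\<close>

lemma float_separation:
  assumes A: "\<alpha> \<in> PP n" and B: "\<beta> \<in> PP n" and c: "uu \<alpha> x y" "\<not> uu \<beta> x y" "\<not> dm \<beta> y"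
  obtains \<gamma> where "\<gamma> \<in> PP n" "pprod n \<gamma> \<alpha> = pprod n (\<omega> n) \<alpha>" "floating n \<gamma> \<alpha> = 0"
    "pprod n \<gamma> \<beta> = pprod n (\<omega> n) \<beta>" "floating n \<gamma> \<beta> > 0"
proof -
  \<comment> \<open>The class of \<open>y\<close> under \<beta> is cut off from the upper row. It
    avoids the domain of \<beta>, so it floats; under \<alpha>, \<open>y\<close> is still tied to
    \<open>x\<close> in the other half.\<close>
  define P where "P = (\<lambda>v. \<not> uu \<beta> y v)"
  let ?\<gamma> = "label_part n (\<lambda>_. True) P"
  have y: "y \<in> {1..n}" using uu_range[OF A c(1)] by auto
  have P: "P x" "\<not> P y" using c uu_sym uu_refl[OF B y] by (auto simp: P_def)
  have g: "\<forall>v w. uu \<beta> v w \<longrightarrow> P v = P w"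
    unfolding P_def using uu_trans[OF B] uu_sym by metis
  have d: "P v" if "dm \<beta> v" for v
    unfolding P_def using that uu_dm[OF B] c by metis
  have "pprod n ?\<gamma> \<beta> = pprod n (\<omega> n) \<beta>"
  proof (rule PP_eqI[of _ n])
    show "uu (pprod n ?\<gamma> \<beta>) = uu (pprod n (\<omega> n) \<beta>)"
      unfolding fun_eq_iff \<omega>_pprod[OF B] uu_label_part_pprod[where g=P, OF B g] by auto
    show "ul (pprod n ?\<gamma> \<beta>) = ul (pprod n (\<omega> n) \<beta>)"
      unfolding fun_eq_iff \<omega>_pprod[OF B] ul_label_part_pprod[where g=P, OF B g] cd_def using d ul_dm by metis
    show "ll (pprod n ?\<gamma> \<beta>) = ll (pprod n (\<omega> n) \<beta>)"
      unfolding fun_eq_iff \<omega>_pprod[OF B] ll_label_part_pprod[where g=P, OF B g] cd_def using d ul_dm by metis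
  qed (simp_all add: pprod_PP B)
  moreover have "floating n ?\<gamma> \<beta> \<noteq> 0"
    unfolding floating_label_part[where g=P, OF B g] using y P d by metis
  ultimately show thesis
    using that[OF label_part_PP two_class_connected[OF A c(1) P]] by simp
qed

subsection \<open>Division\<close>

definition block_of :: "vpart \<Rightarrow> vertex \<Rightarrow> vertex set" where "block_of \<sigma> v = {w. joined \<sigma> v w}"

lemma block_of_eq:
  assumes "\<sigma> \<in> PP n" "v \<in> verts n \<or> w \<in> verts n"
  shows "block_of \<sigma> v = block_of \<sigma> w \<longleftrightarrow> joined \<sigma> v w"
proof
  assume "block_of \<sigma> v = block_of \<sigma> w"
  then show "joined \<sigma> v w"
    unfolding block_of_def using joined_refl[OF assms(1)] joined_sym assms(2) by blast
next
  assume "joined \<sigma> v w"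
  then show "block_of \<sigma> v = block_of \<sigma> w"
    unfolding block_of_def using joined_trans[OF assms(1)] joined_sym by blast
qed

text \<open>Characterises the elements of $\mathcal P_n\alpha$ intrinsically; a left factor can moreover be chosen
  so that no floating component arises.\<close>

definition left_div :: "vpart \<Rightarrow> vpart \<Rightarrow> bool" where
  "left_div \<alpha> \<sigma> \<longleftrightarrow> (\<forall>x y. ll \<alpha> x y \<longrightarrow> ll \<sigma> x y) \<and>
     (\<forall>x y. ll \<sigma> x y \<longrightarrow> ll \<alpha> x y \<or> cd \<alpha> x \<and> cd \<alpha> y) \<and> (\<forall>y. cd \<sigma> y \<longrightarrow> cd \<alpha> y)"

lemma left_div_pprod:
  assumes "\<gamma> \<in> PP n" "\<alpha> \<in> PP n" shows "left_div \<alpha> (pprod n \<gamma> \<alpha>)"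
  unfolding left_div_def using cd_pprod_le[OF assms] ll_pprod[OF assms] ul_cd by metis

text \<open>The factor is labelled by blocks of \<sigma>: an upper point by its own block, a middle
  point in the domain of \<alpha> by the block that its lower partners have in \<sigma>. The clauses
  of \<open>left_div\<close> make this consistent and ensure that the product is no more and no less
  than \<sigma>. The rank bound serves \<open>zero_index_gt\<close>.\<close>

lemma left_division:
  assumes A: "\<alpha> \<in> PP n" and S: "\<sigma> \<in> PP n" and n: "n \<ge> 1" and ld: "left_div \<alpha> \<sigma>"
  obtains \<gamma> where "\<gamma> \<in> PP n" "pprod n \<gamma> \<alpha> = \<sigma>" "floating n \<gamma> \<alpha> = 0"
    "(\<exists>v. dm \<alpha> v) \<Longrightarrow> rank \<gamma> \<le> rank \<sigma>"
proof -
  \<comment> \<open>The label of the middle points outside the domain of \<alpha>. It must occur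
    elsewhere, or these points would float: if \<alpha> has a transversal, it is the label of one;
    otherwise it is the label of the upper point 1, which exists because \<open>n\<close> is at
    least 1.\<close>
  define D where "D = (if \<exists>y. cd \<alpha> y then block_of \<sigma> (Low (SOME y. cd \<alpha> y)) else block_of \<sigma> (Up 1))"
  define g where "g v = (if dm \<alpha> v then block_of \<sigma> (Low (SOME y. ul \<alpha> v y)) else D)" for v
  define u where "u x = block_of \<sigma> (Up x)" for x
  let ?\<gamma> = "label_part n u g"
  have gd: "g v = block_of \<sigma> (Low y)" if v: "ul \<alpha> v y" for v y
  proof -
    have s: "ul \<alpha> v (SOME y. ul \<alpha> v y)" by (rule someI[of "ul \<alpha> v", OF v])
    have "ll \<alpha> (SOME y. ul \<alpha> v y) y" by (rule ul_ul_ll[OF A s v])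
    then have j: "ll \<sigma> (SOME y. ul \<alpha> v y) y" using ld unfolding left_div_def by blast
    have "Low y \<in> verts n" using ul_range[OF A v] by simp
    then have "block_of \<sigma> (Low (SOME y. ul \<alpha> v y)) = block_of \<sigma> (Low y)"
      using block_of_eq[OF S] j unfolding ll_def by blast
    then show ?thesis using ul_dm[OF v] by (simp add: g_def)
  qed
  have g: "\<forall>x y. uu \<alpha> x y \<longrightarrow> g x = g y"
  proof (intro allI impI)
   fix x y assume xy: "uu \<alpha> x y"
   show "g x = g y"
   proof (cases "dm \<alpha> y")
    case True
    then obtain z where "ul \<alpha> y z" by (auto simp: dm_def)
    with uu_ul[OF A xy this] gd show ?thesis by simp
  next
    case False
    then have "\<not> dm \<alpha> x" using uu_dm[OF A uu_sym[OF xy]] by blast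
    with False show ?thesis by (simp add: g_def)
   qed
  qed
  have ull: "u x = block_of \<sigma> (Low y) \<longleftrightarrow> ul \<sigma> x y" if "x \<in> {1..n}" for x y
    using that block_of_eq[OF S, of "Up x" "Low y"] by (simp add: u_def ul_def)
  have eq: "pprod n ?\<gamma> \<alpha> = \<sigma>"
  proof (rule PP_eqI[of _ n])
    show "uu (pprod n ?\<gamma> \<alpha>) = uu \<sigma>"
    proof (intro ext)
      fix x y
      have "x \<in> {1..n} \<Longrightarrow> u x = u y \<longleftrightarrow> uu \<sigma> x y"
        using block_of_eq[OF S, of "Up x" "Up y"] by (simp add: u_def uu_def)
      then show "uu (pprod n ?\<gamma> \<alpha>) x y = uu \<sigma> x y"
        unfolding uu_label_part_pprod[where g=g, OF A g] using uu_range[OF S] by blast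
    qed
    show "ul (pprod n ?\<gamma> \<alpha>) = ul \<sigma>"
    proof (intro ext iffI)
      fix x y assume "ul (pprod n ?\<gamma> \<alpha>) x y"
      then obtain v where "x \<in> {1..n}" "u x = g v" "ul \<alpha> v y" unfolding ul_label_part_pprod[where g=g, OF A g] by blast
      with gd ull show "ul \<sigma> x y" by simp
    next
      fix x y assume xy: "ul \<sigma> x y"
      then have "cd \<alpha> y" using ld ul_cd unfolding left_div_def by blast
      then obtain v where v: "ul \<alpha> v y" by (auto simp: cd_def)
      have "x \<in> {1..n}" using ul_range[OF S xy] by blast
      with v gd[OF v] ull xy show "ul (pprod n ?\<gamma> \<alpha>) x y" unfolding ul_label_part_pprod[where g=g, OF A g] by metis
    qed
    show "ll (pprod n ?\<gamma> \<alpha>) = ll \<sigma>"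
    proof (intro ext iffI)
      fix x y assume "ll (pprod n ?\<gamma> \<alpha>) x y"
      then consider "ll \<alpha> x y" | v w where "ul \<alpha> v x" "g v = g w" "ul \<alpha> w y"
        unfolding ll_label_part_pprod[where g=g, OF A g] by blast
      then show "ll \<sigma> x y"
      proof cases
        case 1
        then show ?thesis using ld unfolding left_div_def by blast
      next
        case 2
        then have "block_of \<sigma> (Low x) = block_of \<sigma> (Low y)" using gd by metis
        then show ?thesis
          using block_of_eq[OF S, of "Low x" "Low y"] ul_range[OF A 2(1)] by (simp add: ll_def)
      qed
    next
      fix x y assume xy: "ll \<sigma> x y"
      then consider "ll \<alpha> x y" | "cd \<alpha> x" "cd \<alpha> y" using ld unfolding left_div_def by blast
      then show "ll (pprod n ?\<gamma> \<alpha>) x y"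
      proof cases
        case 1
        then show ?thesis unfolding ll_label_part_pprod[where g=g, OF A g] by blast
      next
        case 2
        then obtain v w where vw: "ul \<alpha> v x" "ul \<alpha> w y" unfolding cd_def by blast
        have "g v = g w"
          using gd[OF vw(1)] gd[OF vw(2)] xy block_of_eq[OF S, of "Low x" "Low y"] ul_range[OF A vw(1)]
          by (simp add: ll_def)
        with vw show ?thesis unfolding ll_label_part_pprod[where g=g, OF A g] by blast
      qed
    qed
  qed (simp_all add: pprod_PP A S)
  have fl: "floating n ?\<gamma> \<alpha> = 0"
    unfolding floating_label_part[where g=g, OF A g]
  proof
    fix v assume v: "v \<in> {1..n}"
    show "(\<exists>x\<in>{1..n}. u x = g v) \<or> (\<exists>w. g w = g v \<and> dm \<alpha> w)"
    proof (cases "dm \<alpha> v")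
      case False
      then have gv: "g v = D" by (simp add: g_def)
      show ?thesis
      proof (cases "\<exists>y. cd \<alpha> y")
        case True
        then have "cd \<alpha> (SOME y. cd \<alpha> y)" by (rule someI_ex)
        then obtain w where w: "ul \<alpha> w (SOME y. cd \<alpha> y)" unfolding cd_def by blast
        then have "g w = g v" using gv gd[OF w] True by (simp add: D_def)
        with ul_dm[OF w] show ?thesis by blast
      next
        case False
        then have "g v = u 1" using gv by (simp add: D_def u_def)
        with n show ?thesis by force
      qed
    qed blast
  qed
  \<comment> \<open>If \<alpha> has a transversal, every value of \<open>g\<close> is a block of
    \<sigma> with a lower point in it. An upper point in the domain of the factor therefore lies in
    the domain of \<sigma>.\<close>
  have rk: "rank ?\<gamma> \<le> rank \<sigma>" if ex: "\<exists>v. dm \<alpha> v"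
  proof (rule rank_mono(1)[OF S label_part_PP])
    show "uu ?\<gamma> x y" if xy: "uu \<sigma> x y" for x y
    proof -
      have "u x = u y"
        using xy uu_range[OF S xy] block_of_eq[OF S, of "Up x" "Up y"] by (simp add: u_def uu_def)
      then show ?thesis using uu_range[OF S xy] by simp
    qed
    fix x assume "dm ?\<gamma> x"
    then obtain v where x: "x \<in> {1..n}" "u x = g v" by (auto simp: dm_def)
    have cdx: "\<exists>y. cd \<alpha> y" using ex dm_cd_iff by blast
    have "\<exists>y. g v = block_of \<sigma> (Low y)"
      using cdx unfolding g_def D_def by (cases "dm \<alpha> v") auto
    with x ull show "dm \<sigma> x" unfolding dm_def by metis
  qed
  show thesis by (rule that[OF label_part_PP eq fl rk])
qed

lemma right_division:
  assumes A: "\<alpha> \<in> PP n" and S: "\<sigma> \<in> PP n" and n: "n \<ge> 1" and ld: "left_div (star \<alpha>) (star \<sigma>)"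
  obtains \<delta> where "\<delta> \<in> PP n" "pprod n \<alpha> \<delta> = \<sigma>" "floating n \<alpha> \<delta> = 0"
proof -
  have "star \<alpha> \<in> PP n" "star \<sigma> \<in> PP n" using A S by simp_all
  from left_division[OF this n ld] obtain \<gamma> where
    g: "\<gamma> \<in> PP n" "pprod n \<gamma> (star \<alpha>) = star \<sigma>" "floating n \<gamma> (star \<alpha>) = 0" by metis
  have "star \<gamma> \<in> PP n" using g by simp
  moreover have "pprod n \<alpha> (star \<gamma>) = \<sigma>"
    using star_pprod[OF g(1), of "star \<alpha>"] g A by simp
  moreover have "floating n \<alpha> (star \<gamma>) = 0"
    using floating_star[OF g(1), of "star \<alpha>"] g A by simp
  ultimately show thesis by (rule that)
qed

lemma left_div_refl: "left_div \<alpha> \<alpha>" by (simp add: left_div_def)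

lemma left_div_antisym: "left_div \<alpha> \<beta> \<Longrightarrow> left_div \<beta> \<alpha> \<Longrightarrow> ll \<alpha> = ll \<beta> \<and> cd \<alpha> = cd \<beta>"
  unfolding left_div_def fun_eq_iff by blast

lemma left_div_cong: "ll \<alpha> = ll \<beta> \<Longrightarrow> cd \<alpha> = cd \<beta> \<Longrightarrow> left_div \<alpha> = left_div \<beta>"
  unfolding left_div_def by simp

text \<open>Supplies the intermediate elements of later arguments, which have the upper side of one
  partition and the lower side of another. The hypotheses say that \<open>D\<close> and
  \<open>E\<close> are unions of classes, on which \<open>f\<close> and \<open>h\<close> number the
  classes injectively.\<close>

lemma partition_with_cross:
  assumes T: "\<tau> \<in> PP n" and A: "\<alpha> \<in> PP n"
    and D: "\<And>x y. D x \<Longrightarrow> D y \<or> uu \<tau> x y \<Longrightarrow> uu \<tau> x y \<longleftrightarrow> D y \<and> (f x :: nat) = f y"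
    and E: "\<And>x y. E x \<Longrightarrow> E y \<or> ll \<alpha> x y \<Longrightarrow> ll \<alpha> x y \<longleftrightarrow> E y \<and> h x = h y"
  obtains \<sigma> where "\<sigma> \<in> PP n" "uu \<sigma> = uu \<tau>" "ll \<sigma> = ll \<alpha>"
    "\<And>x y. ul \<sigma> x y \<longleftrightarrow> D x \<and> E y \<and> f x = h y"
proof -
  \<comment> \<open>Classes meant for a transversal get their number, the others are labelled by
    themselves. The tags \<open>Inl\<close> and \<open>Inr\<close>, and \<open>Up\<close> and
    \<open>Low\<close> under \<open>Inr\<close>, exclude accidental coincidences.\<close>
  define u where "u x = (if D x then Inl (f x) else Inr (Up ` {z. uu \<tau> x z}))" for x
  define l where "l y = (if E y then Inl (h y) else Inr (Low ` {z. ll \<alpha> y z}))" for y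
  have Dr: "D x \<Longrightarrow> x \<in> {1..n}" for x using D[of x x] uu_range[OF T] by blast
  have Er: "E x \<Longrightarrow> x \<in> {1..n}" for x using E[of x x] ll_range[OF A] by blast
  have iU: "Up ` X = Up ` Y \<longleftrightarrow> X = Y" for X Y by (simp add: inj_image_eq_iff inj_def)
  have iL: "Low ` X = Low ` Y \<longleftrightarrow> X = Y" for X Y by (simp add: inj_image_eq_iff inj_def)
  show thesis
  proof (rule that)
    show "label_part n u l \<in> PP n" by simp
    show "uu (label_part n u l) = uu \<tau>"
    proof (intro ext)
      fix x y
      have "u x = u y \<longleftrightarrow> uu \<tau> x y" if "x \<in> {1..n}" "y \<in> {1..n}"
      proof (cases "D x \<or> D y")
        case True
        then show ?thesis unfolding u_def using D[of x y] D[of y x] uu_sym by auto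
      next
        case False
        then show ?thesis unfolding u_def using uclass_eq[OF T that(1)] by (simp add: iU)
      qed
      then show "uu (label_part n u l) x y = uu \<tau> x y" using uu_range[OF T, of x y] by auto
    qed
    show "ll (label_part n u l) = ll \<alpha>"
    proof (intro ext)
      fix x y
      have lc: "{z. ll \<alpha> x z} = {z. ll \<alpha> y z} \<longleftrightarrow> ll \<alpha> x y" if "x \<in> {1..n}"
        using uclass_eq[of "star \<alpha>" n x y] that A by simp
      have "l x = l y \<longleftrightarrow> ll \<alpha> x y" if "x \<in> {1..n}" "y \<in> {1..n}"
      proof (cases "E x \<or> E y")
        case True
        then show ?thesis unfolding l_def using E[of x y] E[of y x] ll_sym by auto
      next
        case False
        then show ?thesis unfolding l_def using lc[OF that(1)] by (simp add: iL)
      qed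
      then show "ll (label_part n u l) x y = ll \<alpha> x y" using ll_range[OF A, of x y] by auto
    qed
    fix x y
    show "ul (label_part n u l) x y \<longleftrightarrow> D x \<and> E y \<and> f x = h y"
    proof -
      have "u x = l y \<longleftrightarrow> D x \<and> E y \<and> f x = h y" if "x \<in> {1..n}"
      proof -
        have "Up x \<in> Up ` {z. uu \<tau> x z}" using uu_refl[OF T that] by blast
        then have "Up ` {z. uu \<tau> x z} \<noteq> Low ` {z. ll \<alpha> y z}" by blast
        then show ?thesis unfolding u_def l_def by auto
      qed
      then show ?thesis using Dr Er by auto
    qed
  qed
qed

subsection \<open>Numbered transversals\<close>

text \<open>\<open>a x = k\<close> and \<open>b y = k\<close> say that \<open>x\<close> and \<open>y'\<close> lie in the \<open>k\<close>-th transversal; values off the domain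
  and the codomain are irrelevant.\<close>

definition numbering :: "vpart \<Rightarrow> (nat \<Rightarrow> nat) \<Rightarrow> (nat \<Rightarrow> nat) \<Rightarrow> bool" where
  "numbering \<alpha> a b \<longleftrightarrow> (\<forall>x y. dm \<alpha> x \<longrightarrow> cd \<alpha> y \<longrightarrow> (ul \<alpha> x y \<longleftrightarrow> a x = b y)) \<and>
     a ` {x. dm \<alpha> x} = {1..rank \<alpha>} \<and> b ` {y. cd \<alpha> y} = {1..rank \<alpha>}"

text \<open>This is \<partial>(\<alpha>,\<beta>) = \<pi> for a fixed numbering, stated pointwise.
  Fixing the numbering replaces a conjugacy class by one permutation, so that twists can be
  composed, inverted and transported.\<close>

definition twist :: "vpart \<Rightarrow> (nat \<Rightarrow> nat) \<Rightarrow> (nat \<Rightarrow> nat) \<Rightarrow> (nat \<Rightarrow> nat) \<Rightarrow> vpart \<Rightarrow> bool" where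
  "twist \<alpha> a b \<pi> \<beta> \<longleftrightarrow> uu \<beta> = uu \<alpha> \<and> ll \<beta> = ll \<alpha> \<and>
     (\<forall>x y. ul \<beta> x y \<longleftrightarrow> dm \<alpha> x \<and> cd \<alpha> y \<and> b y = \<pi> (a x))"

lemma numbering_star: "numbering (star \<alpha>) b a \<longleftrightarrow> numbering \<alpha> a b"
  unfolding numbering_def star_simps rank_star by metis

lemma numbering_ul: "numbering \<alpha> a b \<Longrightarrow> ul \<alpha> x y \<longleftrightarrow> dm \<alpha> x \<and> cd \<alpha> y \<and> a x = b y"
  unfolding numbering_def using ul_dm ul_cd by metis

lemma numbering_uu:
  assumes "\<alpha> \<in> PP n" "numbering \<alpha> a b" "dm \<alpha> x" "dm \<alpha> y" shows "uu \<alpha> x y \<longleftrightarrow> a x = a y"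
proof
  obtain z where z: "ul \<alpha> y z" using assms(4) by (auto simp: dm_def)
  {
    assume "uu \<alpha> x y"
    then have "ul \<alpha> x z" using uu_ul[OF assms(1)] z by blast
    with z show "a x = a y" using numbering_ul[OF assms(2)] by simp
  next
    assume "a x = a y"
    then have "ul \<alpha> x z" using z assms(3) numbering_ul[OF assms(2)] by simp
    then show "uu \<alpha> x y" using z ul_ul_uu[OF assms(1)] by blast
  }
qed

lemma numbering_ll:
  assumes "\<alpha> \<in> PP n" "numbering \<alpha> a b" "cd \<alpha> x" "cd \<alpha> y" shows "ll \<alpha> x y \<longleftrightarrow> b x = b y"
  using numbering_uu[of "star \<alpha>" n b a x y] assms by (simp add: numbering_star)

lemma numbering_range:
  assumes "numbering \<alpha> a b" shows "dm \<alpha> x \<Longrightarrow> a x \<in> {1..rank \<alpha>}" "cd \<alpha> y \<Longrightarrow> b y \<in> {1..rank \<alpha>}"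
  using assms unfolding numbering_def by blast+

lemma numbering_surj:
  assumes "numbering \<alpha> a b" "k \<in> {1..rank \<alpha>}"
  obtains x y where "dm \<alpha> x" "a x = k" "cd \<alpha> y" "b y = k" "ul \<alpha> x y"
proof -
  have "k \<in> a ` {x. dm \<alpha> x}" "k \<in> b ` {y. cd \<alpha> y}" using assms unfolding numbering_def by auto
  then obtain x y where "dm \<alpha> x" "a x = k" "cd \<alpha> y" "b y = k" by (auto elim!: imageE)
  then show thesis using that numbering_ul[OF assms(1)] by metis
qed

lemma numbering_exists:
  assumes A: "\<alpha> \<in> PP n" obtains a b where "numbering \<alpha> a b"
proof -
  obtain h where h: "bij_betw h {1..rank \<alpha>} (upper_classes \<alpha>)"
    using ex_bij_betw_nat_finite_1[OF finite_upper_classes[OF A]] unfolding rank_upper_classes[OF A] by blast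
  define e where "e = inv_into {1..rank \<alpha>} h"
  have e: "bij_betw e (upper_classes \<alpha>) {1..rank \<alpha>}" unfolding e_def by (rule bij_betw_inv_into[OF h])
  define a where "a x = e {z. uu \<alpha> x z}" for x
  define b where "b y = a (SOME x. ul \<alpha> x y)" for y
  have inD: "{z. uu \<alpha> x z} \<in> upper_classes \<alpha>" if "dm \<alpha> x" for x using that by (auto simp: upper_classes_def)
  have uua: "uu \<alpha> x y \<longleftrightarrow> a x = a y" if "dm \<alpha> x" "dm \<alpha> y" for x y
    unfolding a_def inj_on_eq_iff[OF bij_betw_imp_inj_on[OF e] inD[OF that(1)] inD[OF that(2)]]
    using uclass_eq[OF A dm_range[OF A that(1)]] by blast
  have ima: "a ` {x. dm \<alpha> x} = {1..rank \<alpha>}"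
  proof -
    have "(\<lambda>x. {z. uu \<alpha> x z}) ` {x. dm \<alpha> x} = upper_classes \<alpha>" by (auto simp: upper_classes_def)
    then have "e ` (\<lambda>x. {z. uu \<alpha> x z}) ` {x. dm \<alpha> x} = {1..rank \<alpha>}"
      using bij_betw_imp_surj_on[OF e] by simp
    then show ?thesis by (simp add: image_image a_def)
  qed
  have s: "ul \<alpha> (SOME x. ul \<alpha> x y) y" if "cd \<alpha> y" for y
    using that unfolding cd_def by (rule someI_ex)
  have ulab: "ul \<alpha> x y \<longleftrightarrow> a x = b y" if "dm \<alpha> x" "cd \<alpha> y" for x y
  proof -
    have "ul \<alpha> x y \<longleftrightarrow> uu \<alpha> x (SOME x. ul \<alpha> x y)"
      using s[OF that(2)] uu_ul[OF A] ul_ul_uu[OF A] by blast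
    then show ?thesis using uua[OF that(1) ul_dm[OF s[OF that(2)]]] by (simp add: b_def)
  qed
  have imb: "b ` {y. cd \<alpha> y} = {1..rank \<alpha>}"
  proof -
    have "b y \<in> a ` {x. dm \<alpha> x}" if "cd \<alpha> y" for y
      using ul_dm[OF s[OF that]] by (simp add: b_def)
    moreover have "\<exists>y. cd \<alpha> y \<and> b y = a x" if x: "dm \<alpha> x" for x
    proof -
      obtain y where "ul \<alpha> x y" using x by (auto simp: dm_def)
      then show ?thesis using ulab[OF x] ul_cd by metis
    qed
    ultimately have "b ` {y. cd \<alpha> y} = a ` {x. dm \<alpha> x}" by (force simp: image_iff)
    then show ?thesis using ima by simp
  qed
  show thesis by (rule that[of a b]) (use ulab ima imb in \<open>simp add: numbering_def\<close>)
qed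

section \<open>From transversals as blocks to numberings\<close>

lemma transversals_eq:
  assumes A: "\<alpha> \<in> PP n"
  shows "transversals \<alpha> = {Up ` {z. uu \<alpha> x z} \<union> Low ` {z. ul \<alpha> x z} | x. dm \<alpha> x}"
    and "\<alpha> - transversals \<alpha> = {Up ` {z. uu \<alpha> x z} | x. x \<in> {1..n} \<and> \<not> dm \<alpha> x} \<union>
           {Low ` {z. ll \<alpha> y z} | y. y \<in> {1..n} \<and> \<not> cd \<alpha> y}"
proof -
  have nm: "\<not> joined \<alpha> v (Mid x)" for v x using joined_verts[OF A] verts_simps(3) by blast
  have B: "{w. joined \<alpha> (Up x) w} = Up ` {z. uu \<alpha> x z} \<union> Low ` {z. ul \<alpha> x z}" for x
  proof (rule Set.set_eqI)
    fix w show "w \<in> {w. joined \<alpha> (Up x) w} \<longleftrightarrow> w \<in> Up ` {z. uu \<alpha> x z} \<union> Low ` {z. ul \<alpha> x z}"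
      by (cases w) (auto simp: uu_def ul_def nm)
  qed
  have BL: "{w. joined \<alpha> (Low x) w} = Low ` {z. ll \<alpha> x z} \<union> Up ` {z. ul \<alpha> z x}" for x
  proof (rule Set.set_eqI)
    have s: "joined \<alpha> (Low x) (Up z) = ul \<alpha> z x" for z using joined_sym unfolding ul_def by blast
    fix w show "w \<in> {w. joined \<alpha> (Low x) w} \<longleftrightarrow> w \<in> Low ` {z. ll \<alpha> x z} \<union> Up ` {z. ul \<alpha> z x}"
      by (cases w) (auto simp: ll_def nm s)
  qed
  have inA: "{w. joined \<alpha> v w} \<in> \<alpha>" if "v \<in> verts n" for v
    using that by (subst (2) PP_blocks[OF A]) blast
  have ru: "{w. joined \<alpha> v w} \<in> transversals \<alpha> \<longleftrightarrow>
      (\<exists>z. joined \<alpha> v (Up z)) \<and> (\<exists>z. joined \<alpha> v (Low z))" if "v \<in> verts n" for v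
    using inA[OF that] by (auto simp: transversals_def)
  have tU: "{w. joined \<alpha> (Up x) w} \<in> transversals \<alpha> \<longleftrightarrow> dm \<alpha> x" if "x \<in> {1..n}" for x
    using that ru[of "Up x"] joined_refl[OF A, of "Up x"] by (auto simp: dm_def ul_def)
  have tL: "{w. joined \<alpha> (Low x) w} \<in> transversals \<alpha> \<longleftrightarrow> cd \<alpha> x" if "x \<in> {1..n}" for x
  proof -
    have "joined \<alpha> (Low x) (Up z) = ul \<alpha> z x" for z using joined_sym unfolding ul_def by blast
    then show ?thesis using that ru[of "Low x"] joined_refl[OF A, of "Low x"] by (auto simp: cd_def)
  qed
  show "transversals \<alpha> = {Up ` {z. uu \<alpha> x z} \<union> Low ` {z. ul \<alpha> x z} | x. dm \<alpha> x}"
  proof (intro equalityI subsetI)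
    fix T assume T: "T \<in> transversals \<alpha>"
    then obtain x y where xy: "Up x \<in> T" "ul \<alpha> x y" using transversalD[OF A] by metis
    have "T = {w. joined \<alpha> (Up x) w}" using block_eq[OF A _ xy(1)] T by (simp add: transversals_def)
    then show "T \<in> {Up ` {z. uu \<alpha> x z} \<union> Low ` {z. ul \<alpha> x z} | x. dm \<alpha> x}"
      using B ul_dm[OF xy(2)] by blast
  next
    fix T assume "T \<in> {Up ` {z. uu \<alpha> x z} \<union> Low ` {z. ul \<alpha> x z} | x. dm \<alpha> x}"
    then obtain x where "dm \<alpha> x" "T = {w. joined \<alpha> (Up x) w}" unfolding B by blast
    then show "T \<in> transversals \<alpha>" using tU dm_range[OF A] by simp
  qed
  have noU: "{z. ul \<alpha> x z} = {}" if "\<not> dm \<alpha> x" for x using that by (auto simp: dm_def)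
  have noL: "{z. ul \<alpha> z x} = {}" if "\<not> cd \<alpha> x" for x using that by (auto simp: cd_def)
  show "\<alpha> - transversals \<alpha> = {Up ` {z. uu \<alpha> x z} | x. x \<in> {1..n} \<and> \<not> dm \<alpha> x} \<union>
           {Low ` {z. ll \<alpha> y z} | y. y \<in> {1..n} \<and> \<not> cd \<alpha> y}"
  proof (intro equalityI subsetI)
    fix T assume T: "T \<in> \<alpha> - transversals \<alpha>"
    then obtain v where v: "v \<in> verts n" "T = {w. joined \<alpha> v w}" using PP_blocks[OF A] by blast
    show "T \<in> {Up ` {z. uu \<alpha> x z} | x. x \<in> {1..n} \<and> \<not> dm \<alpha> x} \<union>
           {Low ` {z. ll \<alpha> y z} | y. y \<in> {1..n} \<and> \<not> cd \<alpha> y}"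
    proof (cases v)
      case (Up x)
      then have "x \<in> {1..n}" "\<not> dm \<alpha> x" using v T tU by auto
      moreover from this have "T = Up ` {z. uu \<alpha> x z}" using v B Up noU by simp
      ultimately show ?thesis by blast
    next
      case (Low x)
      then have "x \<in> {1..n}" "\<not> cd \<alpha> x" using v T tL by auto
      moreover from this have "T = Low ` {z. ll \<alpha> x z}" using v BL Low noL by simp
      ultimately show ?thesis by blast
    qed (use v in simp)
  next
    fix T assume "T \<in> {Up ` {z. uu \<alpha> x z} | x. x \<in> {1..n} \<and> \<not> dm \<alpha> x} \<union>
           {Low ` {z. ll \<alpha> y z} | y. y \<in> {1..n} \<and> \<not> cd \<alpha> y}"
    then consider x where "x \<in> {1..n}" "\<not> dm \<alpha> x" "T = {w. joined \<alpha> (Up x) w}"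
      | y where "y \<in> {1..n}" "\<not> cd \<alpha> y" "T = {w. joined \<alpha> (Low y) w}"
      unfolding B BL using noU noL by auto
    then show "T \<in> \<alpha> - transversals \<alpha>"
    proof cases
      case (1 x)
      then show ?thesis using tU inA[of "Up x"] by simp
    next
      case (2 y)
      then show ?thesis using tL inA[of "Low y"] by simp
    qed
  qed
qed

lemma twist_dm:
  assumes "numbering \<alpha> a b" "\<pi> permutes {1..rank \<alpha>}" "twist \<alpha> a b \<pi> \<beta>"
  shows "dm \<beta> = dm \<alpha>" "cd \<beta> = cd \<alpha>"
proof -
  have "\<exists>y. ul \<beta> x y" if "dm \<alpha> x" for x
  proof -
    have "\<pi> (a x) \<in> {1..rank \<alpha>}" using numbering_range(1)[OF assms(1) that] permutes_in_image[OF assms(2)] by simp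
    with numbering_surj[OF assms(1)] obtain y where "cd \<alpha> y" "b y = \<pi> (a x)" by metis
    then show ?thesis using assms(3) that unfolding twist_def by blast
  qed
  moreover have "\<exists>x. ul \<beta> x y" if "cd \<alpha> y" for y
  proof -
    have "inv_into UNIV \<pi> (b y) \<in> {1..rank \<alpha>}"
      using numbering_range(2)[OF assms(1) that] permutes_in_image[OF permutes_inv[OF assms(2)]] by simp
    with numbering_surj[OF assms(1)] obtain x where "dm \<alpha> x" "a x = inv_into UNIV \<pi> (b y)" by metis
    moreover from this have "\<pi> (a x) = b y" using permutes_inverses(1)[OF assms(2)] by simp
    ultimately show ?thesis using assms(3) that unfolding twist_def by metis
  qed
  ultimately show "dm \<beta> = dm \<alpha>" "cd \<beta> = cd \<alpha>"
    using assms(3) unfolding dm_def[of \<beta>] cd_def[of \<beta>] twist_def fun_eq_iff by blast+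
qed

lemma perm_diffI:
  assumes A: "\<alpha> \<in> PP n" and B: "\<beta> \<in> PP n" and numbering: "numbering \<alpha> a b"
    and p: "\<pi> permutes {1..rank \<alpha>}" and tw: "twist \<alpha> a b \<pi> \<beta>"
  shows "perm_diff \<alpha> \<beta> \<pi>"
proof -
  define X where "X k = {x. dm \<alpha> x \<and> a x = k}" for k
  define Y where "Y k = {y. cd \<alpha> y \<and> b y = k}" for k
  note d = twist_dm[OF numbering p tw]
  have tw': "uu \<beta> = uu \<alpha>" "ll \<beta> = ll \<alpha>" "\<And>x y. ul \<beta> x y \<longleftrightarrow> dm \<alpha> x \<and> cd \<alpha> y \<and> b y = \<pi> (a x)"
    using tw unfolding twist_def by blast+
  have uX: "{z. uu \<alpha> x z} = X (a x)" if "dm \<alpha> x" for x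
  proof -
    have "uu \<alpha> x z \<longleftrightarrow> dm \<alpha> z \<and> a z = a x" for z
      using numbering_uu[OF A numbering that] uu_dm[OF A uu_sym] that by metis
    then show ?thesis by (simp add: X_def)
  qed
  have uY: "{z. ul \<alpha> x z} = Y (a x)" if "dm \<alpha> x" for x
    unfolding Y_def numbering_ul[OF numbering] using that by auto
  have uY': "{z. ul \<beta> x z} = Y (\<pi> (a x))" if "dm \<alpha> x" for x
    unfolding Y_def tw'(3) using that by auto
  have ima: "a ` {x. dm \<alpha> x} = {1..rank \<alpha>}" using numbering unfolding numbering_def by blast
  have "transversals \<alpha> = (\<lambda>x. Up ` X (a x) \<union> Low ` Y (a x)) ` {x. dm \<alpha> x}"
    unfolding transversals_eq(1)[OF A] setcompr_eq_image by (rule image_cong) (simp_all add: uX uY)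
  then have tA: "transversals \<alpha> = (\<lambda>k. Up ` X k \<union> Low ` Y k) ` {1..rank \<alpha>}"
    unfolding ima[symmetric] image_image by simp
  have "transversals \<beta> = (\<lambda>x. Up ` X (a x) \<union> Low ` Y (\<pi> (a x))) ` {x. dm \<alpha> x}"
    unfolding transversals_eq(1)[OF B] setcompr_eq_image d tw'(1) by (rule image_cong) (simp_all add: uX uY')
  then have tB: "transversals \<beta> = (\<lambda>k. Up ` X k \<union> Low ` Y (\<pi> k)) ` {1..rank \<alpha>}"
    unfolding ima[symmetric] image_image by simp
  have nt: "\<beta> - transversals \<beta> = \<alpha> - transversals \<alpha>"
    unfolding transversals_eq(2)[OF A] transversals_eq(2)[OF B] tw' d by simp
  have "inj_on (\<lambda>k. Up ` X k \<union> Low ` Y k) {1..rank \<alpha>}"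
  proof (rule inj_onI)
    fix k m assume k: "k \<in> {1..rank \<alpha>}" and e: "Up ` X k \<union> Low ` Y k = Up ` X m \<union> Low ` Y m"
    obtain x where "dm \<alpha> x" "a x = k" using numbering_surj[OF numbering k] by metis
    then have "Up x \<in> Up ` X k \<union> Low ` Y k" by (simp add: X_def)
    then have "Up x \<in> Up ` X m \<union> Low ` Y m" by (simp only: e)
    then have "x \<in> X m" by auto
    then show "k = m" using \<open>a x = k\<close> by (simp add: X_def)
  qed
  with tA have "bij_betw (\<lambda>k. Up ` X k \<union> Low ` Y k) {1..rank \<alpha>} (transversals \<alpha>)"
    unfolding bij_betw_def by simp
  with tB nt p show ?thesis unfolding perm_diff_def by (auto simp: sym_group_def)
qed

text \<open>The sets in \<open>perm_diff\<close> become the level sets of a numbering: distinct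
  transversals are disjoint, so each point of the domain or codomain has exactly one number.\<close>

lemma perm_diffE:
  assumes A: "\<alpha> \<in> PP n" and B: "\<beta> \<in> PP n" and pd: "perm_diff \<alpha> \<beta> \<pi>"
  obtains a b where "numbering \<alpha> a b" "\<pi> permutes {1..rank \<alpha>}" "twist \<alpha> a b \<pi> \<beta>"
proof -
  obtain X Y where p: "\<pi> permutes {1..rank \<alpha>}"
    and bij: "bij_betw (\<lambda>k. Up ` X k \<union> Low ` Y k) {1..rank \<alpha>} (transversals \<alpha>)"
    and tB: "transversals \<beta> = (\<lambda>k. Up ` X k \<union> Low ` Y (\<pi> k)) ` {1..rank \<alpha>}"
    and nt: "\<beta> - transversals \<beta> = \<alpha> - transversals \<alpha>"
    using pd unfolding perm_diff_def by (auto simp: sym_group_def)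
  let ?T = "\<lambda>k. Up ` X k \<union> Low ` Y k"
  have tA: "transversals \<alpha> = ?T ` {1..rank \<alpha>}" using bij by (simp add: bij_betw_def)
  have Tin: "?T k \<in> \<alpha>" "X k \<noteq> {}" "Y k \<noteq> {}" if "k \<in> {1..rank \<alpha>}" for k
  proof -
    have T: "?T k \<in> transversals \<alpha>" unfolding tA using that by (rule imageI)
    then show "?T k \<in> \<alpha>" by (simp add: transversals_def)
    obtain x y where "Up x \<in> ?T k" "Low y \<in> ?T k" using transversalD[OF A T] by metis
    then show "X k \<noteq> {}" "Y k \<noteq> {}" by auto
  qed
  have uniq: "k = m" if "k \<in> {1..rank \<alpha>}" "m \<in> {1..rank \<alpha>}" "v \<in> ?T k" "v \<in> ?T m" for k m v
  proof -
    have "?T k = ?T m" using block_eq[OF A Tin(1)[OF that(1)] that(3)] block_eq[OF A Tin(1)[OF that(2)] that(4)] by simp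
    then show ?thesis using inj_onD[OF bij_betw_imp_inj_on[OF bij] _ that(1,2)] by simp
  qed
  have block: "joined \<alpha> v w \<longleftrightarrow> (\<exists>k\<in>{1..rank \<alpha>}. v \<in> ?T k \<and> w \<in> ?T k) \<or>
      (\<exists>B\<in>\<alpha> - transversals \<alpha>. v \<in> B \<and> w \<in> B)" for v w
  proof -
    have "transversals \<alpha> \<subseteq> \<alpha>" by (auto simp: transversals_def)
    then have "joined \<alpha> v w \<longleftrightarrow> (\<exists>B\<in>transversals \<alpha>. v \<in> B \<and> w \<in> B) \<or> (\<exists>B\<in>\<alpha> - transversals \<alpha>. v \<in> B \<and> w \<in> B)"
      unfolding joined_def by blast
    moreover have "(\<exists>B\<in>transversals \<alpha>. v \<in> B \<and> w \<in> B) \<longleftrightarrow> (\<exists>k\<in>{1..rank \<alpha>}. v \<in> ?T k \<and> w \<in> ?T k)"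
      unfolding tA by (simp only: bex_simps)
    ultimately show ?thesis by (simp only:)
  qed
  have blockB: "joined \<beta> v w \<longleftrightarrow> (\<exists>k\<in>{1..rank \<alpha>}. v \<in> Up ` X k \<union> Low ` Y (\<pi> k) \<and> w \<in> Up ` X k \<union> Low ` Y (\<pi> k)) \<or>
      (\<exists>B\<in>\<alpha> - transversals \<alpha>. v \<in> B \<and> w \<in> B)" for v w
  proof -
    have "transversals \<beta> \<subseteq> \<beta>" by (auto simp: transversals_def)
    then have "joined \<beta> v w \<longleftrightarrow> (\<exists>B\<in>transversals \<beta>. v \<in> B \<and> w \<in> B) \<or> (\<exists>B\<in>\<beta> - transversals \<beta>. v \<in> B \<and> w \<in> B)"
      unfolding joined_def by blast
    moreover have "(\<exists>B\<in>transversals \<beta>. v \<in> B \<and> w \<in> B) \<longleftrightarrow> (\<exists>k\<in>{1..rank \<alpha>}. v \<in> Up ` X k \<union> Low ` Y (\<pi> k) \<and> w \<in> Up ` X k \<union> Low ` Y (\<pi> k))"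
      unfolding tB by (simp only: bex_simps)
    ultimately show ?thesis by (simp only: nt)
  qed
  have ntUL: "\<not> (Up x \<in> B \<and> Low y \<in> B)" if "B \<in> \<alpha> - transversals \<alpha>" for B x y
    using that by (auto simp: transversals_def)
  have ulA: "ul \<alpha> x y \<longleftrightarrow> (\<exists>k\<in>{1..rank \<alpha>}. x \<in> X k \<and> y \<in> Y k)" for x y
    unfolding ul_def block using ntUL by blast
  have ulB: "ul \<beta> x y \<longleftrightarrow> (\<exists>k\<in>{1..rank \<alpha>}. x \<in> X k \<and> y \<in> Y (\<pi> k))" for x y
    unfolding ul_def blockB using ntUL by blast
  have dmA: "dm \<alpha> x \<longleftrightarrow> (\<exists>k\<in>{1..rank \<alpha>}. x \<in> X k)" for x
    unfolding dm_def ulA using Tin(3) by blast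
  have cdA: "cd \<alpha> y \<longleftrightarrow> (\<exists>k\<in>{1..rank \<alpha>}. y \<in> Y k)" for y
    unfolding cd_def ulA using Tin(2) by blast
  define a where "a x = (SOME k. k \<in> {1..rank \<alpha>} \<and> x \<in> X k)" for x
  define b where "b y = (SOME k. k \<in> {1..rank \<alpha>} \<and> y \<in> Y k)" for y
  have a: "a x = k" if "k \<in> {1..rank \<alpha>}" "x \<in> X k" for x k
  proof -
    have "a x \<in> {1..rank \<alpha>} \<and> x \<in> X (a x)" unfolding a_def by (rule someI[of _ k]) (use that in blast)
    then show ?thesis using uniq[of "a x" k "Up x"] that by blast
  qed
  have b: "b x = k" if "k \<in> {1..rank \<alpha>}" "x \<in> Y k" for x k
  proof -
    have "b x \<in> {1..rank \<alpha>} \<and> x \<in> Y (b x)" unfolding b_def by (rule someI[of _ k]) (use that in blast)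
    then show ?thesis using uniq[of "b x" k "Low x"] that by blast
  qed
  have pin: "\<pi> k \<in> {1..rank \<alpha>} \<longleftrightarrow> k \<in> {1..rank \<alpha>}" for k by (rule permutes_in_image[OF p])
  have "numbering \<alpha> a b"
    unfolding numbering_def
  proof (intro conjI allI impI)
    fix x y assume "dm \<alpha> x" "cd \<alpha> y"
    then obtain k m where km: "k \<in> {1..rank \<alpha>}" "x \<in> X k" "m \<in> {1..rank \<alpha>}" "y \<in> Y m"
      unfolding dmA cdA by blast
    then have e: "a x = k" "b y = m" using a b by blast+
    show "ul \<alpha> x y = (a x = b y)"
    proof
      assume "ul \<alpha> x y"
      then obtain j where "j \<in> {1..rank \<alpha>}" "x \<in> X j" "y \<in> Y j" unfolding ulA by blast
      then show "a x = b y" using a b by metis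
    next
      assume "a x = b y"
      then have "y \<in> Y k" using km e by simp
      then show "ul \<alpha> x y" unfolding ulA using km by blast
    qed
  next
    show "a ` {x. dm \<alpha> x} = {1..rank \<alpha>}"
    proof (intro equalityI subsetI)
      fix k assume "k \<in> a ` {x. dm \<alpha> x}"
      then obtain x where x: "dm \<alpha> x" "k = a x" by (auto elim!: imageE)
      then obtain j where j: "j \<in> {1..rank \<alpha>}" "x \<in> X j" unfolding dmA by blast
      then show "k \<in> {1..rank \<alpha>}" using a[OF j] x by simp
    next
      fix k assume k: "k \<in> {1..rank \<alpha>}"
      then obtain x where "x \<in> X k" using Tin(2) by blast
      then have "a x = k" "dm \<alpha> x" using a[OF k] k dmA by blast+
      then show "k \<in> a ` {x. dm \<alpha> x}" by (intro image_eqI[of _ _ x]) simp_all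
    qed
    show "b ` {x. cd \<alpha> x} = {1..rank \<alpha>}"
    proof (intro equalityI subsetI)
      fix k assume "k \<in> b ` {x. cd \<alpha> x}"
      then obtain x where x: "cd \<alpha> x" "k = b x" by (auto elim!: imageE)
      then obtain j where j: "j \<in> {1..rank \<alpha>}" "x \<in> Y j" unfolding cdA by blast
      then show "k \<in> {1..rank \<alpha>}" using b[OF j] x by simp
    next
      fix k assume k: "k \<in> {1..rank \<alpha>}"
      then obtain x where "x \<in> Y k" using Tin(3) by blast
      then have "b x = k" "cd \<alpha> x" using b[OF k] k cdA by blast+
      then show "k \<in> b ` {x. cd \<alpha> x}" by (intro image_eqI[of _ _ x]) simp_all
    qed
  qed
  moreover have "twist \<alpha> a b \<pi> \<beta>"
    unfolding twist_def
  proof (intro conjI allI)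
    show "uu \<beta> = uu \<alpha>" unfolding uu_def block blockB fun_eq_iff by blast
    show "ll \<beta> = ll \<alpha>"
    proof (intro ext)
      fix x y
      have "(\<exists>k\<in>{1..rank \<alpha>}. x \<in> Y (\<pi> k) \<and> y \<in> Y (\<pi> k)) \<longleftrightarrow> (\<exists>k\<in>{1..rank \<alpha>}. x \<in> Y k \<and> y \<in> Y k)"
        using pin permutes_inverses(1)[OF p] by metis
      then show "ll \<beta> x y = ll \<alpha> x y" unfolding ll_def block blockB by blast
    qed
    fix x y
    show "ul \<beta> x y \<longleftrightarrow> dm \<alpha> x \<and> cd \<alpha> y \<and> b y = \<pi> (a x)"
    proof
      assume "ul \<beta> x y"
      then obtain k where k: "k \<in> {1..rank \<alpha>}" "x \<in> X k" "y \<in> Y (\<pi> k)" unfolding ulB by blast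
      then show "dm \<alpha> x \<and> cd \<alpha> y \<and> b y = \<pi> (a x)" using a[of k x] b[of "\<pi> k" y] pin dmA cdA by blast
    next
      assume *: "dm \<alpha> x \<and> cd \<alpha> y \<and> b y = \<pi> (a x)"
      then obtain k m where km: "k \<in> {1..rank \<alpha>}" "x \<in> X k" "m \<in> {1..rank \<alpha>}" "y \<in> Y m"
        unfolding dmA cdA by blast
      then have "a x = k" "b y = m" using a b by blast+
      then have "y \<in> Y (\<pi> k)" using km * by simp
      then show "ul \<beta> x y" unfolding ulB using km by blast
    qed
  qed
  ultimately show thesis using p that by blast
qed

lemma twist_between:
  assumes A: "\<alpha> \<in> PP n" and B: "\<beta> \<in> PP n" and numbering: "numbering \<alpha> a b"
    and eq: "uu \<beta> = uu \<alpha>" "ll \<beta> = ll \<alpha>" "dm \<beta> = dm \<alpha>" "cd \<beta> = cd \<alpha>"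
  obtains \<pi> where "\<pi> permutes {1..rank \<alpha>}" "twist \<alpha> a b \<pi> \<beta>"
proof -
  \<comment> \<open>To find the image of \<open>k\<close>, start at an upper point of the k-th
    transversal of \<alpha>, go down in \<beta> and read the number of the point reached. Equality
    of the patterns makes this independent of the choices. Elsewhere the map is the identity, as
    \<open>permutes\<close> demands.\<close>
  define \<pi> where "\<pi> k = (if k \<in> {1..rank \<alpha>} then b (SOME y. \<exists>x. dm \<alpha> x \<and> a x = k \<and> ul \<beta> x y) else k)" for k
  have key: "ul \<beta> x y \<longleftrightarrow> cd \<alpha> y \<and> b y = \<pi> (a x)" if x: "dm \<alpha> x" for x y
  proof -
    let ?y = "SOME y. \<exists>x'. dm \<alpha> x' \<and> a x' = a x \<and> ul \<beta> x' y"
    have "dm \<beta> x" using x eq by simp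
    then have "\<exists>y. \<exists>x'. dm \<alpha> x' \<and> a x' = a x \<and> ul \<beta> x' y" using x unfolding dm_def[of \<beta>] by blast
    then have "\<exists>x'. dm \<alpha> x' \<and> a x' = a x \<and> ul \<beta> x' ?y" by (rule someI_ex)
    then obtain x' where x': "dm \<alpha> x'" "a x' = a x" "ul \<beta> x' ?y" by blast
    have "uu \<beta> x x'" using numbering_uu[OF A numbering x x'(1)] x'(2) eq by simp
    then have u: "ul \<beta> x ?y" using uu_ul[OF B] x' by blast
    have cy: "cd \<alpha> ?y" using ul_cd[OF u] eq by simp
    have pk: "\<pi> (a x) = b ?y" using numbering_range(1)[OF numbering x] unfolding \<pi>_def by simp
    show ?thesis
    proof
      assume xy: "ul \<beta> x y"
      then have "ll \<alpha> y ?y" using ul_ul_ll[OF B xy u] eq by simp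
      then show "cd \<alpha> y \<and> b y = \<pi> (a x)" using numbering_ll[OF A numbering _ cy] ul_cd[OF xy] eq pk by simp
    next
      assume "cd \<alpha> y \<and> b y = \<pi> (a x)"
      then have "ll \<beta> ?y y" using numbering_ll[OF A numbering cy] pk eq by simp
      then show "ul \<beta> x y" using ul_ll[OF B u] by blast
    qed
  qed
  have "\<pi> permutes {1..rank \<alpha>}"
  proof (rule bij_imp_permutes)
    have into: "\<pi> k \<in> {1..rank \<alpha>}" if "k \<in> {1..rank \<alpha>}" for k
    proof -
      obtain x where x: "dm \<alpha> x" "a x = k" using numbering_surj[OF numbering \<open>k \<in> {1..rank \<alpha>}\<close>] by metis
      then obtain y where "ul \<beta> x y" using eq dm_def by metis
      then show ?thesis using key[OF x(1)] numbering_range(2)[OF numbering] x(2) by metis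
    qed
    have "inj_on \<pi> {1..rank \<alpha>}"
    proof (rule inj_onI)
      fix k m assume km: "k \<in> {1..rank \<alpha>}" "m \<in> {1..rank \<alpha>}" "\<pi> k = \<pi> m"
      obtain x where x: "dm \<alpha> x" "a x = k" using numbering_surj[OF numbering km(1)] by metis
      obtain x' where x': "dm \<alpha> x'" "a x' = m" using numbering_surj[OF numbering km(2)] by metis
      obtain y where y: "ul \<beta> x y" using eq x dm_def by metis
      then have "ul \<beta> x' y" using key[OF x(1)] key[OF x'(1)] x x' km by metis
      then have "uu \<alpha> x x'" using ul_ul_uu[OF B y] eq by simp
      then show "k = m" using numbering_uu[OF A numbering x(1) x'(1)] x x' by simp
    qed
    moreover have "\<pi> ` {1..rank \<alpha>} \<subseteq> {1..rank \<alpha>}" using into by (rule image_subsetI)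
    ultimately show "bij_betw \<pi> {1..rank \<alpha>} {1..rank \<alpha>}"
      using endo_inj_surj[of "{1..rank \<alpha>}" \<pi>] unfolding bij_betw_def by simp
  qed (simp only: \<pi>_def if_False)
  moreover have "twist \<alpha> a b \<pi> \<beta>"
    unfolding twist_def using key eq ul_dm by metis
  ultimately show thesis by (rule that)
qed

lemma twist_exists:
  assumes A: "\<alpha> \<in> PP n" and numbering: "numbering \<alpha> a b" and p: "\<pi> permutes {1..rank \<alpha>}"
  obtains \<beta> where "\<beta> \<in> PP n" "twist \<alpha> a b \<pi> \<beta>"
proof -
  have u: "uu \<alpha> x y \<longleftrightarrow> dm \<alpha> y \<and> \<pi> (a x) = \<pi> (a y)" if "dm \<alpha> x" for x y
  proof (cases "dm \<alpha> y")
    case True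
    then show ?thesis using numbering_uu[OF A numbering that True] permutes_inj[OF p] by (simp add: inj_eq)
  next
    case False
    then show ?thesis using that uu_dm[OF A] uu_sym by blast
  qed
  have l: "ll \<alpha> x y \<longleftrightarrow> cd \<alpha> y \<and> b x = b y" if "cd \<alpha> x" for x y
    using numbering_ll[OF A numbering that] ll_cd[OF A _ that] by blast
  obtain \<beta> where "\<beta> \<in> PP n" "uu \<beta> = uu \<alpha>" "ll \<beta> = ll \<alpha>" "\<And>x y. ul \<beta> x y \<longleftrightarrow> dm \<alpha> x \<and> cd \<alpha> y \<and> \<pi> (a x) = b y"
    by (rule partition_with_cross[OF A A, of "dm \<alpha>" "\<lambda>x. \<pi> (a x)" "cd \<alpha>" b]) (use u l in blast)+
  then show thesis using that unfolding twist_def by metis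
qed


subsection \<open>Products of related partitions\<close>

text \<open>The right factor enters the upper and middle rows of the product graph only through its
  upper pattern and its domain. Hence Green-R-related right factors give equally many floating
  components and Green-R-related products.\<close>

lemma pprod_same_upper:
  assumes C: "\<gamma> \<in> PP n" and A: "\<alpha> \<in> PP n" and B: "\<beta> \<in> PP n"
    and eq: "uu \<alpha> = uu \<beta>" "dm \<alpha> = dm \<beta>"
  shows "mid_joined n \<gamma> \<alpha> = mid_joined n \<gamma> \<beta>" "floating n \<gamma> \<alpha> = floating n \<gamma> \<beta>"
    "uu (pprod n \<gamma> \<alpha>) = uu (pprod n \<gamma> \<beta>)" "dm (pprod n \<gamma> \<alpha>) = dm (pprod n \<gamma> \<beta>)"
    "rank (pprod n \<gamma> \<alpha>) = rank (pprod n \<gamma> \<beta>)"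
proof -
  show mid_joined: "mid_joined n \<gamma> \<alpha> = mid_joined n \<gamma> \<beta>" by (rule mid_joined_cong[OF refl eq(1)])
  show "floating n \<gamma> \<alpha> = floating n \<gamma> \<beta>"
    unfolding floating_float_sets[OF C A] floating_float_sets[OF C B] float_sets_def mid_joined eq ..
  show u: "uu (pprod n \<gamma> \<alpha>) = uu (pprod n \<gamma> \<beta>)"
    unfolding fun_eq_iff uu_pprod[OF C A] uu_pprod[OF C B] mid_joined by simp
  show d: "dm (pprod n \<gamma> \<alpha>) = dm (pprod n \<gamma> \<beta>)"
    unfolding fun_eq_iff dm_pprod[OF C A] dm_pprod[OF C B] mid_joined eq by simp
  show "rank (pprod n \<gamma> \<alpha>) = rank (pprod n \<gamma> \<beta>)"
    by (rule rank_cong[OF pprod_PP[OF C A] pprod_PP[OF C B] u d])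
qed

text \<open>While the rank is kept, every transversal of the product ends in an old lower part: the
  lower numbering stays, the upper one is pulled back, and the permutation is unchanged. The new
  \<open>a'\<close> is chosen before \<pi> and \<beta>, so that one numbering serves all of
  them.\<close>

lemma pprod_twist:
  assumes C: "\<gamma> \<in> PP n" and A: "\<alpha> \<in> PP n" and numbering: "numbering \<alpha> a b"
    and r: "rank (pprod n \<gamma> \<alpha>) = rank \<alpha>"
  obtains a' where "numbering (pprod n \<gamma> \<alpha>) a' b"
    "\<And>\<pi> \<beta>. \<pi> permutes {1..rank \<alpha>} \<Longrightarrow> \<beta> \<in> PP n \<Longrightarrow> twist \<alpha> a b \<pi> \<beta> \<Longrightarrow>
       twist (pprod n \<gamma> \<alpha>) a' b \<pi> (pprod n \<gamma> \<beta>)"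
proof -
  note cl = rank_pprod_right_eq[OF C A r]
  note P = pprod_PP[OF C A]
  \<comment> \<open>The domain points of \<alpha> that \<open>x\<close> reaches. They all lie in one
    transversal, since reaching two would merge lower parts, contrary to the rank being
    kept.\<close>
  define W where "W x w \<longleftrightarrow> (\<exists>v. ul \<gamma> x v \<and> mid_joined n \<gamma> \<alpha> v w \<and> dm \<alpha> w)" for x w
  define a' where "a' x = a (SOME w. W x w)" for x
  have ulW: "ul (pprod n \<gamma> \<alpha>) x y \<longleftrightarrow> (\<exists>w. W x w \<and> ul \<alpha> w y)" for x y
    unfolding ul_pprod[OF C A] W_def using ul_dm by metis
  have dmW: "dm (pprod n \<gamma> \<alpha>) x \<longleftrightarrow> (\<exists>w. W x w)" for x
    unfolding dm_pprod[OF C A] W_def by metis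
  have Wu: "a w = a w'" if w: "W x w" "W x w'" for x w w'
  proof -
    have d: "dm \<alpha> w" "dm \<alpha> w'" using w by (auto simp: W_def)
    then obtain y y' where y: "ul \<alpha> w y" "ul \<alpha> w' y'" unfolding dm_def by blast
    then have "ul (pprod n \<gamma> \<alpha>) x y" "ul (pprod n \<gamma> \<alpha>) x y'" using ulW w by blast+
    then have "ll (pprod n \<gamma> \<alpha>) y y'" by (rule ul_ul_ll[OF P])
    then have "ll \<alpha> y y'" using cl by simp
    then have "ul \<alpha> w y'" by (rule ul_ll[OF A y(1)])
    then have "uu \<alpha> w w'" using ul_ul_uu[OF A _ y(2)] by simp
    then show ?thesis using numbering_uu[OF A numbering d] by simp
  qed
  have a': "a' x = a w" if "W x w" for x w
    unfolding a'_def using someI[of "W x", OF that] that by (rule Wu)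
  have numbering': "numbering (pprod n \<gamma> \<alpha>) a' b"
    unfolding numbering_def
  proof (intro conjI allI impI)
    fix x y assume "dm (pprod n \<gamma> \<alpha>) x" and y: "cd (pprod n \<gamma> \<alpha>) y"
    then obtain w where w: "W x w" using dmW by blast
    have cy: "cd \<alpha> y" using y cl by simp
    have "ul (pprod n \<gamma> \<alpha>) x y \<longleftrightarrow> (\<exists>w. W x w \<and> dm \<alpha> w \<and> a w = b y)"
      unfolding ulW numbering_ul[OF numbering] using cy by blast
    also have "\<dots> \<longleftrightarrow> a' x = b y" using a' w W_def by metis
    finally show "ul (pprod n \<gamma> \<alpha>) x y = (a' x = b y)" .
  next
    show "b ` {y. cd (pprod n \<gamma> \<alpha>) y} = {1..rank (pprod n \<gamma> \<alpha>)}"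
      using numbering unfolding cl r numbering_def by simp
    show "a' ` {x. dm (pprod n \<gamma> \<alpha>) x} = {1..rank (pprod n \<gamma> \<alpha>)}"
      unfolding r
    proof (intro equalityI subsetI)
      fix k assume "k \<in> a' ` {x. dm (pprod n \<gamma> \<alpha>) x}"
      then obtain x where "k = a' x" "dm (pprod n \<gamma> \<alpha>) x" by (auto elim!: imageE)
      moreover from this obtain w where "W x w" using dmW by blast
      ultimately have "k = a w" "dm \<alpha> w" using a' W_def by auto
      then show "k \<in> {1..rank \<alpha>}" using numbering_range[OF numbering] by simp
    next
      fix k assume "k \<in> {1..rank \<alpha>}"
      then obtain y where y: "cd \<alpha> y" "b y = k" using numbering_surj[OF numbering] by metis
      then obtain x where x: "ul (pprod n \<gamma> \<alpha>) x y" using cl cd_def by metis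
      then obtain w where "W x w" "ul \<alpha> w y" using ulW by blast
      then have "a' x = k" using a' numbering_ul[OF numbering] y by simp
      then show "k \<in> a' ` {x. dm (pprod n \<gamma> \<alpha>) x}"
        using ul_dm[OF x] by (intro image_eqI[of _ _ x]) simp_all
    qed
  qed
  have tw: "twist (pprod n \<gamma> \<alpha>) a' b \<pi> (pprod n \<gamma> \<beta>)"
    if p: "\<pi> permutes {1..rank \<alpha>}" and B: "\<beta> \<in> PP n" and t: "twist \<alpha> a b \<pi> \<beta>" for \<pi> \<beta>
  proof -
    note d = twist_dm[OF numbering p t]
    have te: "uu \<alpha> = uu \<beta>" "dm \<alpha> = dm \<beta>" and tl: "ll \<beta> = ll \<alpha>"
      and tu: "\<And>x y. ul \<beta> x y \<longleftrightarrow> dm \<alpha> x \<and> cd \<alpha> y \<and> b y = \<pi> (a x)"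
      using t d unfolding twist_def by simp_all
    note s = pprod_same_upper[OF C A B te]
    have "rank (pprod n \<gamma> \<beta>) = rank \<beta>" using s(5) r rank_cong[OF A B te] by simp
    note cl' = rank_pprod_right_eq[OF C B this]
    show ?thesis
      unfolding twist_def
    proof (intro conjI allI)
      show "uu (pprod n \<gamma> \<beta>) = uu (pprod n \<gamma> \<alpha>)" using s by simp
      show "ll (pprod n \<gamma> \<beta>) = ll (pprod n \<gamma> \<alpha>)" using cl cl' tl by simp
      fix x y
      have "ul (pprod n \<gamma> \<beta>) x y \<longleftrightarrow> (\<exists>w. W x w \<and> ul \<beta> w y)"
        unfolding ul_pprod[OF C B] W_def s(1)[symmetric] te(2) using ul_dm by metis
      also have "\<dots> \<longleftrightarrow> (\<exists>w. W x w \<and> cd \<alpha> y \<and> b y = \<pi> (a w))"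
        unfolding tu W_def by blast
      also have "\<dots> \<longleftrightarrow> dm (pprod n \<gamma> \<alpha>) x \<and> cd (pprod n \<gamma> \<alpha>) y \<and> b y = \<pi> (a' x)"
        unfolding dmW cl using a' by metis
      finally show "ul (pprod n \<gamma> \<beta>) x y \<longleftrightarrow> dm (pprod n \<gamma> \<alpha>) x \<and> cd (pprod n \<gamma> \<alpha>) y \<and> b y = \<pi> (a' x)" .
    qed
  qed
  show thesis by (rule that[OF numbering' tw])
qed

text \<open>Only the middle component through the transversal can behave differently for \<alpha>
  and its hat. If \<gamma> ties it to the upper row, it floats in neither product and the rank stays
  1; if not, it floats for the hat alone and the rank drops to 0.\<close>

lemma pprod_hat:
  assumes C: "\<gamma> \<in> PP n" and A: "\<alpha> \<in> PP n" and r: "rank \<alpha> \<le> 1"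
  shows "pprod n \<gamma> (hat \<alpha>) = hat (pprod n \<gamma> \<alpha>)"
    "floating n \<gamma> (hat \<alpha>) + rank (pprod n \<gamma> \<alpha>) = floating n \<gamma> \<alpha> + rank \<alpha>"
proof -
  note H = hat_PP_joined(1)[OF A]
  note h = hat_simps[OF A]
  note P = pprod_PP[OF C A]
  have mid_joined: "mid_joined n \<gamma> (hat \<alpha>) = mid_joined n \<gamma> \<alpha>" by (rule mid_joined_cong[OF refl h(1)])
  show "pprod n \<gamma> (hat \<alpha>) = hat (pprod n \<gamma> \<alpha>)"
  proof (rule PP_eqI[of _ n])
    show "uu (pprod n \<gamma> (hat \<alpha>)) = uu (hat (pprod n \<gamma> \<alpha>))"
      unfolding hat_simps(1)[OF P] fun_eq_iff uu_pprod[OF C H] uu_pprod[OF C A] mid_joined by simp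
    show "ul (pprod n \<gamma> (hat \<alpha>)) = ul (hat (pprod n \<gamma> \<alpha>))"
      unfolding fun_eq_iff ul_pprod[OF C H] using h(3) hat_simps(3)[OF P] by simp
    have "ll (pprod n \<gamma> \<alpha>) x y \<longleftrightarrow> ll \<alpha> x y" for x y
      unfolding ll_pprod[OF C A] using rank_le_1_cd[OF A r] ul_cd by metis
    then show "ll (pprod n \<gamma> (hat \<alpha>)) = ll (hat (pprod n \<gamma> \<alpha>))"
      unfolding hat_simps(2)[OF P] fun_eq_iff ll_pprod[OF C H] using h(2,3) by simp
  qed (simp_all add: pprod_PP[OF C H] hat_PP_joined(1)[OF P])
  show "floating n \<gamma> (hat \<alpha>) + rank (pprod n \<gamma> \<alpha>) = floating n \<gamma> \<alpha> + rank \<alpha>"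
  proof (cases "rank \<alpha> = 0")
    case True
    then show ?thesis using hat_rank_0[OF A] rank_pprod_right[OF C A] by simp
  next
    case False
    then have r1: "rank \<alpha> = 1" using r by simp
    then obtain x0 where x0: "dm \<alpha> x0" using rank_0_iff[OF A] by auto
    have x0r: "x0 \<in> {1..n}" by (rule dm_range[OF A x0])
    have u0: "uu \<alpha> x0 w" if "dm \<alpha> w" for w using rank_le_1_iff[OF A] r x0 that by blast
    define c0 where "c0 = {y. mid_joined n \<gamma> \<alpha> x0 y}"
    have Jd: "mid_joined n \<gamma> \<alpha> x x0" if "mid_joined n \<gamma> \<alpha> x w" "dm \<alpha> w" for x w
      using that(1) mid_joined_sym[OF mid_joined_uu[OF A u0[OF that(2)]]] by (rule mid_joined_trans)
    have cls: "{y. mid_joined n \<gamma> \<alpha> x y} = c0" if "mid_joined n \<gamma> \<alpha> x x0" for x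
      unfolding c0_def using that mid_joined_trans mid_joined_sym by blast
    have FH: "float_sets n \<gamma> (hat \<alpha>) = {{y. mid_joined n \<gamma> \<alpha> x y} |x. x \<in> {1..n} \<and> (\<forall>v. mid_joined n \<gamma> \<alpha> x v \<longrightarrow> \<not> cd \<gamma> v)}"
      unfolding float_sets_def mid_joined using h(4) by simp
    have c0F: "c0 \<notin> float_sets n \<gamma> \<alpha>"
    proof
      assume "c0 \<in> float_sets n \<gamma> \<alpha>"
      then obtain x where "c0 = {y. mid_joined n \<gamma> \<alpha> x y}" "\<forall>v. mid_joined n \<gamma> \<alpha> x v \<longrightarrow> \<not> dm \<alpha> v"
        unfolding float_sets_def by blast
      moreover have "x0 \<in> c0" using mid_joined_refl[OF x0r] by (simp add: c0_def)
      ultimately show False using x0 by simp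
    qed
    have rk: "rank (pprod n \<gamma> \<alpha>) \<noteq> 0 \<longleftrightarrow> (\<exists>v. mid_joined n \<gamma> \<alpha> x0 v \<and> cd \<gamma> v)"
    proof -
      have "rank (pprod n \<gamma> \<alpha>) \<noteq> 0 \<longleftrightarrow> (\<exists>v w. cd \<gamma> v \<and> mid_joined n \<gamma> \<alpha> v w \<and> dm \<alpha> w)"
        unfolding rank_0_iff[OF P] dm_pprod[OF C A] cd_def by blast
      then show ?thesis using Jd x0 mid_joined_sym by metis
    qed
    show ?thesis
    proof (cases "\<exists>v. mid_joined n \<gamma> \<alpha> x0 v \<and> cd \<gamma> v")
      case True
      then have "rank (pprod n \<gamma> \<alpha>) = 1" using rk rank_pprod_right[OF C A] r1 by simp
      moreover have "float_sets n \<gamma> (hat \<alpha>) = float_sets n \<gamma> \<alpha>"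
      proof (intro equalityI subsetI)
        fix c assume "c \<in> float_sets n \<gamma> (hat \<alpha>)"
        then obtain x where x: "c = {y. mid_joined n \<gamma> \<alpha> x y}" "x \<in> {1..n}" "\<forall>v. mid_joined n \<gamma> \<alpha> x v \<longrightarrow> \<not> cd \<gamma> v"
          unfolding FH by blast
        have "\<not> dm \<alpha> v" if "mid_joined n \<gamma> \<alpha> x v" for v
          using Jd[OF that] True x(3) mid_joined_trans by blast
        with x show "c \<in> float_sets n \<gamma> \<alpha>" unfolding float_sets_def by blast
      next
        fix c assume "c \<in> float_sets n \<gamma> \<alpha>"
        then show "c \<in> float_sets n \<gamma> (hat \<alpha>)" unfolding FH unfolding float_sets_def by blast
      qed
      ultimately show ?thesis using r1 by (simp add: floating_float_sets[OF C A] floating_float_sets[OF C H])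
    next
      case False
      then have "rank (pprod n \<gamma> \<alpha>) = 0" using rk by metis
      moreover have "float_sets n \<gamma> (hat \<alpha>) = insert c0 (float_sets n \<gamma> \<alpha>)"
      proof (intro equalityI subsetI)
        fix c assume "c \<in> float_sets n \<gamma> (hat \<alpha>)"
        then obtain x where x: "c = {y. mid_joined n \<gamma> \<alpha> x y}" "x \<in> {1..n}" "\<forall>v. mid_joined n \<gamma> \<alpha> x v \<longrightarrow> \<not> cd \<gamma> v"
          unfolding FH by blast
        show "c \<in> insert c0 (float_sets n \<gamma> \<alpha>)"
        proof (cases "mid_joined n \<gamma> \<alpha> x x0")
          case True
          then show ?thesis using cls x(1) by simp
        next
          case False
          then have "\<forall>v. mid_joined n \<gamma> \<alpha> x v \<longrightarrow> \<not> cd \<gamma> v \<and> \<not> dm \<alpha> v" using x(3) Jd by blast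
          then show ?thesis using x(1,2) unfolding float_sets_def by blast
        qed
      next
        fix c assume "c \<in> insert c0 (float_sets n \<gamma> \<alpha>)"
        then consider "c = c0" | "c \<in> float_sets n \<gamma> \<alpha>" by blast
        then show "c \<in> float_sets n \<gamma> (hat \<alpha>)"
        proof cases
          case 1
          then show ?thesis unfolding FH c0_def using False x0r by blast
        next
          case 2
          then show ?thesis unfolding FH unfolding float_sets_def by blast
        qed
      qed
      ultimately show ?thesis
        using r1 c0F finite_float_sets[of n \<gamma> \<alpha>] by (simp add: floating_float_sets[OF C A] floating_float_sets[OF C H])
    qed
  qed
qed

subsection \<open>Green's relations\<close>

text \<open>With \<open>el\<close>, an index that exceeds \<open>d\<close> stands for the zero, which removes the case distinction from
  products.\<close>

definition el :: "nat \<Rightarrow> nat \<Rightarrow> vpart \<Rightarrow> telem" where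
  "el d k \<alpha> = (if k \<le> d then Some (k, \<alpha>) else None)"

lemma TPM_carrier: "carrier (TPM n d) = Some ` ({0..d} \<times> PP n) \<union> {None}"
  by (simp add: TPM_def)

lemma TPM_mult [simp]: "x \<otimes>\<^bsub>TPM n d\<^esub> y = tmult n d x y"
  by (simp add: TPM_def)

lemma PM_mult [simp]: "x \<otimes>\<^bsub>PM n\<^esub> y = pprod n x y"
  by (simp add: PM_def)

lemma Some_carrier [simp]: "Some (i, \<alpha>) \<in> carrier (TPM n d) \<longleftrightarrow> i \<le> d \<and> \<alpha> \<in> PP n"
  by (auto simp: TPM_carrier)

lemma None_carrier [simp]: "None \<in> carrier (TPM n d)"
  by (simp add: TPM_carrier)

lemma tmult_el: "tmult n d (Some (i, \<alpha>)) (Some (j, \<beta>)) = el d (i + j + floating n \<alpha> \<beta>) (pprod n \<alpha> \<beta>)"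
  by (simp add: el_def)

lemma tmult_None [simp]: "tmult n d None x = None" "tmult n d x None = None"
  by (cases x; auto)+

lemma el_carrier: "\<alpha> \<in> PP n \<Longrightarrow> el d i \<alpha> \<in> carrier (TPM n d)"
  by (simp add: el_def)

lemma carrier_cases:
  assumes "x \<in> carrier (TPM n d)"
  obtains "x = None" | i \<alpha> where "x = Some (i, \<alpha>)" "i \<le> d" "\<alpha> \<in> PP n"
  using assms by (auto simp: TPM_carrier)

lemma tmult_carrier:
  assumes "x \<in> carrier (TPM n d)" "y \<in> carrier (TPM n d)" shows "tmult n d x y \<in> carrier (TPM n d)"
  using assms(1)
proof (cases rule: carrier_cases)
  case (2 i \<alpha>)
  note x = this
  from assms(2) show ?thesis
  proof (cases rule: carrier_cases)
    case (2 j \<beta>)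
    then show ?thesis unfolding x(1) 2(1) tmult_el using x by (intro el_carrier pprod_PP) simp_all
  qed simp
qed simp

lemma left_ideal_PM:
  assumes n: "n \<ge> 1" and A: "\<alpha> \<in> PP n"
  shows "(\<lambda>s. pprod n s \<alpha>) ` PP n = {\<sigma> \<in> PP n. left_div \<alpha> \<sigma>}"
proof (intro equalityI subsetI)
  fix \<sigma> assume "\<sigma> \<in> (\<lambda>s. pprod n s \<alpha>) ` PP n"
  then show "\<sigma> \<in> {\<sigma> \<in> PP n. left_div \<alpha> \<sigma>}" using left_div_pprod[OF _ A] pprod_PP[OF _ A] by (auto elim!: imageE)
next
  fix \<sigma> assume "\<sigma> \<in> {\<sigma> \<in> PP n. left_div \<alpha> \<sigma>}"
  then have "\<sigma> \<in> PP n" "left_div \<alpha> \<sigma>" by simp_all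
  then obtain \<gamma> where "\<gamma> \<in> PP n" "pprod n \<gamma> \<alpha> = \<sigma>" by (rule left_division[OF A _ n])
  then show "\<sigma> \<in> (\<lambda>s. pprod n s \<alpha>) ` PP n" by (intro image_eqI[of _ _ \<gamma>]) simp_all
qed

text \<open>Division without floating components leaves the index free to be raised by any amount,
  including none. So a left ideal consists of all left multiples of \<alpha> with all indices from
  \<open>i\<close> on, and Green's relations of the twisted monoid are those of the partitions
  together with equality of the indices.\<close>

lemma left_ideal_TPM:
  assumes n: "n \<ge> 1" and A: "\<alpha> \<in> PP n" and i: "i \<le> d"
  shows "(\<lambda>s. tmult n d s (Some (i, \<alpha>))) ` carrier (TPM n d) =
    insert None {Some (k, \<sigma>) | k \<sigma>. i \<le> k \<and> k \<le> d \<and> \<sigma> \<in> PP n \<and> left_div \<alpha> \<sigma>}" (is "_ = ?R")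
proof (intro equalityI subsetI)
  fix t assume "t \<in> (\<lambda>s. tmult n d s (Some (i, \<alpha>))) ` carrier (TPM n d)"
  then obtain s where s: "s \<in> carrier (TPM n d)" "t = tmult n d s (Some (i, \<alpha>))" by (auto elim!: imageE)
  from s(1) show "t \<in> ?R"
  proof (cases rule: carrier_cases)
    case (2 j \<gamma>)
    then show ?thesis
      unfolding s(2) 2(1) tmult_el using left_div_pprod[OF 2(3) A] pprod_PP[OF 2(3) A]
      by (simp add: el_def)
  qed (simp add: s(2))
next
  fix t assume "t \<in> ?R"
  then consider "t = None" | k \<sigma> where "t = Some (k, \<sigma>)" "i \<le> k" "k \<le> d" "\<sigma> \<in> PP n" "left_div \<alpha> \<sigma>" by auto
  then show "t \<in> (\<lambda>s. tmult n d s (Some (i, \<alpha>))) ` carrier (TPM n d)"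
  proof cases
    case 1
    then show ?thesis by (intro image_eqI[of _ _ None]) simp_all
  next
    case 2
    from 2(4,5) obtain \<gamma> where g: "\<gamma> \<in> PP n" "pprod n \<gamma> \<alpha> = \<sigma>" "floating n \<gamma> \<alpha> = 0"
      by (rule left_division[OF A _ n])
    show ?thesis
    proof (rule image_eqI[of _ _ "Some (k - i, \<gamma>)"])
      show "t = tmult n d (Some (k - i, \<gamma>)) (Some (i, \<alpha>))" unfolding tmult_el g using 2 by (simp add: el_def)
    qed (use 2 g in simp)
  qed
qed

lemma green_L_PM:
  assumes "n \<ge> 1" "\<alpha> \<in> PP n" "\<beta> \<in> PP n"
  shows "(\<alpha>, \<beta>) \<in> green_L (PM n) \<longleftrightarrow> ll \<alpha> = ll \<beta> \<and> cd \<alpha> = cd \<beta>"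
proof -
  have "(\<alpha>, \<beta>) \<in> green_L (PM n) \<longleftrightarrow> {\<sigma> \<in> PP n. left_div \<alpha> \<sigma>} = {\<sigma> \<in> PP n. left_div \<beta> \<sigma>}"
    using assms by (simp add: green_L_def left_ideal_PM)
  also have "\<dots> \<longleftrightarrow> ll \<alpha> = ll \<beta> \<and> cd \<alpha> = cd \<beta>"
  proof
    assume "{\<sigma> \<in> PP n. left_div \<alpha> \<sigma>} = {\<sigma> \<in> PP n. left_div \<beta> \<sigma>}"
    then have "left_div \<beta> \<alpha>" "left_div \<alpha> \<beta>" using left_div_refl assms by blast+
    then show "ll \<alpha> = ll \<beta> \<and> cd \<alpha> = cd \<beta>" using left_div_antisym by blast
  next
    assume "ll \<alpha> = ll \<beta> \<and> cd \<alpha> = cd \<beta>"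
    then have "left_div \<alpha> = left_div \<beta>" using left_div_cong by blast
    then show "{\<sigma> \<in> PP n. left_div \<alpha> \<sigma>} = {\<sigma> \<in> PP n. left_div \<beta> \<sigma>}" by (simp only:)
  qed
  finally show ?thesis .
qed

lemma green_L_TPM:
  assumes "n \<ge> 1" "\<alpha> \<in> PP n" "\<beta> \<in> PP n" "i \<le> d" "j \<le> d"
  shows "(Some (i, \<alpha>), Some (j, \<beta>)) \<in> green_L (TPM n d) \<longleftrightarrow> i = j \<and> ll \<alpha> = ll \<beta> \<and> cd \<alpha> = cd \<beta>"
proof -
  let ?R = "\<lambda>i \<alpha>. insert None {Some (k, \<sigma>) | k \<sigma>. i \<le> k \<and> k \<le> d \<and> \<sigma> \<in> PP n \<and> left_div \<alpha> \<sigma>}"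
  have "(Some (i, \<alpha>), Some (j, \<beta>)) \<in> green_L (TPM n d) \<longleftrightarrow> ?R i \<alpha> = ?R j \<beta>"
    using assms by (simp add: green_L_def left_ideal_TPM)
  also have "\<dots> \<longleftrightarrow> i = j \<and> ll \<alpha> = ll \<beta> \<and> cd \<alpha> = cd \<beta>"
  proof
    assume eq: "?R i \<alpha> = ?R j \<beta>"
    have "Some (i, \<alpha>) \<in> ?R i \<alpha>" "Some (j, \<beta>) \<in> ?R j \<beta>" using left_div_refl assms by simp_all
    then have "Some (i, \<alpha>) \<in> ?R j \<beta>" "Some (j, \<beta>) \<in> ?R i \<alpha>" by (simp_all only: eq)
    then show "i = j \<and> ll \<alpha> = ll \<beta> \<and> cd \<alpha> = cd \<beta>" using left_div_antisym[of \<alpha> \<beta>] by simp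
  next
    assume "i = j \<and> ll \<alpha> = ll \<beta> \<and> cd \<alpha> = cd \<beta>"
    moreover from this have "left_div \<alpha> = left_div \<beta>" using left_div_cong by blast
    ultimately show "?R i \<alpha> = ?R j \<beta>" by (simp only:)
  qed
  finally show ?thesis .
qed

section \<open>The anti-involution on the twisted monoid\<close>

definition tstar :: "telem \<Rightarrow> telem" where
  "tstar = map_option (map_prod id star)"

lemma tstar_simps [simp]: "tstar None = None" "tstar (Some (i, \<alpha>)) = Some (i, star \<alpha>)"
  by (simp_all add: tstar_def)

lemma tstar_tstar [simp]: "tstar (tstar x) = x"
  by (cases x) auto

lemma tstar_carrier [simp]: "tstar x \<in> carrier (TPM n d) \<longleftrightarrow> x \<in> carrier (TPM n d)"
  by (cases x) auto

lemma tstar_el: "tstar (el d k \<alpha>) = el d k (star \<alpha>)"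
  by (simp add: el_def)

lemma tstar_tmult:
  assumes "x \<in> carrier (TPM n d)" "y \<in> carrier (TPM n d)"
  shows "tstar (tmult n d x y) = tmult n d (tstar y) (tstar x)"
  using assms(1)
proof (cases rule: carrier_cases)
  case (2 i \<alpha>)
  note x = this
  from assms(2) show ?thesis
  proof (cases rule: carrier_cases)
    case (2 j \<beta>)
    show ?thesis
      unfolding x(1) 2(1) tstar_simps tmult_el tstar_el floating_star[OF x(3) 2(3)] star_pprod[OF x(3) 2(3)]
      by (simp add: add.commute)
  qed simp
qed simp

lemma green_R_PM:
  assumes "n \<ge> 1" "\<alpha> \<in> PP n" "\<beta> \<in> PP n"
  shows "(\<alpha>, \<beta>) \<in> green_R (PM n) \<longleftrightarrow> uu \<alpha> = uu \<beta> \<and> dm \<alpha> = dm \<beta>"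
proof -
  have *: "(\<lambda>s. pprod n \<alpha> s) ` PP n = star ` (\<lambda>s. pprod n s (star \<alpha>)) ` PP n" if "\<alpha> \<in> PP n" for \<alpha>
  proof (intro equalityI subsetI)
    fix t assume "t \<in> (\<lambda>s. pprod n \<alpha> s) ` PP n"
    then obtain s where s: "s \<in> PP n" "t = pprod n \<alpha> s" by (auto elim!: imageE)
    then have "t = star (pprod n (star s) (star \<alpha>))" using star_pprod[OF that s(1)] star_star by metis
    moreover have "pprod n (star s) (star \<alpha>) \<in> (\<lambda>s. pprod n s (star \<alpha>)) ` PP n"
      using s by (intro image_eqI[of _ _ "star s"]) simp_all
    ultimately show "t \<in> star ` (\<lambda>s. pprod n s (star \<alpha>)) ` PP n" by (simp only: imageI)
  next
    fix t assume "t \<in> star ` (\<lambda>s. pprod n s (star \<alpha>)) ` PP n"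
    then obtain s where s: "s \<in> PP n" "t = star (pprod n s (star \<alpha>))" by (auto elim!: imageE)
    then have "t = pprod n \<alpha> (star s)" using star_pprod[OF s(1), of "star \<alpha>"] that by simp
    then show "t \<in> (\<lambda>s. pprod n \<alpha> s) ` PP n" using s by (intro image_eqI[of _ _ "star s"]) simp_all
  qed
  have "inj star" by (metis injI star_star)
  then have "(\<alpha>, \<beta>) \<in> green_R (PM n) \<longleftrightarrow> (star \<alpha>, star \<beta>) \<in> green_L (PM n)"
    using assms by (simp add: green_R_def green_L_def * inj_image_eq_iff)
  then show ?thesis using green_L_PM[of n "star \<alpha>" "star \<beta>"] assms by simp
qed

lemma green_R_TPM:
  assumes "n \<ge> 1" "\<alpha> \<in> PP n" "\<beta> \<in> PP n" "i \<le> d" "j \<le> d"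
  shows "(Some (i, \<alpha>), Some (j, \<beta>)) \<in> green_R (TPM n d) \<longleftrightarrow> i = j \<and> uu \<alpha> = uu \<beta> \<and> dm \<alpha> = dm \<beta>"
proof -
  let ?S = "carrier (TPM n d)"
  have *: "(\<lambda>s. tmult n d x s) ` ?S = tstar ` (\<lambda>s. tmult n d s (tstar x)) ` ?S" if "x \<in> ?S" for x
  proof (intro equalityI subsetI)
    fix t assume "t \<in> (\<lambda>s. tmult n d x s) ` ?S"
    then obtain s where s: "s \<in> ?S" "t = tmult n d x s" by (auto elim!: imageE)
    then have "t = tstar (tmult n d (tstar s) (tstar x))" using tstar_tmult[OF that s(1)] tstar_tstar by metis
    moreover have "tmult n d (tstar s) (tstar x) \<in> (\<lambda>s. tmult n d s (tstar x)) ` ?S"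
      using s by (intro image_eqI[of _ _ "tstar s"]) simp_all
    ultimately show "t \<in> tstar ` (\<lambda>s. tmult n d s (tstar x)) ` ?S" by (simp only: imageI)
  next
    fix t assume "t \<in> tstar ` (\<lambda>s. tmult n d s (tstar x)) ` ?S"
    then obtain s where s: "s \<in> ?S" "t = tstar (tmult n d s (tstar x))" by (auto elim!: imageE)
    then have "t = tmult n d x (tstar s)" using tstar_tmult[OF s(1), of "tstar x"] that by simp
    then show "t \<in> (\<lambda>s. tmult n d x s) ` ?S" using s by (intro image_eqI[of _ _ "tstar s"]) simp_all
  qed
  have "inj tstar" by (metis injI tstar_tstar)
  then have "(Some (i, \<alpha>), Some (j, \<beta>)) \<in> green_R (TPM n d) \<longleftrightarrow>
      (Some (i, star \<alpha>), Some (j, star \<beta>)) \<in> green_L (TPM n d)"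
    using assms by (simp add: green_R_def green_L_def * inj_image_eq_iff)
  then show ?thesis using green_L_TPM[of n "star \<alpha>" "star \<beta>" i d j] assms by simp
qed

subsection \<open>Zero classes of a congruence\<close>

lemma transport:
  assumes n: "n \<ge> 1" and A: "\<alpha> \<in> PP n" and B: "\<beta> \<in> PP n" and r: "rank \<beta> \<le> rank \<alpha>"
  obtains \<gamma> \<delta> where "\<gamma> \<in> PP n" "\<delta> \<in> PP n" "floating n \<gamma> \<alpha> = 0" "floating n (pprod n \<gamma> \<alpha>) \<delta> = 0"
    "pprod n (pprod n \<gamma> \<alpha>) \<delta> = \<beta>"
proof -
  obtain a b where numbering: "numbering \<alpha> a b" by (rule numbering_exists[OF A])
  obtain a' b' where numbering': "numbering \<beta> a' b'" by (rule numbering_exists[OF B])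
  have u: "uu \<beta> x y \<longleftrightarrow> dm \<beta> y \<and> a' x = a' y" if "dm \<beta> x" for x y
    using numbering_uu[OF B numbering' that] uu_dm[OF B] uu_sym that by metis
  have l: "ll \<alpha> x y \<longleftrightarrow> (cd \<alpha> y \<and> b y \<in> {1..rank \<beta>}) \<and> b x = b y" if "cd \<alpha> x \<and> b x \<in> {1..rank \<beta>}" for x y
    using numbering_ll[OF A numbering] ll_cd[OF A] that by metis
  \<comment> \<open>The way leads through an element with the upper pattern of \<beta>, the lower
    pattern of \<alpha> and as many transversals as \<beta>; the transversals of \<alpha> with
    larger numbers are cut. From there one right division arrives at \<beta>.\<close>
  obtain \<sigma> where S: "\<sigma> \<in> PP n" "uu \<sigma> = uu \<beta>" "ll \<sigma> = ll \<alpha>"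
    and ulS: "\<And>x y. ul \<sigma> x y \<longleftrightarrow> dm \<beta> x \<and> (cd \<alpha> y \<and> b y \<in> {1..rank \<beta>}) \<and> a' x = b y"
    by (rule partition_with_cross[OF B A, of "dm \<beta>" a' "\<lambda>y. cd \<alpha> y \<and> b y \<in> {1..rank \<beta>}" b]) (use u l in blast)+
  have "left_div \<alpha> \<sigma>" unfolding left_div_def S(3) cd_def[of \<sigma>] ulS by blast
  then obtain \<gamma> where g: "\<gamma> \<in> PP n" "pprod n \<gamma> \<alpha> = \<sigma>" "floating n \<gamma> \<alpha> = 0"
    by (rule left_division[OF A S(1) n])
  have "dm \<sigma> x" if x: "dm \<beta> x" for x
  proof -
    have "a' x \<in> {1..rank \<beta>}" using numbering_range(1)[OF numbering' x] .
    moreover from this r have "a' x \<in> {1..rank \<alpha>}" by simp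
    then obtain y where "cd \<alpha> y" "b y = a' x" using numbering_surj[OF numbering] by metis
    ultimately have "ul \<sigma> x y" unfolding ulS using x by simp
    then show ?thesis by (rule ul_dm)
  qed
  then have "left_div (star \<sigma>) (star \<beta>)" unfolding left_div_def star_simps S(2) by blast
  then obtain \<delta> where "\<delta> \<in> PP n" "pprod n \<sigma> \<delta> = \<beta>" "floating n \<sigma> \<delta> = 0"
    by (rule right_division[OF S(1) B n])
  with g that show thesis by simp
qed

text \<open>Indices above \<open>d\<close> are included; for them both entries are
  \<open>None\<close>, and the condition holds by reflexivity. This spares a bound at each
  use.\<close>

definition zero :: "nat \<Rightarrow> nat \<Rightarrow> (telem \<times> telem) set \<Rightarrow> nat \<Rightarrow> nat \<Rightarrow> bool" where
  "zero n d \<theta> q i \<longleftrightarrow> (\<forall>\<alpha>\<in>PP n. \<forall>j\<ge>i. rank \<alpha> \<le> q \<longrightarrow> (el d j \<alpha>, None) \<in> \<theta>)"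

text \<open>The mirror image of a relation. For a congruence it is again one (\<open>dual\<close>),
  so each lemma about left multiplication applies to right multiplication, and each lemma about
  \<open>uu\<close> and \<open>dm\<close> yields one about \<open>ll\<close> and
  \<open>cd\<close>.\<close>

definition tdual :: "(telem \<times> telem) set \<Rightarrow> (telem \<times> telem) set" where
  "tdual \<theta> = {(x, y). (tstar x, tstar y) \<in> \<theta>}"

lemma tdual_tdual [simp]: "tdual (tdual \<theta>) = \<theta>"
  by (simp add: tdual_def)

lemma tdual_el [simp]: "(el d i \<alpha>, el d j \<beta>) \<in> tdual \<theta> \<longleftrightarrow> (el d i (star \<alpha>), el d j (star \<beta>)) \<in> \<theta>"
  by (simp add: tdual_def tstar_el)

lemma zero_tdual: "zero n d (tdual \<theta>) q i \<longleftrightarrow> zero n d \<theta> q i"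
proof -
  have "zero n d (tdual \<theta>) q i" if "zero n d \<theta> q i" for \<theta>
    using that unfolding zero_def tdual_def by (simp add: tstar_el)
  from this[of \<theta>] this[of "tdual \<theta>"] show ?thesis by auto
qed

lemma zero_mono: "zero n d \<theta> q i \<Longrightarrow> r \<le> q \<Longrightarrow> i \<le> j \<Longrightarrow> zero n d \<theta> r j"
  by (auto simp: zero_def)

lemma zeroD: "zero n d \<theta> q i \<Longrightarrow> \<alpha> \<in> PP n \<Longrightarrow> rank \<alpha> \<le> q \<Longrightarrow> i \<le> j \<Longrightarrow> (el d j \<alpha>, None) \<in> \<theta>"
  by (auto simp: zero_def)

lemma congruence_onI:
  assumes "equiv (carrier S) \<theta>"
    and "\<And>x y s. (x, y) \<in> \<theta> \<Longrightarrow> s \<in> carrier S \<Longrightarrow> (s \<otimes>\<^bsub>S\<^esub> x, s \<otimes>\<^bsub>S\<^esub> y) \<in> \<theta>"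
    and "\<And>x y s. (x, y) \<in> \<theta> \<Longrightarrow> s \<in> carrier S \<Longrightarrow> (x \<otimes>\<^bsub>S\<^esub> s, y \<otimes>\<^bsub>S\<^esub> s) \<in> \<theta>"
  shows "congruence_on S \<theta>"
  using assms unfolding congruence_on_def by blast

locale tcong =
  fixes n d :: nat and \<theta> :: "(telem \<times> telem) set"
  assumes n: "n \<ge> 1" and cong: "congruence_on (TPM n d) \<theta>"
begin

lemma eqv: "equiv (carrier (TPM n d)) \<theta>" using cong by (simp add: congruence_on_def)
lemma symm: "(x, y) \<in> \<theta> \<Longrightarrow> (y, x) \<in> \<theta>" using eqv by (meson equivE symD)
lemma tran: "(x, y) \<in> \<theta> \<Longrightarrow> (y, z) \<in> \<theta> \<Longrightarrow> (x, z) \<in> \<theta>" using eqv by (meson equivE transD)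
lemma reflx: "x \<in> carrier (TPM n d) \<Longrightarrow> (x, x) \<in> \<theta>" using eqv by (meson equivE refl_onD)
lemma in_carrier: "(x, y) \<in> \<theta> \<Longrightarrow> x \<in> carrier (TPM n d) \<and> y \<in> carrier (TPM n d)"
  using eqv by (auto simp: equiv_def)

lemma tmul:
  assumes "(x, y) \<in> \<theta>" "s \<in> carrier (TPM n d)"
  shows "(tmult n d s x, tmult n d s y) \<in> \<theta>" "(tmult n d x s, tmult n d y s) \<in> \<theta>"
  using cong assms unfolding congruence_on_def TPM_mult by blast+

text \<open>Here \<open>k\<close> is the index of the multiplier; beyond \<open>d\<close> it stands
  for zero, which \<open>el\<close> absorbs on both sides.\<close>

lemma lm:
  assumes "(el d i \<alpha>, el d j \<beta>) \<in> \<theta>" "\<gamma> \<in> PP n"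
  shows "(el d (i + k + floating n \<gamma> \<alpha>) (pprod n \<gamma> \<alpha>), el d (j + k + floating n \<gamma> \<beta>) (pprod n \<gamma> \<beta>)) \<in> \<theta>"
proof -
  have "tmult n d (el d k \<gamma>) (el d i \<alpha>) = el d (i + k + floating n \<gamma> \<alpha>) (pprod n \<gamma> \<alpha>)" for i \<alpha>
  proof (cases "k \<le> d \<and> i \<le> d")
    case True
    then have "el d k \<gamma> = Some (k, \<gamma>)" "el d i \<alpha> = Some (i, \<alpha>)" by (simp_all add: el_def)
    then show ?thesis by (simp only: tmult_el add.commute[of i k])
  next
    case False
    then show ?thesis by (auto simp: el_def)
  qed
  with tmul(1)[OF assms(1) el_carrier[OF assms(2), of d k]] show ?thesis by simp
qed

lemma dual: "tcong n d (tdual \<theta>)"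
proof
  have e: "(tstar x, tstar y) \<in> \<theta>" if "(x, y) \<in> tdual \<theta>" for x y using that by (simp add: tdual_def)
  have i: "(x, y) \<in> tdual \<theta>" if "(tstar x, tstar y) \<in> \<theta>" for x y using that by (simp add: tdual_def)
  show "congruence_on (TPM n d) (tdual \<theta>)"
  proof (rule congruence_onI)
    show "equiv (carrier (TPM n d)) (tdual \<theta>)"
    proof (rule equivI)
      show "tdual \<theta> \<subseteq> carrier (TPM n d) \<times> carrier (TPM n d)"
        using in_carrier by (auto simp: tdual_def dest!: in_carrier)
      show "refl_on (carrier (TPM n d)) (tdual \<theta>)"
        by (rule refl_onI) (simp add: tdual_def reflx)
      show "sym (tdual \<theta>)" by (rule symI) (simp add: tdual_def symm)
      show "trans (tdual \<theta>)"
      proof (rule transI)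
        fix x y z assume *: "(x, y) \<in> tdual \<theta>" "(y, z) \<in> tdual \<theta>"
        show "(x, z) \<in> tdual \<theta>" by (rule i[OF tran[OF e[OF *(1)] e[OF *(2)]]])
      qed
    qed
    fix x y s assume xy: "(x, y) \<in> tdual \<theta>" and s: "s \<in> carrier (TPM n d)"
    have c: "x \<in> carrier (TPM n d)" "y \<in> carrier (TPM n d)" "tstar s \<in> carrier (TPM n d)"
      using in_carrier[OF e[OF xy]] s by simp_all
    show "(s \<otimes>\<^bsub>TPM n d\<^esub> x, s \<otimes>\<^bsub>TPM n d\<^esub> y) \<in> tdual \<theta>"
      using tmul(2)[OF e[OF xy] c(3)] by (simp add: tdual_def tstar_tmult[OF s c(1)] tstar_tmult[OF s c(2)])
    show "(x \<otimes>\<^bsub>TPM n d\<^esub> s, y \<otimes>\<^bsub>TPM n d\<^esub> s) \<in> tdual \<theta>"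
      using tmul(1)[OF e[OF xy] c(3)] by (simp add: tdual_def tstar_tmult[OF c(1) s] tstar_tmult[OF c(2) s])
  qed
qed (rule n)

lemma rm:
  assumes h: "(el d i \<alpha>, el d j \<beta>) \<in> \<theta>" and D: "\<delta> \<in> PP n" and A: "\<alpha> \<in> PP n" and B: "\<beta> \<in> PP n"
  shows "(el d (i + k + floating n \<alpha> \<delta>) (pprod n \<alpha> \<delta>), el d (j + k + floating n \<beta> \<delta>) (pprod n \<beta> \<delta>)) \<in> \<theta>"
proof -
  interpret D: tcong n d "tdual \<theta>" by (rule dual)
  have "(el d i (star \<alpha>), el d j (star \<beta>)) \<in> tdual \<theta>" using h by simp
  from D.lm[OF this, of "star \<delta>" k] D show ?thesis
    by (simp add: floating_star[OF A D] floating_star[OF B D] star_pprod[OF A D, symmetric] star_pprod[OF B D, symmetric])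
qed

lemma zeroI:
  assumes A: "\<alpha> \<in> PP n" and h: "(el d i \<alpha>, None) \<in> \<theta>" shows "zero n d \<theta> (rank \<alpha>) i"
  unfolding zero_def
proof (intro ballI allI impI)
  fix \<beta> j assume B: "\<beta> \<in> PP n" and ij: "i \<le> j" and r: "rank \<beta> \<le> rank \<alpha>"
  obtain \<gamma> \<delta> where g: "\<gamma> \<in> PP n" "\<delta> \<in> PP n" "floating n \<gamma> \<alpha> = 0" "floating n (pprod n \<gamma> \<alpha>) \<delta> = 0"
    "pprod n (pprod n \<gamma> \<alpha>) \<delta> = \<beta>" by (rule transport[OF n A B r])
  \<comment> \<open>Zero is written with the index d+1, so that the multiplication lemmas apply to
    it.\<close>
  have N: "el d (Suc d + k) \<alpha> = None" for k \<alpha> by (simp add: el_def)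
  have "(el d i \<alpha>, el d (Suc d + 0) \<alpha>) \<in> \<theta>" unfolding N by (rule h)
  from rm[OF lm[OF this g(1), of "j - i"] g(2) pprod_PP[OF g(1) A] pprod_PP[OF g(1) A], of 0]
  have "(el d j \<beta>, el d (Suc d + (j - i)) \<beta>) \<in> \<theta>"
    unfolding g add_0_right le_add_diff_inverse[OF ij] .
  then show "(el d j \<beta>, None) \<in> \<theta>" unfolding N .
qed

lemma zero_from_chain:
  assumes A: "\<alpha> \<in> PP n" and B: "\<beta> \<in> PP n" and h: "(el d i \<alpha>, el d j \<beta>) \<in> \<theta>"
    and r: "rank \<beta> \<le> rank \<alpha>" and ij: "i < j"
  shows "zero n d \<theta> (rank \<alpha>) i"
proof -
  obtain \<gamma> \<delta> where g: "\<gamma> \<in> PP n" "\<delta> \<in> PP n" "floating n \<gamma> \<alpha> = 0" "floating n (pprod n \<gamma> \<alpha>) \<delta> = 0"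
    "pprod n (pprod n \<gamma> \<alpha>) \<delta> = \<beta>" by (rule transport[OF n A B r])
  \<comment> \<open>The factors that turn (i,\<alpha>) into (j,\<beta>) are applied to the pair
    already reached. This relates (j,\<beta>) to an element whose index has grown by at least j-i,
    and transitivity with the given pair completes the step.\<close>
  have "\<exists>l \<phi>. (el d i \<alpha>, el d l \<phi>) \<in> \<theta> \<and> \<phi> \<in> PP n \<and> i + m \<le> l" for m
  proof (induction m)
    case 0
    then show ?case using A reflx[OF el_carrier[OF A]] by (intro exI[of _ i] exI[of _ \<alpha>]) simp
  next
    case (Suc m)
    then obtain l \<phi> where l: "(el d i \<alpha>, el d l \<phi>) \<in> \<theta>" "\<phi> \<in> PP n" "i + m \<le> l" by blast
    let ?\<phi> = "pprod n (pprod n \<gamma> \<phi>) \<delta>"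
    let ?l = "l + (j - i) + floating n \<gamma> \<phi> + floating n (pprod n \<gamma> \<phi>) \<delta>"
    have "(el d j \<beta>, el d ?l ?\<phi>) \<in> \<theta>"
      using rm[OF lm[OF l(1) g(1), of "j - i"] g(2) pprod_PP[OF g(1) A] pprod_PP[OF g(1) l(2)], of 0] g ij by simp
    from tran[OF h this] show ?case
      using l ij pprod_PP[OF pprod_PP[OF g(1) l(2)] g(2)]
      by (intro exI[of _ ?l] exI[of _ ?\<phi>]) simp
  qed
  from this[of "Suc d"] obtain l \<phi> where "(el d i \<alpha>, el d l \<phi>) \<in> \<theta>" "i + Suc d \<le> l" by blast
  then have "(el d i \<alpha>, None) \<in> \<theta>" by (simp add: el_def split: if_splits)
  then show ?thesis by (rule zeroI[OF A])
qed

lemma rank_\<omega>: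
  assumes A: "\<alpha> \<in> PP n" shows "rank (pprod n (\<omega> n) \<alpha>) = (if rank \<alpha> = 0 then 0 else 1)"
proof -
  have P: "pprod n (\<omega> n) \<alpha> \<in> PP n" by (rule pprod_PP[OF \<omega>_PP A])
  have "rank (pprod n (\<omega> n) \<alpha>) \<le> 1"
    unfolding rank_le_1_iff[OF P] dm_def \<omega>_pprod[OF A] by blast
  moreover have "rank (pprod n (\<omega> n) \<alpha>) = 0 \<longleftrightarrow> rank \<alpha> = 0"
    unfolding rank_0_iff[OF P] rank_0_iff[OF A] dm_def[of "pprod n (\<omega> n) \<alpha>"] \<omega>_pprod[OF A]
    using n dm_cd_iff[of \<alpha>] by force
  ultimately show ?thesis by auto
qed

lemma lm_\<omega>:
  assumes "(el d i \<alpha>, el d j \<beta>) \<in> \<theta>" "\<alpha> \<in> PP n" "\<beta> \<in> PP n"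
  shows "(el d i (pprod n (\<omega> n) \<alpha>), el d j (pprod n (\<omega> n) \<beta>)) \<in> \<theta>"
  using lm[OF assms(1) \<omega>_PP, of 0] \<omega>_pprod(4) assms(2,3) by simp

lemma zero_back:
  assumes "(el d i \<alpha>, el d j \<beta>) \<in> \<theta>" "\<alpha> \<in> PP n" "\<beta> \<in> PP n" "zero n d \<theta> (rank \<beta>) j"
  shows "zero n d \<theta> (rank \<alpha>) i"
  using tran[OF assms(1) zeroD[OF assms(4,3) order_refl order_refl]] by (rule zeroI[OF assms(2)])

lemma zero_same_rank_uu:
  assumes A: "\<alpha> \<in> PP n" and B: "\<beta> \<in> PP n" and h: "(el d i \<alpha>, el d i \<beta>) \<in> \<theta>"
    and r: "rank \<alpha> = rank \<beta>" "rank \<alpha> \<le> 1" and ne: "uu \<alpha> \<noteq> uu \<beta>"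
  shows "zero n d \<theta> (rank \<alpha>) i"
proof -
  have aux: "zero n d \<theta> (rank \<alpha>) i"
    if A: "\<alpha> \<in> PP n" and B: "\<beta> \<in> PP n" and h: "(el d i \<alpha>, el d i \<beta>) \<in> \<theta>"
      and r: "rank \<alpha> = rank \<beta>" "rank \<alpha> \<le> 1" and xy: "uu \<alpha> x y" "\<not> uu \<beta> x y" for \<alpha> \<beta> x y
  proof -
    \<comment> \<open>In rank at most 1 the domain is contained in one upper block, so
      \<open>x\<close> and \<open>y\<close> are not both in it. After swapping them if need be, the
      class of the second point can be made to float.\<close>
    have "\<not> (dm \<beta> x \<and> dm \<beta> y)" using rank_le_1_iff[OF B] r xy by auto
    then obtain x' y' where xy': "uu \<alpha> x' y'" "\<not> uu \<beta> x' y'" "\<not> dm \<beta> y'" using xy uu_sym by blast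
    obtain \<gamma> where g: "\<gamma> \<in> PP n" "pprod n \<gamma> \<alpha> = pprod n (\<omega> n) \<alpha>" "floating n \<gamma> \<alpha> = 0"
      "pprod n \<gamma> \<beta> = pprod n (\<omega> n) \<beta>" "floating n \<gamma> \<beta> > 0" by (rule float_separation[OF A B xy'])
    have "(el d i (pprod n (\<omega> n) \<alpha>), el d (i + floating n \<gamma> \<beta>) (pprod n (\<omega> n) \<beta>)) \<in> \<theta>"
      using lm[OF h g(1), of 0] g by simp
    from zero_from_chain[OF pprod_PP[OF \<omega>_PP A] pprod_PP[OF \<omega>_PP B] this] g(5) r(1)
    have "zero n d \<theta> (if rank \<alpha> = 0 then 0 else 1) i" by (simp add: rank_\<omega>[OF A] rank_\<omega>[OF B])
    moreover have "(if rank \<alpha> = 0 then 0 else 1) = rank \<alpha>" using r(2) by simp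
    ultimately show ?thesis by simp
  qed
  from ne obtain x y where "uu \<alpha> x y \<and> \<not> uu \<beta> x y \<or> uu \<beta> x y \<and> \<not> uu \<alpha> x y" unfolding fun_eq_iff by blast
  then show ?thesis
  proof
    assume "uu \<alpha> x y \<and> \<not> uu \<beta> x y"
    then show ?thesis using aux[OF A B h r] by blast
  next
    assume xy: "uu \<beta> x y \<and> \<not> uu \<alpha> x y"
    have "zero n d \<theta> (rank \<beta>) i"
      by (rule aux[OF B A symm[OF h], of x y]) (use r xy in simp_all)
    then show ?thesis using r by simp
  qed
qed

lemma zero_same_rank:
  assumes A: "\<alpha> \<in> PP n" and B: "\<beta> \<in> PP n" and h: "(el d i \<alpha>, el d i \<beta>) \<in> \<theta>"
    and r: "rank \<alpha> = rank \<beta>" "rank \<alpha> \<le> 1" and ne: "hat \<alpha> \<noteq> hat \<beta>"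
  shows "zero n d \<theta> (rank \<alpha>) i"
proof (cases "uu \<alpha> = uu \<beta>")
  case False
  then show ?thesis by (rule zero_same_rank_uu[OF A B h r])
next
  case True
  then have l: "ll \<alpha> \<noteq> ll \<beta>" using ne hat_eq_iff[OF A B] by simp
  interpret D: tcong n d "tdual \<theta>" by (rule dual)
  have "zero n d (tdual \<theta>) (rank (star \<alpha>)) i"
    by (rule D.zero_same_rank_uu[of _ "star \<beta>"]) (use A B h r l in simp_all)
  then show ?thesis by (simp add: zero_tdual)
qed

lemma zero_rank_1_0_uu:
  assumes A: "\<alpha> \<in> PP n" and B: "\<beta> \<in> PP n" and h: "(el d i \<alpha>, el d j \<beta>) \<in> \<theta>"
    and r: "rank \<alpha> = 1" "rank \<beta> = 0" and ne: "uu \<alpha> \<noteq> uu \<beta>"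
  shows "zero n d \<theta> 1 i"
proof -
  note P = pprod_PP[OF \<omega>_PP A] pprod_PP[OF \<omega>_PP B]
  have w: "(el d i (pprod n (\<omega> n) \<alpha>), el d j (pprod n (\<omega> n) \<beta>)) \<in> \<theta>" by (rule lm_\<omega>[OF h A B])
  \<comment> \<open>Whichever side acquires the floating component, combining the new pair with
    \<open>w\<close> relates one and the same element to itself at a larger index.\<close>
  from ne obtain x y where "uu \<alpha> x y \<and> \<not> uu \<beta> x y \<or> uu \<beta> x y \<and> \<not> uu \<alpha> x y" unfolding fun_eq_iff by blast
  then show ?thesis
  proof
    assume xy: "uu \<alpha> x y \<and> \<not> uu \<beta> x y"
    have nd: "\<not> dm \<beta> y" using r rank_0_iff[OF B] by blast
    obtain \<gamma> where g: "\<gamma> \<in> PP n" "pprod n \<gamma> \<alpha> = pprod n (\<omega> n) \<alpha>" "floating n \<gamma> \<alpha> = 0"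
      "pprod n \<gamma> \<beta> = pprod n (\<omega> n) \<beta>" "floating n \<gamma> \<beta> > 0"
      using float_separation[OF A B _ _ nd] xy by blast
    have "(el d i (pprod n (\<omega> n) \<alpha>), el d (j + floating n \<gamma> \<beta>) (pprod n (\<omega> n) \<beta>)) \<in> \<theta>"
      using lm[OF h g(1), of 0] g by simp
    from zero_from_chain[OF P(2) P(2) tran[OF symm[OF w] this]] g(5)
    have "zero n d \<theta> (rank \<beta>) j" using r by (simp add: rank_\<omega>[OF B])
    from zero_back[OF h A B this] r show ?thesis by simp
  next
    assume xy: "uu \<beta> x y \<and> \<not> uu \<alpha> x y"
    have "\<not> (dm \<alpha> x \<and> dm \<alpha> y)" using rank_le_1_iff[OF A] r xy by auto
    then obtain x' y' where xy': "uu \<beta> x' y'" "\<not> uu \<alpha> x' y'" "\<not> dm \<alpha> y'" using xy uu_sym by blast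
    obtain \<gamma> where g: "\<gamma> \<in> PP n" "pprod n \<gamma> \<beta> = pprod n (\<omega> n) \<beta>" "floating n \<gamma> \<beta> = 0"
      "pprod n \<gamma> \<alpha> = pprod n (\<omega> n) \<alpha>" "floating n \<gamma> \<alpha> > 0" by (rule float_separation[OF B A xy'])
    have "(el d (i + floating n \<gamma> \<alpha>) (pprod n (\<omega> n) \<alpha>), el d j (pprod n (\<omega> n) \<beta>)) \<in> \<theta>"
      using lm[OF h g(1), of 0] g by simp
    from zero_from_chain[OF P(1) P(1) tran[OF w symm[OF this]]] g(5)
    show ?thesis using r by (simp add: rank_\<omega>[OF A])
  qed
qed

lemma zero_rank_1_0:
  assumes A: "\<alpha> \<in> PP n" and B: "\<beta> \<in> PP n" and h: "(el d i \<alpha>, el d j \<beta>) \<in> \<theta>"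
    and r: "rank \<alpha> = 1" "rank \<beta> = 0" and c: "i \<le> j \<or> hat \<alpha> \<noteq> \<beta>"
  shows "zero n d \<theta> 1 i" "zero n d \<theta> 0 j"
proof -
  show z: "zero n d \<theta> 1 i"
  proof (cases "i \<le> j")
    case True
    show ?thesis
    proof (cases "i < j")
      case True
      from zero_from_chain[OF A B h _ this] r show ?thesis by simp
    next
      case False
      with \<open>i \<le> j\<close> have ij: "j = i" by simp
      \<comment> \<open>This multiplier connects the whole middle row but cuts it off from the upper
        row. For \<alpha> the middle row still reaches down through the transversal, for \<beta> of
        rank 0 it floats; so the index grows on one side only.\<close>
      define \<zeta> where "\<zeta> = label_part n (\<lambda>_. True) (\<lambda>_. False)"
      have Z: "\<zeta> \<in> PP n" by (simp add: \<zeta>_def)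
      have g: "\<forall>x y. uu \<alpha> x y \<longrightarrow> False = False" for \<alpha> by simp
      have d: "\<not> dm (pprod n \<zeta> \<alpha>) x" if "\<alpha> \<in> PP n" for \<alpha> x
        unfolding \<zeta>_def dm_label_part_pprod[where g="\<lambda>_. False", OF that g] by simp
      obtain x where x: "dm \<alpha> x" using r rank_0_iff[OF A] by auto
      have f: "floating n \<zeta> \<alpha> = 0" "floating n \<zeta> \<beta> \<noteq> 0"
        unfolding \<zeta>_def floating_label_part[where g="\<lambda>_. False", OF A g] floating_label_part[where g="\<lambda>_. False", OF B g]
        using x r rank_0_iff[OF B] n by force+
      have rz: "rank (pprod n \<zeta> \<alpha>) = 0" "rank (pprod n \<zeta> \<beta>) = 0"
        unfolding rank_0_iff[OF pprod_PP[OF Z A]] rank_0_iff[OF pprod_PP[OF Z B]] using d A B by blast+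
      have "(el d i (pprod n \<zeta> \<alpha>), el d (i + floating n \<zeta> \<beta>) (pprod n \<zeta> \<beta>)) \<in> \<theta>"
        using lm[OF h Z, of 0] f ij by simp
      from zero_from_chain[OF pprod_PP[OF Z A] pprod_PP[OF Z B] this] rz f
      have "zero n d \<theta> (rank \<beta>) j" using r ij by simp
      from zero_back[OF h A B this] r show ?thesis by simp
    qed
  next
    case False
    then have ne: "uu \<alpha> \<noteq> uu \<beta> \<or> ll \<alpha> \<noteq> ll \<beta>" using c hat_eq_iff[OF A B] hat_rank_0[OF B r(2)] by simp
    show ?thesis
    proof (cases "uu \<alpha> = uu \<beta>")
      case False
      then show ?thesis by (rule zero_rank_1_0_uu[OF A B h r])
    next
      case True
      then have l: "ll \<alpha> \<noteq> ll \<beta>" using ne by simp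
      interpret D: tcong n d "tdual \<theta>" by (rule dual)
      have "zero n d (tdual \<theta>) 1 i"
        by (rule D.zero_rank_1_0_uu[of "star \<alpha>" "star \<beta>" i j]) (use A B h r l in simp_all)
      then show ?thesis by (simp add: zero_tdual)
    qed
  qed
  have "zero n d \<theta> (rank \<beta>) j" by (rule zero_back[OF symm[OF h] B A]) (use z r in simp)
  then show "zero n d \<theta> 0 j" using r by simp
qed

lemma zero_rank_1:
  assumes A: "\<alpha> \<in> PP n" and B: "\<beta> \<in> PP n" and h: "(el d i \<alpha>, el d (i + f) \<beta>) \<in> \<theta>"
    and r: "rank \<alpha> = 1" "rank \<beta> \<le> 1" and c: "f > 0 \<or> rank \<beta> = 0 \<or> hat \<alpha> \<noteq> hat \<beta>"
  shows "zero n d \<theta> 1 i"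
proof -
  consider "f > 0" | "rank \<beta> = 0" | "f = 0" "rank \<beta> = 1" "hat \<alpha> \<noteq> hat \<beta>" using c r by linarith
  then show ?thesis
  proof cases
    case 1
    then show ?thesis using zero_from_chain[OF A B h] r by simp
  next
    case 2
    then show ?thesis using zero_rank_1_0(1)[OF A B h r(1)] by simp
  next
    case 3
    then show ?thesis using zero_same_rank[OF A B, of i] h r by simp
  qed
qed

subsection \<open>Pairs of rank at least two\<close>

lemma two_transversals:
  assumes A: "\<alpha> \<in> PP n" and r: "rank \<alpha> \<ge> 2"
  obtains x1 x2 y1 y2 where "ul \<alpha> x1 y1" "ul \<alpha> x2 y2" "\<not> uu \<alpha> x1 x2" "\<not> ll \<alpha> y1 y2"
proof -
  have "\<not> rank \<alpha> \<le> 1" using r by simp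
  then obtain x1 x2 where x: "dm \<alpha> x1" "dm \<alpha> x2" "\<not> uu \<alpha> x1 x2" unfolding rank_le_1_iff[OF A] by blast
  then obtain y1 y2 where y: "ul \<alpha> x1 y1" "ul \<alpha> x2 y2" unfolding dm_def by blast
  have "\<not> ll \<alpha> y1 y2" using ul_ll[OF A y(1)] ul_ul_uu[OF A _ y(2)] x(3) by blast
  with x y that show thesis by blast
qed

lemma zero_rank_2_0:
  assumes A: "\<alpha> \<in> PP n" and B: "\<beta> \<in> PP n" and h: "(el d i \<alpha>, el d j \<beta>) \<in> \<theta>"
    and r: "rank \<alpha> \<ge> 2" "rank \<beta> = 0"
  shows "zero n d \<theta> (rank \<alpha>) i" "zero n d \<theta> 0 j"
proof -
  obtain x1 x2 y1 y2 where xy: "ul \<alpha> x1 y1" "ul \<alpha> x2 y2" "\<not> uu \<alpha> x1 x2" "\<not> ll \<alpha> y1 y2"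
    by (rule two_transversals[OF A r(1)])
  \<comment> \<open>This multiplier keeps the transversal of \<open>x1\<close> apart from that of
    \<open>x2\<close>, whereas \<open>\<omega> n\<close> merges all transversals. So the two
    products with \<alpha> have different lower patterns, but those with \<beta>, which has no
    transversal, have the same one. At least one of the two pairs has unequal hats and falls under
    \<open>zero_rank_1_0\<close>.\<close>
  define P where "P = uu \<alpha> x1"
  define \<gamma> where "\<gamma> = label_part n (\<lambda>_. True) P"
  have G: "\<gamma> \<in> PP n" by (simp add: \<gamma>_def)
  have g: "\<forall>v w. uu \<alpha> v w \<longrightarrow> P v = P w" unfolding P_def using uu_trans[OF A] uu_sym by metis
  note P = pprod_PP[OF \<omega>_PP A] pprod_PP[OF \<omega>_PP B] pprod_PP[OF G A] pprod_PP[OF G B]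
  have px: "P x1" "\<not> P x2" unfolding P_def using xy uu_refl[OF A] ul_range[OF A xy(1)] by auto
  have f: "floating n \<gamma> \<alpha> = 0"
    unfolding \<gamma>_def floating_label_part[where g=P, OF A g] using px ul_dm[OF xy(1)] ul_dm[OF xy(2)] by metis
  have rg: "rank (pprod n \<gamma> \<alpha>) = 1"
  proof -
    have "rank (pprod n \<gamma> \<alpha>) \<le> 1"
      unfolding rank_le_1_iff[OF P(3)] unfolding \<gamma>_def uu_label_part_pprod[where g=P, OF A g] dm_label_part_pprod[where g=P, OF A g] by blast
    moreover have "rank (pprod n \<gamma> \<alpha>) \<noteq> 0"
      unfolding rank_0_iff[OF P(3)] unfolding \<gamma>_def dm_label_part_pprod[where g=P, OF A g] using px ul_dm[OF xy(1)] n by force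
    ultimately show ?thesis by simp
  qed
  have rg0: "rank (pprod n \<gamma> \<beta>) = 0" using rank_pprod_right[OF G B] r by simp
  have w: "(el d i (pprod n (\<omega> n) \<alpha>), el d j (pprod n (\<omega> n) \<beta>)) \<in> \<theta>" by (rule lm_\<omega>[OF h A B])
  have v: "(el d i (pprod n \<gamma> \<alpha>), el d (j + floating n \<gamma> \<beta>) (pprod n \<gamma> \<beta>)) \<in> \<theta>"
    using lm[OF h G, of 0] f by simp
  have nul: "\<not> ul \<beta> x y" for x y using r(2) rank_0_iff[OF B] ul_dm by blast
  have z1: "zero n d \<theta> 1 i"
  proof (cases "hat (pprod n (\<omega> n) \<alpha>) = pprod n (\<omega> n) \<beta>")
    case False
    then show ?thesis using zero_rank_1_0(1)[OF P(1,2) w] r by (simp add: rank_\<omega>[OF A] rank_\<omega>[OF B])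
  next
    case True
    have "hat (pprod n \<gamma> \<alpha>) \<noteq> pprod n \<gamma> \<beta>"
    proof
      assume e: "hat (pprod n \<gamma> \<alpha>) = pprod n \<gamma> \<beta>"
      have "ll (pprod n \<gamma> \<alpha>) = ll (pprod n \<gamma> \<beta>)" using hat_simps(2)[OF P(3)] e by metis
      also have "\<dots> = ll \<beta>" unfolding fun_eq_iff ll_pprod[OF G B] using nul by blast
      also have "\<dots> = ll (pprod n (\<omega> n) \<beta>)" unfolding fun_eq_iff ll_pprod[OF \<omega>_PP B] using nul by blast
      also have "\<dots> = ll (pprod n (\<omega> n) \<alpha>)" using hat_simps(2)[OF P(1)] True by metis
      finally have "ll (pprod n \<gamma> \<alpha>) y1 y2 = ll (pprod n (\<omega> n) \<alpha>) y1 y2" by simp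
      moreover have "ll (pprod n (\<omega> n) \<alpha>) y1 y2" unfolding \<omega>_pprod[OF A] using xy ul_cd by blast
      ultimately have "ll \<alpha> y1 y2 \<or> (\<exists>v w. ul \<alpha> v y1 \<and> P v = P w \<and> ul \<alpha> w y2)"
        unfolding \<gamma>_def ll_label_part_pprod[where g=P, OF A g] by simp
      then obtain v w where vw: "ul \<alpha> v y1" "P v = P w" "ul \<alpha> w y2" using xy by blast
      have "P v = P x1" "P w = P x2" using g ul_ul_uu[OF A vw(1) xy(1)] ul_ul_uu[OF A vw(3) xy(2)] by blast+
      then show False using px vw(2) by simp
    qed
    then show ?thesis using zero_rank_1_0(1)[OF P(3,4) v rg rg0] by simp
  qed
  have "zero n d \<theta> (rank (pprod n (\<omega> n) \<alpha>)) i" using z1 r by (simp add: rank_\<omega>[OF A])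
  from zero_back[OF symm[OF w] P(2,1) this] show z0: "zero n d \<theta> 0 j" using r by (simp add: rank_\<omega>[OF B])
  show "zero n d \<theta> (rank \<alpha>) i" by (rule zero_back[OF h A B]) (use z0 r in simp)
qed

text \<open>The element of larger index may have the larger rank, so the chain argument does not
  apply at once. A left identity of \<beta> whose rank is at most that of \<beta> fixes \<beta> and
  lowers the rank of the other side; then the chain starts at (j,\<beta>).\<close>

lemma zero_index_gt:
  assumes A: "\<alpha> \<in> PP n" and B: "\<beta> \<in> PP n" and h: "(el d i \<alpha>, el d j \<beta>) \<in> \<theta>"
    and r: "rank \<beta> \<ge> 1" and ij: "j < i"
  shows "zero n d \<theta> (rank \<beta>) j"
proof -
  have "rank \<beta> \<noteq> 0" using r by simp
  then have ex: "\<exists>v. dm \<beta> v" using rank_0_iff[OF B] by auto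
  obtain \<gamma> where g: "\<gamma> \<in> PP n" "pprod n \<gamma> \<beta> = \<beta>" "floating n \<gamma> \<beta> = 0" "(\<exists>v. dm \<beta> v) \<Longrightarrow> rank \<gamma> \<le> rank \<beta>"
    by (rule left_division[OF B B n left_div_refl]) blast
  have "(el d j \<beta>, el d (i + floating n \<gamma> \<alpha>) (pprod n \<gamma> \<alpha>)) \<in> \<theta>"
    using symm[OF lm[OF h g(1), of 0]] g by simp
  then show ?thesis
    using zero_from_chain[OF B pprod_PP[OF g(1) A]] rank_pprod_left[OF g(1) A] g(4)[OF ex] ij by simp
qed

lemma separate_transversal:
  assumes A: "\<alpha> \<in> PP n" and x: "dm \<alpha> x"
  obtains \<gamma> where "\<gamma> \<in> PP n" "rank \<gamma> \<le> 1" "floating n \<gamma> \<alpha> = 0" "rank (pprod n \<gamma> \<alpha>) = 1"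
    "\<And>y z. ll (pprod n \<gamma> \<alpha>) y z \<Longrightarrow> ul \<alpha> x y \<Longrightarrow> ll \<alpha> y z"
proof -
  \<comment> \<open>One class of the middle row holds the transversal of \<open>x\<close> and all
    points outside the domain; the other holds domain points only, so neither floats. Only the first
    class is tied to the upper row: its transversal alone survives, and its lower part merges with
    no other.\<close>
  define P where "P v \<longleftrightarrow> \<not> dm \<alpha> v \<or> uu \<alpha> x v" for v
  define \<gamma> where "\<gamma> = label_part n (\<lambda>_. True) P"
  have G: "\<gamma> \<in> PP n" by (simp add: \<gamma>_def)
  have g: "\<forall>v w. uu \<alpha> v w \<longrightarrow> P v = P w"
    unfolding P_def using uu_trans[OF A] uu_sym uu_dm[OF A] by metis
  have px: "P x" unfolding P_def using uu_refl[OF A dm_range[OF A x]] by blast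
  have f: "floating n \<gamma> \<alpha> = 0"
    unfolding \<gamma>_def floating_label_part[where g=P, OF A g] using px x P_def by metis
  have rk: "rank \<gamma> \<le> 1" unfolding rank_le_1_iff[OF G] unfolding dm_def \<gamma>_def label_part_simps by blast
  have "rank (pprod n \<gamma> \<alpha>) \<noteq> 0"
    unfolding rank_0_iff[OF pprod_PP[OF G A]] unfolding \<gamma>_def dm_label_part_pprod[where g=P, OF A g] using px x n by force
  then have r1: "rank (pprod n \<gamma> \<alpha>) = 1" using rank_pprod_left[OF G A] rk by simp
  have l: "ll \<alpha> y z" if yz: "ll (pprod n \<gamma> \<alpha>) y z" "ul \<alpha> x y" for y z
  proof (rule ccontr)
    assume "\<not> ll \<alpha> y z"
    then obtain v w where vw: "ul \<alpha> v y" "P v = P w" "ul \<alpha> w z"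
      using yz(1) unfolding \<gamma>_def ll_label_part_pprod[where g=P, OF A g] by blast
    have "P v" using ul_ul_uu[OF A that(2) vw(1)] by (simp add: P_def)
    then have "uu \<alpha> x w" using vw ul_dm[OF vw(3)] by (simp add: P_def)
    then have "ul \<alpha> x z" using uu_ul[OF A _ vw(3)] by blast
    then show False using ul_ul_ll[OF A that(2)] \<open>\<not> ll \<alpha> y z\<close> by blast
  qed
  show thesis by (rule that[OF G rk f r1 l])
qed

text \<open>If (1,i) is no zero position, a product of rank 1 at index \<open>i\<close> forces its
  partner of rank at most 1 to have the same hat, by \<open>zero_rank_1\<close>. Multipliers that
  isolate one transversal thus compare the lower patterns, and \<open>\<omega> n\<close> compares
  the codomains.\<close>

lemma zero_1_of_not_L:
  assumes A: "\<alpha> \<in> PP n" and B: "\<beta> \<in> PP n" and h: "(el d i \<alpha>, el d i \<beta>) \<in> \<theta>"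
    and r: "rank \<alpha> \<ge> 2" "rank \<beta> \<ge> 1" and ne: "\<not> (ll \<alpha> = ll \<beta> \<and> cd \<alpha> = cd \<beta>)"
  shows "zero n d \<theta> 1 i"
proof (rule ccontr)
  assume nz: "\<not> zero n d \<theta> 1 i"
  have aux: "ll \<alpha> y z"
    if A: "\<alpha> \<in> PP n" and B: "\<beta> \<in> PP n" and h: "(el d i \<alpha>, el d i \<beta>) \<in> \<theta>" and r: "rank \<alpha> \<ge> 1"
      and yz: "ll \<beta> y z" for \<alpha> \<beta> y z
  proof (rule ccontr)
    assume nl: "\<not> ll \<alpha> y z"
    \<comment> \<open>Lower points that are separate in \<alpha> can be joined in the product only
      by merging codomain blocks, and the lower part of the isolated transversal takes no part in
      that. So \<open>y\<close> would lie in the codomain and yet under no transversal.\<close>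
    have sep: "cd \<alpha> y \<and> \<not> ul \<alpha> x y" if x: "dm \<alpha> x" for x
    proof -
      obtain \<gamma> where g: "\<gamma> \<in> PP n" "rank \<gamma> \<le> 1" "floating n \<gamma> \<alpha> = 0" "rank (pprod n \<gamma> \<alpha>) = 1"
        "\<And>y z. ll (pprod n \<gamma> \<alpha>) y z \<Longrightarrow> ul \<alpha> x y \<Longrightarrow> ll \<alpha> y z"
        by (rule separate_transversal[OF A x]) blast
      have "(el d i (pprod n \<gamma> \<alpha>), el d (i + floating n \<gamma> \<beta>) (pprod n \<gamma> \<beta>)) \<in> \<theta>"
        using lm[OF h g(1), of 0] g by simp
      moreover have "rank (pprod n \<gamma> \<beta>) \<le> 1" using rank_pprod_left[OF g(1) B] g(2) by simp
      ultimately have "hat (pprod n \<gamma> \<alpha>) = hat (pprod n \<gamma> \<beta>)"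
        using zero_rank_1[OF pprod_PP[OF g(1) A] pprod_PP[OF g(1) B] _ g(4)] nz by blast
      then have "ll (pprod n \<gamma> \<alpha>) = ll (pprod n \<gamma> \<beta>)"
        using hat_eq_iff[OF pprod_PP[OF g(1) A] pprod_PP[OF g(1) B]] by simp
      then have l: "ll (pprod n \<gamma> \<alpha>) y z" using ll_pprod_ge[OF g(1) B yz] by simp
      then have "cd \<alpha> y" using nl ul_cd unfolding ll_pprod[OF g(1) A] by blast
      with g(5)[OF l] nl show ?thesis by blast
    qed
    have "rank \<alpha> \<noteq> 0" using r by simp
    then obtain x where "dm \<alpha> x" using rank_0_iff[OF A] by auto
    then have "cd \<alpha> y" using sep by blast
    then show False using sep ul_dm unfolding cd_def by blast
  qed
  have leq: "ll \<alpha> = ll \<beta>"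
    using aux[OF A B h] aux[OF B A symm[OF h]] r unfolding fun_eq_iff by auto
  have weq: "ll (pprod n (\<omega> n) \<alpha>) = ll (pprod n (\<omega> n) \<beta>)"
  proof -
    have "hat (pprod n (\<omega> n) \<alpha>) = hat (pprod n (\<omega> n) \<beta>)"
      using zero_same_rank[OF pprod_PP[OF \<omega>_PP A] pprod_PP[OF \<omega>_PP B] lm_\<omega>[OF h A B]] nz r
      by (auto simp: rank_\<omega>[OF A] rank_\<omega>[OF B])
    then show ?thesis using hat_eq_iff[OF pprod_PP[OF \<omega>_PP A] pprod_PP[OF \<omega>_PP B]] by simp
  qed
  then have w: "ll \<beta> y z \<or> cd \<alpha> y \<and> cd \<alpha> z \<longleftrightarrow> ll \<beta> y z \<or> cd \<beta> y \<and> cd \<beta> z" for y z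
    unfolding fun_eq_iff \<omega>_pprod[OF A] \<omega>_pprod[OF B] leq by blast
  obtain x1 x2 y1 y2 where "ul \<alpha> x1 y1" "ul \<alpha> x2 y2" "\<not> uu \<alpha> x1 x2" "\<not> ll \<alpha> y1 y2"
    by (rule two_transversals[OF A r(1)])
  then have y: "cd \<alpha> y1" "cd \<alpha> y2" "\<not> ll \<beta> y1 y2" using ul_cd leq by auto
  \<comment> \<open>Two transversals guarantee, for each \<open>z\<close>, a codomain point in
    another block. Only then does the merged pattern left by \<open>\<omega> n\<close> tell whether
    \<open>z\<close> is in the codomain.\<close>
  have other: "\<exists>y'. cd \<alpha> y' \<and> \<not> ll \<beta> z y'" for z
    using y ll_trans[OF B] ll_sym by blast
  have "cd \<alpha> z \<longleftrightarrow> cd \<beta> z" for z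
  proof -
    obtain y' where y': "cd \<alpha> y'" "\<not> ll \<beta> z y'" using other by blast
    obtain y'' where "cd \<alpha> y''" "\<not> ll \<beta> y' y''" using other by blast
    then have "cd \<beta> y'" using w[of y' y''] y'(1) by blast
    then show ?thesis using w[of z y'] y' by blast
  qed
  then have "cd \<alpha> = cd \<beta>" by blast
  with leq ne show False by blast
qed

text \<open>Test functions for \<open>zero_Suc_of_not_R\<close>: p+1 labels, all taken on the
  domain, with label 1 setting the class of a given point apart from all other classes if the point
  is in the domain, and otherwise from the classes outside the domain.\<close>

lemma coarsening_exists:
  assumes A: "\<alpha> \<in> PP n" and p: "1 \<le> p" "Suc p \<le> rank \<alpha>" and x: "x \<in> {1..n}"
  obtains g where "\<forall>v w. uu \<alpha> v w \<longrightarrow> g v = g w" "\<forall>v\<in>{1..n}. g v \<in> {1..Suc p}"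
    "g ` {v. dm \<alpha> v} = {1..Suc p}" "g x = 1"
    "\<And>v. dm \<alpha> x \<or> \<not> dm \<alpha> v \<Longrightarrow> g v = 1 \<Longrightarrow> uu \<alpha> x v"
proof -
  obtain a b where numbering: "numbering \<alpha> a b" by (rule numbering_exists[OF A])
  define k where "k = (if dm \<alpha> x then a x else 1)"
  have k: "k \<in> {1..rank \<alpha>}" using numbering_range(1)[OF numbering, of x] p by (auto simp: k_def)
  define s where "s = Transposition.transpose 1 k"
  have s: "bij_betw s {1..rank \<alpha>} {1..rank \<alpha>}"
    unfolding s_def using k by (intro permutes_imp_bij permutes_swap_id) auto
  have sk: "s m = 1 \<longleftrightarrow> m = k" for m unfolding s_def by (auto simp: Transposition.transpose_def)
  \<comment> \<open>The transposition \<open>s\<close> gives number 1 to the transversal of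
    \<open>x\<close>. Surplus transversals share the last label p+1. Points outside the domain get 1
    or 2, and as p is at least 1 both labels occur on the domain too.\<close>
  define g where "g v = (if dm \<alpha> v then min (s (a v)) (Suc p) else if uu \<alpha> x v then 1 else 2)" for v
  have sr: "s (a v) \<in> {1..rank \<alpha>}" if "dm \<alpha> v" for v
    using bij_betwE[OF s] numbering_range(1)[OF numbering that] by blast
  have g1: "\<forall>v w. uu \<alpha> v w \<longrightarrow> g v = g w"
  proof (intro allI impI)
    fix v w assume vw: "uu \<alpha> v w"
    show "g v = g w"
    proof (cases "dm \<alpha> v")
      case True
      then have "dm \<alpha> w" using uu_dm[OF A uu_sym[OF vw]] by blast
      with True numbering_uu[OF A numbering True this] vw show ?thesis by (simp add: g_def)
    next
      case False
      then have "\<not> dm \<alpha> w" using uu_dm[OF A vw] by blast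
      moreover have "uu \<alpha> x v \<longleftrightarrow> uu \<alpha> x w" using vw uu_trans[OF A] uu_sym by blast
      ultimately show ?thesis using False by (simp add: g_def)
    qed
  qed
  have g2: "\<forall>v\<in>{1..n}. g v \<in> {1..Suc p}"
    using sr p by (auto simp: g_def)
  have "(\<lambda>v. s (a v)) ` {v. dm \<alpha> v} = {1..rank \<alpha>}"
    using numbering bij_betw_imp_surj_on[OF s] unfolding numbering_def by (simp add: image_image[symmetric])
  then have "(\<lambda>m. min m (Suc p)) ` (\<lambda>v. s (a v)) ` {v. dm \<alpha> v} = (\<lambda>m. min m (Suc p)) ` {1..rank \<alpha>}" by simp
  also have "\<dots> = {1..Suc p}"
  proof (intro equalityI subsetI)
    fix m assume "m \<in> {1..Suc p}"
    then show "m \<in> (\<lambda>m. min m (Suc p)) ` {1..rank \<alpha>}" using p by (intro image_eqI[of _ _ m]) auto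
  qed (use p in auto)
  finally have g3: "g ` {v. dm \<alpha> v} = {1..Suc p}" by (simp add: image_image g_def)
  have g4: "g x = 1"
  proof (cases "dm \<alpha> x")
    case True
    then have "s (a x) = 1" using sk[of "a x"] by (simp add: k_def)
    with True show ?thesis by (simp add: g_def)
  next
    case False
    then show ?thesis using uu_refl[OF A x] by (simp add: g_def)
  qed
  have g5: "uu \<alpha> x v" if c: "dm \<alpha> x \<or> \<not> dm \<alpha> v" and v: "g v = 1" for v
  proof (cases "dm \<alpha> v")
    case True
    then have dx: "dm \<alpha> x" using c by blast
    have "s (a v) = 1" using v True p by (simp add: g_def min_def split: if_splits)
    then have "a v = a x" using sk dx by (simp add: k_def)
    then show ?thesis using numbering_uu[OF A numbering dx True] by simp
  next
    case False
    then show ?thesis using v by (simp add: g_def split: if_splits)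
  qed
  show thesis by (rule that[OF g1 g2 g3 g4 g5])
qed

lemma rank_coarsening:
  assumes A: "\<alpha> \<in> PP n" and g: "\<forall>v w. uu \<alpha> v w \<longrightarrow> g v = g w" and s: "\<forall>v\<in>{1..n}. \<exists>w. dm \<alpha> w \<and> g w = g v"
  shows "rank (label_part n g g) = card (g ` {v. dm \<alpha> v})" "rank (pprod n (label_part n g g) \<alpha>) = card (g ` {v. dm \<alpha> v})"
proof -
  have sub: "{v. dm \<alpha> v} \<subseteq> {1..n}" using dm_range[OF A] by blast
  have im: "g ` {1..n} = g ` {v. dm \<alpha> v}"
  proof (rule equalityI[OF image_subsetI image_mono[OF sub]])
    fix v assume "v \<in> {1..n}"
    then obtain w where "dm \<alpha> w" "g w = g v" using s by blast
    then show "g v \<in> g ` {v. dm \<alpha> v}" by (intro image_eqI[of _ _ w]) simp_all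
  qed
  have d: "dm (label_part n g g) v \<longleftrightarrow> v \<in> {1..n}" for v by (auto simp: dm_def)
  have "rank (label_part n g g) = card (g ` {v. dm (label_part n g g) v})"
    by (rule rank_label[OF label_part_PP]) (simp add: d)
  then show "rank (label_part n g g) = card (g ` {v. dm \<alpha> v})" unfolding d Collect_mem_eq im .
  have d': "dm (pprod n (label_part n g g) \<alpha>) v \<longleftrightarrow> v \<in> {1..n}" for v
    unfolding dm_label_part_pprod[where g=g, OF A g] using s by metis
  have "rank (pprod n (label_part n g g) \<alpha>) = card (g ` {v. dm (pprod n (label_part n g g) \<alpha>) v})"
    by (rule rank_label[OF pprod_PP[OF label_part_PP A]]) (simp add: d' uu_label_part_pprod[where g=g, OF A g])
  then show "rank (pprod n (label_part n g g) \<alpha>) = card (g ` {v. dm \<alpha> v})" unfolding d' Collect_mem_eq im .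
qed

text \<open>Equal labels above and below tie every middle point to the upper point with the same
  number.\<close>

lemma floating_full: "\<beta> \<in> PP n \<Longrightarrow> floating n (label_part n g g) \<beta> = 0"
  unfolding floating_0_iff[OF label_part_PP] cd_def label_part_simps using mid_joined_refl by blast

text \<open>A multiplier of rank p+1 labelled by a coarsening of \<alpha> gives a product of rank
  p+1 with \<alpha>. A partner of rank at most p would lie in the known zero class and make (p+1,i)
  a zero position. So the partner has rank p+1 as well, and then \<open>g\<close> must respect the
  upper pattern of \<beta> and take each of its labels on the domain of \<beta>. Varying
  \<open>g\<close> forces \<alpha> and \<beta> to be Green-R-related.\<close>

lemma zero_Suc_of_not_R:
  assumes A: "\<alpha> \<in> PP n" and B: "\<beta> \<in> PP n" and h: "(el d i \<alpha>, el d i \<beta>) \<in> \<theta>"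
    and p: "1 \<le> p" "Suc p \<le> rank \<alpha>" "Suc p \<le> rank \<beta>" and z: "zero n d \<theta> p i"
    and ne: "\<not> (uu \<alpha> = uu \<beta> \<and> dm \<alpha> = dm \<beta>)"
  shows "zero n d \<theta> (Suc p) i"
proof (rule ccontr)
  assume nz: "\<not> zero n d \<theta> (Suc p) i"
  have key: "(\<forall>v w. uu \<beta> v w \<longrightarrow> g v = g w) \<and> (\<forall>v\<in>{1..n}. \<exists>w. dm \<beta> w \<and> g w = g v)"
    if A: "\<alpha> \<in> PP n" and B: "\<beta> \<in> PP n" and h: "(el d i \<alpha>, el d i \<beta>) \<in> \<theta>"
      and g: "\<forall>v w. uu \<alpha> v w \<longrightarrow> g v = g w" "\<forall>v\<in>{1..n}. g v \<in> {1..Suc p}" "g ` {v. dm \<alpha> v} = {1..Suc p}"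
    for \<alpha> \<beta> g
  proof -
    let ?\<gamma> = "label_part n g g"
    have "\<exists>w. dm \<alpha> w \<and> g w = g v" if v: "v \<in> {1..n}" for v
    proof -
      have "g v \<in> g ` {v. dm \<alpha> v}" unfolding g(3) using v g(2) by blast
      then show ?thesis by (auto elim!: imageE)
    qed
    then have rk: "rank ?\<gamma> = Suc p" "rank (pprod n ?\<gamma> \<alpha>) = Suc p"
      using rank_coarsening[OF A g(1)] g(3) by simp_all
    note PB = pprod_PP[OF label_part_PP B, of g g]
    have hh: "(el d i (pprod n ?\<gamma> \<alpha>), el d i (pprod n ?\<gamma> \<beta>)) \<in> \<theta>"
      using lm[OF h label_part_PP, of 0 g g] by (simp add: floating_full A B)
    have "rank (pprod n ?\<gamma> \<beta>) = Suc p"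
    proof (rule ccontr)
      assume "rank (pprod n ?\<gamma> \<beta>) \<noteq> Suc p"
      then have "rank (pprod n ?\<gamma> \<beta>) \<le> p" using rank_pprod_left[OF label_part_PP B, of g g] rk by simp
      from zero_back[OF hh pprod_PP[OF label_part_PP A] PB zero_mono[OF z this order_refl]] rk nz show False by simp
    qed
    then have "rank (pprod n ?\<gamma> \<beta>) = rank ?\<gamma>" using rk by simp
    note e = rank_pprod_left_eq[OF label_part_PP B this]
    have 1: "g v = g w" if vw: "uu \<beta> v w" for v w
    proof -
      have r: "v \<in> {1..n}" "w \<in> {1..n}" using uu_range[OF B vw] by auto
      have "uu (pprod n ?\<gamma> \<beta>) v w"
        unfolding uu_pprod[OF label_part_PP B] using r mid_joined_uu[OF B vw] by (intro disjI2 exI[of _ v] exI[of _ w]) simp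
      then show ?thesis unfolding e by simp
    qed
    then have g': "\<forall>v w. uu \<beta> v w \<longrightarrow> g v = g w" by blast
    have 2: "\<exists>w. dm \<beta> w \<and> g w = g v" if v: "v \<in> {1..n}" for v
    proof -
      have "dm (pprod n ?\<gamma> \<beta>) v" unfolding e dm_def using v by auto
      then show ?thesis unfolding dm_label_part_pprod[where g=g, OF B g'] by metis
    qed
    show ?thesis using g' 2 by blast
  qed
  have uu: "uu \<alpha> v w"
    if A: "\<alpha> \<in> PP n" and B: "\<beta> \<in> PP n" and h: "(el d i \<alpha>, el d i \<beta>) \<in> \<theta>" and p': "Suc p \<le> rank \<alpha>"
      and vw: "uu \<beta> v w" for \<alpha> \<beta> v w
  proof -
    have aux: "uu \<alpha> x y" if xy: "uu \<beta> x y" and c: "dm \<alpha> x \<or> \<not> dm \<alpha> y" for x y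
    proof -
      have x: "x \<in> {1..n}" using uu_range[OF B xy] by blast
      obtain g where g: "\<forall>v w. uu \<alpha> v w \<longrightarrow> g v = g w" "\<forall>v\<in>{1..n}. g v \<in> {1..Suc p}"
        "g ` {v. dm \<alpha> v} = {1..Suc p}" "g x = 1" "\<And>v. dm \<alpha> x \<or> \<not> dm \<alpha> v \<Longrightarrow> g v = 1 \<Longrightarrow> uu \<alpha> x v"
        by (rule coarsening_exists[OF A p(1) p' x]) blast
      have "g x = g y" using key[OF A B h g(1,2,3)] xy by blast
      then show ?thesis using g(4) g(5)[OF c] by simp
    qed
    show ?thesis using aux[OF vw] aux[OF uu_sym[OF vw]] uu_sym by blast
  qed
  have ueq: "uu \<alpha> = uu \<beta>" using uu[OF A B h p(2)] uu[OF B A symm[OF h] p(3)] unfolding fun_eq_iff by blast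
  have dm: "dm \<beta> x"
    if A: "\<alpha> \<in> PP n" and B: "\<beta> \<in> PP n" and h: "(el d i \<alpha>, el d i \<beta>) \<in> \<theta>" and p': "Suc p \<le> rank \<alpha>"
      and u: "uu \<alpha> = uu \<beta>" and dx: "dm \<alpha> x" for \<alpha> \<beta> x
  proof -
    have x: "x \<in> {1..n}" using dm_range[OF A dx] by blast
    obtain g where g: "\<forall>v w. uu \<alpha> v w \<longrightarrow> g v = g w" "\<forall>v\<in>{1..n}. g v \<in> {1..Suc p}"
      "g ` {v. dm \<alpha> v} = {1..Suc p}" "g x = 1" "\<And>v. dm \<alpha> x \<or> \<not> dm \<alpha> v \<Longrightarrow> g v = 1 \<Longrightarrow> uu \<alpha> x v"
      by (rule coarsening_exists[OF A p(1) p' x]) blast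
    obtain w where w: "dm \<beta> w" "g w = g x" using key[OF A B h g(1,2,3)] x by blast
    then have "uu \<beta> x w" using g(4) g(5)[of w] dx u by simp
    then show ?thesis using uu_dm[OF B] w by blast
  qed
  have "dm \<alpha> = dm \<beta>"
    using dm[OF A B h p(2) ueq] dm[OF B A symm[OF h] p(3) ueq[symmetric]] unfolding fun_eq_iff by blast
  with ueq ne show False by blast
qed

text \<open>The rank is raised one at a time up to that of \<beta>, by the direct or the mirrored
  argument according to the side on which \<alpha> and \<beta> differ. The last jump, to the rank of
  \<alpha>, is made by the pair itself.\<close>

lemma zero_of_not_H:
  assumes A: "\<alpha> \<in> PP n" and B: "\<beta> \<in> PP n" and h: "(el d i \<alpha>, el d i \<beta>) \<in> \<theta>"
    and r: "rank \<alpha> \<ge> 2" "1 \<le> rank \<beta>" "rank \<beta> \<le> rank \<alpha>"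
    and ne: "\<not> (uu \<alpha> = uu \<beta> \<and> dm \<alpha> = dm \<beta> \<and> ll \<alpha> = ll \<beta> \<and> cd \<alpha> = cd \<beta>)"
  shows "zero n d \<theta> (rank \<alpha>) i"
proof -
  interpret D: tcong n d "tdual \<theta>" by (rule dual)
  have SA: "star \<alpha> \<in> PP n" and SB: "star \<beta> \<in> PP n" and Sh: "(el d i (star \<alpha>), el d i (star \<beta>)) \<in> tdual \<theta>"
    using A B h by simp_all
  have one: "zero n d \<theta> 1 i"
  proof (cases "ll \<alpha> = ll \<beta> \<and> cd \<alpha> = cd \<beta>")
    case False
    then show ?thesis by (rule zero_1_of_not_L[OF A B h r(1,2)])
  next
    case True
    then have "\<not> (uu \<alpha> = uu \<beta> \<and> dm \<alpha> = dm \<beta>)" using ne by blast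
    then have "zero n d (tdual \<theta>) 1 i" by (intro D.zero_1_of_not_L[OF SA SB Sh]) (use r in simp_all)
    then show ?thesis by (simp add: zero_tdual)
  qed
  have step: "zero n d \<theta> (Suc p) i" if p: "1 \<le> p" "Suc p \<le> rank \<beta>" and z: "zero n d \<theta> p i" for p
  proof (cases "uu \<alpha> = uu \<beta> \<and> dm \<alpha> = dm \<beta>")
    case False
    then show ?thesis using p r by (intro zero_Suc_of_not_R[OF A B h p(1) _ p(2) z]) simp_all
  next
    case True
    then have "\<not> (ll \<alpha> = ll \<beta> \<and> cd \<alpha> = cd \<beta>)" using ne by blast
    then have "zero n d (tdual \<theta>) (Suc p) i"
      using p r z by (intro D.zero_Suc_of_not_R[OF SA SB Sh p(1)]) (simp_all add: zero_tdual)
    then show ?thesis by (simp add: zero_tdual)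
  qed
  have "1 \<le> p \<Longrightarrow> p \<le> rank \<beta> \<Longrightarrow> zero n d \<theta> p i" for p
  proof (induction p)
    case (Suc p)
    then show ?case using one step by (cases "p = 0") simp_all
  qed simp
  then have "zero n d \<theta> (rank \<beta>) i" using r by simp
  then show ?thesis by (rule zero_back[OF h A B])
qed

lemma zero_rank_ge_2:
  assumes A: "\<alpha> \<in> PP n" and B: "\<beta> \<in> PP n" and h: "(el d i \<alpha>, el d j \<beta>) \<in> \<theta>"
    and r: "rank \<alpha> \<ge> 2" "rank \<beta> \<le> rank \<alpha>"
    and ne: "\<not> (i = j \<and> uu \<alpha> = uu \<beta> \<and> dm \<alpha> = dm \<beta> \<and> ll \<alpha> = ll \<beta> \<and> cd \<alpha> = cd \<beta>)"
  shows "zero n d \<theta> (rank \<alpha>) i" "zero n d \<theta> (rank \<beta>) j"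
proof -
  have "zero n d \<theta> (rank \<alpha>) i \<or> zero n d \<theta> (rank \<beta>) j"
  proof (cases "rank \<beta> = 0")
    case True
    then show ?thesis using zero_rank_2_0[OF A B h r(1)] by simp
  next
    case False
    then have 1: "1 \<le> rank \<beta>" by simp
    consider "i < j" | "j < i" | "i = j" by linarith
    then show ?thesis
    proof cases
      case 1
      then show ?thesis using zero_from_chain[OF A B h r(2)] by simp
    next
      case 2
      then show ?thesis using zero_index_gt[OF A B h 1] by simp
    next
      case 3
      then show ?thesis using zero_of_not_H[OF A B _ r(1) 1 r(2)] h ne by simp
    qed
  qed
  then show "zero n d \<theta> (rank \<alpha>) i" "zero n d \<theta> (rank \<beta>) j"
    using zero_back[OF h A B] zero_back[OF symm[OF h] B A] by blast+
qed

end

subsection \<open>Pairs of rank one\<close>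

lemma pprod_hat_right:
  assumes D: "\<delta> \<in> PP n" and A: "\<alpha> \<in> PP n" and r: "rank \<alpha> \<le> 1"
  shows "pprod n (hat \<alpha>) \<delta> = hat (pprod n \<alpha> \<delta>)"
    "floating n (hat \<alpha>) \<delta> + rank (pprod n \<alpha> \<delta>) = floating n \<alpha> \<delta> + rank \<alpha>"
proof -
  have S: "star \<delta> \<in> PP n" "star \<alpha> \<in> PP n" "rank (star \<alpha>) \<le> 1" using assms by simp_all
  note H = hat_PP_joined(1)[OF A]
  note P = pprod_PP[OF A D]
  have "star (pprod n (hat \<alpha>) \<delta>) = star (hat (pprod n \<alpha> \<delta>))"
    unfolding star_pprod[OF H D] star_hat[OF A] star_hat[OF P] star_pprod[OF A D] by (rule pprod_hat(1)[OF S])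
  then show "pprod n (hat \<alpha>) \<delta> = hat (pprod n \<alpha> \<delta>)" by (metis star_star)
  show "floating n (hat \<alpha>) \<delta> + rank (pprod n \<alpha> \<delta>) = floating n \<alpha> \<delta> + rank \<alpha>"
    using pprod_hat(2)[OF S] unfolding star_hat[OF A, symmetric] floating_star[OF H D] floating_star[OF A D]
      star_pprod[OF A D, symmetric] rank_star .
qed

lemma rank_le_1_eqI:
  assumes "\<alpha> \<in> PP n" "\<beta> \<in> PP n" "rank \<alpha> \<le> 1" "rank \<beta> \<le> 1"
    "uu \<alpha> = uu \<beta>" "ll \<alpha> = ll \<beta>" "dm \<alpha> = dm \<beta>" "cd \<alpha> = cd \<beta>"
  shows "\<alpha> = \<beta>"
proof (rule PP_eqI[OF assms(1,2,5,6)])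
  show "ul \<alpha> = ul \<beta>"
    unfolding fun_eq_iff rank_le_1_ul[OF assms(1,3)] rank_le_1_ul[OF assms(2,4)] assms(7,8) by simp
qed

text \<open>Each domain is empty or a single class of the common upper pattern, and two classes are
  equal or disjoint.\<close>

lemma dm_disjoint:
  assumes A: "\<alpha> \<in> PP n" and B: "\<beta> \<in> PP n" and r: "rank \<alpha> \<le> 1" "rank \<beta> \<le> 1" and u: "uu \<alpha> = uu \<beta>"
    and ne: "dm \<alpha> \<noteq> dm \<beta>"
  shows "\<not> (dm \<alpha> x \<and> dm \<beta> x)"
proof
  assume x: "dm \<alpha> x \<and> dm \<beta> x"
  have "dm \<alpha> y \<longleftrightarrow> uu \<alpha> x y" for y
    using rank_le_1_iff[OF A] r x uu_dm[OF A uu_sym, of x y] by blast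
  moreover have "dm \<beta> y \<longleftrightarrow> uu \<beta> x y" for y
    using rank_le_1_iff[OF B] r x uu_dm[OF B uu_sym, of x y] by blast
  ultimately show False using ne u by (simp add: fun_eq_iff)
qed

lemma rank_1_ex:
  assumes "\<alpha> \<in> PP n" "rank \<alpha> = 1" shows "\<exists>x. dm \<alpha> x" "\<exists>y. cd \<alpha> y"
  using assms rank_0_iff[OF assms(1)] dm_cd_iff[of \<alpha>] by auto

context tcong
begin

text \<open>By conservation of weight, factors that carry \<alpha> to \<open>\<alpha>1\<close>
  without floating components and without loss of rank cause no floating component on the hats
  either; so they carry the whole pair.\<close>

lemma mu_transport_hat:
  assumes A: "\<alpha> \<in> PP n" and r: "rank \<alpha> = 1" and h: "(el d i \<alpha>, el d j (hat \<alpha>)) \<in> \<theta>"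
    and A1: "\<alpha>1 \<in> PP n" "rank \<alpha>1 = 1"
  shows "(el d (i + k) \<alpha>1, el d (j + k) (hat \<alpha>1)) \<in> \<theta>"
proof -
  have "rank \<alpha>1 \<le> rank \<alpha>" using A1 r by simp
  then obtain \<gamma> \<delta> where g: "\<gamma> \<in> PP n" "\<delta> \<in> PP n" "floating n \<gamma> \<alpha> = 0" "floating n (pprod n \<gamma> \<alpha>) \<delta> = 0"
    "pprod n (pprod n \<gamma> \<alpha>) \<delta> = \<alpha>1" by (rule transport[OF n A A1(1)])
  note P = pprod_PP[OF g(1) A]
  have H: "hat \<alpha> \<in> PP n" by (rule hat_PP_joined(1)[OF A])
  have r1: "rank (pprod n \<gamma> \<alpha>) = 1"
    using rank_pprod_right[OF g(1) A] rank_pprod_left[OF P g(2)] g(5) A1 r by simp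
  have rr: "rank \<alpha> \<le> 1" "rank (pprod n \<gamma> \<alpha>) \<le> 1" using r r1 by simp_all
  note L = pprod_hat[OF g(1) A rr(1)]
  note R = pprod_hat_right[OF g(2) P rr(2)]
  have f: "floating n \<gamma> (hat \<alpha>) = 0" "floating n (hat (pprod n \<gamma> \<alpha>)) \<delta> = 0"
    using L(2) R(2) g r r1 A1 by simp_all
  show ?thesis
    using rm[OF lm[OF h g(1), of k] g(2) P pprod_PP[OF g(1) H], of 0] L(1) R(1) f g by simp
qed

lemma \<omega>_right:
  assumes A: "\<alpha> \<in> PP n"
  shows "floating n \<alpha> (\<omega> n) = 0" "dm (pprod n \<alpha> (\<omega> n)) = dm \<alpha>"
    "cd (pprod n \<alpha> (\<omega> n)) y \<longleftrightarrow> y \<in> {1..n} \<and> rank \<alpha> \<noteq> 0"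
    "rank \<alpha> \<le> 1 \<Longrightarrow> uu (pprod n \<alpha> (\<omega> n)) = uu \<alpha>" "ll (pprod n \<alpha> (\<omega> n)) x y \<longleftrightarrow> x \<in> {1..n} \<and> y \<in> {1..n}"
    "rank (pprod n \<alpha> (\<omega> n)) = (if rank \<alpha> = 0 then 0 else 1)"
proof -
  have S: "star \<alpha> \<in> PP n" using A by simp
  have e: "pprod n \<alpha> (\<omega> n) = star (pprod n (\<omega> n) (star \<alpha>))"
    using star_pprod[OF \<omega>_PP S] by simp
  have "floating n (star (star \<alpha>)) (star (\<omega> n)) = 0" unfolding floating_star[OF \<omega>_PP S] by (rule \<omega>_pprod(4)[OF S])
  then show "floating n \<alpha> (\<omega> n) = 0" by simp
  have ex: "\<exists>x. x \<in> {1..n}" using n by force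
  show "dm (pprod n \<alpha> (\<omega> n)) = dm \<alpha>"
    unfolding e star_simps fun_eq_iff cd_def[of "pprod n (\<omega> n) (star \<alpha>)"] \<omega>_pprod[OF S] using ex by blast
  show "cd (pprod n \<alpha> (\<omega> n)) y \<longleftrightarrow> y \<in> {1..n} \<and> rank \<alpha> \<noteq> 0"
    unfolding e star_simps dm_def[of "pprod n (\<omega> n) (star \<alpha>)"] \<omega>_pprod[OF S] rank_0_iff[OF A] by blast
  show "uu (pprod n \<alpha> (\<omega> n)) = uu \<alpha>" if "rank \<alpha> \<le> 1"
    unfolding e star_simps fun_eq_iff \<omega>_pprod[OF S] using rank_le_1_iff[OF A] that by blast
  show "ll (pprod n \<alpha> (\<omega> n)) x y \<longleftrightarrow> x \<in> {1..n} \<and> y \<in> {1..n}"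
    unfolding e star_simps \<omega>_pprod[OF S] ..
  show "rank (pprod n \<alpha> (\<omega> n)) = (if rank \<alpha> = 0 then 0 else 1)"
    unfolding e rank_star rank_\<omega>[OF S] ..
qed

lemma rm_\<omega>:
  assumes "(el d i \<alpha>, el d j \<beta>) \<in> \<theta>" "\<alpha> \<in> PP n" "\<beta> \<in> PP n"
  shows "(el d i (pprod n \<alpha> (\<omega> n)), el d j (pprod n \<beta> (\<omega> n))) \<in> \<theta>"
  using rm[OF assms(1) \<omega>_PP assms(2,3), of 0] \<omega>_right(1) assms(2,3) by simp

lemma mu_drop_dm:
  assumes A: "\<alpha> \<in> PP n" and B: "\<beta> \<in> PP n" and r: "rank \<alpha> = 1" "rank \<beta> = 1" and h: "(el d i \<alpha>, el d i \<beta>) \<in> \<theta>"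
    and eq: "hat \<alpha> = hat \<beta>" and ne: "dm \<alpha> \<noteq> dm \<beta>" and A1: "\<alpha>1 \<in> PP n" "rank \<alpha>1 = 1"
  shows "(el d (Suc i + k) \<alpha>1, el d (i + k) (hat \<alpha>1)) \<in> \<theta>"
proof -
  have u: "uu \<alpha> = uu \<beta>" using eq hat_eq_iff[OF A B] by simp
  have rr: "rank \<alpha> \<le> 1" "rank \<beta> \<le> 1" using r by simp_all
  \<comment> \<open>Only the points outside the domain of \<alpha> are tied to the upper row. The
    transversal of \<alpha> is thereby split, and nothing floats, because its component continues
    downwards. The transversal of \<beta> survives, while the block that was the domain of \<alpha>
    floats in the product with \<beta>.\<close>
  define \<gamma> where "\<gamma> = label_part n (\<lambda>_. False) (dm \<alpha>)"
  have G: "\<gamma> \<in> PP n" by (simp add: \<gamma>_def)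
  have g: "\<forall>v w. uu \<alpha> v w \<longrightarrow> dm \<alpha> v = dm \<alpha> w" using uu_dm[OF A] uu_sym by blast
  have g': "\<forall>v w. uu \<beta> v w \<longrightarrow> dm \<alpha> v = dm \<alpha> w" using g u by simp
  have f: "floating n \<gamma> \<alpha> = 0"
    unfolding \<gamma>_def floating_label_part[where g="dm \<alpha>", OF A g] by metis
  have ra: "rank (pprod n \<gamma> \<alpha>) = 0"
    unfolding rank_0_iff[OF pprod_PP[OF G A]] unfolding \<gamma>_def dm_label_part_pprod[where g="dm \<alpha>", OF A g] by blast
  obtain v where v: "dm \<beta> v" using rank_1_ex[OF B r(2)] by blast
  then have "\<not> dm \<alpha> v" using dm_disjoint[OF A B rr u ne] by blast
  then have "rank (pprod n \<gamma> \<beta>) \<noteq> 0"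
    unfolding rank_0_iff[OF pprod_PP[OF G B]] unfolding \<gamma>_def dm_label_part_pprod[where g="dm \<alpha>", OF B g']
    using v dm_range[OF B v] by metis
  then have rb: "rank (pprod n \<gamma> \<beta>) = 1" using rank_pprod_right[OF G B] r by simp
  note HA = pprod_hat[OF G A rr(1)] and HB = pprod_hat[OF G B rr(2)]
  have fb: "floating n \<gamma> \<beta> = 1" using HA(2) HB(2) eq f ra rb r by simp
  have "pprod n \<gamma> \<alpha> = hat (pprod n \<gamma> \<beta>)"
    using HA(1) HB(1) eq hat_rank_0[OF pprod_PP[OF G A] ra] by simp
  then have "(el d (Suc i) (pprod n \<gamma> \<beta>), el d i (hat (pprod n \<gamma> \<beta>))) \<in> \<theta>"
    using symm[OF lm[OF h G, of 0]] f fb by simp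
  from mu_transport_hat[OF pprod_PP[OF G B] rb this A1] show ?thesis .
qed

text \<open>Right multiplication by \<open>\<omega> n\<close> makes the lower sides of the given
  pair equal; a left factor moves the two domains to those of the target pair, and one right factor
  produces the lower side that the targets share.\<close>

lemma mu_pairs_dm:
  assumes A: "\<alpha> \<in> PP n" and B: "\<beta> \<in> PP n" and r: "rank \<alpha> = 1" "rank \<beta> = 1" and h: "(el d i \<alpha>, el d i \<beta>) \<in> \<theta>"
    and eq: "hat \<alpha> = hat \<beta>" and ne: "dm \<alpha> \<noteq> dm \<beta>"
    and A1: "\<alpha>1 \<in> PP n" "rank \<alpha>1 = 1" and B1: "\<beta>1 \<in> PP n" "rank \<beta>1 = 1"
    and eq1: "hat \<alpha>1 = hat \<beta>1" "cd \<alpha>1 = cd \<beta>1"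
  shows "(el d (i + k) \<alpha>1, el d (i + k) \<beta>1) \<in> \<theta>"
proof (cases "dm \<alpha>1 = dm \<beta>1")
  case True
  have "\<alpha>1 = \<beta>1" using hat_eq_iff[OF A1(1) B1(1)] eq1 A1 B1 True by (intro rank_le_1_eqI) simp_all
  then show ?thesis using reflx[OF el_carrier[OF A1(1)]] by simp
next
  case False
  define \<alpha>' where "\<alpha>' = pprod n \<alpha> (\<omega> n)"
  define \<beta>' where "\<beta>' = pprod n \<beta> (\<omega> n)"
  have rr: "rank \<alpha> \<le> 1" "rank \<beta> \<le> 1" using r by simp_all
  have A': "\<alpha>' \<in> PP n" and B': "\<beta>' \<in> PP n" using pprod_PP A B by (simp_all add: \<alpha>'_def \<beta>'_def)
  have r': "rank \<alpha>' = 1" "rank \<beta>' = 1" unfolding \<alpha>'_def \<beta>'_def \<omega>_right(6)[OF A] \<omega>_right(6)[OF B] using r by simp_all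
  have rr': "rank \<alpha>' \<le> 1" "rank \<beta>' \<le> 1" using r' by simp_all
  have u: "uu \<alpha> = uu \<beta>" using eq hat_eq_iff[OF A B] by simp
  have d': "dm \<alpha>' = dm \<alpha>" "dm \<beta>' = dm \<beta>" unfolding \<alpha>'_def \<beta>'_def \<omega>_right(2)[OF A] \<omega>_right(2)[OF B] by simp_all
  have u': "uu \<alpha>' = uu \<beta>'" unfolding \<alpha>'_def \<beta>'_def \<omega>_right(4)[OF A rr(1)] \<omega>_right(4)[OF B rr(2)] by (rule u)
  have l': "ll \<alpha>' = ll \<beta>'" unfolding fun_eq_iff \<alpha>'_def \<beta>'_def \<omega>_right(5)[OF A] \<omega>_right(5)[OF B] by simp
  have c': "cd \<alpha>' = cd \<beta>'" unfolding fun_eq_iff \<alpha>'_def \<beta>'_def \<omega>_right(3)[OF A] \<omega>_right(3)[OF B] using r by simp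
  have h': "(el d i \<alpha>', el d i \<beta>') \<in> \<theta>" unfolding \<alpha>'_def \<beta>'_def by (rule rm_\<omega>[OF h A B])
  have u1: "uu \<alpha>1 = uu \<beta>1" and l1: "ll \<alpha>1 = ll \<beta>1" using eq1 hat_eq_iff[OF A1(1) B1(1)] by simp_all
  have dis: "\<not> (dm \<alpha> x \<and> dm \<beta> x)" for x by (rule dm_disjoint[OF A B rr u ne])
  have dis1: "\<not> (dm \<alpha>1 x \<and> dm \<beta>1 x)" for x
    by (rule dm_disjoint[OF A1(1) B1(1) _ _ u1 False]) (use A1 B1 in simp_all)
  \<comment> \<open>The middle row gets two classes: the domain of \<alpha> and its complement,
    which contains the domain of \<beta>. The upper row attaches the first to the domain of
    \<open>\<alpha>1\<close> and the second to that of \<open>\<beta>1\<close>; all other upper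
    points keep their own class, tagged by \<open>Inr\<close>.\<close>
  define v where "v x = (if dm \<alpha>1 x then Inl True else if dm \<beta>1 x then Inl False else Inr {z. uu \<alpha>1 x z})" for x
  define g where "g x = (Inl (dm \<alpha> x) :: bool + nat set)" for x
  define \<gamma> where "\<gamma> = label_part n v g"
  have G: "\<gamma> \<in> PP n" by (simp add: \<gamma>_def)
  have ga: "\<forall>x y. uu \<alpha>' x y \<longrightarrow> g x = g y"
  proof (intro allI impI)
    fix x y assume "uu \<alpha>' x y"
    then have "dm \<alpha>' x = dm \<alpha>' y" using uu_dm[OF A'] uu_sym by blast
    then show "g x = g y" by (simp add: g_def d')
  qed
  have gb: "\<forall>x y. uu \<beta>' x y \<longrightarrow> g x = g y" using ga u' by simp
  obtain x1 where x1: "dm \<alpha>1 x1" using rank_1_ex[OF A1] by blast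
  obtain x2 where x2: "dm \<beta>1 x2" using rank_1_ex[OF B1] by blast
  have v12: "v x1 = Inl True" "v x2 = Inl False" using x1 x2 dis1 by (auto simp: v_def)
  have cov: "\<exists>x\<in>{1..n}. v x = g y" for y
    using v12 dm_range[OF A1(1) x1] dm_range[OF B1(1) x2] unfolding g_def by (cases "dm \<alpha> y") metis+
  have f: "floating n \<gamma> \<alpha>' = 0" "floating n \<gamma> \<beta>' = 0"
    unfolding \<gamma>_def floating_label_part[where g=g, OF A' ga] floating_label_part[where g=g, OF B' gb] using cov by blast+
  have vT: "v x = Inl True \<longleftrightarrow> dm \<alpha>1 x" "v x = Inl False \<longleftrightarrow> dm \<beta>1 x" for x
    using dis1 by (auto simp: v_def)
  have vu: "v x = v y \<longleftrightarrow> uu \<alpha>1 x y" if "x \<in> {1..n}" "y \<in> {1..n}" for x y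
  proof -
    have da: "uu \<alpha>1 x y" if "dm \<alpha>1 x" "dm \<alpha>1 y" for x y
      using that rank_le_1_iff[OF A1(1)] A1(2) by simp
    have db: "uu \<alpha>1 x y" if "dm \<beta>1 x" "dm \<beta>1 y" for x y
      using that rank_le_1_iff[OF B1(1)] B1(2) u1 by simp
    have ca: "dm \<alpha>1 x = dm \<alpha>1 y" "dm \<beta>1 x = dm \<beta>1 y" if "uu \<alpha>1 x y" for x y
      using that uu_dm[OF A1(1)] uu_dm[OF B1(1)] uu_sym u1 by metis+
    consider "dm \<alpha>1 x" | "\<not> dm \<alpha>1 x" "dm \<beta>1 x" | "\<not> dm \<alpha>1 x" "\<not> dm \<beta>1 x" by blast
    then show ?thesis
    proof cases
      case 1
      then have "v x = v y \<longleftrightarrow> dm \<alpha>1 y" using vT(1)[of x] vT(1)[of y] by metis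
      then show ?thesis using 1 da[OF 1] ca(1)[of x y] by blast
    next
      case 2
      then have "v x = v y \<longleftrightarrow> dm \<beta>1 y" using vT(2)[of x] vT(2)[of y] by metis
      then show ?thesis using 2 db[OF 2(2)] ca(2)[of x y] by blast
    next
      case 3
      show ?thesis
      proof (cases "dm \<alpha>1 y \<or> dm \<beta>1 y")
        case True
        then have "v x \<noteq> v y" using 3 vT[of x] vT[of y] by metis
        then show ?thesis using True 3 ca[of x y] by blast
      next
        case False
        then have "v x = v y \<longleftrightarrow> {z. uu \<alpha>1 x z} = {z. uu \<alpha>1 y z}" using 3 by (simp add: v_def)
        then show ?thesis using uclass_eq[OF A1(1) that(1)] by simp
      qed
    qed
  qed
  have vuE: "R = uu \<alpha>1" if R: "\<And>x y. R x y \<longleftrightarrow> x \<in> {1..n} \<and> y \<in> {1..n} \<and> v x = v y" for R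
  proof (intro ext)
    fix x y
    show "R x y = uu \<alpha>1 x y"
    proof (cases "x \<in> {1..n} \<and> y \<in> {1..n}")
      case True
      then show ?thesis using vu[of x y] unfolding R by simp
    next
      case False
      then show ?thesis using uu_range[OF A1(1), of x y] unfolding R by blast
    qed
  qed
  have ea: "uu (pprod n \<gamma> \<alpha>') = uu \<alpha>1" "dm (pprod n \<gamma> \<alpha>') = dm \<alpha>1"
  proof -
    show "uu (pprod n \<gamma> \<alpha>') = uu \<alpha>1"
      unfolding \<gamma>_def by (rule vuE[OF uu_label_part_pprod[where g=g, OF A' ga]])
    have "(\<exists>w. v x = g w \<and> dm \<alpha>' w) \<longleftrightarrow> v x = Inl True" for x
      unfolding d' g_def using rank_1_ex(1)[OF A r(1)] by force
    then show "dm (pprod n \<gamma> \<alpha>') = dm \<alpha>1"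
      unfolding fun_eq_iff \<gamma>_def dm_label_part_pprod[where g=g, OF A' ga] vT(1)[symmetric]
      using dm_range[OF A1(1)] vT(1) by metis
  qed
  have eb: "uu (pprod n \<gamma> \<beta>') = uu \<beta>1" "dm (pprod n \<gamma> \<beta>') = dm \<beta>1"
  proof -
    show "uu (pprod n \<gamma> \<beta>') = uu \<beta>1"
      unfolding \<gamma>_def u1[symmetric] by (rule vuE[OF uu_label_part_pprod[where g=g, OF B' gb]])
    have "(\<exists>w. v x = g w \<and> dm \<beta>' w) \<longleftrightarrow> v x = Inl False" for x
      unfolding d' g_def using rank_1_ex(1)[OF B r(2)] dis by force
    then show "dm (pprod n \<gamma> \<beta>') = dm \<beta>1"
      unfolding fun_eq_iff \<gamma>_def dm_label_part_pprod[where g=g, OF B' gb] vT(2)[symmetric]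
      using dm_range[OF B1(1)] vT(2) by metis
  qed
  note PA = pprod_PP[OF G A'] and PB = pprod_PP[OF G B']
  have rp: "rank (pprod n \<gamma> \<alpha>') = 1" "rank (pprod n \<gamma> \<beta>') = 1"
    using rank_cong[OF PA A1(1) ea] rank_cong[OF PB B1(1) eb] A1 B1 by simp_all
  \<comment> \<open>The right factor is found for the first product; as the two products agree on
    their lower sides, it serves the second one too.\<close>
  have "left_div (star (pprod n \<gamma> \<alpha>')) (star \<alpha>1)" unfolding left_div_def star_simps ea by blast
  then obtain \<delta> where D: "\<delta> \<in> PP n" "pprod n (pprod n \<gamma> \<alpha>') \<delta> = \<alpha>1" "floating n (pprod n \<gamma> \<alpha>') \<delta> = 0"
    by (rule right_division[OF PA A1(1) n])
  have lc: "ll (pprod n \<gamma> \<alpha>') = ll (pprod n \<gamma> \<beta>')" "cd (pprod n \<gamma> \<alpha>') = cd (pprod n \<gamma> \<beta>')"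
  proof -
    have "rank (pprod n \<gamma> \<alpha>') = rank \<alpha>'" "rank (pprod n \<gamma> \<beta>') = rank \<beta>'" using rp r' by simp_all
    from rank_pprod_right_eq[OF G A' this(1)] rank_pprod_right_eq[OF G B' this(2)]
    show "ll (pprod n \<gamma> \<alpha>') = ll (pprod n \<gamma> \<beta>')" "cd (pprod n \<gamma> \<alpha>') = cd (pprod n \<gamma> \<beta>')"
      using l' c' by simp_all
  qed
  have S: "star \<delta> \<in> PP n" "star (pprod n \<gamma> \<alpha>') \<in> PP n" "star (pprod n \<gamma> \<beta>') \<in> PP n"
    "uu (star (pprod n \<gamma> \<alpha>')) = uu (star (pprod n \<gamma> \<beta>'))" "dm (star (pprod n \<gamma> \<alpha>')) = dm (star (pprod n \<gamma> \<beta>'))"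
    using D PA PB lc by simp_all
  have sa: "pprod n (star \<delta>) (star (pprod n \<gamma> \<alpha>')) = star \<alpha>1" using star_pprod[OF PA D(1)] D(2) by simp
  have sb: "pprod n (star \<delta>) (star (pprod n \<gamma> \<beta>')) = star (pprod n (pprod n \<gamma> \<beta>') \<delta>)" using star_pprod[OF PB D(1)] by simp
  note s = pprod_same_upper[OF S, unfolded sa sb floating_star[OF PA D(1)] floating_star[OF PB D(1)] star_simps rank_star]
  have PBD: "pprod n (pprod n \<gamma> \<beta>') \<delta> \<in> PP n" by (rule pprod_PP[OF PB D(1)])
  have "rank (pprod n (pprod n \<gamma> \<beta>') \<delta>) = rank (pprod n \<gamma> \<beta>')" using s(5) A1 rp by simp
  note e = rank_pprod_left_eq[OF PB D(1) this]
  have "pprod n (pprod n \<gamma> \<beta>') \<delta> = \<beta>1"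
    by (rule rank_le_1_eqI[OF PBD B1(1)]) (use s(5) A1 B1 e eb s(3,4) l1 eq1 in simp_all)
  moreover have "floating n (pprod n \<gamma> \<beta>') \<delta> = 0" using s(2) D(3) by simp
  ultimately show ?thesis
    using rm[OF lm[OF h' G, of k] D(1) PA PB, of 0] f D by simp
qed

lemma mu_pairs_cd:
  assumes A: "\<alpha> \<in> PP n" and B: "\<beta> \<in> PP n" and r: "rank \<alpha> = 1" "rank \<beta> = 1" and h: "(el d i \<alpha>, el d i \<beta>) \<in> \<theta>"
    and eq: "hat \<alpha> = hat \<beta>" and ne: "cd \<alpha> \<noteq> cd \<beta>"
    and A1: "\<alpha>1 \<in> PP n" "rank \<alpha>1 = 1" and B1: "\<beta>1 \<in> PP n" "rank \<beta>1 = 1"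
    and eq1: "hat \<alpha>1 = hat \<beta>1" "dm \<alpha>1 = dm \<beta>1"
  shows "(el d (i + k) \<alpha>1, el d (i + k) \<beta>1) \<in> \<theta>"
proof -
  interpret D: tcong n d "tdual \<theta>" by (rule dual)
  have s: "hat (star \<alpha>) = hat (star \<beta>)" "hat (star \<alpha>1) = hat (star \<beta>1)"
    using star_hat[OF A] star_hat[OF B] star_hat[OF A1(1)] star_hat[OF B1(1)] eq eq1 by simp_all
  have "(el d (i + k) (star \<alpha>1), el d (i + k) (star \<beta>1)) \<in> tdual \<theta>"
    by (rule D.mu_pairs_dm[of "star \<alpha>" "star \<beta>"]) (use A B r h ne A1 B1 s eq1 in simp_all)
  then show ?thesis by simp
qed

lemma mu_drop:
  assumes A: "\<alpha> \<in> PP n" and B: "\<beta> \<in> PP n" and r: "rank \<alpha> = 1" "rank \<beta> = 1" and h: "(el d i \<alpha>, el d i \<beta>) \<in> \<theta>"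
    and eq: "hat \<alpha> = hat \<beta>" and ne: "\<alpha> \<noteq> \<beta>" and A1: "\<alpha>1 \<in> PP n" "rank \<alpha>1 = 1"
  shows "(el d (Suc i + k) \<alpha>1, el d (i + k) (hat \<alpha>1)) \<in> \<theta>"
proof (cases "dm \<alpha> = dm \<beta>")
  case False
  then show ?thesis by (rule mu_drop_dm[OF A B r h eq _ A1])
next
  case True
  have "cd \<alpha> \<noteq> cd \<beta>"
  proof
    assume c: "cd \<alpha> = cd \<beta>"
    have u: "uu \<alpha> = uu \<beta>" "ll \<alpha> = ll \<beta>" using eq unfolding hat_eq_iff[OF A B] by simp_all
    have "\<alpha> = \<beta>" by (rule rank_le_1_eqI[OF A B _ _ u True c]) (use r in simp_all)
    with ne show False by simp
  qed
  interpret D: tcong n d "tdual \<theta>" by (rule dual)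
  have s: "hat (star \<alpha>) = hat (star \<beta>)" using star_hat[OF A] star_hat[OF B] eq by simp
  have "(el d (Suc i + k) (star \<alpha>1), el d (i + k) (hat (star \<alpha>1))) \<in> tdual \<theta>"
    by (rule D.mu_drop_dm[of "star \<alpha>" "star \<beta>"]) (use A B r h \<open>cd \<alpha> \<noteq> cd \<beta>\<close> A1 s in simp_all)
  then show ?thesis unfolding star_hat[OF A1(1), symmetric] tdual_el star_star .
qed

lemma zero_0_d:
  assumes i: "i \<le> d" and h: "\<And>\<alpha> k. \<alpha> \<in> PP n \<Longrightarrow> rank \<alpha> = 1 \<Longrightarrow> (el d (Suc i + k) \<alpha>, el d (i + k) (hat \<alpha>)) \<in> \<theta>"
  shows "zero n d \<theta> 0 d"
proof -
  have w: "rank (\<omega> n) = 1"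
  proof -
    have "rank (\<omega> n) \<le> 1" unfolding rank_le_1_iff[OF \<omega>_PP] unfolding \<omega>_def dm_def label_part_simps by blast
    moreover have "dm (\<omega> n) 1" using n unfolding \<omega>_def dm_def label_part_simps by force
    ultimately show ?thesis using rank_0_iff[OF \<omega>_PP] by fastforce
  qed
  \<comment> \<open>At the last column the side of rank 1 has index d+1 and is zero, while its
    partner of rank 0 still has index d.\<close>
  have "(el d (Suc d) (\<omega> n), el d d (hat (\<omega> n))) \<in> \<theta>" using h[OF \<omega>_PP w, of "d - i"] i by simp
  then have "(el d d (hat (\<omega> n)), None) \<in> \<theta>" using symm by (simp add: el_def)
  from zeroI[OF hat_PP_joined(1)[OF \<omega>_PP] this] show ?thesis by (simp add: rank_hat[OF \<omega>_PP])
qed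

lemma zero_of_hat_gap:
  assumes A: "\<alpha> \<in> PP n" and r: "rank \<alpha> = 1" and h: "(el d i \<alpha>, el d j (hat \<alpha>)) \<in> \<theta>" and ij: "Suc j < i"
  shows "zero n d \<theta> 0 (Suc j)" "zero n d \<theta> 1 (Suc i)"
proof -
  note H = hat_PP_joined(1)[OF A]
  have rr: "rank \<alpha> \<le> 1" using r by simp
  \<comment> \<open>Cutting the transversal makes both products the same element. The hat acquires
    one floating component, so this element occurs with the indices j+1 and i, which are different
    because of the gap.\<close>
  define \<zeta> where "\<zeta> = label_part n (\<lambda>_. True) (\<lambda>_. False)"
  have Z: "\<zeta> \<in> PP n" by (simp add: \<zeta>_def)
  have g: "\<forall>x y. uu \<alpha> x y \<longrightarrow> False = False" by simp
  obtain x where x: "dm \<alpha> x" using rank_1_ex[OF A r] by blast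
  have f: "floating n \<zeta> \<alpha> = 0"
    unfolding \<zeta>_def floating_label_part[where g="\<lambda>_. False", OF A g] using x by blast
  have rz: "rank (pprod n \<zeta> \<alpha>) = 0"
    unfolding rank_0_iff[OF pprod_PP[OF Z A]] unfolding \<zeta>_def dm_label_part_pprod[where g="\<lambda>_. False", OF A g] by simp
  note h2 = pprod_hat[OF Z A rr]
  have e: "pprod n \<zeta> (hat \<alpha>) = pprod n \<zeta> \<alpha>" using h2(1) hat_rank_0[OF pprod_PP[OF Z A] rz] by simp
  have "floating n \<zeta> (hat \<alpha>) = 1" using h2(2) f rz r by simp
  then have "(el d (Suc j) (pprod n \<zeta> \<alpha>), el d i (pprod n \<zeta> \<alpha>)) \<in> \<theta>"
    using symm[OF lm[OF h Z, of 0]] f e by simp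
  from zero_from_chain[OF pprod_PP[OF Z A] pprod_PP[OF Z A] this _ ij] rz
  show z: "zero n d \<theta> 0 (Suc j)" by simp
  have "(el d (i + 1) \<alpha>, el d (j + 1) (hat \<alpha>)) \<in> \<theta>" by (rule mu_transport_hat[OF A r h A r])
  from zero_back[OF this A H] z r show "zero n d \<theta> 1 (Suc i)" by (simp add: rank_hat[OF A])
qed

lemma mu_from_rank_2:
  assumes A: "\<alpha> \<in> PP n" and B: "\<beta> \<in> PP n" and r: "rank \<alpha> = 2" and h: "(el d i \<alpha>, el d i \<beta>) \<in> \<theta>"
    and eq: "uu \<alpha> = uu \<beta>" "dm \<alpha> = dm \<beta>" "ll \<alpha> = ll \<beta>" and ne: "\<alpha> \<noteq> \<beta>"
  obtains \<alpha>' \<beta>' where "\<alpha>' \<in> PP n" "\<beta>' \<in> PP n" "rank \<alpha>' = 1" "rank \<beta>' = 1" "hat \<alpha>' = hat \<beta>'" "cd \<alpha>' \<noteq> cd \<beta>'"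
    "(el d i \<alpha>', el d i \<beta>') \<in> \<theta>"
proof -
  have "ul \<alpha> \<noteq> ul \<beta>" using PP_eqI[OF A B eq(1,3)] ne by blast
  then obtain x y where xy: "ul \<alpha> x y \<noteq> ul \<beta> x y" unfolding fun_eq_iff by blast
  have x: "dm \<alpha> x" using xy ul_dm eq(2) by metis
  have rb: "rank \<beta> = 2" using rank_cong[OF A B eq(1,2)] r by simp
  \<comment> \<open>The multiplier ties only the transversal of \<open>x\<close> to the upper row.
    The codomain of the product is then the set of lower partners of \<open>x\<close>, in which
    \<alpha> and \<beta> differ.\<close>
  define P where "P = uu \<alpha> x"
  define \<gamma> where "\<gamma> = label_part n (\<lambda>_. True) P"
  have G: "\<gamma> \<in> PP n" by (simp add: \<gamma>_def)
  have g: "\<forall>v w. uu \<alpha> v w \<longrightarrow> P v = P w" unfolding P_def using uu_trans[OF A] uu_sym by metis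
  have gb: "\<forall>v w. uu \<beta> v w \<longrightarrow> P v = P w" using g eq by simp
  note PA = pprod_PP[OF G A] and PB = pprod_PP[OF G B]
  have xr: "x \<in> {1..n}" by (rule dm_range[OF A x])
  have px: "P x" unfolding P_def by (rule uu_refl[OF A xr])
  obtain a b where numbering: "numbering \<alpha> a b" by (rule numbering_exists[OF A])
  \<comment> \<open>Of two transversals only one lies outside \<open>P\<close>, so no lower parts
    are merged and the lower patterns survive; hence the equal hats.\<close>
  have two: "uu \<alpha> v w" if "dm \<alpha> v" "dm \<alpha> w" "\<not> P v" "\<not> P w" for v w
  proof -
    have "a v \<in> {1..2}" "a w \<in> {1..2}" "a x \<in> {1..2}" using numbering_range(1)[OF numbering] that x r by simp_all
    moreover have "a x \<noteq> a v" "a x \<noteq> a w" using numbering_uu[OF A numbering x] that by (simp_all add: P_def)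
    ultimately have "a v = a w" by auto
    then show ?thesis using numbering_uu[OF A numbering that(1,2)] by simp
  qed
  obtain x2 where x2: "dm \<alpha> x2" "\<not> P x2"
  proof -
    have "rank \<alpha> \<ge> 2" using r by simp
    then obtain z1 z2 w1 w2 where z: "ul \<alpha> z1 w1" "ul \<alpha> z2 w2" "\<not> uu \<alpha> z1 z2" "\<not> ll \<alpha> w1 w2"
      by (rule two_transversals[OF A])
    have "\<not> (P z1 \<and> P z2)" using z(3) uu_trans[OF A] uu_sym unfolding P_def by blast
    then show thesis using that z ul_dm by blast
  qed
  note s = pprod_same_upper[OF G A B eq(1,2)]
  have f: "floating n \<gamma> \<alpha> = 0"
    unfolding \<gamma>_def floating_label_part[where g=P, OF A g] using px x x2 by metis
  have rk: "rank (pprod n \<gamma> \<alpha>) = 1"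
  proof -
    have "rank (pprod n \<gamma> \<alpha>) \<noteq> 0"
      unfolding rank_0_iff[OF PA] unfolding \<gamma>_def dm_label_part_pprod[where g=P, OF A g] using px x xr by blast
    moreover have "rank (pprod n \<gamma> \<alpha>) \<le> 1"
      unfolding rank_le_1_iff[OF PA] unfolding \<gamma>_def dm_label_part_pprod[where g=P, OF A g] uu_label_part_pprod[where g=P, OF A g] by blast
    ultimately show ?thesis by simp
  qed
  have lls: "ll (pprod n \<gamma> \<alpha>') = ll \<alpha>'"
    if A': "\<alpha>' \<in> PP n" and g': "\<forall>v w. uu \<alpha>' v w \<longrightarrow> P v = P w" and e: "uu \<alpha>' = uu \<alpha>" "dm \<alpha>' = dm \<alpha>" for \<alpha>'
  proof -
    have "ll \<alpha>' y z" if "ul \<alpha>' v y" "P v = P w" "ul \<alpha>' w z" for v w y z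
    proof -
      have "uu \<alpha> v w"
      proof (cases "P v")
        case True
        then show ?thesis using that(2) uu_trans[OF A uu_sym] unfolding P_def by blast
      next
        case False
        then show ?thesis using two ul_dm[OF that(1)] ul_dm[OF that(3)] that(2) e by simp
      qed
      then have "ul \<alpha>' v z" using uu_ul[OF A' _ that(3)] e by simp
      then show ?thesis using ul_ul_ll[OF A' that(1)] by blast
    qed
    then show ?thesis unfolding fun_eq_iff \<gamma>_def ll_label_part_pprod[where g=P, OF A' g'] by blast
  qed
  have "hat (pprod n \<gamma> \<alpha>) = hat (pprod n \<gamma> \<beta>)"
    unfolding hat_eq_iff[OF PA PB] using s(3) lls[OF A g refl refl] lls[OF B gb eq(1)[symmetric] eq(2)[symmetric]] eq by simp
  moreover have "cd (pprod n \<gamma> \<alpha>) \<noteq> cd (pprod n \<gamma> \<beta>)"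
  proof -
    have "cd (pprod n \<gamma> \<alpha>) y = ul \<alpha> x y"
    proof -
      have "cd (pprod n \<gamma> \<alpha>) y \<longleftrightarrow> (\<exists>v. P v \<and> ul \<alpha> v y)"
        unfolding \<gamma>_def cd_label_part_pprod[where g=P, OF A g] using xr by blast
      also have "\<dots> \<longleftrightarrow> ul \<alpha> x y" using px uu_ul[OF A] unfolding P_def by blast
      finally show ?thesis .
    qed
    moreover have "cd (pprod n \<gamma> \<beta>) y = ul \<beta> x y"
    proof -
      have "cd (pprod n \<gamma> \<beta>) y \<longleftrightarrow> (\<exists>v. P v \<and> ul \<beta> v y)"
        unfolding \<gamma>_def cd_label_part_pprod[where g=P, OF B gb] using xr by blast
      also have "\<dots> \<longleftrightarrow> ul \<beta> x y" using px uu_ul[OF B] unfolding P_def eq(1) by blast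
      finally show ?thesis .
    qed
    ultimately show ?thesis using xy by metis
  qed
  moreover have "(el d i (pprod n \<gamma> \<alpha>), el d i (pprod n \<gamma> \<beta>)) \<in> \<theta>"
    using lm[OF h G, of 0] f s(2) by simp
  moreover have "rank (pprod n \<gamma> \<beta>) = 1" using s(5) rk by simp
  ultimately show thesis using that[OF PA PB rk] by blast
qed

end

subsection \<open>Normal subgroups and twists\<close>

lemma sym_group_normal_iff:
  "N \<lhd> sym_group q \<longleftrightarrow> (\<forall>\<sigma>\<in>N. \<sigma> permutes {1..q}) \<and> id \<in> N \<and> (\<forall>\<sigma>\<in>N. \<forall>\<tau>\<in>N. \<sigma> \<circ> \<tau> \<in> N) \<and>
     (\<forall>\<sigma>\<in>N. inv' \<sigma> \<in> N) \<and> (\<forall>\<tau>. \<tau> permutes {1..q} \<longrightarrow> (\<forall>\<sigma>\<in>N. \<tau> \<circ> \<sigma> \<circ> inv' \<tau> \<in> N))" (is "_ \<longleftrightarrow> ?R")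
proof -
  interpret G: group "sym_group q" by (rule sym_group_is_group)
  have c: "\<sigma> \<in> carrier (sym_group q) \<longleftrightarrow> \<sigma> permutes {1..q}" for \<sigma> by (rule sym_group_carrier)
  show ?thesis
  proof
    assume N: "N \<lhd> sym_group q"
    then have s: "subgroup N (sym_group q)"
      and k: "\<And>x h. x \<in> carrier (sym_group q) \<Longrightarrow> h \<in> N \<Longrightarrow> x \<otimes>\<^bsub>sym_group q\<^esub> h \<otimes>\<^bsub>sym_group q\<^esub> inv\<^bsub>sym_group q\<^esub> x \<in> N"
      using G.normal_invE by blast+
    have p: "\<sigma> permutes {1..q}" if "\<sigma> \<in> N" for \<sigma> using subgroup.mem_carrier[OF s that] c by blast
    have i: "inv\<^bsub>sym_group q\<^esub> \<sigma> = inv' \<sigma>" if "\<sigma> permutes {1..q}" for \<sigma>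
      using that c by (intro sym_group_inv_equality) blast
    show ?R
    proof (intro conjI ballI allI impI)
      show "\<sigma> permutes {1..q}" if "\<sigma> \<in> N" for \<sigma> using p that .
      show "id \<in> N" using subgroup.one_closed[OF s] by (simp add: sym_group_one)
      show "\<sigma> \<circ> \<tau> \<in> N" if "\<sigma> \<in> N" "\<tau> \<in> N" for \<sigma> \<tau>
        using subgroup.m_closed[OF s that] by (simp add: sym_group_mult)
      show "inv' \<sigma> \<in> N" if "\<sigma> \<in> N" for \<sigma> using subgroup.m_inv_closed[OF s that] i[OF p[OF that]] by simp
      show "\<tau> \<circ> \<sigma> \<circ> inv' \<tau> \<in> N" if "\<tau> permutes {1..q}" "\<sigma> \<in> N" for \<tau> \<sigma>
        using k[of \<tau> \<sigma>] that c i by (simp add: sym_group_mult)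
    qed
  next
    assume R: ?R
    have i: "inv\<^bsub>sym_group q\<^esub> \<sigma> = inv' \<sigma>" if "\<sigma> permutes {1..q}" for \<sigma>
      using that c by (intro sym_group_inv_equality) blast
    show "N \<lhd> sym_group q"
    proof (rule G.normal_invI)
      show "subgroup N (sym_group q)"
      proof (rule G.subgroupI)
        show "N \<subseteq> carrier (sym_group q)" using R c by blast
        show "N \<noteq> {}" using R by blast
        show "inv\<^bsub>sym_group q\<^esub> a \<in> N" if "a \<in> N" for a using R that i by simp
        show "a \<otimes>\<^bsub>sym_group q\<^esub> b \<in> N" if "a \<in> N" "b \<in> N" for a b
          using R that by (simp add: sym_group_mult)
      qed
      show "x \<otimes>\<^bsub>sym_group q\<^esub> h \<otimes>\<^bsub>sym_group q\<^esub> inv\<^bsub>sym_group q\<^esub> x \<in> N"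
        if "x \<in> carrier (sym_group q)" "h \<in> N" for x h
        using R that i[of x] c by (simp add: sym_group_mult)
    qed
  qed
qed

section \<open>Calculus of twists\<close>

lemma numbering_relabel:
  assumes "numbering \<alpha> a b" "\<tau> permutes {1..rank \<alpha>}" shows "numbering \<alpha> (\<tau> \<circ> a) (\<tau> \<circ> b)"
proof -
  have "a ` {x. dm \<alpha> x} = {1..rank \<alpha>}" "b ` {y. cd \<alpha> y} = {1..rank \<alpha>}" using assms(1) by (simp_all only: numbering_def)
  then have "(\<tau> \<circ> a) ` {x. dm \<alpha> x} = {1..rank \<alpha>}" "(\<tau> \<circ> b) ` {y. cd \<alpha> y} = {1..rank \<alpha>}"
    unfolding image_comp[symmetric] by (simp_all only: permutes_image[OF assms(2)])
  moreover have "(\<tau> \<circ> a) x = (\<tau> \<circ> b) y \<longleftrightarrow> a x = b y" for x y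
    using permutes_inj[OF assms(2)] by (simp add: inj_eq)
  ultimately show ?thesis using assms(1) unfolding numbering_def by blast
qed

lemma numbering_twist:
  assumes A: "\<alpha> \<in> PP n" and B: "\<beta> \<in> PP n" and numbering: "numbering \<alpha> a b" and p: "\<pi> permutes {1..rank \<alpha>}" and t: "twist \<alpha> a b \<pi> \<beta>"
  shows "numbering \<beta> (\<pi> \<circ> a) b" "rank \<beta> = rank \<alpha>"
proof -
  note d = twist_dm[OF numbering p t]
  have "uu \<beta> = uu \<alpha>" using t by (simp add: twist_def)
  then show r: "rank \<beta> = rank \<alpha>" by (rule rank_cong[OF B A _ d(1)])
  have "(\<pi> \<circ> a) ` {x. dm \<alpha> x} = {1..rank \<alpha>}"
  proof -
    have "a ` {x. dm \<alpha> x} = {1..rank \<alpha>}" using numbering by (simp only: numbering_def)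
    then show ?thesis unfolding image_comp[symmetric] by (simp only: permutes_image[OF p])
  qed
  then show "numbering \<beta> (\<pi> \<circ> a) b"
    using numbering t unfolding numbering_def twist_def d r by auto
qed

lemma twist_comp:
  assumes "numbering \<alpha> a b" "\<rho> permutes {1..rank \<alpha>}" "twist \<alpha> a b \<rho> \<beta>"
  shows "twist \<beta> (\<rho> \<circ> a) b \<sigma> \<gamma> \<longleftrightarrow> twist \<alpha> a b (\<sigma> \<circ> \<rho>) \<gamma>"
  using assms(3) unfolding twist_def twist_dm[OF assms] by simp

lemma twist_id: "numbering \<alpha> a b \<Longrightarrow> twist \<alpha> a b id \<alpha>"
  unfolding twist_def using numbering_ul[of \<alpha> a b] by auto

lemma twist_unique:
  assumes "\<beta> \<in> PP n" "\<gamma> \<in> PP n" "twist \<alpha> a b \<pi> \<beta>" "twist \<alpha> a b \<pi> \<gamma>" shows "\<beta> = \<gamma>"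
  using assms(3,4) by (intro PP_eqI[OF assms(1,2)]) (simp_all add: twist_def fun_eq_iff)

lemma twist_conj:
  assumes "\<tau> permutes S" shows "twist \<alpha> (\<tau> \<circ> a) (\<tau> \<circ> b) \<sigma> \<beta> \<longleftrightarrow> twist \<alpha> a b (inv' \<tau> \<circ> \<sigma> \<circ> \<tau>) \<beta>"
proof -
  have "\<tau> (b y) = \<sigma> (\<tau> (a x)) \<longleftrightarrow> b y = inv' \<tau> (\<sigma> (\<tau> (a x)))" for x y
    using permutes_inverses[OF assms] by metis
  then show ?thesis unfolding twist_def by simp
qed

lemma twist_star:
  assumes "\<pi> permutes S" shows "twist (star \<alpha>) b a (inv' \<pi>) (star \<beta>) \<longleftrightarrow> twist \<alpha> a b \<pi> \<beta>"
proof -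
  have "a x = inv' \<pi> (b y) \<longleftrightarrow> b y = \<pi> (a x)" for x y using permutes_inverses[OF assms] by metis
  then show ?thesis unfolding twist_def star_simps by blast
qed

lemma twist_relabel_cong:
  assumes "\<forall>x. dm \<alpha> x \<longrightarrow> a x = a' x" "\<forall>y. cd \<alpha> y \<longrightarrow> b y = b' y"
  shows "twist \<alpha> a b \<pi> \<beta> \<longleftrightarrow> twist \<alpha> a' b' \<pi> \<beta>"
  using assms unfolding twist_def by metis

context tcong
begin

text \<open>The way leads through an element \<sigma> with the upper side of
  \<open>\<alpha>1\<close> and the lower side of \<alpha>, in which equally numbered parts are
  joined. Because of this the numberings carried along agree with \<open>a1\<close> and
  \<open>b1\<close>, and the permutation arrives as \<pi> itself and not merely as a
  conjugate.\<close>

lemma twist_transport: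
  assumes A: "\<alpha> \<in> PP n" and B: "\<beta> \<in> PP n" and h: "(el d i \<alpha>, el d i \<beta>) \<in> \<theta>" and numbering: "numbering \<alpha> a b"
    and p: "\<pi> permutes {1..rank \<alpha>}" and t: "twist \<alpha> a b \<pi> \<beta>"
    and A1: "\<alpha>1 \<in> PP n" "rank \<alpha>1 = rank \<alpha>" and num1: "numbering \<alpha>1 a1 b1" and B1: "\<beta>1 \<in> PP n" and t1: "twist \<alpha>1 a1 b1 \<pi> \<beta>1"
  shows "(el d (i + k) \<alpha>1, el d (i + k) \<beta>1) \<in> \<theta>"
proof -
  have u: "uu \<alpha>1 x y \<longleftrightarrow> dm \<alpha>1 y \<and> a1 x = a1 y" if "dm \<alpha>1 x" for x y
    using numbering_uu[OF A1(1) num1 that] uu_dm[OF A1(1)] uu_sym that by metis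
  have l: "ll \<alpha> x y \<longleftrightarrow> cd \<alpha> y \<and> b x = b y" if "cd \<alpha> x" for x y
    using numbering_ll[OF A numbering that] ll_cd[OF A] that by metis
  obtain \<sigma> where S: "\<sigma> \<in> PP n" "uu \<sigma> = uu \<alpha>1" "ll \<sigma> = ll \<alpha>"
    and ulS: "\<And>x y. ul \<sigma> x y \<longleftrightarrow> dm \<alpha>1 x \<and> cd \<alpha> y \<and> a1 x = b y"
    by (rule partition_with_cross[OF A1(1) A, of "dm \<alpha>1" a1 "cd \<alpha>" b]) (use u l in blast)+
  have dS: "dm \<sigma> x \<longleftrightarrow> dm \<alpha>1 x" for x
  proof -
    have "\<exists>y. cd \<alpha> y \<and> a1 x = b y" if x: "dm \<alpha>1 x"
    proof -
      have "a1 x \<in> {1..rank \<alpha>}" using numbering_range(1)[OF num1 x] A1(2) by simp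
      then show ?thesis using numbering_surj[OF numbering] by metis
    qed
    then show ?thesis unfolding dm_def[of \<sigma>] ulS by blast
  qed
  have cS: "cd \<sigma> y \<longleftrightarrow> cd \<alpha> y" for y
  proof -
    have "\<exists>x. dm \<alpha>1 x \<and> a1 x = b y" if y: "cd \<alpha> y"
    proof -
      have "b y \<in> {1..rank \<alpha>1}" using numbering_range(2)[OF numbering y] A1(2) by simp
      then show ?thesis using numbering_surj[OF num1] by metis
    qed
    then show ?thesis unfolding cd_def[of \<sigma>] ulS by blast
  qed
  have dS': "dm \<sigma> = dm \<alpha>1" and cS': "cd \<sigma> = cd \<alpha>" using dS cS by blast+
  have rS: "rank \<sigma> = rank \<alpha>" by (rule rank_cong'[OF S(1) A S(3) cS'])
  have "left_div \<alpha> \<sigma>" unfolding left_div_def S(3) cS' by blast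
  then obtain \<gamma> where g: "\<gamma> \<in> PP n" "pprod n \<gamma> \<alpha> = \<sigma>" "floating n \<gamma> \<alpha> = 0"
    by (rule left_division[OF A S(1) n])
  have "rank (pprod n \<gamma> \<alpha>) = rank \<alpha>" using g rS by simp
  then obtain a' where a': "numbering \<sigma> a' b"
    "\<And>\<pi> \<beta>. \<pi> permutes {1..rank \<alpha>} \<Longrightarrow> \<beta> \<in> PP n \<Longrightarrow> twist \<alpha> a b \<pi> \<beta> \<Longrightarrow> twist \<sigma> a' b \<pi> (pprod n \<gamma> \<beta>)"
    using pprod_twist[OF g(1) A numbering] unfolding g(2) by metis
  define \<tau> where "\<tau> = pprod n \<gamma> \<beta>"
  have T: "\<tau> \<in> PP n" unfolding \<tau>_def by (rule pprod_PP[OF g(1) B])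
  have tw: "twist \<sigma> a' b \<pi> \<tau>" unfolding \<tau>_def by (rule a'(2)[OF p B t])
  have pS: "\<pi> permutes {1..rank \<sigma>}" using p rS by simp
  note td = twist_dm[OF numbering p t] and td' = twist_dm[OF a'(1) pS tw]
  have fb: "floating n \<gamma> \<beta> = 0"
    using pprod_same_upper(2)[OF g(1) A B] t td g(3) by (simp add: twist_def)
  have "left_div (star \<sigma>) (star \<alpha>1)" unfolding left_div_def star_simps S(2) dS' by blast
  then obtain \<delta> where D: "\<delta> \<in> PP n" "pprod n \<sigma> \<delta> = \<alpha>1" "floating n \<sigma> \<delta> = 0"
    by (rule right_division[OF S(1) A1(1) n])
  have sD: "star \<delta> \<in> PP n" "star \<sigma> \<in> PP n" using D S by simp_all
  have e1: "pprod n (star \<delta>) (star \<sigma>) = star \<alpha>1" using star_pprod[OF S(1) D(1)] D(2) by simp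
  have "rank (pprod n (star \<delta>) (star \<sigma>)) = rank (star \<sigma>)" unfolding e1 using A1 rS by simp
  then obtain b' where b': "numbering (star \<alpha>1) b' a'"
    "\<And>\<pi> \<beta>. \<pi> permutes {1..rank \<sigma>} \<Longrightarrow> \<beta> \<in> PP n \<Longrightarrow> twist (star \<sigma>) b a' \<pi> \<beta> \<Longrightarrow>
      twist (star \<alpha>1) b' a' \<pi> (pprod n (star \<delta>) \<beta>)"
    using pprod_twist[OF sD, of b a'] a'(1) unfolding e1 numbering_star rank_star by metis
  have "twist (star \<alpha>1) b' a' (inv' \<pi>) (pprod n (star \<delta>) (star \<tau>))"
    by (rule b'(2)) (use permutes_inv[OF pS] T tw twist_star[OF pS] in simp_all)
  then have "twist (star \<alpha>1) b' a' (inv' \<pi>) (star (pprod n \<tau> \<delta>))" using star_pprod[OF T D(1)] by simp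
  then have tw1: "twist \<alpha>1 a' b' \<pi> (pprod n \<tau> \<delta>)" using twist_star[OF pS] by blast
  have numbering': "numbering \<alpha>1 a' b'" using b'(1) by (simp add: numbering_star)
  have ae: "a' x = a1 x" if x: "dm \<alpha>1 x" for x
  proof -
    have "dm \<sigma> x" using dS x by simp
    then obtain y where y: "ul \<sigma> x y" unfolding dm_def by blast
    then show ?thesis using numbering_ul[OF a'(1), of x y] ulS[of x y] by simp
  qed
  have be: "b' y = b1 y" if y: "cd \<alpha>1 y" for y
  proof -
    obtain x where x: "ul \<alpha>1 x y" using y unfolding cd_def by blast
    then show ?thesis using numbering_ul[OF numbering', of x y] numbering_ul[OF num1, of x y] ae ul_dm[OF x] by simp
  qed
  have tw2: "twist \<alpha>1 a1 b1 \<pi> (pprod n \<tau> \<delta>)" using tw1 twist_relabel_cong[of \<alpha>1 a' a1 b' b1] ae be by blast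
  have fin: "pprod n \<tau> \<delta> = \<beta>1" by (rule twist_unique[OF pprod_PP[OF T D(1)] B1 tw2 t1])
  have "floating n (star \<delta>) (star \<sigma>) = floating n (star \<delta>) (star \<tau>)"
    by (rule pprod_same_upper(2)[OF sD]) (use T tw td' in \<open>simp_all add: twist_def\<close>)
  then have "floating n \<tau> \<delta> = 0" using floating_star[OF S(1) D(1)] floating_star[OF T D(1)] D(3) by simp
  then show ?thesis
    using rm[OF lm[OF h g(1), of k] D(1) pprod_PP[OF g(1) A] pprod_PP[OF g(1) B], of 0] g fb D fin
    by (simp add: \<tau>_def[symmetric])
qed

text \<open>Quantifying over all elements, numberings and larger indices makes closure under
  conjugation visible, since conjugating is renumbering. That a single occurrence already puts a
  permutation into this set is \<open>twist_transport\<close>.\<close>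

definition twists :: "nat \<Rightarrow> nat \<Rightarrow> (nat \<Rightarrow> nat) set" where
  "twists q i = {\<sigma>. \<sigma> permutes {1..q} \<and> (\<forall>\<alpha>\<in>PP n. \<forall>\<beta>\<in>PP n. \<forall>a b k. rank \<alpha> = q \<longrightarrow> numbering \<alpha> a b \<longrightarrow>
     twist \<alpha> a b \<sigma> \<beta> \<longrightarrow> (el d (i + k) \<alpha>, el d (i + k) \<beta>) \<in> \<theta>)}"

lemma twistsD:
  "\<sigma> \<in> twists q i \<Longrightarrow> \<alpha> \<in> PP n \<Longrightarrow> \<beta> \<in> PP n \<Longrightarrow> rank \<alpha> = q \<Longrightarrow> numbering \<alpha> a b \<Longrightarrow> twist \<alpha> a b \<sigma> \<beta> \<Longrightarrow>
    (el d (i + k) \<alpha>, el d (i + k) \<beta>) \<in> \<theta>"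
  unfolding twists_def by blast

lemma twists_normal: "twists q i \<lhd> sym_group q"
  unfolding sym_group_normal_iff
proof (intro conjI ballI allI impI)
  show p: "\<sigma> permutes {1..q}" if "\<sigma> \<in> twists q i" for \<sigma> using that by (simp add: twists_def)
  show "id \<in> twists q i"
    unfolding twists_def
  proof (intro CollectI conjI ballI allI impI)
    fix \<alpha> \<beta> a b k
    assume *: "\<alpha> \<in> PP n" "\<beta> \<in> PP n" "numbering \<alpha> a b" "twist \<alpha> a b id \<beta>"
    have "\<beta> = \<alpha>" by (rule twist_unique[OF *(2,1,4) twist_id[OF *(3)]])
    then show "(el d (i + k) \<alpha>, el d (i + k) \<beta>) \<in> \<theta>" using reflx[OF el_carrier[OF *(1)]] by simp
  qed (rule permutes_id)
  show "\<sigma> \<circ> \<rho> \<in> twists q i" if s: "\<sigma> \<in> twists q i" "\<rho> \<in> twists q i" for \<sigma> \<rho>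
    unfolding twists_def
  proof (intro CollectI conjI ballI allI impI)
    show "\<sigma> \<circ> \<rho> permutes {1..q}" by (rule permutes_compose[OF p[OF s(2)] p[OF s(1)]])
    fix \<alpha> \<beta> a b k
    assume *: "\<alpha> \<in> PP n" "\<beta> \<in> PP n" "rank \<alpha> = q" "numbering \<alpha> a b" "twist \<alpha> a b (\<sigma> \<circ> \<rho>) \<beta>"
    have r: "\<rho> permutes {1..rank \<alpha>}" using p[OF s(2)] *(3) by simp
    obtain \<gamma> where g: "\<gamma> \<in> PP n" "twist \<alpha> a b \<rho> \<gamma>" by (rule twist_exists[OF *(1,4) r])
    note nt = numbering_twist[OF *(1) g(1) *(4) r g(2)]
    have "twist \<gamma> (\<rho> \<circ> a) b \<sigma> \<beta>" using twist_comp[OF *(4) r g(2)] *(5) by blast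
    then have "(el d (i + k) \<gamma>, el d (i + k) \<beta>) \<in> \<theta>" using twistsD[OF s(1) g(1) *(2) _ nt(1)] nt(2) *(3) by simp
    with twistsD[OF s(2) *(1) g(1) *(3,4) g(2)] show "(el d (i + k) \<alpha>, el d (i + k) \<beta>) \<in> \<theta>" by (rule tran)
  qed
  show "inv' \<sigma> \<in> twists q i" if s: "\<sigma> \<in> twists q i" for \<sigma>
    unfolding twists_def
  proof (intro CollectI conjI ballI allI impI)
    show ip: "inv' \<sigma> permutes {1..q}" by (rule permutes_inv[OF p[OF s]])
    fix \<alpha> \<beta> a b k
    assume *: "\<alpha> \<in> PP n" "\<beta> \<in> PP n" "rank \<alpha> = q" "numbering \<alpha> a b" "twist \<alpha> a b (inv' \<sigma>) \<beta>"
    have r: "inv' \<sigma> permutes {1..rank \<alpha>}" using ip *(3) by simp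
    note nt = numbering_twist[OF *(1,2,4) r *(5)]
    have "twist \<beta> (inv' \<sigma> \<circ> a) b \<sigma> \<alpha>"
      unfolding twist_comp[OF *(4) r *(5)] permutes_inv_o(1)[OF p[OF s]] by (rule twist_id[OF *(4)])
    then have "(el d (i + k) \<beta>, el d (i + k) \<alpha>) \<in> \<theta>" using twistsD[OF s *(2,1) _ nt(1)] nt(2) *(3) by simp
    then show "(el d (i + k) \<alpha>, el d (i + k) \<beta>) \<in> \<theta>" by (rule symm)
  qed
  show "\<tau> \<circ> \<sigma> \<circ> inv' \<tau> \<in> twists q i" if t: "\<tau> permutes {1..q}" and s: "\<sigma> \<in> twists q i" for \<tau> \<sigma>
    unfolding twists_def
  proof (intro CollectI conjI ballI allI impI)
    have it: "inv' \<tau> permutes {1..q}" by (rule permutes_inv[OF t])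
    show "\<tau> \<circ> \<sigma> \<circ> inv' \<tau> permutes {1..q}" by (intro permutes_compose it p[OF s] t)
    fix \<alpha> \<beta> a b k
    assume *: "\<alpha> \<in> PP n" "\<beta> \<in> PP n" "rank \<alpha> = q" "numbering \<alpha> a b" "twist \<alpha> a b (\<tau> \<circ> \<sigma> \<circ> inv' \<tau>) \<beta>"
    have nr: "numbering \<alpha> (inv' \<tau> \<circ> a) (inv' \<tau> \<circ> b)" using numbering_relabel[OF *(4)] it *(3) by simp
    have "twist \<alpha> (inv' \<tau> \<circ> a) (inv' \<tau> \<circ> b) \<sigma> \<beta>"
      unfolding twist_conj[OF it] permutes_inv_inv[OF t] by (rule *(5))
    then show "(el d (i + k) \<alpha>, el d (i + k) \<beta>) \<in> \<theta>" by (rule twistsD[OF s *(1,2,3) nr])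
  qed
qed

lemma normal_closure_twists:
  assumes A: "\<alpha> \<in> PP n" and B: "\<beta> \<in> PP n" and h: "(el d i \<alpha>, el d i \<beta>) \<in> \<theta>" and pd: "perm_diff \<alpha> \<beta> \<pi>"
  shows "normal_closure (sym_group (rank \<alpha>)) \<pi> \<subseteq> twists (rank \<alpha>) i"
proof -
  obtain a b where ab: "numbering \<alpha> a b" "\<pi> permutes {1..rank \<alpha>}" "twist \<alpha> a b \<pi> \<beta>"
    by (rule perm_diffE[OF A B pd])
  have "\<pi> \<in> twists (rank \<alpha>) i"
    unfolding twists_def using twist_transport[OF A B h ab] ab(2) by blast
  then show ?thesis using twists_normal unfolding normal_closure_def by blast
qed

text \<open>The numbers \<open>s\<close> and \<open>m\<close> are different and chosen so that the
  s-th upper part is joined in \<beta> to the m-th lower part. Merging the s-th upper part with a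
  third one, which exists from rank 3 on, joins the m-th lower part to another one in the product
  with \<beta>, but leaves it alone in the product with \<alpha>. So the two products, of rank one
  less, are not Green-H-related.\<close>

lemma zero_below_twist:
  assumes A: "\<alpha> \<in> PP n" and B: "\<beta> \<in> PP n" and h: "(el d i \<alpha>, el d i \<beta>) \<in> \<theta>" and r: "rank \<alpha> \<ge> 3"
    and eq: "uu \<alpha> = uu \<beta>" "dm \<alpha> = dm \<beta>" "ll \<alpha> = ll \<beta>" "cd \<alpha> = cd \<beta>" and ne: "\<alpha> \<noteq> \<beta>"
  shows "zero n d \<theta> (rank \<alpha> - 1) i"
proof -
  obtain a b where numbering: "numbering \<alpha> a b" by (rule numbering_exists[OF A])
  have "ul \<alpha> \<noteq> ul \<beta>" using PP_eqI[OF A B eq(1,3)] ne by blast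
  then obtain x y0 where "ul \<alpha> x y0 \<noteq> ul \<beta> x y0" unfolding fun_eq_iff by blast
  then have x: "dm \<alpha> x" "dm \<beta> x" using ul_dm eq(2) by metis+
  obtain y where y: "ul \<alpha> x y" using x(1) by (auto simp: dm_def)
  obtain y' where y': "ul \<beta> x y'" using x(2) by (auto simp: dm_def)
  have nl: "\<not> ll \<alpha> y y'"
  proof
    assume l: "ll \<alpha> y y'"
    have "ul \<alpha> x z \<longleftrightarrow> ll \<alpha> y z" for z using ul_ul_ll[OF A y] ul_ll[OF A y] by blast
    moreover have "ul \<beta> x z \<longleftrightarrow> ll \<alpha> y' z" for z
      using ul_ul_ll[OF B y'] ul_ll[OF B y'] eq(3) by metis
    moreover have "ll \<alpha> y z \<longleftrightarrow> ll \<alpha> y' z" for z using l ll_trans[OF A] ll_sym by blast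
    ultimately show False using \<open>ul \<alpha> x y0 \<noteq> ul \<beta> x y0\<close> by blast
  qed
  have cy': "cd \<alpha> y'" using ul_cd[OF y'] eq by simp
  then obtain x' where x': "ul \<alpha> x' y'" by (auto simp: cd_def)
  define s where "s = a x"
  define m where "m = a x'"
  have sm: "s \<in> {1..rank \<alpha>}" "m \<in> {1..rank \<alpha>}" "s \<noteq> m"
  proof -
    show "s \<in> {1..rank \<alpha>}" "m \<in> {1..rank \<alpha>}" unfolding s_def m_def using numbering_range(1)[OF numbering] x ul_dm[OF x'] by blast+
    have "\<not> uu \<alpha> x x'" using uu_ul[OF A _ x'] ul_ul_ll[OF A y] nl by blast
    then show "s \<noteq> m" unfolding s_def m_def using numbering_uu[OF A numbering x(1) ul_dm[OF x']] by simp
  qed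
  have "\<exists>t\<in>{1, 2, 3::nat}. t \<noteq> s \<and> t \<noteq> m" by auto
  then obtain t where t0: "t \<in> {1, 2, 3}" "t \<noteq> s" "t \<noteq> m" by blast
  then have t: "t \<in> {1..rank \<alpha>}" "t \<noteq> s" "t \<noteq> m" using r by auto
  obtain x'' where x'': "dm \<alpha> x''" "a x'' = t" using numbering_surj[OF numbering t(1)] by metis
  \<comment> \<open>Points outside the domain also get \<open>s\<close>, so that every label occurs
    on the domain.\<close>
  define g where "g v = (if dm \<alpha> v then if a v = t then s else a v else s)" for v
  have g: "\<forall>v w. uu \<alpha> v w \<longrightarrow> g v = g w"
  proof (intro allI impI)
    fix v w assume vw: "uu \<alpha> v w"
    have "dm \<alpha> v \<longleftrightarrow> dm \<alpha> w" using uu_dm[OF A vw] uu_dm[OF A uu_sym[OF vw]] by blast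
    then show "g v = g w" using numbering_uu[OF A numbering, of v w] vw by (simp add: g_def)
  qed
  have gx: "g x = s" "g x'' = s" "g x' = m" using x x'' ul_dm[OF x'] t by (simp_all add: g_def s_def m_def)
  have cov: "\<forall>v\<in>{1..n}. \<exists>w. dm \<alpha> w \<and> g w = g v"
  proof
    fix v
    show "\<exists>w. dm \<alpha> w \<and> g w = g v"
    proof (cases "dm \<alpha> v")
      case False
      then have "g v = g x" using gx(1) by (simp add: g_def)
      then show ?thesis using x(1) by metis
    qed blast
  qed
  have im: "g ` {v. dm \<alpha> v} = {1..rank \<alpha>} - {t}"
  proof (intro equalityI subsetI)
    fix k assume "k \<in> g ` {v. dm \<alpha> v}"
    then obtain v where "dm \<alpha> v" "k = g v" by (auto elim!: imageE)
    then show "k \<in> {1..rank \<alpha>} - {t}" using numbering_range(1)[OF numbering] sm t by (auto simp: g_def)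
  next
    fix k assume k: "k \<in> {1..rank \<alpha>} - {t}"
    then obtain v where "dm \<alpha> v" "a v = k" using numbering_surj[OF numbering, of k] by blast
    then show "k \<in> g ` {v. dm \<alpha> v}" using k by (intro image_eqI[of _ _ v]) (auto simp: g_def)
  qed
  let ?\<gamma> = "label_part n g g"
  have G: "?\<gamma> \<in> PP n" by simp
  note PA = pprod_PP[OF G A] and PB = pprod_PP[OF G B]
  have rk: "rank (pprod n ?\<gamma> \<alpha>) = rank \<alpha> - 1"
    using rank_coarsening(2)[OF A g cov] unfolding im using t(1) by simp
  note ss = pprod_same_upper[OF G A B eq(1,2)]
  have hh: "(el d i (pprod n ?\<gamma> \<alpha>), el d i (pprod n ?\<gamma> \<beta>)) \<in> \<theta>"
    using lm[OF h G, of 0] by (simp add: floating_full A B)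
  have "ll (pprod n ?\<gamma> \<alpha>) \<noteq> ll (pprod n ?\<gamma> \<beta>)"
  proof
    assume e: "ll (pprod n ?\<gamma> \<alpha>) = ll (pprod n ?\<gamma> \<beta>)"
    have "dm \<beta> x''" using x'' eq by simp
    then obtain z where z: "ul \<beta> x'' z" by (auto simp: dm_def)
    have nux: "\<not> uu \<alpha> x x''" using numbering_uu[OF A numbering x(1) x''(1)] x''(2) t by (simp add: s_def)
    have nlz: "\<not> ll \<alpha> y' z"
    proof
      assume "ll \<alpha> y' z"
      then have "ul \<beta> x z" using ul_ll[OF B y'] eq by simp
      then have "uu \<beta> x x''" using ul_ul_uu[OF B _ z] by blast
      with nux eq show False by simp
    qed
    have gb: "\<forall>v w. uu \<beta> v w \<longrightarrow> g v = g w" using g eq by simp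
    have "ll (pprod n ?\<gamma> \<beta>) y' z"
      unfolding ll_label_part_pprod[where g=g, OF B gb] using y' z gx by metis
    then have "ll (pprod n ?\<gamma> \<alpha>) y' z" using e by simp
    then obtain v w where vw: "ul \<alpha> v y'" "g v = g w" "ul \<alpha> w z"
      unfolding ll_label_part_pprod[where g=g, OF A g] using nlz by blast
    have "g v = m" using g ul_ul_uu[OF A vw(1) x'] gx by simp
    then have "g w = m" using vw by simp
    then have "a w = m" using ul_dm[OF vw(3)] sm by (auto simp: g_def split: if_splits)
    then have "uu \<alpha> x' w" using numbering_uu[OF A numbering ul_dm[OF x'] ul_dm[OF vw(3)]] by (simp add: m_def)
    then have "ul \<alpha> x' z" using uu_ul[OF A _ vw(3)] by blast
    then show False using ul_ul_ll[OF A x'] nlz by blast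
  qed
  moreover have "rank (pprod n ?\<gamma> \<alpha>) \<ge> 2" "rank (pprod n ?\<gamma> \<beta>) \<le> rank (pprod n ?\<gamma> \<alpha>)"
    using rk ss(5) r by simp_all
  ultimately have "zero n d \<theta> (rank (pprod n ?\<gamma> \<alpha>)) i" using zero_rank_ge_2(1)[OF PA PB hh] by blast
  then show ?thesis using rk by simp
qed

end

subsection \<open>Matrix congruences\<close>

text \<open>Clause (3) of \<open>cg_pair\<close>, with Green's relation H unfolded into patterns,
  domain and codomain.\<close>

definition H_twist :: "(nat \<Rightarrow> nat) set \<Rightarrow> vpart \<Rightarrow> vpart \<Rightarrow> bool" where
  "H_twist N \<alpha> \<beta> \<longleftrightarrow> uu \<alpha> = uu \<beta> \<and> dm \<alpha> = dm \<beta> \<and> ll \<alpha> = ll \<beta> \<and> cd \<alpha> = cd \<beta> \<and> (\<exists>\<pi>\<in>N. perm_diff \<alpha> \<beta> \<pi>)"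

lemma numbering_change:
  assumes A: "\<alpha> \<in> PP n" and numbering: "numbering \<alpha> a b" and numbering': "numbering \<alpha> a' b'"
  obtains \<tau> where "\<tau> permutes {1..rank \<alpha>}" "\<forall>x. dm \<alpha> x \<longrightarrow> a' x = \<tau> (a x)" "\<forall>y. cd \<alpha> y \<longrightarrow> b' y = \<tau> (b y)"
proof -
  define \<tau> where "\<tau> k = (if k \<in> {1..rank \<alpha>} then a' (SOME x. dm \<alpha> x \<and> a x = k) else k)" for k
  have ta: "a' x = \<tau> (a x)" if x: "dm \<alpha> x" for x
  proof -
    have "dm \<alpha> (SOME x'. dm \<alpha> x' \<and> a x' = a x) \<and> a (SOME x'. dm \<alpha> x' \<and> a x' = a x) = a x"
      by (rule someI[of _ x]) (use x in simp)
    then have "a' (SOME x'. dm \<alpha> x' \<and> a x' = a x) = a' x"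
      using numbering_uu[OF A numbering _ x] numbering_uu[OF A numbering' _ x] by blast
    then show ?thesis using numbering_range(1)[OF numbering x] unfolding \<tau>_def by simp
  qed
  have tb: "b' y = \<tau> (b y)" if y: "cd \<alpha> y" for y
  proof -
    obtain x where x: "ul \<alpha> x y" using y unfolding cd_def by blast
    then show ?thesis using numbering_ul[OF numbering, of x y] numbering_ul[OF numbering', of x y] ta[OF ul_dm[OF x]] by simp
  qed
  have "\<tau> permutes {1..rank \<alpha>}"
  proof (rule bij_imp_permutes)
    have inj: "inj_on \<tau> {1..rank \<alpha>}"
    proof (rule inj_onI)
      fix k m assume km: "k \<in> {1..rank \<alpha>}" "m \<in> {1..rank \<alpha>}" "\<tau> k = \<tau> m"
      obtain x where x: "dm \<alpha> x" "a x = k" using numbering_surj[OF numbering km(1)] by metis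
      obtain x' where x': "dm \<alpha> x'" "a x' = m" using numbering_surj[OF numbering km(2)] by metis
      have "a' x = a' x'" using ta x x' km(3) by simp
      then show "k = m" using numbering_uu[OF A numbering x(1) x'(1)] numbering_uu[OF A numbering' x(1) x'(1)] x x' by simp
    qed
    have "\<tau> ` {1..rank \<alpha>} \<subseteq> {1..rank \<alpha>}"
    proof (rule image_subsetI)
      fix k assume k: "k \<in> {1..rank \<alpha>}"
      obtain x where x: "dm \<alpha> x" "a x = k" using numbering_surj[OF numbering k] by metis
      then show "\<tau> k \<in> {1..rank \<alpha>}" using ta numbering_range(1)[OF numbering' x(1)] by simp
    qed
    with inj show "bij_betw \<tau> {1..rank \<alpha>} {1..rank \<alpha>}"
      using endo_inj_surj[of "{1..rank \<alpha>}" \<tau>] unfolding bij_betw_def by simp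
  qed (simp only: \<tau>_def if_False)
  with ta tb that show thesis by blast
qed

text \<open>Two numberings differ by one permutation applied to both sides, which conjugates the
  twist; a normal subgroup absorbs this. Hence membership may be tested in any numbering.\<close>

lemma H_twist_twist:
  assumes A: "\<alpha> \<in> PP n" and B: "\<beta> \<in> PP n" and N: "N \<lhd> sym_group (rank \<alpha>)" and h: "H_twist N \<alpha> \<beta>" and numbering: "numbering \<alpha> a b"
  obtains \<pi> where "\<pi> \<in> N" "\<pi> permutes {1..rank \<alpha>}" "twist \<alpha> a b \<pi> \<beta>"
proof -
  obtain \<pi> where p: "\<pi> \<in> N" "perm_diff \<alpha> \<beta> \<pi>" using h unfolding H_twist_def by blast
  obtain a' b' where ab: "numbering \<alpha> a' b'" "\<pi> permutes {1..rank \<alpha>}" "twist \<alpha> a' b' \<pi> \<beta>"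
    by (rule perm_diffE[OF A B p(2)])
  obtain \<tau> where t: "\<tau> permutes {1..rank \<alpha>}" "\<forall>x. dm \<alpha> x \<longrightarrow> a' x = \<tau> (a x)" "\<forall>y. cd \<alpha> y \<longrightarrow> b' y = \<tau> (b y)"
    by (rule numbering_change[OF A numbering ab(1)])
  have "twist \<alpha> (\<tau> \<circ> a) (\<tau> \<circ> b) \<pi> \<beta>"
    using ab(3) twist_relabel_cong[of \<alpha> a' "\<tau> \<circ> a" b' "\<tau> \<circ> b"] t(2,3) by simp
  then have tw: "twist \<alpha> a b (inv' \<tau> \<circ> \<pi> \<circ> \<tau>) \<beta>" using twist_conj[OF t(1)] by blast
  have "inv' \<tau> \<circ> \<pi> \<circ> inv' (inv' \<tau>) \<in> N"
    using N permutes_inv[OF t(1)] p(1) unfolding sym_group_normal_iff by blast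
  then have "inv' \<tau> \<circ> \<pi> \<circ> \<tau> \<in> N" by (simp only: permutes_inv_inv[OF t(1)])
  moreover from this have "inv' \<tau> \<circ> \<pi> \<circ> \<tau> permutes {1..rank \<alpha>}" using N unfolding sym_group_normal_iff by blast
  ultimately show thesis using tw that by blast
qed

lemma hnI:
  assumes A: "\<alpha> \<in> PP n" and B: "\<beta> \<in> PP n" and numbering: "numbering \<alpha> a b" and p: "\<pi> \<in> N" "\<pi> permutes {1..rank \<alpha>}"
    and t: "twist \<alpha> a b \<pi> \<beta>"
  shows "H_twist N \<alpha> \<beta>"
  using perm_diffI[OF A B numbering p(2) t] p(1) twist_dm[OF numbering p(2) t] t unfolding H_twist_def twist_def by auto

lemma H_twist_refl:
  assumes A: "\<alpha> \<in> PP n" and N: "N \<lhd> sym_group (rank \<alpha>)" shows "H_twist N \<alpha> \<alpha>"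
proof -
  obtain a b where numbering: "numbering \<alpha> a b" by (rule numbering_exists[OF A])
  show ?thesis
    by (rule hnI[OF A A numbering _ permutes_id twist_id[OF numbering]]) (use N in \<open>simp add: sym_group_normal_iff\<close>)
qed

lemma H_twist_sym:
  assumes A: "\<alpha> \<in> PP n" and B: "\<beta> \<in> PP n" and N: "N \<lhd> sym_group (rank \<alpha>)" and h: "H_twist N \<alpha> \<beta>"
  shows "H_twist N \<beta> \<alpha>"
proof -
  obtain a b where numbering: "numbering \<alpha> a b" by (rule numbering_exists[OF A])
  obtain \<pi> where p: "\<pi> \<in> N" "\<pi> permutes {1..rank \<alpha>}" "twist \<alpha> a b \<pi> \<beta>" by (rule H_twist_twist[OF A B N h numbering])
  note nt = numbering_twist[OF A B numbering p(2,3)]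
  have "twist \<beta> (\<pi> \<circ> a) b (inv' \<pi>) \<alpha>"
    unfolding twist_comp[OF numbering p(2,3)] permutes_inv_o(2)[OF p(2)] by (rule twist_id[OF numbering])
  moreover have "inv' \<pi> \<in> N" using N p(1) unfolding sym_group_normal_iff by blast
  ultimately show ?thesis
    using permutes_inv[OF p(2)] nt(2) by (intro hnI[OF B A nt(1)]) simp_all
qed

lemma H_twist_trans:
  assumes A: "\<alpha> \<in> PP n" and B: "\<beta> \<in> PP n" and C: "\<gamma> \<in> PP n" and N: "N \<lhd> sym_group (rank \<alpha>)"
    and h: "H_twist N \<alpha> \<beta>" "H_twist N \<beta> \<gamma>"
  shows "H_twist N \<alpha> \<gamma>"
proof -
  obtain a b where numbering: "numbering \<alpha> a b" by (rule numbering_exists[OF A])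
  obtain \<pi> where p: "\<pi> \<in> N" "\<pi> permutes {1..rank \<alpha>}" "twist \<alpha> a b \<pi> \<beta>" by (rule H_twist_twist[OF A B N h(1) numbering])
  note nt = numbering_twist[OF A B numbering p(2,3)]
  have "N \<lhd> sym_group (rank \<beta>)" using N nt(2) by simp
  then obtain \<rho> where r: "\<rho> \<in> N" "\<rho> permutes {1..rank \<beta>}" "twist \<beta> (\<pi> \<circ> a) b \<rho> \<gamma>"
    by (rule H_twist_twist[OF B C _ h(2) nt(1)])
  have "twist \<alpha> a b (\<rho> \<circ> \<pi>) \<gamma>" using r(3) twist_comp[OF numbering p(2,3)] by blast
  moreover have "\<rho> \<circ> \<pi> \<in> N" "\<rho> \<circ> \<pi> permutes {1..rank \<alpha>}" using N p(1) r(1) unfolding sym_group_normal_iff by blast+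
  ultimately show ?thesis by (intro hnI[OF A C numbering])
qed

lemma H_twist_star:
  assumes A: "\<alpha> \<in> PP n" and B: "\<beta> \<in> PP n" and N: "N \<lhd> sym_group (rank \<alpha>)" and h: "H_twist N \<alpha> \<beta>"
  shows "H_twist N (star \<alpha>) (star \<beta>)"
proof -
  obtain a b where numbering: "numbering \<alpha> a b" by (rule numbering_exists[OF A])
  obtain \<pi> where p: "\<pi> \<in> N" "\<pi> permutes {1..rank \<alpha>}" "twist \<alpha> a b \<pi> \<beta>" by (rule H_twist_twist[OF A B N h numbering])
  have "inv' \<pi> \<in> N" using N p(1) unfolding sym_group_normal_iff by blast
  then show ?thesis
    using A B numbering p twist_star[OF p(2)] permutes_inv[OF p(2)] numbering_star
    by (intro hnI[of "star \<alpha>" n "star \<beta>" b a "inv' \<pi>"]) simp_all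
qed

lemma H_twist_pprod:
  assumes C: "\<gamma> \<in> PP n" and A: "\<alpha> \<in> PP n" and B: "\<beta> \<in> PP n" and N: "N \<lhd> sym_group (rank \<alpha>)" and h: "H_twist N \<alpha> \<beta>"
    and r: "rank (pprod n \<gamma> \<alpha>) = rank \<alpha>"
  shows "H_twist N (pprod n \<gamma> \<alpha>) (pprod n \<gamma> \<beta>)"
proof -
  obtain a b where numbering: "numbering \<alpha> a b" by (rule numbering_exists[OF A])
  obtain \<pi> where p: "\<pi> \<in> N" "\<pi> permutes {1..rank \<alpha>}" "twist \<alpha> a b \<pi> \<beta>" by (rule H_twist_twist[OF A B N h numbering])
  obtain a' where a': "numbering (pprod n \<gamma> \<alpha>) a' b"
    "\<And>\<pi> \<beta>. \<pi> permutes {1..rank \<alpha>} \<Longrightarrow> \<beta> \<in> PP n \<Longrightarrow> twist \<alpha> a b \<pi> \<beta> \<Longrightarrow>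
       twist (pprod n \<gamma> \<alpha>) a' b \<pi> (pprod n \<gamma> \<beta>)"
    by (rule pprod_twist[OF C A numbering r]) blast
  show ?thesis
    by (rule hnI[OF pprod_PP[OF C A] pprod_PP[OF C B] a'(1) p(1)]) (use p r a'(2)[OF p(2) B p(3)] in simp_all)
qed

section \<open>Matrix relations as equivalences and their closure under multiplication\<close>

lemma cg_pair_iff:
  assumes n: "n \<ge> 1" and A: "\<alpha> \<in> PP n" and B: "\<beta> \<in> PP n"
  shows "cg_pair n d M i \<alpha> j \<beta> \<longleftrightarrow>
     (M (rank \<alpha>) i = EDelta \<and> M (rank \<beta>) j = EDelta \<and> i = j \<and> \<alpha> = \<beta>) \<or>
     (M (rank \<alpha>) i = ER \<and> M (rank \<beta>) j = ER) \<or>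
     (\<exists>N. M (rank \<alpha>) i = EN N \<and> M (rank \<beta>) j = EN N \<and> i = j \<and> H_twist N \<alpha> \<beta>) \<or>
     (M (rank \<alpha>) i = EMuDown \<and> M (rank \<beta>) j = EMuDown \<and> uu \<alpha> = uu \<beta> \<and> ll \<alpha> = ll \<beta> \<and> cd \<alpha> = cd \<beta>) \<or>
     (M (rank \<alpha>) i = EMuUp \<and> M (rank \<beta>) j = EMuUp \<and> uu \<alpha> = uu \<beta> \<and> ll \<alpha> = ll \<beta> \<and> dm \<alpha> = dm \<beta>) \<or>
     (M (rank \<alpha>) i = EMu \<and> M (rank \<beta>) j = EMu \<and> uu \<alpha> = uu \<beta> \<and> ll \<alpha> = ll \<beta> \<and>
        ((rank \<alpha>, i) = (rank \<beta>, j) \<or> int i - int j = int (min_row d M (rank \<alpha>)) - int (min_row d M (rank \<beta>))))"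
proof -
  have H: "(\<alpha>, \<beta>) \<in> green_H (PM n) \<and> (\<exists>\<pi>\<in>N. perm_diff \<alpha> \<beta> \<pi>) \<longleftrightarrow> H_twist N \<alpha> \<beta>" for N
    unfolding H_twist_def green_H_def Int_iff green_L_PM[OF n A B] green_R_PM[OF n A B] by blast
  show ?thesis
    unfolding cg_pair_def Let_def hat_eq_iff[OF A B] green_L_PM[OF n A B] green_R_PM[OF n A B] H by blast
qed

lemma cg_simps:
  "(Some (i, \<alpha>), Some (j, \<beta>)) \<in> cg n d M \<longleftrightarrow> i \<le> d \<and> j \<le> d \<and> \<alpha> \<in> PP n \<and> \<beta> \<in> PP n \<and> cg_pair n d M i \<alpha> j \<beta>"
  "(Some (i, \<alpha>), None) \<in> cg n d M \<longleftrightarrow> i \<le> d \<and> \<alpha> \<in> PP n \<and> M (rank \<alpha>) i = ER"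
  "(None, Some (i, \<alpha>)) \<in> cg n d M \<longleftrightarrow> i \<le> d \<and> \<alpha> \<in> PP n \<and> M (rank \<alpha>) i = ER"
  "(None, None) \<in> cg n d M"
  by (auto simp: cg_def)

lemma cg_cases:
  assumes "(x, y) \<in> cg n d M"
  obtains i \<alpha> j \<beta> where "x = Some (i, \<alpha>)" "y = Some (j, \<beta>)" "i \<le> d" "j \<le> d" "\<alpha> \<in> PP n" "\<beta> \<in> PP n" "cg_pair n d M i \<alpha> j \<beta>"
  | i \<alpha> where "x = Some (i, \<alpha>)" "y = None" "i \<le> d" "\<alpha> \<in> PP n" "M (rank \<alpha>) i = ER"
  | i \<alpha> where "x = None" "y = Some (i, \<alpha>)" "i \<le> d" "\<alpha> \<in> PP n" "M (rank \<alpha>) i = ER"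
  | "x = None" "y = None"
  using assms unfolding cg_def by blast

definition normal_entries :: "cmatrix \<Rightarrow> bool" where
  "normal_entries M \<longleftrightarrow> (\<forall>q l N. M q l = EN N \<longrightarrow> N \<lhd> sym_group q)"

lemma cg_pair_refl:
  assumes n: "n \<ge> 1" and N: "normal_entries M" and A: "\<alpha> \<in> PP n" shows "cg_pair n d M i \<alpha> i \<alpha>"
proof (cases "M (rank \<alpha>) i")
  case (EN K)
  then have "H_twist K \<alpha> \<alpha>" using N unfolding normal_entries_def by (intro H_twist_refl[OF A]) blast
  with EN show ?thesis unfolding cg_pair_iff[OF n A A] by blast
qed (simp_all add: cg_pair_iff[OF n A A])

lemma cg_pair_sym:
  assumes n: "n \<ge> 1" and N: "normal_entries M" and A: "\<alpha> \<in> PP n" and B: "\<beta> \<in> PP n" and h: "cg_pair n d M i \<alpha> j \<beta>"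
  shows "cg_pair n d M j \<beta> i \<alpha>"
proof -
  have "H_twist K \<beta> \<alpha>" if "H_twist K \<alpha> \<beta>" "M (rank \<alpha>) i = EN K" for K
    using N that unfolding normal_entries_def by (intro H_twist_sym[OF A B]) blast+
  then show ?thesis using h unfolding cg_pair_iff[OF n A B] cg_pair_iff[OF n B A]
    by (cases "M (rank \<alpha>) i") auto
qed

lemma cg_pair_trans:
  assumes n: "n \<ge> 1" and N: "normal_entries M" and A: "\<alpha> \<in> PP n" and B: "\<beta> \<in> PP n" and C: "\<gamma> \<in> PP n"
    and h: "cg_pair n d M i \<alpha> j \<beta>" "cg_pair n d M j \<beta> k \<gamma>"
  shows "cg_pair n d M i \<alpha> k \<gamma>"
proof (cases "M (rank \<beta>) j")
  case EDelta
  with h(1) have "i = j" "\<alpha> = \<beta>" unfolding cg_pair_iff[OF n A B] by auto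
  with h(2) show ?thesis by simp
next
  case EMuUp
  with h show ?thesis unfolding cg_pair_iff[OF n A B] cg_pair_iff[OF n B C] cg_pair_iff[OF n A C] by simp
next
  case EMuDown
  with h show ?thesis unfolding cg_pair_iff[OF n A B] cg_pair_iff[OF n B C] cg_pair_iff[OF n A C] by simp
next
  case EMu
  with h show ?thesis unfolding cg_pair_iff[OF n A B] cg_pair_iff[OF n B C] cg_pair_iff[OF n A C] by auto
next
  case ER
  with h show ?thesis unfolding cg_pair_iff[OF n A B] cg_pair_iff[OF n B C] cg_pair_iff[OF n A C] by simp
next
  case (EN K)
  with h have 1: "M (rank \<alpha>) i = EN K" "i = j" "H_twist K \<alpha> \<beta>" unfolding cg_pair_iff[OF n A B] by auto
  from EN h have 2: "M (rank \<gamma>) k = EN K" "j = k" "H_twist K \<beta> \<gamma>" unfolding cg_pair_iff[OF n B C] by auto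
  have "H_twist K \<alpha> \<gamma>"
    by (rule H_twist_trans[OF A B C _ 1(3) 2(3)]) (use N 1 in \<open>simp add: normal_entries_def\<close>)
  with 1 2 show ?thesis unfolding cg_pair_iff[OF n A C] by simp
qed

lemma cg_pair_ER:
  assumes "n \<ge> 1" "\<alpha> \<in> PP n" "\<beta> \<in> PP n"
  shows "M (rank \<alpha>) i = ER \<Longrightarrow> cg_pair n d M i \<alpha> j \<beta> \<longleftrightarrow> M (rank \<beta>) j = ER"
    "M (rank \<beta>) j = ER \<Longrightarrow> cg_pair n d M i \<alpha> j \<beta> \<longleftrightarrow> M (rank \<alpha>) i = ER"
  unfolding cg_pair_iff[OF assms] by auto

lemma cg_equiv:
  assumes n: "n \<ge> 1" and N: "normal_entries M" shows "equiv (carrier (TPM n d)) (cg n d M)"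
proof (rule equivI)
  show "cg n d M \<subseteq> carrier (TPM n d) \<times> carrier (TPM n d)"
  proof (rule subrelI)
    fix x y assume "(x, y) \<in> cg n d M"
    then show "(x, y) \<in> carrier (TPM n d) \<times> carrier (TPM n d)" by (cases rule: cg_cases) simp_all
  qed
  show "refl_on (carrier (TPM n d)) (cg n d M)"
  proof (rule refl_onI)
    fix x assume "x \<in> carrier (TPM n d)"
    then show "(x, x) \<in> cg n d M"
      by (cases rule: carrier_cases) (simp_all add: cg_simps cg_pair_refl[OF n N])
  qed
  show "sym (cg n d M)"
  proof (rule symI)
    fix x y assume "(x, y) \<in> cg n d M"
    then show "(y, x) \<in> cg n d M"
      by (cases rule: cg_cases) (simp_all add: cg_simps cg_pair_sym[OF n N])
  qed
  show "trans (cg n d M)"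
  proof (rule transI)
    fix x y z assume xy: "(x, y) \<in> cg n d M" and yz: "(y, z) \<in> cg n d M"
    show "(x, z) \<in> cg n d M"
      using xy
    proof (cases rule: cg_cases)
      case (1 i \<alpha> j \<beta>)
      note c1 = this
      from yz show ?thesis
      proof (cases rule: cg_cases)
        case (1 j' \<beta>' k \<gamma>)
        then show ?thesis using c1 cg_pair_trans[OF n N c1(5,6) 1(6) c1(7)] by (simp add: cg_simps)
      next
        case (2 j' \<beta>')
        then show ?thesis using c1 cg_pair_ER(2)[OF n c1(5,6)] by (simp add: cg_simps)
      qed (use c1 in simp_all)
    next
      case (2 i \<alpha>)
      note c1 = this
      from yz show ?thesis
      proof (cases rule: cg_cases)
        case (3 k \<gamma>)
        then show ?thesis using c1 cg_pair_ER(1)[OF n c1(4) 3(4)] by (simp add: cg_simps)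
      next
        case 4
        then show ?thesis using c1 by (simp add: cg_simps)
      qed (use c1 in simp_all)
    next
      case (3 j \<beta>)
      note c1 = this
      from yz show ?thesis
      proof (cases rule: cg_cases)
        case (1 j' \<beta>' k \<gamma>)
        then show ?thesis using c1 cg_pair_ER(1)[OF n 1(5,6)] by (simp add: cg_simps)
      next
        case 2
        then show ?thesis using c1 by (simp add: cg_simps)
      qed (use c1 in simp_all)
    next
      case 4
      then show ?thesis using yz by simp
    qed
  qed
qed

text \<open>The anti-involution exchanges $\mu^\uparrow$ and $\mu^\downarrow$.\<close>

fun estar :: "entry \<Rightarrow> entry" where
  "estar EMuUp = EMuDown"
| "estar EMuDown = EMuUp"
| "estar e = e"

lemma estar_estar [simp]: "estar (estar e) = e" by (cases e) auto
lemma estar_iff: "estar e = EDelta \<longleftrightarrow> e = EDelta" "estar e = EMuUp \<longleftrightarrow> e = EMuDown" "estar e = EMuDown \<longleftrightarrow> e = EMuUp"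
  "estar e = EMu \<longleftrightarrow> e = EMu" "estar e = ER \<longleftrightarrow> e = ER" "estar e = EN N \<longleftrightarrow> e = EN N"
  by (cases e; simp)+

definition mstar :: "cmatrix \<Rightarrow> cmatrix" where "mstar M q i = estar (M q i)"

lemma mstar_mstar [simp]: "mstar (mstar M) = M" by (simp add: mstar_def fun_eq_iff)

lemma min_row_mstar: "min_row d (mstar M) q = min_row d M q"
  unfolding min_row_def mstar_def estar_iff ..

lemma normal_entries_mstar: "normal_entries M \<Longrightarrow> normal_entries (mstar M)"
  by (simp add: normal_entries_def mstar_def estar_iff)

lemma cg_star:
  assumes n: "n \<ge> 1" and N: "normal_entries M" and xy: "(x, y) \<in> cg n d M"
  shows "(tstar x, tstar y) \<in> cg n d (mstar M)"
  using xy
proof (cases rule: cg_cases)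
  case (1 i \<alpha> j \<beta>)
  have S: "star \<alpha> \<in> PP n" "star \<beta> \<in> PP n" using 1 by simp_all
  have "H_twist K (star \<alpha>) (star \<beta>)" if "H_twist K \<alpha> \<beta>" "M (rank \<alpha>) i = EN K" for K
    using N that unfolding normal_entries_def by (intro H_twist_star[OF 1(5,6)]) blast+
  then have "cg_pair n d (mstar M) i (star \<alpha>) j (star \<beta>)"
    using 1(7) unfolding cg_pair_iff[OF n 1(5,6)] cg_pair_iff[OF n S] star_simps rank_star min_row_mstar
    unfolding mstar_def estar_iff by (cases "M (rank \<alpha>) i") auto
  with 1 show ?thesis by (simp add: cg_simps)
qed (simp_all add: cg_simps mstar_def)

definition er_ideal :: "nat \<Rightarrow> cmatrix \<Rightarrow> bool" where
  "er_ideal d M \<longleftrightarrow> (\<forall>q i r j. M q i = ER \<longrightarrow> r \<le> q \<longrightarrow> i \<le> j \<longrightarrow> j \<le> d \<longrightarrow> M r j = ER)"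

text \<open>Restricted to the entries for which work remains: equal elements stay equal, and
  products of elements at R-entries are covered by \<open>er_ideal\<close>.\<close>

definition left_closed :: "nat \<Rightarrow> nat \<Rightarrow> cmatrix \<Rightarrow> bool" where
  "left_closed n d M \<longleftrightarrow> (\<forall>i \<alpha> j \<beta> \<gamma> k. i \<le> d \<longrightarrow> j \<le> d \<longrightarrow> \<alpha> \<in> PP n \<longrightarrow> \<beta> \<in> PP n \<longrightarrow> cg_pair n d M i \<alpha> j \<beta> \<longrightarrow>
     M (rank \<alpha>) i \<noteq> EDelta \<longrightarrow> M (rank \<alpha>) i \<noteq> ER \<longrightarrow> \<gamma> \<in> PP n \<longrightarrow>
     (el d (i + k + floating n \<gamma> \<alpha>) (pprod n \<gamma> \<alpha>), el d (j + k + floating n \<gamma> \<beta>) (pprod n \<gamma> \<beta>)) \<in> cg n d M)"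

lemma el_cgI:
  assumes "\<alpha> \<in> PP n" "\<beta> \<in> PP n" "i \<le> d \<Longrightarrow> j \<le> d \<Longrightarrow> cg_pair n d M i \<alpha> j \<beta>"
    "i \<le> d \<Longrightarrow> d < j \<Longrightarrow> M (rank \<alpha>) i = ER" "d < i \<Longrightarrow> j \<le> d \<Longrightarrow> M (rank \<beta>) j = ER"
  shows "(el d i \<alpha>, el d j \<beta>) \<in> cg n d M"
  using assms by (cases "i \<le> d"; cases "j \<le> d") (simp_all add: el_def cg_simps)

lemma el_zeroI:
  assumes "\<alpha> \<in> PP n" "i \<le> d \<Longrightarrow> M (rank \<alpha>) i = ER" shows "(el d i \<alpha>, None) \<in> cg n d M"
  using assms by (simp add: el_def cg_simps)

lemma cg_left_mult:
  assumes n: "n \<ge> 1" and N: "normal_entries M" and er: "er_ideal d M" and lc: "left_closed n d M"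
    and xy: "(x, y) \<in> cg n d M" and s: "s \<in> carrier (TPM n d)"
  shows "(tmult n d s x, tmult n d s y) \<in> cg n d M"
  using s
proof (cases rule: carrier_cases)
  case 1
  then show ?thesis by (simp add: cg_simps)
next
  case (2 k \<gamma>)
  note s = this
  note eqv = cg_equiv[OF n N, of d]
  have er': "(el d (k + i + floating n \<gamma> \<alpha>) (pprod n \<gamma> \<alpha>), None) \<in> cg n d M" if "M (rank \<alpha>) i = ER" "\<alpha> \<in> PP n" for i \<alpha>
  proof (rule el_zeroI[OF pprod_PP[OF s(3) that(2)]])
    assume "k + i + floating n \<gamma> \<alpha> \<le> d"
    then show "M (rank (pprod n \<gamma> \<alpha>)) (k + i + floating n \<gamma> \<alpha>) = ER"
      using er that rank_pprod_right[OF s(3) that(2)] unfolding er_ideal_def by auto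
  qed
  have sy: "(None, z) \<in> cg n d M" if "(z, None) \<in> cg n d M" for z using eqv that by (meson equivE symD)
  from xy show ?thesis
  proof (cases rule: cg_cases)
    case (1 i \<alpha> j \<beta>)
    consider "M (rank \<alpha>) i = EDelta" | "M (rank \<alpha>) i = ER" | "M (rank \<alpha>) i \<noteq> EDelta" "M (rank \<alpha>) i \<noteq> ER" by blast
    then show ?thesis
    proof cases
      case a: 1
      then have "i = j" "\<alpha> = \<beta>" using 1(7) unfolding cg_pair_iff[OF n 1(5,6)] by simp_all
      then have "x = y" "y \<in> carrier (TPM n d)" using 1 by simp_all
      then show ?thesis using tmult_carrier[OF assms(6)] eqv by (auto simp: equiv_def intro: refl_onD)
    next
      case a: 2
      then have "M (rank \<beta>) j = ER" using 1(7) cg_pair_ER(1)[OF n 1(5,6)] by simp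
      from er'[OF a 1(5)] sy[OF er'[OF this 1(6)]] eqv show ?thesis
        unfolding 1(1,2) s(1) tmult_el by (meson equivE transD)
    next
      case a: 3
      have "(el d (i + k + floating n \<gamma> \<alpha>) (pprod n \<gamma> \<alpha>), el d (j + k + floating n \<gamma> \<beta>) (pprod n \<gamma> \<beta>)) \<in> cg n d M"
        using lc 1 a s(3) unfolding left_closed_def by blast
      then show ?thesis unfolding 1(1,2) s(1) tmult_el by (simp only: add.commute[of k])
    qed
  next
    case (2 i \<alpha>)
    then show ?thesis unfolding 2(1,2) s(1) tmult_el using er' by simp
  next
    case (3 i \<alpha>)
    then show ?thesis unfolding 3(1,2) s(1) tmult_el using sy[OF er'] by simp
  qed (simp add: cg_simps)
qed

text \<open>Reflection turns right multiplication into left multiplication and \<open>M\<close> into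
  \<open>mstar M\<close>; hence the condition on both matrices.\<close>

lemma cg_congruence:
  assumes n: "n \<ge> 1" and N: "normal_entries M" and er: "er_ideal d M" and lc: "left_closed n d M" "left_closed n d (mstar M)"
  shows "congruence_on (TPM n d) (cg n d M)"
proof (rule congruence_onI[OF cg_equiv[OF n N]])
  fix x y s assume xy: "(x, y) \<in> cg n d M" and s: "s \<in> carrier (TPM n d)"
  then show "(s \<otimes>\<^bsub>TPM n d\<^esub> x, s \<otimes>\<^bsub>TPM n d\<^esub> y) \<in> cg n d M"
    using cg_left_mult[OF n N er lc(1)] by simp
  have c: "x \<in> carrier (TPM n d)" "y \<in> carrier (TPM n d)"
    using xy cg_equiv[OF n N, of d] by (auto simp: equiv_def)
  have N': "normal_entries (mstar M)" by (rule normal_entries_mstar[OF N])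
  have er': "er_ideal d (mstar M)" using er by (simp add: er_ideal_def mstar_def estar_iff)
  have "(tmult n d (tstar s) (tstar x), tmult n d (tstar s) (tstar y)) \<in> cg n d (mstar M)"
    using cg_left_mult[OF n N' er' lc(2) cg_star[OF n N xy]] s by simp
  from cg_star[OF n N' this] show "(x \<otimes>\<^bsub>TPM n d\<^esub> s, y \<otimes>\<^bsub>TPM n d\<^esub> s) \<in> cg n d M"
    using c s by (simp add: tstar_tmult)
qed

text \<open>Left multiplication either connects the two transversals, and then the whole codomain
  becomes one block, or keeps them apart, and then the lower pattern is unchanged. Which of the two
  happens is decided by the upper side, which \<alpha> and \<beta> share.\<close>

lemma hat_pprod_rank_2:
  assumes C: "\<gamma> \<in> PP n" and A: "\<alpha> \<in> PP n" and B: "\<beta> \<in> PP n" and r: "rank \<alpha> = 2"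
    and eq: "uu \<alpha> = uu \<beta>" "dm \<alpha> = dm \<beta>" "ll \<alpha> = ll \<beta>" "cd \<alpha> = cd \<beta>"
  shows "hat (pprod n \<gamma> \<alpha>) = hat (pprod n \<gamma> \<beta>)"
proof -
  note s = pprod_same_upper[OF C A B eq(1,2)]
  obtain a b where numbering: "numbering \<alpha> a b" by (rule numbering_exists[OF A])
  have "ll (pprod n \<gamma> \<alpha>) = ll (pprod n \<gamma> \<beta>)"
  proof (cases "\<exists>v w. dm \<alpha> v \<and> dm \<alpha> w \<and> mid_joined n \<gamma> \<alpha> v w \<and> \<not> uu \<alpha> v w")
    case True
    then obtain v0 w0 where vw: "dm \<alpha> v0" "dm \<alpha> w0" "mid_joined n \<gamma> \<alpha> v0 w0" "\<not> uu \<alpha> v0 w0" by blast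
    have a0: "a v0 \<in> {1..2}" "a w0 \<in> {1..2}" "a v0 \<noteq> a w0"
      using numbering_range(1)[OF numbering vw(1)] numbering_range(1)[OF numbering vw(2)] numbering_uu[OF A numbering vw(1,2)] vw(4) r by simp_all
    have to0: "mid_joined n \<gamma> \<alpha> v0 v" if v: "dm \<alpha> v" for v
    proof -
      have "a v \<in> {1..2}" using numbering_range(1)[OF numbering v] r by simp
      then have "a v = a v0 \<or> a v = a w0" using a0 by auto
      then have "uu \<alpha> v0 v \<or> uu \<alpha> w0 v" using numbering_uu[OF A numbering vw(1) v] numbering_uu[OF A numbering vw(2) v] by metis
      then show ?thesis using mid_joined_uu[OF A] mid_joined_trans[OF vw(3)] by blast
    qed
    have all: "mid_joined n \<gamma> \<alpha> v w" if "dm \<alpha> v" "dm \<alpha> w" for v w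
      by (rule mid_joined_trans[OF mid_joined_sym[OF to0[OF that(1)]] to0[OF that(2)]])
    have 1: "(\<exists>v w. ul \<alpha> v x \<and> mid_joined n \<gamma> \<alpha> v w \<and> ul \<alpha> w y) \<longleftrightarrow> cd \<alpha> x \<and> cd \<alpha> y" for x y
      unfolding cd_def using all ul_dm by metis
    have 2: "(\<exists>v w. ul \<beta> v x \<and> mid_joined n \<gamma> \<alpha> v w \<and> ul \<beta> w y) \<longleftrightarrow> cd \<beta> x \<and> cd \<beta> y" for x y
      unfolding cd_def using all ul_dm[of \<beta>] unfolding eq(2) by metis
    show ?thesis
      unfolding fun_eq_iff ll_pprod[OF C A] ll_pprod[OF C B] s(1)[symmetric] 1 2 eq(3,4) by simp
  next
    case False
    have 1: "ll \<alpha> x y" if h: "ul \<alpha> v x" "mid_joined n \<gamma> \<alpha> v w" "ul \<alpha> w y" for v w x y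
    proof -
      have "uu \<alpha> v w" using False h ul_dm by blast
      then show ?thesis using ul_ul_ll[OF A h(1) uu_ul[OF A _ h(3)]] by blast
    qed
    have 2: "ll \<beta> x y" if h: "ul \<beta> v x" "mid_joined n \<gamma> \<alpha> v w" "ul \<beta> w y" for v w x y
    proof -
      have "dm \<alpha> v" "dm \<alpha> w" using ul_dm[OF h(1)] ul_dm[OF h(3)] eq(2) by simp_all
      then have "uu \<alpha> v w" using False h(2) by blast
      then have "uu \<beta> v w" using eq(1) by simp
      then show ?thesis using ul_ul_ll[OF B h(1) uu_ul[OF B _ h(3)]] by blast
    qed
    have 3: "ll (pprod n \<gamma> \<alpha>) = ll \<alpha>" unfolding fun_eq_iff ll_pprod[OF C A] using 1 by blast
    have 4: "ll (pprod n \<gamma> \<beta>) = ll \<beta>" unfolding fun_eq_iff ll_pprod[OF C B] s(1)[symmetric] using 2 by blast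
    show ?thesis unfolding 3 4 by (rule eq(3))
  qed
  then show ?thesis unfolding hat_eq_iff[OF pprod_PP[OF C A] pprod_PP[OF C B]] using s(3) by simp
qed

text \<open>Hypothesis \<open>w\<close> says that index minus rank agrees, written additively to
  stay within the natural numbers. Both weights change by \<open>k\<close> plus the floating count
  of the common hat.\<close>

lemma hat_weight_pprod:
  assumes C: "\<gamma> \<in> PP n" and A: "\<alpha> \<in> PP n" and B: "\<beta> \<in> PP n" and r: "rank \<alpha> \<le> 1" "rank \<beta> \<le> 1"
    and eq: "hat \<alpha> = hat \<beta>" and w: "i + rank \<beta> = j + rank \<alpha>"
  shows "hat (pprod n \<gamma> \<alpha>) = hat (pprod n \<gamma> \<beta>)"
    "(i + k + floating n \<gamma> \<alpha>) + rank (pprod n \<gamma> \<beta>) = (j + k + floating n \<gamma> \<beta>) + rank (pprod n \<gamma> \<alpha>)"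
proof -
  note a = pprod_hat[OF C A r(1)] and b = pprod_hat[OF C B r(2)]
  show "hat (pprod n \<gamma> \<alpha>) = hat (pprod n \<gamma> \<beta>)" using a(1) b(1) eq by simp
  show "(i + k + floating n \<gamma> \<alpha>) + rank (pprod n \<gamma> \<beta>) = (j + k + floating n \<gamma> \<beta>) + rank (pprod n \<gamma> \<alpha>)"
    using a(2) b(2) eq w by simp
qed

lemma rank_pprod_le:
  assumes "\<gamma> \<in> PP n" "\<alpha> \<in> PP n" "rank \<alpha> \<le> 1" shows "rank (pprod n \<gamma> \<alpha>) = 0 \<or> rank (pprod n \<gamma> \<alpha>) = 1 \<and> rank \<alpha> = 1"
  using rank_pprod_right[OF assms(1,2)] assms(3) by linarith

lemma rank_0_eqI:
  assumes "\<alpha> \<in> PP n" "\<beta> \<in> PP n" "rank \<alpha> = 0" "rank \<beta> = 0" "hat \<alpha> = hat \<beta>" shows "\<alpha> = \<beta>"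
  by (rule trans[OF hat_rank_0[OF assms(1,3), symmetric] trans[OF assms(5) hat_rank_0[OF assms(2,4)]]])

section \<open>The matrices of the individual cases\<close>

lemma mat_iii_congruence:
  assumes n: "n \<ge> 1" and N: "N \<lhd> sym_group q"
  shows "congruence_on (TPM n d) (cg n d (mat_iii d q i0 N))"
proof -
  let ?M = "mat_iii d q i0 N"
  have ms: "mstar ?M = ?M" by (simp add: mstar_def mat_iii_def fun_eq_iff)
  have lc: "left_closed n d ?M"
    unfolding left_closed_def
  proof (intro allI impI)
    fix i \<alpha> j \<beta> \<gamma> k
    assume ij: "i \<le> d" "j \<le> d" and A: "\<alpha> \<in> PP n" and B: "\<beta> \<in> PP n" and C: "\<gamma> \<in> PP n"
      and cp: "cg_pair n d ?M i \<alpha> j \<beta>" and ne: "?M (rank \<alpha>) i \<noteq> EDelta" "?M (rank \<alpha>) i \<noteq> ER"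
    have q: "rank \<alpha> = q" "i0 \<le> i" "?M (rank \<alpha>) i = EN N" using ne by (auto simp: mat_iii_def split: if_splits)
    have h: "i = j" "H_twist N \<alpha> \<beta>" using cp q(3) unfolding cg_pair_iff[OF n A B] by auto
    note s = pprod_same_upper[OF C A B]
    have e: "uu \<alpha> = uu \<beta>" "dm \<alpha> = dm \<beta>" using h(2) by (simp_all add: H_twist_def)
    note s = s[OF e]
    show "(el d (i + k + floating n \<gamma> \<alpha>) (pprod n \<gamma> \<alpha>), el d (j + k + floating n \<gamma> \<beta>) (pprod n \<gamma> \<beta>)) \<in> cg n d ?M"
      unfolding h(1) s(2)[symmetric]
    proof (rule el_cgI[OF pprod_PP[OF C A] pprod_PP[OF C B]])
      assume l: "j + k + floating n \<gamma> \<alpha> \<le> d"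
      show "cg_pair n d ?M (j + k + floating n \<gamma> \<alpha>) (pprod n \<gamma> \<alpha>) (j + k + floating n \<gamma> \<alpha>) (pprod n \<gamma> \<beta>)"
      proof (cases "rank (pprod n \<gamma> \<alpha>) = q")
        case True
        have "H_twist N (pprod n \<gamma> \<alpha>) (pprod n \<gamma> \<beta>)"
          by (rule H_twist_pprod[OF C A B _ h(2)]) (use N q(1) True in simp_all)
        moreover have "?M q (j + k + floating n \<gamma> \<alpha>) = EN N" using l q(2) h(1) by (simp add: mat_iii_def)
        ultimately show ?thesis
          unfolding cg_pair_iff[OF n pprod_PP[OF C A] pprod_PP[OF C B]] s(5)[symmetric] True by blast
      next
        case False
        then have "rank (pprod n \<gamma> \<alpha>) < q" using rank_pprod_right[OF C A] q(1) by simp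
        then have "?M (rank (pprod n \<gamma> \<alpha>)) (j + k + floating n \<gamma> \<alpha>) = ER" using l q(2) h(1) by (simp add: mat_iii_def)
        then show ?thesis
          unfolding cg_pair_iff[OF n pprod_PP[OF C A] pprod_PP[OF C B]] s(5)[symmetric] by blast
      qed
    qed simp_all
  qed
  show ?thesis
  proof (rule cg_congruence[OF n _ _ lc])
    show "normal_entries ?M" using N by (auto simp: normal_entries_def mat_iii_def split: if_splits)
    show "er_ideal d ?M" by (auto simp: er_ideal_def mat_iii_def split: if_splits)
    show "left_closed n d (mstar ?M)" unfolding ms by (rule lc)
  qed
qed

text \<open>A common form of the matrices of (iv), (v) and (vi).\<close>

definition mat_gen :: "nat \<Rightarrow> nat \<Rightarrow> nat \<Rightarrow> entry \<Rightarrow> bool \<Rightarrow> cmatrix" where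
  "mat_gen d i j \<zeta> b = (\<lambda>s l.
     if s = 2 \<and> b \<and> i \<le> l \<and> l \<le> d then EN (carrier (sym_group 2))
     else if s = 1 \<and> l = i then \<zeta>
     else if s = 1 \<and> i < l \<and> l \<le> d then EMu
     else if s = 0 \<and> j \<le> l \<and> l < d then EMu
     else if s = 0 \<and> l = d then ER
     else EDelta)"

lemma sym_group_normal_self: "carrier (sym_group q) \<lhd> sym_group q"
  unfolding sym_group_normal_iff Ball_def sym_group_carrier
  by (intro conjI allI impI permutes_id permutes_compose permutes_inv) assumption+

context
  fixes n d i0 j0 :: nat and \<zeta> :: entry and b :: bool
  assumes n: "n \<ge> 1" and ij0: "j0 \<le> i0" "i0 \<le> Suc j0" "i0 \<le> d"
    and z: "\<zeta> = EMu \<or> \<zeta> = EMuUp \<or> \<zeta> = EMuDown" and b: "b \<longrightarrow> \<zeta> = EMu"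
begin

abbreviation (input) "MG \<equiv> mat_gen d i0 j0 \<zeta> b"

text \<open>The positions at which elements with equal hats and equal weights have to be related.
  Indices beyond \<open>d\<close> and the R-entry at (0,d) are included: there zero takes the place
  of (d+1,\<alpha>). This makes the zone closed under multiplication, which the \<mu>-entries alone
  are not.\<close>

definition mu_zone :: "nat \<Rightarrow> nat \<Rightarrow> bool" where
  "mu_zone r l \<longleftrightarrow> r = 0 \<and> j0 \<le> l \<or> r = 1 \<and> (i0 < l \<or> \<zeta> = EMu \<and> i0 \<le> l)"

text \<open>Row 1 has no R, so its value is the default d+1, one more than that of row 0. The offset
  in clause (6) is thus the difference of the ranks.\<close>

lemma mat_gen_min_row: "min_row d MG 1 = Suc d" "min_row d MG 0 = d"
proof -
  show "min_row d MG 1 = Suc d" using z by (auto simp: min_row_def mat_gen_def)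
  have "MG 0 l = ER \<longleftrightarrow> l = d" for l by (simp add: mat_gen_def)
  then show "min_row d MG 0 = d" by (auto simp: min_row_def intro: Least_equality)
qed

lemma mat_gen_normal: "normal_entries MG"
  using z sym_group_normal_self by (auto simp: normal_entries_def mat_gen_def split: if_splits)

lemma mat_gen_er: "MG q l = ER \<longleftrightarrow> q = 0 \<and> l = d"
  using z by (auto simp: mat_gen_def)

lemma mat_gen_mu: "MG q l = EMu \<longleftrightarrow> mu_zone q l \<and> (q = 0 \<longrightarrow> l < d) \<and> l \<le> d"
  using z ij0 by (auto simp: mat_gen_def mu_zone_def)

lemma mat_gen_mu_pair:
  assumes A: "\<alpha> \<in> PP n" and B: "\<beta> \<in> PP n" and r: "rank \<alpha> \<le> 1" "rank \<beta> \<le> 1" and eq: "hat \<alpha> = hat \<beta>"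
    and w: "i + rank \<beta> = j + rank \<alpha>" and zn: "mu_zone (rank \<alpha>) i" "mu_zone (rank \<beta>) j"
  shows "(el d i \<alpha>, el d j \<beta>) \<in> cg n d MG"
proof -
  note eqv = cg_equiv[OF n mat_gen_normal, of d]
  have ul: "uu \<alpha> = uu \<beta>" "ll \<alpha> = ll \<beta>" using eq hat_eq_iff[OF A B] by simp_all
  have drop: "(el d i \<alpha>, el d j \<beta>) \<in> cg n d MG"
    if A: "\<alpha> \<in> PP n" and B: "\<beta> \<in> PP n" and r: "rank \<alpha> = 1" "rank \<beta> = 0" and ul: "uu \<alpha> = uu \<beta>" "ll \<alpha> = ll \<beta>"
      and w: "i = Suc j" and zn: "mu_zone 1 i" "mu_zone 0 j" for \<alpha> \<beta> i j
  proof (rule el_cgI[OF A B])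
    assume "i \<le> d" "j \<le> d"
    then have "MG 1 i = EMu" "MG 0 j = EMu" using zn w unfolding mat_gen_mu by simp_all
    then show "cg_pair n d MG i \<alpha> j \<beta>"
      unfolding cg_pair_iff[OF n A B] r using ul w mat_gen_min_row by simp
  next
    assume "i \<le> d" "d < j"
    then show "MG (rank \<alpha>) i = ER" using w by simp
  next
    \<comment> \<open>Here j = d: the element of rank 1 has become zero, and its partner sits at the
      R-entry.\<close>
    assume "d < i" "j \<le> d"
    then show "MG (rank \<beta>) j = ER" using w r unfolding mat_gen_er by simp
  qed
  consider "rank \<alpha> = 0" "rank \<beta> = 0" | "rank \<alpha> = 1" "rank \<beta> = 1" | "rank \<alpha> = 1" "rank \<beta> = 0" | "rank \<alpha> = 0" "rank \<beta> = 1"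
    using r by linarith
  then show ?thesis
  proof cases
    case 1
    then have "\<alpha> = \<beta>" "i = j" using rank_0_eqI[OF A B _ _ eq] w by simp_all
    then show ?thesis using eqv el_carrier[OF B] by (auto simp: equiv_def intro: refl_onD)
  next
    case 2
    then have "i = j" using w by simp
    show ?thesis
    proof (rule el_cgI[OF A B])
      assume "i \<le> d" "j \<le> d"
      then have "MG 1 i = EMu" using zn(1) 2 unfolding mat_gen_mu by simp
      then show "cg_pair n d MG i \<alpha> j \<beta>" unfolding cg_pair_iff[OF n A B] 2 using ul \<open>i = j\<close> by simp
    qed (use \<open>i = j\<close> in simp_all)
  next
    case 3
    then show ?thesis using drop[OF A B 3 ul] w zn by simp
  next
    case 4
    then have "(el d j \<beta>, el d i \<alpha>) \<in> cg n d MG"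
      by (intro drop[OF B A 4(2,1) ul(1)[symmetric] ul(2)[symmetric]]) (use w zn 4 in simp_all)
    then show ?thesis using eqv by (meson equivE symD)
  qed
qed

text \<open>An N-entry persists while the rank is 2, and \<mu>-up or \<mu>-down while the rank is 1
  and the column is \<open>i0\<close>. Otherwise the products have equal hats and weights at
  positions in \<open>mu_zone\<close>, where \<open>mat_gen_mu_pair\<close> applies.\<close>

lemma mat_gen_left_closed: "left_closed n d MG"
  unfolding left_closed_def
proof (intro allI impI)
  fix i \<alpha> j \<beta> \<gamma> k
  assume id: "i \<le> d" "j \<le> d" and A: "\<alpha> \<in> PP n" and B: "\<beta> \<in> PP n" and C: "\<gamma> \<in> PP n"
    and cp: "cg_pair n d MG i \<alpha> j \<beta>" and ne: "MG (rank \<alpha>) i \<noteq> EDelta" "MG (rank \<alpha>) i \<noteq> ER"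
  let ?a = "pprod n \<gamma> \<alpha>" and ?b = "pprod n \<gamma> \<beta>"
  let ?i = "i + k + floating n \<gamma> \<alpha>" and ?j = "j + k + floating n \<gamma> \<beta>"
  note PA = pprod_PP[OF C A] and PB = pprod_PP[OF C B]
  note cpi = cp[unfolded cg_pair_iff[OF n A B]]
  show "(el d ?i ?a, el d ?j ?b) \<in> cg n d MG"
  proof (cases "MG (rank \<alpha>) i")
    case (EN N)
    then have q: "rank \<alpha> = 2" "b" "i0 \<le> i" "N = carrier (sym_group 2)"
      using z by (auto simp: mat_gen_def split: if_splits)
    have h: "i = j" "H_twist N \<alpha> \<beta>" using cpi EN by auto
    have e: "uu \<alpha> = uu \<beta>" "dm \<alpha> = dm \<beta>" "ll \<alpha> = ll \<beta>" "cd \<alpha> = cd \<beta>" using h(2) by (simp_all add: H_twist_def)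
    note s = pprod_same_upper[OF C A B e(1,2)]
    have ij: "?j = ?i" using h(1) s(2) by simp
    show ?thesis
    proof (cases "rank ?a = 2")
      case True
      show ?thesis
        unfolding ij
      proof (rule el_cgI[OF PA PB])
        assume "?i \<le> d"
        then have "MG 2 ?i = EN N" using q by (simp add: mat_gen_def)
        moreover have "H_twist N ?a ?b"
          by (rule H_twist_pprod[OF C A B _ h(2)]) (use q True sym_group_normal_self in simp_all)
        ultimately show "cg_pair n d MG ?i ?a ?i ?b"
          unfolding cg_pair_iff[OF n PA PB] s(5)[symmetric] True by blast
      qed simp_all
    next
      case False
      then have r: "rank ?a \<le> 1" using rank_pprod_right[OF C A] q(1) by simp
      have "rank ?a = 0 \<or> rank ?a = 1" using r by linarith
      then have "mu_zone (rank ?a) ?i" unfolding mu_zone_def using q(3) b q(2) ij0 by auto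
      then show ?thesis
        unfolding ij using r s(5) hat_pprod_rank_2[OF C A B q(1) e] by (intro mat_gen_mu_pair[OF PA PB]) simp_all
    qed
  next
    case EMu
    then have E: "MG (rank \<beta>) j = EMu" and ul: "uu \<alpha> = uu \<beta>" "ll \<alpha> = ll \<beta>"
      and c: "(rank \<alpha>, i) = (rank \<beta>, j) \<or> int i - int j = int (min_row d MG (rank \<alpha>)) - int (min_row d MG (rank \<beta>))"
      using cpi by simp_all
    have zn: "mu_zone (rank \<alpha>) i" "mu_zone (rank \<beta>) j" using EMu E unfolding mat_gen_mu by simp_all
    then have ra: "rank \<alpha> = 0 \<or> rank \<alpha> = 1" and rb: "rank \<beta> = 0 \<or> rank \<beta> = 1" by (auto simp: mu_zone_def)
    have r: "rank \<alpha> \<le> 1" "rank \<beta> \<le> 1" using ra rb by auto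
    have w: "i + rank \<beta> = j + rank \<alpha>"
    proof -
      have "int (min_row d MG r) = int d + int r" if "r = 0 \<or> r = 1" for r
        using that mat_gen_min_row by auto
      then show ?thesis using c ra rb by auto
    qed
    have eq: "hat \<alpha> = hat \<beta>" using ul hat_eq_iff[OF A B] by simp
    have zp: "mu_zone (rank (pprod n \<gamma> \<alpha>)) (i + k + floating n \<gamma> \<alpha>)"
      if "mu_zone (rank \<alpha>) i" "\<alpha> \<in> PP n" "rank \<alpha> \<le> 1" for \<alpha> i
      using rank_pprod_le[OF C that(2,3)] that(1) ij0 by (auto simp: mu_zone_def)
    note hw = hat_weight_pprod[OF C A B r eq w]
    show ?thesis
      by (rule mat_gen_mu_pair[OF PA PB _ _ hw zp[OF zn(1) A r(1)] zp[OF zn(2) B r(2)]])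
        (use rank_pprod_right[OF C A] rank_pprod_right[OF C B] r in simp_all)
  next
    case EMuUp
    then have E: "MG (rank \<beta>) j = EMuUp" and ul: "uu \<alpha> = uu \<beta>" "ll \<alpha> = ll \<beta>" "dm \<alpha> = dm \<beta>"
      using cpi by simp_all
    have p: "rank \<alpha> = 1" "i = i0" "\<zeta> = EMuUp" "rank \<beta> = 1" "j = i0"
      using EMuUp E by (auto simp: mat_gen_def split: if_splits)
    have r: "rank \<alpha> \<le> 1" "rank \<beta> \<le> 1" using p by auto
    have eq: "hat \<alpha> = hat \<beta>" using ul hat_eq_iff[OF A B] by simp
    note s = pprod_same_upper[OF C A B ul(1,3)]
    have w: "i + rank \<beta> = j + rank \<alpha>" using p by simp
    note hw = hat_weight_pprod[OF C A B r eq w]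
    have ij: "?j = ?i" using s(2) p by simp
    show ?thesis
    proof (cases "rank ?a = 1 \<and> ?i = i0")
      case True
      show ?thesis
        unfolding ij
      proof (rule el_cgI[OF PA PB])
        have "MG 1 ?i = EMuUp" using True p by (simp add: mat_gen_def)
        then show "cg_pair n d MG ?i ?a ?i ?b"
          unfolding cg_pair_iff[OF n PA PB] s(5)[symmetric] using True s(3,4) hw(1)[unfolded hat_eq_iff[OF PA PB]] by simp
      qed simp_all
    next
      case False
      have "mu_zone (rank ?a) ?i" "mu_zone (rank ?b) ?i"
        unfolding mu_zone_def s(5)[symmetric] using False rank_pprod_le[OF C A r(1)] p(2) ij0(1) by auto
      then show ?thesis
        unfolding ij using hw(1) s(5) rank_pprod_right[OF C A] r by (intro mat_gen_mu_pair[OF PA PB]) simp_all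
    qed
  next
    case EMuDown
    then have E: "MG (rank \<beta>) j = EMuDown" and ul: "uu \<alpha> = uu \<beta>" "ll \<alpha> = ll \<beta>" "cd \<alpha> = cd \<beta>"
      using cpi by simp_all
    have p: "rank \<alpha> = 1" "i = i0" "\<zeta> = EMuDown" "rank \<beta> = 1" "j = i0"
      using EMuDown E by (auto simp: mat_gen_def split: if_splits)
    have r: "rank \<alpha> \<le> 1" "rank \<beta> \<le> 1" using p by auto
    have eq: "hat \<alpha> = hat \<beta>" using ul hat_eq_iff[OF A B] by simp
    have w: "i + rank \<beta> = j + rank \<alpha>" using p by simp
    note hw = hat_weight_pprod[OF C A B r eq w]
    note ra = rank_pprod_le[OF C A r(1)] and rb = rank_pprod_le[OF C B r(2)]
    show ?thesis
    proof (cases "rank ?a = 1 \<and> rank ?b = 1 \<and> ?i = i0")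
      case True
      then have ij: "?j = i0" "?i = i0" using hw(2)[of k] by auto
      have "rank ?a = rank \<alpha>" "rank ?b = rank \<beta>" using True p by simp_all
      from rank_pprod_right_eq(1)[OF C A this(1)] rank_pprod_right_eq(1)[OF C B this(2)]
      have cd: "cd ?a = cd ?b" using ul(3) by simp
      show ?thesis
        unfolding ij
      proof (rule el_cgI[OF PA PB])
        have "MG 1 i0 = EMuDown" using p by (simp add: mat_gen_def)
        then show "cg_pair n d MG i0 ?a i0 ?b"
          unfolding cg_pair_iff[OF n PA PB] using True cd hw(1)[unfolded hat_eq_iff[OF PA PB]] by simp
      qed (use ij0(3) in simp_all)
    next
      case False
      \<comment> \<open>As the domains may differ, one product can lose its transversal and the
        other not. The weights agree, so the product that keeps rank 1 has the larger index, which
        puts it beyond column \<open>i0\<close>.\<close>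
      have "mu_zone (rank ?a) ?i" "mu_zone (rank ?b) ?j"
        unfolding mu_zone_def using False ra rb hw(2)[of k] p(2,5) ij0(1) by auto
      then show ?thesis
        using hw rank_pprod_right[OF C A] rank_pprod_right[OF C B] r by (intro mat_gen_mu_pair[OF PA PB]) simp_all
    qed
  qed (use ne in simp_all)
qed

end

lemma mat_gen_congruence:
  assumes n: "n \<ge> 1" and ij0: "j0 \<le> i0" "i0 \<le> Suc j0" "i0 \<le> d"
    and z: "\<zeta> = EMu \<or> \<zeta> = EMuUp \<or> \<zeta> = EMuDown" and b: "b \<longrightarrow> \<zeta> = EMu"
  shows "congruence_on (TPM n d) (cg n d (mat_gen d i0 j0 \<zeta> b))"
proof (rule cg_congruence[OF n])
  show "normal_entries (mat_gen d i0 j0 \<zeta> b)" by (rule mat_gen_normal[OF n ij0 z b])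
  show "er_ideal d (mat_gen d i0 j0 \<zeta> b)" unfolding er_ideal_def mat_gen_er[OF n ij0 z b] by auto
  show "left_closed n d (mat_gen d i0 j0 \<zeta> b)" by (rule mat_gen_left_closed[OF n ij0 z b])
  have "mstar (mat_gen d i0 j0 \<zeta> b) = mat_gen d i0 j0 (estar \<zeta>) b"
    by (simp add: mstar_def mat_gen_def fun_eq_iff)
  moreover have "left_closed n d (mat_gen d i0 j0 (estar \<zeta>) b)"
    by (rule mat_gen_left_closed[OF n ij0]) (use z b in auto)
  ultimately show "left_closed n d (mstar (mat_gen d i0 j0 \<zeta> b))" by simp
qed

lemma mat_vii_min_row:
  assumes "Suc j0 < i0" "i0 \<le> d"
  shows "min_row d (mat_vii d i0 j0) 1 = Suc i0" "min_row d (mat_vii d i0 j0) 0 = Suc j0"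
proof -
  have 1: "mat_vii d i0 j0 1 l = ER \<longleftrightarrow> i0 < l \<and> l \<le> d" for l by (simp add: mat_vii_def)
  show "min_row d (mat_vii d i0 j0) 1 = Suc i0"
  proof (cases "i0 < d")
    case True
    then have "(LEAST l. i0 < l \<and> l \<le> d) = Suc i0" by (intro Least_equality) auto
    then show ?thesis using True unfolding min_row_def 1 by auto
  next
    \<comment> \<open>For i0 = d row 1 has no R, but the default d+1 is the same value
      \<open>Suc i0\<close>.\<close>
    case False
    then show ?thesis using assms unfolding min_row_def 1 by auto
  qed
  have 0: "mat_vii d i0 j0 0 l = ER \<longleftrightarrow> j0 < l \<and> l \<le> d" for l by (simp add: mat_vii_def)
  have "(LEAST l. j0 < l \<and> l \<le> d) = Suc j0" using assms by (intro Least_equality) auto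
  then show "min_row d (mat_vii d i0 j0) 0 = Suc j0" using assms unfolding min_row_def 0 by auto
qed

lemma mat_vii_congruence:
  assumes n: "n \<ge> 1" and ij: "Suc j0 < i0" "i0 \<le> d"
  shows "congruence_on (TPM n d) (cg n d (mat_vii d i0 j0))"
proof -
  let ?M = "mat_vii d i0 j0"
  have ms: "mstar ?M = ?M" by (simp add: mstar_def mat_vii_def fun_eq_iff)
  have nm: "normal_entries ?M" by (auto simp: normal_entries_def mat_vii_def split: if_splits)
  note eqv = cg_equiv[OF n nm, of d]
  have lc: "left_closed n d ?M"
    unfolding left_closed_def
  proof (intro allI impI)
    fix i \<alpha> j \<beta> \<gamma> k
    assume id: "i \<le> d" "j \<le> d" and A: "\<alpha> \<in> PP n" and B: "\<beta> \<in> PP n" and C: "\<gamma> \<in> PP n"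
      and cp: "cg_pair n d ?M i \<alpha> j \<beta>" and ne: "?M (rank \<alpha>) i \<noteq> EDelta" "?M (rank \<alpha>) i \<noteq> ER"
    let ?a = "pprod n \<gamma> \<alpha>" and ?b = "pprod n \<gamma> \<beta>"
    let ?i = "i + k + floating n \<gamma> \<alpha>" and ?j = "j + k + floating n \<gamma> \<beta>"
    note PA = pprod_PP[OF C A] and PB = pprod_PP[OF C B]
    have EMu: "?M (rank \<alpha>) i = EMu" using ne by (auto simp: mat_vii_def split: if_splits)
    then have E: "?M (rank \<beta>) j = EMu" and ul: "uu \<alpha> = uu \<beta>" "ll \<alpha> = ll \<beta>"
      using cp unfolding cg_pair_iff[OF n A B] by simp_all
    have pos: "rank \<alpha> = 1 \<and> i = i0 \<or> rank \<alpha> = 0 \<and> i = j0" if "?M (rank \<alpha>) i = EMu" for \<alpha> i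
      using that by (auto simp: mat_vii_def split: if_splits)
    note pa = pos[OF EMu] and pb = pos[OF E]
    have r: "rank \<alpha> \<le> 1" "rank \<beta> \<le> 1" using pa pb by auto
    have eq: "hat \<alpha> = hat \<beta>" using ul hat_eq_iff[OF A B] by simp
    note ha = pprod_hat[OF C A r(1)] and hb = pprod_hat[OF C B r(2)]
    have heq: "hat ?a = hat ?b" using ha(1) hb(1) eq by simp
    \<comment> \<open>The floating count of the common hat decides for both sides at once: if it and
      \<open>k\<close> vanish, ranks and indices stay as they are; otherwise both products leave the
      \<mu>-positions and fall into R.\<close>
    define f where "f = floating n \<gamma> (hat \<alpha>)"
    have fa: "f + rank ?a = floating n \<gamma> \<alpha> + rank \<alpha>" and fb: "f + rank ?b = floating n \<gamma> \<beta> + rank \<beta>"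
      using ha(2) hb(2) eq by (simp_all add: f_def)
    note ra = rank_pprod_le[OF C A r(1)] and rb = rank_pprod_le[OF C B r(2)]
    show "(el d ?i ?a, el d ?j ?b) \<in> cg n d ?M"
    proof (cases "k + f = 0")
      case True
      have e: "rank ?a = rank \<alpha>" "?i = i" "rank ?b = rank \<beta>" "?j = j" using True fa fb ra rb pa pb by auto
      have "?M (rank \<alpha>) i = EMu" "?M (rank \<beta>) j = EMu" using EMu E by simp_all
      moreover have "int i - int j = int (min_row d ?M (rank \<alpha>)) - int (min_row d ?M (rank \<beta>))"
        using pa pb mat_vii_min_row[OF ij] by auto
      ultimately have "cg_pair n d ?M i ?a j ?b"
        unfolding cg_pair_iff[OF n PA PB] e(1,3) using heq[unfolded hat_eq_iff[OF PA PB]] by blast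
      then show ?thesis unfolding e(2,4) using id by (intro el_cgI[OF PA PB]) simp_all
    next
      case False
      have "(el d ?i ?a, None) \<in> cg n d ?M"
      proof (rule el_zeroI[OF PA])
        assume "?i \<le> d"
        \<comment> \<open>If the transversal is lost, one floating component fewer is counted than
          for the hat, and the index may still be \<open>i0\<close>; in row 0 this is already beyond
          \<open>j0\<close>.\<close>
        then show "?M (rank ?a) ?i = ER" using False fa ra pa ij by (auto simp: mat_vii_def)
      qed
      moreover have "(el d ?j ?b, None) \<in> cg n d ?M"
      proof (rule el_zeroI[OF PB])
        assume "?j \<le> d"
        then show "?M (rank ?b) ?j = ER" using False fb rb pb ij by (auto simp: mat_vii_def)
      qed
      ultimately show ?thesis using eqv by (meson equivE symD transD)
    qed
  qed
  show ?thesis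
  proof (rule cg_congruence[OF n nm _ lc])
    show "er_ideal d ?M" using ij by (auto simp: er_ideal_def mat_vii_def split: if_splits)
    show "left_closed n d (mstar ?M)" unfolding ms by (rule lc)
  qed
qed

subsection \<open>The principal congruences\<close>

lemma cong_gen_eqI:
  assumes "congruence_on S \<rho>" "(x, y) \<in> \<rho>" "\<And>\<theta>. congruence_on S \<theta> \<Longrightarrow> (x, y) \<in> \<theta> \<Longrightarrow> \<rho> \<subseteq> \<theta>"
  shows "cong_gen S x y = \<rho>"
  unfolding cong_gen_def using assms by blast

lemma cong_gen_commute: "cong_gen S x y = cong_gen S y x"
proof -
  have "(x, y) \<in> \<theta> \<longleftrightarrow> (y, x) \<in> \<theta>" if "congruence_on S \<theta>" for \<theta>
    using that unfolding congruence_on_def by (meson equivE symD)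
  then show ?thesis unfolding cong_gen_def by (intro arg_cong[of _ _ Inter]) blast
qed

section \<open>Rees congruences\<close>

lemma Itw_simps [simp]:
  "Some (j, \<beta>) \<in> Itw n d q i \<longleftrightarrow> i \<le> j \<and> j \<le> d \<and> \<beta> \<in> PP n \<and> rank \<beta> \<le> q" "None \<in> Itw n d q i"
  unfolding Itw_def Dtw_def Dcl_def by (auto simp: image_iff)

definition tideal :: "nat \<Rightarrow> nat \<Rightarrow> telem set \<Rightarrow> bool" where
  "tideal n d I \<longleftrightarrow> I \<subseteq> carrier (TPM n d) \<and> None \<in> I \<and>
     (\<forall>x\<in>I. \<forall>s\<in>carrier (TPM n d). tmult n d s x \<in> I \<and> tmult n d x s \<in> I)"

lemma tideal_Un: "tideal n d I \<Longrightarrow> tideal n d I' \<Longrightarrow> tideal n d (I \<union> I')"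
  unfolding tideal_def by blast

lemma tideal_Itw: "tideal n d (Itw n d q i)"
  unfolding tideal_def
proof (intro conjI ballI subsetI)
  fix x assume x: "x \<in> Itw n d q i"
  then show "x \<in> carrier (TPM n d)" by (cases x) auto
  fix s assume s: "s \<in> carrier (TPM n d)"
  show "tmult n d s x \<in> Itw n d q i"
  proof (cases x)
    case (Some p)
    then obtain j \<beta> where p: "x = Some (j, \<beta>)" by (cases p) auto
    then have b: "i \<le> j" "\<beta> \<in> PP n" "rank \<beta> \<le> q" using x by auto
    from s show ?thesis
    proof (cases rule: carrier_cases)
      case (2 k \<gamma>)
      then show ?thesis
        unfolding 2(1) p tmult_el using b rank_pprod_right[OF 2(3) b(2)] by (simp add: el_def pprod_PP)
    qed simp
  qed simp
  show "tmult n d x s \<in> Itw n d q i"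
  proof (cases x)
    case (Some p)
    then obtain j \<beta> where p: "x = Some (j, \<beta>)" by (cases p) auto
    then have b: "i \<le> j" "\<beta> \<in> PP n" "rank \<beta> \<le> q" using x by auto
    from s show ?thesis
    proof (cases rule: carrier_cases)
      case (2 k \<gamma>)
      then show ?thesis
        unfolding 2(1) p tmult_el using b rank_pprod_left[OF b(2) 2(3)] by (simp add: el_def pprod_PP)
    qed simp
  qed simp
qed simp

lemma rees_congruence:
  assumes "tideal n d I" shows "congruence_on (TPM n d) (rees_cong (TPM n d) I)"
proof (rule congruence_onI)
  have I: "I \<subseteq> carrier (TPM n d)" using assms by (simp add: tideal_def)
  show "equiv (carrier (TPM n d)) (rees_cong (TPM n d) I)"
  proof (rule equivI)
    show "rees_cong (TPM n d) I \<subseteq> carrier (TPM n d) \<times> carrier (TPM n d)" using I by (auto simp: rees_cong_def)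
    show "refl_on (carrier (TPM n d)) (rees_cong (TPM n d) I)" by (rule refl_onI) (simp add: rees_cong_def Id_on_iff)
    show "sym (rees_cong (TPM n d) I)" by (rule symI) (auto simp: rees_cong_def)
    show "trans (rees_cong (TPM n d) I)" by (rule transI) (auto simp: rees_cong_def)
  qed
  fix x y s assume xy: "(x, y) \<in> rees_cong (TPM n d) I" and s: "s \<in> carrier (TPM n d)"
  then consider "x = y" "x \<in> carrier (TPM n d)" | "x \<in> I" "y \<in> I" by (auto simp: rees_cong_def)
  then show "(s \<otimes>\<^bsub>TPM n d\<^esub> x, s \<otimes>\<^bsub>TPM n d\<^esub> y) \<in> rees_cong (TPM n d) I"
    using tmult_carrier[OF s] s assms by cases (auto simp: rees_cong_def tideal_def)
  from \<open>(x, y) \<in> rees_cong (TPM n d) I\<close> consider "x = y" "x \<in> carrier (TPM n d)" | "x \<in> I" "y \<in> I" by (auto simp: rees_cong_def)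
  then show "(x \<otimes>\<^bsub>TPM n d\<^esub> s, y \<otimes>\<^bsub>TPM n d\<^esub> s) \<in> rees_cong (TPM n d) I"
    using tmult_carrier[OF _ s] s assms by cases (auto simp: rees_cong_def tideal_def)
qed

lemma Id_congruence: "congruence_on (TPM n d) (Id_on (carrier (TPM n d)))"
proof -
  have "rees_cong (TPM n d) {None} = Id_on (carrier (TPM n d))"
    unfolding rees_cong_def using Id_onI[OF None_carrier[of n d]] by blast
  moreover have "tideal n d {None}" by (simp add: tideal_def)
  ultimately show ?thesis using rees_congruence[of n d "{None}"] by simp
qed

lemma el_le: "i \<le> d \<Longrightarrow> el d i \<alpha> = Some (i, \<alpha>)" by (simp add: el_def)

lemma green_H_TPM:
  assumes "n \<ge> 1" "\<alpha> \<in> PP n" "\<beta> \<in> PP n" "i \<le> d" "j \<le> d"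
  shows "(Some (i, \<alpha>), Some (j, \<beta>)) \<in> green_H (TPM n d) \<longleftrightarrow>
    i = j \<and> uu \<alpha> = uu \<beta> \<and> dm \<alpha> = dm \<beta> \<and> ll \<alpha> = ll \<beta> \<and> cd \<alpha> = cd \<beta>"
  unfolding green_H_def Int_iff green_L_TPM[OF assms] green_R_TPM[OF assms] by blast

context tcong
begin

lemma Id_subset: "Id_on (carrier (TPM n d)) \<subseteq> \<theta>"
  using reflx by auto

lemma zero_Itw: "zero n d \<theta> q i \<Longrightarrow> x \<in> Itw n d q i \<Longrightarrow> (x, None) \<in> \<theta>"
proof (cases x)
  case (Some p)
  assume z: "zero n d \<theta> q i" and x: "x \<in> Itw n d q i"
  obtain j \<beta> where p: "x = Some (j, \<beta>)" using Some by (cases p) auto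
  show ?thesis using zeroD[OF z, of \<beta> j] x unfolding p by (simp add: el_le)
qed (simp add: reflx)

lemma rees_subset:
  assumes "\<And>x. x \<in> I \<Longrightarrow> (x, None) \<in> \<theta>" shows "rees_cong (TPM n d) I \<subseteq> \<theta>"
  unfolding rees_cong_def using Id_subset tran[OF assms symm[OF assms]] by auto

lemma case_ii_zero:
  assumes sp: "std_pair n d i \<alpha> j \<beta>" and c: "case_ii n d i \<alpha> j \<beta>" and h: "(Some (i, \<alpha>), Some (j, \<beta>)) \<in> \<theta>"
  shows "zero n d \<theta> (rank \<alpha>) i" "zero n d \<theta> (rank \<beta>) j"
proof -
  have s: "\<alpha> \<in> PP n" "\<beta> \<in> PP n" "i \<le> d" "j \<le> d" "rank \<beta> \<le> rank \<alpha>" "rank \<alpha> = rank \<beta> \<Longrightarrow> i \<le> j"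
    using sp by (simp_all add: std_pair_def)
  have h': "(el d i \<alpha>, el d j \<beta>) \<in> \<theta>" using h s by (simp add: el_le)
  consider "rank \<alpha> \<ge> 2" "(Some (i, \<alpha>), Some (j, \<beta>)) \<notin> green_H (TPM n d)"
    | "rank \<alpha> = rank \<beta>" "rank \<beta> \<le> 1" "i \<noteq> j \<or> hat \<alpha> \<noteq> hat \<beta>"
    | "rank \<alpha> = 1" "rank \<beta> = 0" "i \<le> j \<or> hat \<alpha> \<noteq> \<beta>"
    using c unfolding case_ii_def Let_def by auto
  then have "zero n d \<theta> (rank \<alpha>) i \<and> zero n d \<theta> (rank \<beta>) j"
  proof cases
    case 1
    have "\<not> (i = j \<and> uu \<alpha> = uu \<beta> \<and> dm \<alpha> = dm \<beta> \<and> ll \<alpha> = ll \<beta> \<and> cd \<alpha> = cd \<beta>)"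
      using 1(2) green_H_TPM[OF n s(1-4)] by blast
    then show ?thesis using zero_rank_ge_2[OF s(1,2) h' 1(1) s(5)] by blast
  next
    case 2
    have "zero n d \<theta> (rank \<alpha>) i"
    proof (cases "i < j")
      case True
      then show ?thesis by (intro zero_from_chain[OF s(1,2) h' s(5)])
    next
      case False
      then have ij: "i = j" using s(6) 2(1) by simp
      then have "hat \<alpha> \<noteq> hat \<beta>" using 2(3) by simp
      moreover have "rank \<alpha> \<le> 1" using 2 by simp
      ultimately show ?thesis using zero_same_rank[OF s(1,2) h'[folded ij] 2(1)] by blast
    qed
    moreover have "zero n d \<theta> (rank \<beta>) j"
      by (rule zero_mono[OF calculation]) (use 2(1) s(6) in simp_all)
    ultimately show ?thesis by blast
  next
    case 3
    then show ?thesis using zero_rank_1_0[OF s(1,2) h' 3] by simp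
  qed
  then show "zero n d \<theta> (rank \<alpha>) i" "zero n d \<theta> (rank \<beta>) j" by blast+
qed

lemma cg_subsetI:
  assumes er: "\<And>i \<alpha>. i \<le> d \<Longrightarrow> \<alpha> \<in> PP n \<Longrightarrow> M (rank \<alpha>) i = ER \<Longrightarrow> (el d i \<alpha>, None) \<in> \<theta>"
    and other: "\<And>i \<alpha> j \<beta>. i \<le> d \<Longrightarrow> j \<le> d \<Longrightarrow> \<alpha> \<in> PP n \<Longrightarrow> \<beta> \<in> PP n \<Longrightarrow> cg_pair n d M i \<alpha> j \<beta> \<Longrightarrow>
      M (rank \<alpha>) i \<noteq> EDelta \<Longrightarrow> M (rank \<alpha>) i \<noteq> ER \<Longrightarrow> (el d i \<alpha>, el d j \<beta>) \<in> \<theta>"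
  shows "cg n d M \<subseteq> \<theta>"
proof (rule subrelI)
  fix x y assume "(x, y) \<in> cg n d M"
  then show "(x, y) \<in> \<theta>"
  proof (cases rule: cg_cases)
    case (1 i \<alpha> j \<beta>)
    consider "M (rank \<alpha>) i = EDelta" | "M (rank \<alpha>) i = ER" | "M (rank \<alpha>) i \<noteq> EDelta" "M (rank \<alpha>) i \<noteq> ER" by blast
    then show ?thesis
    proof cases
      case a: 1
      then have "i = j" "\<alpha> = \<beta>" using 1(7) unfolding cg_pair_iff[OF n 1(5,6)] by simp_all
      then show ?thesis using 1 reflx[of x] by simp
    next
      case a: 2
      then have "M (rank \<beta>) j = ER" using 1(7) cg_pair_ER(1)[OF n 1(5,6)] by simp
      from tran[OF er[OF 1(3,5) a] symm[OF er[OF 1(4,6) this]]] show ?thesis using 1 by (simp add: el_le)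
    next
      case a: 3
      from other[OF 1(3-7) a] show ?thesis using 1 by (simp add: el_le)
    qed
  next
    case (2 i \<alpha>)
    then show ?thesis using er[OF 2(3-5)] by (simp add: el_le)
  next
    case (3 i \<alpha>)
    then show ?thesis using symm[OF er[OF 3(3-5)]] by (simp add: el_le)
  next
    case 4
    then show ?thesis by (simp add: reflx)
  qed
qed

lemma mat_iii_subset:
  assumes A: "\<alpha> \<in> PP n" and B: "\<beta> \<in> PP n" and h: "(el d i \<alpha>, el d i \<beta>) \<in> \<theta>" and r: "rank \<alpha> \<ge> 3"
    and eq: "uu \<alpha> = uu \<beta>" "dm \<alpha> = dm \<beta>" "ll \<alpha> = ll \<beta>" "cd \<alpha> = cd \<beta>" and ne: "\<alpha> \<noteq> \<beta>"
    and pd: "perm_diff \<alpha> \<beta> \<pi>" and N: "normal_closure (sym_group (rank \<alpha>)) \<pi> = N" "N \<lhd> sym_group (rank \<alpha>)"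
  shows "cg n d (mat_iii d (rank \<alpha>) i N) \<subseteq> \<theta>"
proof (rule cg_subsetI)
  have z: "zero n d \<theta> (rank \<alpha> - 1) i" by (rule zero_below_twist[OF A B h r eq ne])
  have sub: "N \<subseteq> twists (rank \<alpha>) i" using normal_closure_twists[OF A B h pd] N by simp
  show "(el d l \<sigma>, None) \<in> \<theta>" if "l \<le> d" "\<sigma> \<in> PP n" "mat_iii d (rank \<alpha>) i N (rank \<sigma>) l = ER" for l \<sigma>
    by (rule zeroD[OF z that(2)]) (use that(3) in \<open>auto simp: mat_iii_def split: if_splits\<close>)
  show "(el d l \<sigma>, el d m \<tau>) \<in> \<theta>"
    if lm: "l \<le> d" "m \<le> d" and S: "\<sigma> \<in> PP n" and T: "\<tau> \<in> PP n" and cp: "cg_pair n d (mat_iii d (rank \<alpha>) i N) l \<sigma> m \<tau>"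
      and e: "mat_iii d (rank \<alpha>) i N (rank \<sigma>) l \<noteq> EDelta" "mat_iii d (rank \<alpha>) i N (rank \<sigma>) l \<noteq> ER" for l \<sigma> m \<tau>
  proof -
    have q: "rank \<sigma> = rank \<alpha>" "i \<le> l" "mat_iii d (rank \<alpha>) i N (rank \<sigma>) l = EN N"
      using e by (auto simp: mat_iii_def split: if_splits)
    have hh: "l = m" "H_twist N \<sigma> \<tau>" using cp q(3) unfolding cg_pair_iff[OF n S T] by auto
    obtain a b where numbering: "numbering \<sigma> a b" by (rule numbering_exists[OF S])
    have NS: "N \<lhd> sym_group (rank \<sigma>)" using N(2) q(1) by simp
    obtain \<rho> where p: "\<rho> \<in> N" "\<rho> permutes {1..rank \<sigma>}" "twist \<sigma> a b \<rho> \<tau>" by (rule H_twist_twist[OF S T NS hh(2) numbering])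
    have "(el d (i + (l - i)) \<sigma>, el d (i + (l - i)) \<tau>) \<in> \<theta>"
      by (rule twistsD[OF _ S T q(1) numbering p(3)]) (use sub p(1) in blast)
    then show ?thesis using q(2) hh(1) by simp
  qed
qed

text \<open>Hypothesis \<open>H\<close> gives the hat pairs from column j0+1 on. There, two elements
  of rank 1 with equal hats are related through their common hat one column lower. Only column
  \<open>i0\<close> with i0 = j0 is left to \<open>L\<close>; in (vi), where i0 = j0+1, no such
  column remains.\<close>

lemma mat_gen_subset:
  assumes ij: "j0 \<le> i0" "i0 \<le> Suc j0" "i0 \<le> d" and z: "\<zeta> = EMu \<or> \<zeta> = EMuUp \<or> \<zeta> = EMuDown" and b: "b \<longrightarrow> \<zeta> = EMu"
    and H: "\<And>\<alpha> k. \<alpha> \<in> PP n \<Longrightarrow> rank \<alpha> = 1 \<Longrightarrow> (el d (Suc j0 + k) \<alpha>, el d (j0 + k) (hat \<alpha>)) \<in> \<theta>"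
    and L: "\<And>\<alpha> \<beta>. \<alpha> \<in> PP n \<Longrightarrow> \<beta> \<in> PP n \<Longrightarrow> rank \<alpha> = 1 \<Longrightarrow> rank \<beta> = 1 \<Longrightarrow> hat \<alpha> = hat \<beta> \<Longrightarrow> i0 = j0 \<Longrightarrow>
      (\<zeta> = EMuUp \<longrightarrow> dm \<alpha> = dm \<beta>) \<Longrightarrow> (\<zeta> = EMuDown \<longrightarrow> cd \<alpha> = cd \<beta>) \<Longrightarrow> (el d i0 \<alpha>, el d i0 \<beta>) \<in> \<theta>"
    and ne: "\<zeta> \<noteq> EMu \<Longrightarrow> i0 = j0"
    and two: "\<And>\<alpha> \<beta> k. b \<Longrightarrow> \<alpha> \<in> PP n \<Longrightarrow> \<beta> \<in> PP n \<Longrightarrow> rank \<alpha> = 2 \<Longrightarrow> H_twist (carrier (sym_group 2)) \<alpha> \<beta> \<Longrightarrow>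
      (el d (i0 + k) \<alpha>, el d (i0 + k) \<beta>) \<in> \<theta>"
  shows "cg n d (mat_gen d i0 j0 \<zeta> b) \<subseteq> \<theta>"
proof -
  let ?M = "mat_gen d i0 j0 \<zeta> b"
  note mr = mat_gen_min_row[OF n ij z b] and er = mat_gen_er[OF n ij z b]
  have z0: "zero n d \<theta> 0 d" by (rule zero_0_d[of j0]) (use ij H in simp_all)
  have H': "(el d l \<alpha>, el d (l - 1) (hat \<alpha>)) \<in> \<theta>" if "\<alpha> \<in> PP n" "rank \<alpha> = 1" "Suc j0 \<le> l" for \<alpha> l
    using H[OF that(1,2), of "l - Suc j0"] that(3) by (simp add: Suc_diff_le)
  show ?thesis
  proof (rule cg_subsetI)
    show "(el d l \<sigma>, None) \<in> \<theta>" if "l \<le> d" "\<sigma> \<in> PP n" "?M (rank \<sigma>) l = ER" for l \<sigma>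
      using that zeroD[OF z0 that(2)] unfolding er by simp
    show "(el d l \<sigma>, el d m \<tau>) \<in> \<theta>"
      if lm: "l \<le> d" "m \<le> d" and S: "\<sigma> \<in> PP n" and T: "\<tau> \<in> PP n" and cp: "cg_pair n d ?M l \<sigma> m \<tau>"
        and e: "?M (rank \<sigma>) l \<noteq> EDelta" "?M (rank \<sigma>) l \<noteq> ER" for l \<sigma> m \<tau>
    proof (cases "?M (rank \<sigma>) l")
      case (EN N)
      then have q: "rank \<sigma> = 2" "b" "i0 \<le> l" "N = carrier (sym_group 2)"
        using z by (auto simp: mat_gen_def split: if_splits)
      have hh: "l = m" "H_twist N \<sigma> \<tau>" using cp EN unfolding cg_pair_iff[OF n S T] by auto
      show ?thesis using two[OF q(2) S T q(1), of "l - i0"] hh q by simp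
    next
      case EMuUp
      then have q: "rank \<sigma> = 1" "l = i0" "\<zeta> = EMuUp" using z by (auto simp: mat_gen_def split: if_splits)
      have c: "?M (rank \<tau>) m = EMuUp" "uu \<sigma> = uu \<tau>" "ll \<sigma> = ll \<tau>" "dm \<sigma> = dm \<tau>"
        using cp EMuUp unfolding cg_pair_iff[OF n S T] by auto
      have q': "rank \<tau> = 1" "m = i0" using c(1) z by (auto simp: mat_gen_def split: if_splits)
      show ?thesis
        unfolding q(2) q'(2) by (rule L[OF S T q(1) q'(1)]) (use c q ne hat_eq_iff[OF S T] in simp_all)
    next
      case EMuDown
      then have q: "rank \<sigma> = 1" "l = i0" "\<zeta> = EMuDown" using z by (auto simp: mat_gen_def split: if_splits)
      have c: "?M (rank \<tau>) m = EMuDown" "uu \<sigma> = uu \<tau>" "ll \<sigma> = ll \<tau>" "cd \<sigma> = cd \<tau>"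
        using cp EMuDown unfolding cg_pair_iff[OF n S T] by auto
      have q': "rank \<tau> = 1" "m = i0" using c(1) z by (auto simp: mat_gen_def split: if_splits)
      show ?thesis
        unfolding q(2) q'(2) by (rule L[OF S T q(1) q'(1)]) (use c q ne hat_eq_iff[OF S T] in simp_all)
    next
      case EMu
      have c: "?M (rank \<tau>) m = EMu" "uu \<sigma> = uu \<tau>" "ll \<sigma> = ll \<tau>"
        "(rank \<sigma>, l) = (rank \<tau>, m) \<or> int l - int m = int (min_row d ?M (rank \<sigma>)) - int (min_row d ?M (rank \<tau>))"
        using cp EMu unfolding cg_pair_iff[OF n S T] by auto
      have heq: "hat \<sigma> = hat \<tau>" using c hat_eq_iff[OF S T] by simp
      have pos: "rank \<sigma> = 1 \<and> (i0 < l \<or> \<zeta> = EMu \<and> l = i0) \<or> rank \<sigma> = 0 \<and> j0 \<le> l" if "?M (rank \<sigma>) l = EMu" for \<sigma> l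
        using that by (auto simp: mat_gen_def split: if_splits)
      note p1 = pos[OF EMu] and p2 = pos[OF c(1)]
      consider "rank \<sigma> = 0" "rank \<tau> = 0" | "rank \<sigma> = 1" "rank \<tau> = 1" | "rank \<sigma> = 1" "rank \<tau> = 0" | "rank \<sigma> = 0" "rank \<tau> = 1"
        using p1 p2 by auto
      then show ?thesis
      proof cases
        case 1
        then have "l = m" "\<sigma> = \<tau>" using c(4) rank_0_eqI[OF S T 1 heq] by simp_all
        then show ?thesis using reflx[OF el_carrier[OF S]] by simp
      next
        case 2
        then have l: "l = m" using c(4) by simp
        show ?thesis
        proof (cases "Suc j0 \<le> l")
          case True
          from tran[OF H'[OF S 2(1) True] symm[OF H'[OF T 2(2) True, folded heq]]] show ?thesis using l by simp
        next
          case False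
          then have "l = i0" "i0 = j0" "\<zeta> = EMu" using p1 2 ij by auto
          then show ?thesis using L[OF S T 2 heq] l by simp
        qed
      next
        case 3
        then have lm: "l = Suc m" using c(4) mr by simp
        have "Suc j0 \<le> l" using p2 3 lm by simp
        from H'[OF S 3(1) this] show ?thesis unfolding lm diff_Suc_1 heq hat_rank_0[OF T 3(2)] .
      next
        case 4
        then have lm: "m = Suc l" using c(4) mr by simp
        have "Suc j0 \<le> m" using p1 4 lm by simp
        from symm[OF H'[OF T 4(2) this]] show ?thesis unfolding lm diff_Suc_1 heq[symmetric] hat_rank_0[OF S 4(1)] .
      qed
    qed (use e in simp_all)
  qed
qed

lemma mat_vii_subset:
  assumes A: "\<alpha> \<in> PP n" and r: "rank \<alpha> = 1" and h: "(el d i \<alpha>, el d j (hat \<alpha>)) \<in> \<theta>" and ij: "Suc j < i" "i \<le> d"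
  shows "cg n d (mat_vii d i j) \<subseteq> \<theta>"
proof (rule cg_subsetI)
  let ?M = "mat_vii d i j"
  note z = zero_of_hat_gap[OF A r h ij(1)]
  have H: "(el d i \<sigma>, el d j (hat \<sigma>)) \<in> \<theta>" if "\<sigma> \<in> PP n" "rank \<sigma> = 1" for \<sigma>
    using mu_transport_hat[OF A r h that, of 0] by simp
  show "(el d l \<sigma>, None) \<in> \<theta>" if l: "l \<le> d" and S: "\<sigma> \<in> PP n" and e: "?M (rank \<sigma>) l = ER" for l \<sigma>
  proof -
    have "rank \<sigma> = 1 \<and> Suc i \<le> l \<or> rank \<sigma> = 0 \<and> Suc j \<le> l" using e by (auto simp: mat_vii_def split: if_splits)
    then show ?thesis
    proof
      assume "rank \<sigma> = 1 \<and> Suc i \<le> l"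
      then show ?thesis by (intro zeroD[OF z(2) S]) simp_all
    next
      assume "rank \<sigma> = 0 \<and> Suc j \<le> l"
      then show ?thesis by (intro zeroD[OF z(1) S]) simp_all
    qed
  qed
  show "(el d l \<sigma>, el d m \<tau>) \<in> \<theta>"
    if lm: "l \<le> d" "m \<le> d" and S: "\<sigma> \<in> PP n" and T: "\<tau> \<in> PP n" and cp: "cg_pair n d ?M l \<sigma> m \<tau>"
      and e: "?M (rank \<sigma>) l \<noteq> EDelta" "?M (rank \<sigma>) l \<noteq> ER" for l \<sigma> m \<tau>
  proof -
    have EMu: "?M (rank \<sigma>) l = EMu" using e by (auto simp: mat_vii_def split: if_splits)
    have c: "?M (rank \<tau>) m = EMu" "uu \<sigma> = uu \<tau>" "ll \<sigma> = ll \<tau>"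
      using cp EMu unfolding cg_pair_iff[OF n S T] by auto
    have heq: "hat \<sigma> = hat \<tau>" using c hat_eq_iff[OF S T] by simp
    have pos: "rank \<sigma> = 1 \<and> l = i \<or> rank \<sigma> = 0 \<and> l = j" if "?M (rank \<sigma>) l = EMu" for \<sigma> l
      using that by (auto simp: mat_vii_def split: if_splits)
    \<comment> \<open>Every element at a \<mu>-position is related to its hat at column
      \<open>j\<close>, so elements with a common hat are related to each other.\<close>
    have base: "(el d l \<sigma>, el d j (hat \<sigma>)) \<in> \<theta>" if S: "\<sigma> \<in> PP n" and M: "?M (rank \<sigma>) l = EMu" for \<sigma> l
      using pos[OF M]
    proof
      assume "rank \<sigma> = 1 \<and> l = i"
      then show ?thesis using H[OF S] by simp
    next
      assume "rank \<sigma> = 0 \<and> l = j"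
      then show ?thesis using reflx[OF el_carrier[OF S]] hat_rank_0[OF S] by simp
    qed
    from tran[OF base[OF S EMu] symm[OF base[OF T c(1), folded heq]]] show ?thesis .
  qed
qed

lemma mu_full:
  assumes A: "\<alpha> \<in> PP n" and B: "\<beta> \<in> PP n" and r: "rank \<alpha> = 1" "rank \<beta> = 1" and h: "(el d i \<alpha>, el d i \<beta>) \<in> \<theta>"
    and eq: "hat \<alpha> = hat \<beta>" and ne: "dm \<alpha> \<noteq> dm \<beta>"
    and A': "\<alpha>' \<in> PP n" and B': "\<beta>' \<in> PP n" and r': "rank \<alpha>' = 1" "rank \<beta>' = 1" and h': "(el d i \<alpha>', el d i \<beta>') \<in> \<theta>"
    and eq': "hat \<alpha>' = hat \<beta>'" and ne': "cd \<alpha>' \<noteq> cd \<beta>'"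
    and S: "\<sigma> \<in> PP n" and T: "\<tau> \<in> PP n" and rs: "rank \<sigma> = 1" "rank \<tau> = 1" and he: "hat \<sigma> = hat \<tau>"
  shows "(el d i \<sigma>, el d i \<tau>) \<in> \<theta>"
proof -
  have ul: "uu \<sigma> = uu \<tau>" "ll \<sigma> = ll \<tau>" using he hat_eq_iff[OF S T] by simp_all
  have 1: "uu \<sigma> x y \<longleftrightarrow> dm \<sigma> y \<and> (0::nat) = 0" if "dm \<sigma> x" for x y
  proof -
    have "rank \<sigma> \<le> 1" using rs(1) by simp
    then have "uu \<sigma> x y" if "dm \<sigma> y" using rank_le_1_iff[OF S] \<open>dm \<sigma> x\<close> that by blast
    then show ?thesis using uu_dm[OF S uu_sym _] \<open>dm \<sigma> x\<close> by blast
  qed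
  have 2: "ll \<tau> x y \<longleftrightarrow> cd \<tau> y \<and> (0::nat) = 0" if "cd \<tau> x" for x y
  proof -
    have "rank \<tau> \<le> 1" using rs(2) by simp
    then have "ll \<tau> x y" if "cd \<tau> y" using rank_le_1_cd[OF T _ \<open>cd \<tau> x\<close> that] by blast
    then show ?thesis using ll_cd[OF T _ \<open>cd \<tau> x\<close>] by blast
  qed
  \<comment> \<open>One side is changed at a time: the intermediate element has the domain of
    \<sigma> and the codomain of \<tau>.\<close>
  obtain \<rho> where R: "\<rho> \<in> PP n" "uu \<rho> = uu \<sigma>" "ll \<rho> = ll \<tau>" "\<And>x y. ul \<rho> x y \<longleftrightarrow> dm \<sigma> x \<and> cd \<tau> y \<and> (0::nat) = 0"
    by (rule partition_with_cross[OF S T, of "dm \<sigma>" "\<lambda>_. 0" "cd \<tau>" "\<lambda>_. 0"]) (use 1 2 in blast)+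
  have d: "dm \<rho> = dm \<sigma>" unfolding fun_eq_iff dm_def[of \<rho>] R(4) using rank_1_ex(2)[OF T rs(2)] by blast
  have c: "cd \<rho> = cd \<tau>" unfolding fun_eq_iff cd_def[of \<rho>] R(4) using rank_1_ex(1)[OF S rs(1)] by blast
  have rr: "rank \<rho> = 1" using rank_cong[OF R(1) S R(2) d] rs by simp
  have h1: "hat \<sigma> = hat \<rho>" "hat \<rho> = hat \<tau>" using hat_eq_iff[OF S R(1)] hat_eq_iff[OF R(1) T] R(2,3) ul by simp_all
  have "(el d (i + 0) \<sigma>, el d (i + 0) \<rho>) \<in> \<theta>"
    by (rule mu_pairs_cd[OF A' B' r' h' eq' ne' S rs(1) R(1) rr h1(1) d[symmetric]])
  moreover have "(el d (i + 0) \<rho>, el d (i + 0) \<tau>) \<in> \<theta>"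
    by (rule mu_pairs_dm[OF A B r h eq ne R(1) rr T rs(2) h1(2) c])
  ultimately show ?thesis using tran by simp
qed

end

section \<open>Generated congruences, case by case\<close>

lemma normal_closure_iff: "\<sigma> \<in> normal_closure G \<pi> \<longleftrightarrow> (\<forall>N. N \<lhd> G \<longrightarrow> \<pi> \<in> N \<longrightarrow> \<sigma> \<in> N)"
  by (auto simp: normal_closure_def)

lemma normal_closure_normal:
  assumes "\<pi> permutes {1..q}" shows "normal_closure (sym_group q) \<pi> \<lhd> sym_group q"
proof -
  let ?C = "normal_closure (sym_group q) \<pi>"
  have D: "\<sigma> \<in> N" if "\<sigma> \<in> ?C" "N \<lhd> sym_group q" "\<pi> \<in> N" for \<sigma> N
    using that unfolding normal_closure_iff by blast
  have I: "\<sigma> \<in> ?C" if "\<And>N. N \<lhd> sym_group q \<Longrightarrow> \<pi> \<in> N \<Longrightarrow> \<sigma> \<in> N" for \<sigma>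
    using that unfolding normal_closure_iff by blast
  show ?thesis
    unfolding sym_group_normal_iff
  proof (intro conjI ballI allI impI)
    show "\<sigma> permutes {1..q}" if "\<sigma> \<in> ?C" for \<sigma>
      using D[OF that sym_group_normal_self] assms by (simp add: sym_group_carrier)
    show "id \<in> ?C" by (rule I) (simp add: sym_group_normal_iff)
    show "\<sigma> \<circ> \<tau> \<in> ?C" if "\<sigma> \<in> ?C" "\<tau> \<in> ?C" for \<sigma> \<tau>
    proof (rule I)
      fix N assume N: "N \<lhd> sym_group q" "\<pi> \<in> N"
      with D[OF that(1) N] D[OF that(2) N] show "\<sigma> \<circ> \<tau> \<in> N" unfolding sym_group_normal_iff by blast
    qed
    show "inv' \<sigma> \<in> ?C" if "\<sigma> \<in> ?C" for \<sigma>
    proof (rule I)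
      fix N assume N: "N \<lhd> sym_group q" "\<pi> \<in> N"
      with D[OF that N] show "inv' \<sigma> \<in> N" unfolding sym_group_normal_iff by blast
    qed
    show "\<tau> \<circ> \<sigma> \<circ> inv' \<tau> \<in> ?C" if "\<tau> permutes {1..q}" "\<sigma> \<in> ?C" for \<sigma> \<tau>
    proof (rule I)
      fix N assume N: "N \<lhd> sym_group q" "\<pi> \<in> N"
      with D[OF that(2) N] that(1) show "\<tau> \<circ> \<sigma> \<circ> inv' \<tau> \<in> N" unfolding sym_group_normal_iff by blast
    qed
  qed
qed

lemma H_twist_carrier:
  assumes A: "\<alpha> \<in> PP n" and B: "\<beta> \<in> PP n" and eq: "uu \<alpha> = uu \<beta>" "dm \<alpha> = dm \<beta>" "ll \<alpha> = ll \<beta>" "cd \<alpha> = cd \<beta>"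
  shows "H_twist (carrier (sym_group (rank \<alpha>))) \<alpha> \<beta>"
proof -
  obtain a b where numbering: "numbering \<alpha> a b" by (rule numbering_exists[OF A])
  obtain \<pi> where "\<pi> permutes {1..rank \<alpha>}" "twist \<alpha> a b \<pi> \<beta>"
    by (rule twist_between[OF A B numbering]) (simp_all add: eq)
  then show ?thesis by (intro hnI[OF A B numbering]) (simp_all add: sym_group_carrier)
qed

lemma permutes_12_unique:
  assumes "\<pi> permutes {1..2}" "\<pi>' permutes {1..2}" "\<pi> \<noteq> id" "\<pi>' \<noteq> id" shows "\<pi> = (\<pi>' :: nat \<Rightarrow> nat)"
proof -
  have "{1..2::nat} = {1, 2}" by auto
  then show ?thesis using assms permutes_doubleton_iff[of _ 1 "2::nat"] by auto
qed

lemma cong_gen_self: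
  assumes n: "n \<ge> 1" and a: "a \<in> carrier (TPM n d)"
  shows "cong_gen (TPM n d) a a = Id_on (carrier (TPM n d))"
proof (rule cong_gen_eqI[OF Id_congruence])
  fix \<theta> assume "congruence_on (TPM n d) \<theta>"
  then interpret tcong n d \<theta> by (rule tcong.intro[OF n])
  show "Id_on (carrier (TPM n d)) \<subseteq> \<theta>" by (rule Id_subset)
qed (rule Id_onI[OF a])

lemma cong_gen_case_ii:
  assumes n: "n \<ge> 1" and sp: "std_pair n d i \<alpha> j \<beta>" and c: "case_ii n d i \<alpha> j \<beta>"
  shows "cong_gen (TPM n d) (Some (i, \<alpha>)) (Some (j, \<beta>)) = rees_cong (TPM n d) (Itw n d (rank \<alpha>) i \<union> Itw n d (rank \<beta>) j)"
proof (rule cong_gen_eqI[OF rees_congruence[OF tideal_Un[OF tideal_Itw tideal_Itw]]])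
  show "(Some (i, \<alpha>), Some (j, \<beta>)) \<in> rees_cong (TPM n d) (Itw n d (rank \<alpha>) i \<union> Itw n d (rank \<beta>) j)"
    using sp by (simp add: rees_cong_def std_pair_def)
  fix \<theta> assume "congruence_on (TPM n d) \<theta>" and h: "(Some (i, \<alpha>), Some (j, \<beta>)) \<in> \<theta>"
  then interpret tcong n d \<theta> by (intro tcong.intro[OF n])
  note z = case_ii_zero[OF sp c h]
  show "rees_cong (TPM n d) (Itw n d (rank \<alpha>) i \<union> Itw n d (rank \<beta>) j) \<subseteq> \<theta>"
    by (rule rees_subset) (use zero_Itw[OF z(1)] zero_Itw[OF z(2)] in blast)
qed

lemma cong_gen_zero:
  assumes n: "n \<ge> 1" and A: "\<alpha> \<in> PP n" "i \<le> d"
  shows "cong_gen (TPM n d) (Some (i, \<alpha>)) None = rees_cong (TPM n d) (Itw n d (rank \<alpha>) i)"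
proof (rule cong_gen_eqI[OF rees_congruence[OF tideal_Itw]])
  show "(Some (i, \<alpha>), None) \<in> rees_cong (TPM n d) (Itw n d (rank \<alpha>) i)" using A by (simp add: rees_cong_def)
  fix \<theta> assume "congruence_on (TPM n d) \<theta>" and h: "(Some (i, \<alpha>), None) \<in> \<theta>"
  then interpret tcong n d \<theta> by (intro tcong.intro[OF n])
  have "(el d i \<alpha>, None) \<in> \<theta>" using h A(2) by (simp add: el_le)
  from zero_Itw[OF zeroI[OF A(1) this]] show "rees_cong (TPM n d) (Itw n d (rank \<alpha>) i) \<subseteq> \<theta>" by (rule rees_subset)
qed

lemma cong_gen_case_iii:
  assumes n: "n \<ge> 1" and A: "\<alpha> \<in> PP n" and B: "\<beta> \<in> PP n" and i: "i \<le> d" and r: "rank \<alpha> \<ge> 3"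
    and eq: "uu \<alpha> = uu \<beta>" "dm \<alpha> = dm \<beta>" "ll \<alpha> = ll \<beta>" "cd \<alpha> = cd \<beta>" and ne: "\<alpha> \<noteq> \<beta>" and pd: "perm_diff \<alpha> \<beta> \<pi>"
  shows "cong_gen (TPM n d) (Some (i, \<alpha>)) (Some (i, \<beta>)) =
    cg n d (mat_iii d (rank \<alpha>) i (normal_closure (sym_group (rank \<alpha>)) \<pi>))" (is "_ = cg n d (mat_iii d _ i ?N)")
proof -
  obtain a b where "\<pi> permutes {1..rank \<alpha>}" by (rule perm_diffE[OF A B pd])
  then have N: "?N \<lhd> sym_group (rank \<alpha>)" by (rule normal_closure_normal)
  show ?thesis
  proof (rule cong_gen_eqI[OF mat_iii_congruence[OF n N]])
    have "H_twist ?N \<alpha> \<beta>" unfolding H_twist_def using eq pd normal_closure_iff[of \<pi>] by blast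
    then show "(Some (i, \<alpha>), Some (i, \<beta>)) \<in> cg n d (mat_iii d (rank \<alpha>) i ?N)"
      unfolding cg_simps cg_pair_iff[OF n A B] using A B i rank_cong[OF A B eq(1,2)] by (simp add: mat_iii_def)
    fix \<theta> assume "congruence_on (TPM n d) \<theta>" and h: "(Some (i, \<alpha>), Some (i, \<beta>)) \<in> \<theta>"
    then interpret tcong n d \<theta> by (intro tcong.intro[OF n])
    have h': "(el d i \<alpha>, el d i \<beta>) \<in> \<theta>" using h i by (simp add: el_le)
    show "cg n d (mat_iii d (rank \<alpha>) i ?N) \<subseteq> \<theta>" by (rule mat_iii_subset[OF A B h' r eq ne pd refl N])
  qed
qed

lemma mat_iv_gen: "i \<le> d \<Longrightarrow> mat_iv d i = mat_gen d i i EMu True"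
  by (auto simp: fun_eq_iff mat_iv_def mat_gen_def)

lemma mat_v_gen: "mat_v d i \<zeta> = mat_gen d i i \<zeta> False"
  by (auto simp: fun_eq_iff mat_v_def mat_gen_def)

lemma mat_vi_gen: "i \<le> d \<Longrightarrow> mat_vi d i j = mat_gen d i j EMu False"
  by (auto simp: fun_eq_iff mat_vi_def mat_gen_def)

lemma cong_gen_case_iv:
  assumes n: "n \<ge> 1" and A: "\<alpha> \<in> PP n" and B: "\<beta> \<in> PP n" and i: "i \<le> d" and r: "rank \<alpha> = 2"
    and eq: "uu \<alpha> = uu \<beta>" "dm \<alpha> = dm \<beta>" "ll \<alpha> = ll \<beta>" "cd \<alpha> = cd \<beta>" and ne: "\<alpha> \<noteq> \<beta>"
  shows "cong_gen (TPM n d) (Some (i, \<alpha>)) (Some (i, \<beta>)) = cg n d (mat_iv d i)"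
  unfolding mat_iv_gen[OF i]
proof (rule cong_gen_eqI)
  show "congruence_on (TPM n d) (cg n d (mat_gen d i i EMu True))" by (rule mat_gen_congruence[OF n]) (use i in simp_all)
  show "(Some (i, \<alpha>), Some (i, \<beta>)) \<in> cg n d (mat_gen d i i EMu True)"
    unfolding cg_simps cg_pair_iff[OF n A B] using A B i H_twist_carrier[OF A B eq] rank_cong[OF A B eq(1,2)] r
    by (simp add: mat_gen_def)
  fix \<theta> assume "congruence_on (TPM n d) \<theta>" and h0: "(Some (i, \<alpha>), Some (i, \<beta>)) \<in> \<theta>"
  then interpret tcong n d \<theta> by (intro tcong.intro[OF n])
  have h: "(el d i \<alpha>, el d i \<beta>) \<in> \<theta>" using h0 i by (simp add: el_le)
  \<comment> \<open>For \<theta> itself, \<open>mu_from_rank_2\<close> yields a pair with different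
    codomains; for the mirror image it yields one with different domains. Both enter
    \<open>mu_full\<close>.\<close>
  interpret D: tcong n d "tdual \<theta>" by (rule dual)
  obtain \<gamma> \<delta> where c: "\<gamma> \<in> PP n" "\<delta> \<in> PP n" "rank \<gamma> = 1" "rank \<delta> = 1" "hat \<gamma> = hat \<delta>" "cd \<gamma> \<noteq> cd \<delta>"
    "(el d i \<gamma>, el d i \<delta>) \<in> \<theta>"
    by (rule mu_from_rank_2[OF A B r h eq(1-3) ne])
  have sn: "star \<alpha> \<noteq> star \<beta>" using ne star_star by metis
  have sp: "star \<alpha> \<in> PP n" "star \<beta> \<in> PP n" "rank (star \<alpha>) = 2" using A B r by simp_all
  have sh: "(el d i (star \<alpha>), el d i (star \<beta>)) \<in> tdual \<theta>" using h by simp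
  have su: "uu (star \<alpha>) = uu (star \<beta>)" "dm (star \<alpha>) = dm (star \<beta>)" "ll (star \<alpha>) = ll (star \<beta>)" using eq by simp_all
  obtain \<gamma>' \<delta>' where s: "\<gamma>' \<in> PP n" "\<delta>' \<in> PP n" "rank \<gamma>' = 1" "rank \<delta>' = 1" "hat \<gamma>' = hat \<delta>'" "cd \<gamma>' \<noteq> cd \<delta>'"
    "(el d i \<gamma>', el d i \<delta>') \<in> tdual \<theta>"
    by (rule D.mu_from_rank_2[OF sp sh su sn])
  have sh: "star \<gamma>' \<in> PP n" "star \<delta>' \<in> PP n" "rank (star \<gamma>') = 1" "rank (star \<delta>') = 1" using s by simp_all
  have se: "hat (star \<gamma>') = hat (star \<delta>')"
    unfolding hat_eq_iff[OF sh(1,2)] using s(5) unfolding hat_eq_iff[OF s(1,2)] by simp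
  have sn: "dm (star \<gamma>') \<noteq> dm (star \<delta>')" using s(6) by simp
  have st: "(el d i (star \<gamma>'), el d i (star \<delta>')) \<in> \<theta>" using s(7) by simp
  have cne: "\<gamma> \<noteq> \<delta>" using c(6) by blast
  show "cg n d (mat_gen d i i EMu True) \<subseteq> \<theta>"
  proof (rule mat_gen_subset)
    show "(el d (Suc i + k) \<sigma>, el d (i + k) (hat \<sigma>)) \<in> \<theta>" if "\<sigma> \<in> PP n" "rank \<sigma> = 1" for \<sigma> k
      by (rule mu_drop[OF c(1-4) c(7) c(5) cne that])
    show "(el d i \<sigma>, el d i \<tau>) \<in> \<theta>" if "\<sigma> \<in> PP n" "\<tau> \<in> PP n" "rank \<sigma> = 1" "rank \<tau> = 1" "hat \<sigma> = hat \<tau>" for \<sigma> \<tau>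
      by (rule mu_full[OF sh st se sn c(1-4) c(7) c(5,6) that])
    show "(el d (i + k) \<sigma>, el d (i + k) \<tau>) \<in> \<theta>"
      if S: "\<sigma> \<in> PP n" and T: "\<tau> \<in> PP n" and rs: "rank \<sigma> = 2" and hh: "H_twist (carrier (sym_group 2)) \<sigma> \<tau>" for \<sigma> \<tau> k
    proof -
      obtain a b where numbering: "numbering \<alpha> a b" by (rule numbering_exists[OF A])
      obtain \<pi> where p: "\<pi> permutes {1..rank \<alpha>}" "twist \<alpha> a b \<pi> \<beta>"
        by (rule twist_between[OF A B numbering]) (simp_all add: eq)
      have pid: "\<pi> \<noteq> id" using twist_unique[OF A B twist_id[OF numbering]] p(2) ne by blast
      obtain a' b' where numbering': "numbering \<sigma> a' b'" by (rule numbering_exists[OF S])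
      have "carrier (sym_group 2) \<lhd> sym_group (rank \<sigma>)" using sym_group_normal_self rs by simp
      then obtain \<pi>' where p': "\<pi>' permutes {1..rank \<sigma>}" "twist \<sigma> a' b' \<pi>' \<tau>" by (rule H_twist_twist[OF S T _ hh numbering'])
      show ?thesis
      proof (cases "\<pi>' = id")
        case True
        then have "\<sigma> = \<tau>" using twist_unique[OF S T twist_id[OF numbering']] p'(2) by blast
        then show ?thesis using reflx[OF el_carrier[OF S]] by blast
      next
        case False
        \<comment> \<open>The symmetric group on two letters has only one element besides the
          identity, so the given pair realises every twist.\<close>
        then have "\<pi>' = \<pi>" using permutes_12_unique[of \<pi>' \<pi>] p(1) p'(1) pid r rs by simp
        then show ?thesis by (intro twist_transport[OF A B h numbering p S _ numbering' T]) (use p'(2) r rs in simp_all)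
      qed
    qed
  qed (use i in simp_all)
qed

lemma cong_gen_case_v:
  assumes n: "n \<ge> 1" and A: "\<alpha> \<in> PP n" and B: "\<beta> \<in> PP n" and i: "i \<le> d" and r: "rank \<alpha> = 1" "rank \<beta> = 1"
    and eq: "hat \<alpha> = hat \<beta>"
    and z: "(\<zeta> = EMu \<and> dm \<alpha> \<noteq> dm \<beta> \<and> cd \<alpha> \<noteq> cd \<beta>) \<or> (\<zeta> = EMuUp \<and> dm \<alpha> = dm \<beta> \<and> \<alpha> \<noteq> \<beta>) \<or>
      (\<zeta> = EMuDown \<and> cd \<alpha> = cd \<beta> \<and> \<alpha> \<noteq> \<beta>)"
  shows "cong_gen (TPM n d) (Some (i, \<alpha>)) (Some (i, \<beta>)) = cg n d (mat_v d i \<zeta>)"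
  unfolding mat_v_gen
proof (rule cong_gen_eqI)
  have ul: "uu \<alpha> = uu \<beta>" "ll \<alpha> = ll \<beta>" using eq hat_eq_iff[OF A B] by simp_all
  have ne: "\<alpha> \<noteq> \<beta>" using z by blast
  have ne2: "dm \<alpha> \<noteq> dm \<beta> \<or> cd \<alpha> \<noteq> cd \<beta>" using rank_le_1_eqI[OF A B _ _ ul] r ne by auto
  have z': "\<zeta> = EMu \<or> \<zeta> = EMuUp \<or> \<zeta> = EMuDown" using z by blast
  show "congruence_on (TPM n d) (cg n d (mat_gen d i i \<zeta> False))"
    by (rule mat_gen_congruence[OF n]) (use i z' in simp_all)
  show "(Some (i, \<alpha>), Some (i, \<beta>)) \<in> cg n d (mat_gen d i i \<zeta> False)"
    unfolding cg_simps cg_pair_iff[OF n A B] using A B i ul r z by (auto simp: mat_gen_def)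
  fix \<theta> assume "congruence_on (TPM n d) \<theta>" and h0: "(Some (i, \<alpha>), Some (i, \<beta>)) \<in> \<theta>"
  then interpret tcong n d \<theta> by (intro tcong.intro[OF n])
  have h: "(el d i \<alpha>, el d i \<beta>) \<in> \<theta>" using h0 i by (simp add: el_le)
  show "cg n d (mat_gen d i i \<zeta> False) \<subseteq> \<theta>"
  proof (rule mat_gen_subset)
    show "\<zeta> = EMu \<or> \<zeta> = EMuUp \<or> \<zeta> = EMuDown" by (rule z')
    show "(el d (Suc i + k) \<sigma>, el d (i + k) (hat \<sigma>)) \<in> \<theta>" if "\<sigma> \<in> PP n" "rank \<sigma> = 1" for \<sigma> k
      by (rule mu_drop[OF A B r h eq ne that])
    show "(el d i \<sigma>, el d i \<tau>) \<in> \<theta>"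
      if st: "\<sigma> \<in> PP n" "\<tau> \<in> PP n" "rank \<sigma> = 1" "rank \<tau> = 1" "hat \<sigma> = hat \<tau>"
        and up: "\<zeta> = EMuUp \<longrightarrow> dm \<sigma> = dm \<tau>" and dn: "\<zeta> = EMuDown \<longrightarrow> cd \<sigma> = cd \<tau>" for \<sigma> \<tau>
      using z
    proof (elim disjE conjE)
      assume "dm \<alpha> \<noteq> dm \<beta>" "cd \<alpha> \<noteq> cd \<beta>"
      \<comment> \<open>A pair that differs in both domain and codomain plays both roles in
        \<open>mu_full\<close>.\<close>
      then show ?thesis by (intro mu_full[OF A B r h eq _ A B r h eq _ st])
    next
      assume "\<zeta> = EMuUp" "dm \<alpha> = dm \<beta>"
      then have "cd \<alpha> \<noteq> cd \<beta>" "dm \<sigma> = dm \<tau>" using ne2 up by blast+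
      from mu_pairs_cd[OF A B r h eq this(1) st(1,3,2,4,5) this(2), of 0] show ?thesis by simp
    next
      assume "\<zeta> = EMuDown" "cd \<alpha> = cd \<beta>"
      then have "dm \<alpha> \<noteq> dm \<beta>" "cd \<sigma> = cd \<tau>" using ne2 dn by blast+
      from mu_pairs_dm[OF A B r h eq this(1) st(1,3,2,4,5) this(2), of 0] show ?thesis by simp
    qed
  qed (use i in simp_all)
qed

lemma cong_gen_case_vi:
  assumes n: "n \<ge> 1" and A: "\<alpha> \<in> PP n" and i: "Suc j \<le> d" and r: "rank \<alpha> = 1"
  shows "cong_gen (TPM n d) (Some (Suc j, \<alpha>)) (Some (j, hat \<alpha>)) = cg n d (mat_vi d (Suc j) j)"
  unfolding mat_vi_gen[OF i]
proof (rule cong_gen_eqI)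
  let ?M = "mat_gen d (Suc j) j EMu False"
  have B: "hat \<alpha> \<in> PP n" by (rule hat_PP_joined(1)[OF A])
  have r0: "rank (hat \<alpha>) = 0" by (rule rank_hat[OF A])
  have ul: "uu \<alpha> = uu (hat \<alpha>)" "ll \<alpha> = ll (hat \<alpha>)"
    using hat_eq_iff[OF A B] hat_rank_0[OF B r0] by simp_all
  show "congruence_on (TPM n d) (cg n d ?M)" by (rule mat_gen_congruence[OF n]) (use i in simp_all)
  have mr: "min_row d ?M 1 = Suc d" "min_row d ?M 0 = d" by (rule mat_gen_min_row[OF n]; use i in simp)+
  have "?M 1 (Suc j) = EMu" "?M 0 j = EMu" using i by (simp_all add: mat_gen_def)
  then show "(Some (Suc j, \<alpha>), Some (j, hat \<alpha>)) \<in> cg n d ?M"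
    unfolding cg_simps cg_pair_iff[OF n A B] r r0 mr using A B i ul[symmetric] by simp
  fix \<theta> assume "congruence_on (TPM n d) \<theta>" and h0: "(Some (Suc j, \<alpha>), Some (j, hat \<alpha>)) \<in> \<theta>"
  then interpret tcong n d \<theta> by (intro tcong.intro[OF n])
  have h: "(el d (Suc j) \<alpha>, el d j (hat \<alpha>)) \<in> \<theta>" using h0 i by (simp add: el_le)
  show "cg n d ?M \<subseteq> \<theta>"
  proof (rule mat_gen_subset)
    show "(el d (Suc j + k) \<sigma>, el d (j + k) (hat \<sigma>)) \<in> \<theta>" if "\<sigma> \<in> PP n" "rank \<sigma> = 1" for \<sigma> k
      by (rule mu_transport_hat[OF A r h that])
  qed (use i in simp_all)
qed

lemma cong_gen_case_vii:
  assumes n: "n \<ge> 1" and A: "\<alpha> \<in> PP n" and ij: "Suc j < i" "i \<le> d" and r: "rank \<alpha> = 1"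
  shows "cong_gen (TPM n d) (Some (i, \<alpha>)) (Some (j, hat \<alpha>)) = cg n d (mat_vii d i j)"
proof (rule cong_gen_eqI[OF mat_vii_congruence[OF n ij]])
  have B: "hat \<alpha> \<in> PP n" by (rule hat_PP_joined(1)[OF A])
  have r0: "rank (hat \<alpha>) = 0" by (rule rank_hat[OF A])
  have ul: "uu \<alpha> = uu (hat \<alpha>)" "ll \<alpha> = ll (hat \<alpha>)"
    using hat_eq_iff[OF A B] hat_rank_0[OF B r0] by simp_all
  have "mat_vii d i j 1 i = EMu" "mat_vii d i j 0 j = EMu" by (simp_all add: mat_vii_def)
  then show "(Some (i, \<alpha>), Some (j, hat \<alpha>)) \<in> cg n d (mat_vii d i j)"
    unfolding cg_simps cg_pair_iff[OF n A B] r r0 mat_vii_min_row[OF ij] using A B ij ul[symmetric] by simp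
  fix \<theta> assume "congruence_on (TPM n d) \<theta>" and h0: "(Some (i, \<alpha>), Some (j, hat \<alpha>)) \<in> \<theta>"
  then interpret tcong n d \<theta> by (intro tcong.intro[OF n])
  have h: "(el d i \<alpha>, el d j (hat \<alpha>)) \<in> \<theta>" using h0 ij by (simp add: el_le)
  show "cg n d (mat_vii d i j) \<subseteq> \<theta>" by (rule mat_vii_subset[OF A r h ij])
qed

lemma mu_iff:
  assumes n: "n \<ge> 1" and A: "\<alpha> \<in> PP n" and B: "\<beta> \<in> PP n" and r: "rank \<alpha> = 1" "rank \<beta> = 1"
  shows "(\<alpha>, \<beta>) \<in> mu_up n \<longleftrightarrow> hat \<alpha> = hat \<beta> \<and> dm \<alpha> = dm \<beta>"
    and "(\<alpha>, \<beta>) \<in> mu_down n \<longleftrightarrow> hat \<alpha> = hat \<beta> \<and> cd \<alpha> = cd \<beta>"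
    and "(\<alpha>, \<beta>) \<in> mu_one n \<longleftrightarrow> hat \<alpha> = hat \<beta>"
    and "(\<alpha>, \<beta>) \<in> Id_on (Dcl n 1) \<longleftrightarrow> \<alpha> = \<beta>"
proof -
  note h = hat_eq_iff[OF A B]
  have D: "\<alpha> \<in> Dcl n 1" "\<beta> \<in> Dcl n 1" using A B r by (simp_all add: Dcl_def)
  show "(\<alpha>, \<beta>) \<in> mu_up n \<longleftrightarrow> hat \<alpha> = hat \<beta> \<and> dm \<alpha> = dm \<beta>"
    unfolding mu_up_def mem_Collect_eq case_prod_conv mem_Times_iff fst_conv snd_conv green_R_PM[OF n A B] h using D by blast
  show "(\<alpha>, \<beta>) \<in> mu_down n \<longleftrightarrow> hat \<alpha> = hat \<beta> \<and> cd \<alpha> = cd \<beta>"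
    unfolding mu_down_def mem_Collect_eq case_prod_conv mem_Times_iff fst_conv snd_conv green_L_PM[OF n A B] h using D by blast
  show "(\<alpha>, \<beta>) \<in> mu_one n \<longleftrightarrow> hat \<alpha> = hat \<beta>"
    unfolding mu_one_def using A B r by auto
  show "(\<alpha>, \<beta>) \<in> Id_on (Dcl n 1) \<longleftrightarrow> \<alpha> = \<beta>" using D by auto
qed

lemma std_pairD:
  assumes "std_pair n d i \<alpha> j \<beta>"
  shows "\<alpha> \<in> PP n" "\<beta> \<in> PP n" "i \<le> d" "j \<le> d" "rank \<beta> \<le> rank \<alpha>" "rank \<alpha> = rank \<beta> \<Longrightarrow> i \<le> j"
  using assms by (simp_all add: std_pair_def)

context
  fixes n d :: nat
  assumes n: "n \<ge> 1"
begin

lemma std_case_iii: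
  assumes sp: "std_pair n d i \<alpha> j \<beta>" and c: "case_iii n d i \<alpha> j \<beta>"
  shows "\<exists>\<pi>. perm_diff \<alpha> \<beta> \<pi>"
    and "perm_diff \<alpha> \<beta> \<pi> \<Longrightarrow> cong_gen (TPM n d) (Some (i, \<alpha>)) (Some (j, \<beta>)) =
      cg n d (mat_iii d (rank \<alpha>) i (normal_closure (sym_group (rank \<alpha>)) \<pi>))"
proof -
  note s = std_pairD[OF sp]
  have r: "rank \<alpha> \<ge> 3" and ij: "i = j" and ne: "\<alpha> \<noteq> \<beta>"
    and eq: "uu \<alpha> = uu \<beta>" "dm \<alpha> = dm \<beta>" "ll \<alpha> = ll \<beta>" "cd \<alpha> = cd \<beta>"
    using c unfolding case_iii_def green_H_TPM[OF n s(1-4)] by blast+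
  show "\<exists>\<pi>. perm_diff \<alpha> \<beta> \<pi>" using H_twist_carrier[OF s(1,2) eq] unfolding H_twist_def by blast
  show "cong_gen (TPM n d) (Some (i, \<alpha>)) (Some (j, \<beta>)) =
      cg n d (mat_iii d (rank \<alpha>) i (normal_closure (sym_group (rank \<alpha>)) \<pi>))" if "perm_diff \<alpha> \<beta> \<pi>"
    unfolding ij[symmetric] by (rule cong_gen_case_iii[OF n s(1-3) r eq ne that])
qed

lemma std_case_iv:
  assumes sp: "std_pair n d i \<alpha> j \<beta>" and c: "case_iv n d i \<alpha> j \<beta>"
  shows "cong_gen (TPM n d) (Some (i, \<alpha>)) (Some (j, \<beta>)) = cg n d (mat_iv d i)"
proof -
  note s = std_pairD[OF sp]
  have r: "rank \<alpha> = 2" and ij: "i = j" and ne: "\<alpha> \<noteq> \<beta>"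
    and eq: "uu \<alpha> = uu \<beta>" "dm \<alpha> = dm \<beta>" "ll \<alpha> = ll \<beta>" "cd \<alpha> = cd \<beta>"
    using c unfolding case_iv_def green_H_TPM[OF n s(1-4)] by blast+
  show ?thesis unfolding ij[symmetric] by (rule cong_gen_case_iv[OF n s(1-3) r eq ne])
qed

lemma std_case_v:
  assumes sp: "std_pair n d i \<alpha> j \<beta>" and c: "case_v n i \<alpha> j \<beta> \<zeta>"
  shows "cong_gen (TPM n d) (Some (i, \<alpha>)) (Some (j, \<beta>)) = cg n d (mat_v d i \<zeta>)"
proof -
  note s = std_pairD[OF sp]
  have r: "rank \<alpha> = 1" "rank \<beta> = 1" and ij: "i = j" using c unfolding case_v_def by blast+
  have z: "hat \<alpha> = hat \<beta>" "(\<zeta> = EMu \<and> dm \<alpha> \<noteq> dm \<beta> \<and> cd \<alpha> \<noteq> cd \<beta>) \<or> (\<zeta> = EMuUp \<and> dm \<alpha> = dm \<beta> \<and> \<alpha> \<noteq> \<beta>) \<or>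
      (\<zeta> = EMuDown \<and> cd \<alpha> = cd \<beta> \<and> \<alpha> \<noteq> \<beta>)"
    using c unfolding case_v_def Diff_iff Un_iff mu_iff[OF n s(1,2) r] by blast+
  show ?thesis unfolding ij[symmetric] by (rule cong_gen_case_v[OF n s(1-3) r z])
qed

lemma std_case_vi:
  assumes sp: "std_pair n d i \<alpha> j \<beta>" and c: "case_vi i \<alpha> j \<beta>"
  shows "cong_gen (TPM n d) (Some (i, \<alpha>)) (Some (j, \<beta>)) = cg n d (mat_vi d i j)"
proof -
  note s = std_pairD[OF sp]
  have r: "rank \<alpha> = 1" and ij: "i = Suc j" and b: "\<beta> = hat \<alpha>" using c unfolding case_vi_def by simp_all
  show ?thesis unfolding ij b by (rule cong_gen_case_vi[OF n s(1) s(3)[unfolded ij] r])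
qed

lemma std_case_vii:
  assumes sp: "std_pair n d i \<alpha> j \<beta>" and c: "case_vii i \<alpha> j \<beta>"
  shows "cong_gen (TPM n d) (Some (i, \<alpha>)) (Some (j, \<beta>)) = cg n d (mat_vii d i j)"
proof -
  note s = std_pairD[OF sp]
  have r: "rank \<alpha> = 1" and ij: "Suc j < i" and b: "\<beta> = hat \<alpha>" using c unfolding case_vii_def by simp_all
  show ?thesis unfolding b by (rule cong_gen_case_vii[OF n s(1) ij s(3) r])
qed

lemma std_pair_cases:
  assumes sp: "std_pair n d i \<alpha> j \<beta>"
  obtains "i = j" "\<alpha> = \<beta>" | "case_ii n d i \<alpha> j \<beta>" | "case_iii n d i \<alpha> j \<beta>" | "case_iv n d i \<alpha> j \<beta>"
    | \<zeta> where "case_v n i \<alpha> j \<beta> \<zeta>" | "case_vi i \<alpha> j \<beta>" | "case_vii i \<alpha> j \<beta>"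
proof -
  note s = std_pairD[OF sp]
  consider (id) "(i, \<alpha>) = (j, \<beta>)" | (two) "rank \<alpha> \<ge> 2" "(i, \<alpha>) \<noteq> (j, \<beta>)"
    | (one) "rank \<alpha> = 1" "rank \<beta> = 1" "(i, \<alpha>) \<noteq> (j, \<beta>)" | (zero) "rank \<alpha> = 0" "(i, \<alpha>) \<noteq> (j, \<beta>)" | (mix) "rank \<alpha> = 1" "rank \<beta> = 0"
    using s(5) by linarith
  then show thesis
  proof cases
    case id
    then show ?thesis using that(1) by blast
  next
    case two
    then have "case_ii n d i \<alpha> j \<beta> \<or> case_iii n d i \<alpha> j \<beta> \<or> case_iv n d i \<alpha> j \<beta>"
      unfolding case_ii_def case_iii_def case_iv_def Let_def by auto
    then show ?thesis using that(2-4) by blast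
  next
    case zero
    \<comment> \<open>In rank 0 an element equals its hat, so distinct elements differ in the index
      or in the hat.\<close>
    then have "case_ii n d i \<alpha> j \<beta>"
      using s(5) rank_0_eqI[OF s(1,2)] unfolding case_ii_def Let_def by auto
    then show ?thesis by (rule that(2))
  next
    case one
    show ?thesis
    proof (cases "i = j \<and> hat \<alpha> = hat \<beta>")
      case False
      then have "case_ii n d i \<alpha> j \<beta>" using one unfolding case_ii_def Let_def by simp
      then show ?thesis by (rule that(2))
    next
      case True
      then have "\<alpha> \<noteq> \<beta>" using one(3) by blast
      then have "case_v n i \<alpha> j \<beta> EMu \<or> case_v n i \<alpha> j \<beta> EMuUp \<or> case_v n i \<alpha> j \<beta> EMuDown"
        unfolding case_v_def Diff_iff Un_iff mu_iff[OF n s(1,2) one(1,2)]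
        by (cases "dm \<alpha> = dm \<beta>"; cases "cd \<alpha> = cd \<beta>") (simp_all add: True one(1,2))
      then show ?thesis using that(5) by blast
    qed
  next
    case mix
    have "case_ii n d i \<alpha> j \<beta> \<or> case_vi i \<alpha> j \<beta> \<or> case_vii i \<alpha> j \<beta>"
    proof (cases "i \<le> j \<or> hat \<alpha> \<noteq> \<beta>")
      case True
      then show ?thesis using mix unfolding case_ii_def Let_def by simp
    next
      case False
      then have "i = j + 1 \<or> i > j + 1" by linarith
      then show ?thesis using mix False unfolding case_vi_def case_vii_def by blast
    qed
    then show ?thesis using that(2,6,7) by blast
  qed
qed

end

theorem theorem8p1:
  fixes n d :: nat
  assumes "n \<ge> 1"
  shows
    "(\<forall>i \<alpha> j \<beta> q r. std_pair n d i \<alpha> j \<beta> \<and> q = rank \<alpha> \<and> r = rank \<beta> \<longrightarrow>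
       (let S = TPM n d; a = Some (i, \<alpha>); b = Some (j, \<beta>) in
         (a = b \<longrightarrow> cong_gen S a b = Id_on (carrier S)) \<and>
         (case_ii n d i \<alpha> j \<beta> \<longrightarrow>
            cong_gen S a b = rees_cong S (Itw n d q i \<union> Itw n d r j)) \<and>
         cong_gen S a None = rees_cong S (Itw n d q i) \<and>
         (case_iii n d i \<alpha> j \<beta> \<longrightarrow>
            (\<exists>\<pi>. perm_diff \<alpha> \<beta> \<pi>) \<and>
            (\<forall>\<pi>. perm_diff \<alpha> \<beta> \<pi> \<longrightarrow>
               cong_gen S a b = cg n d (mat_iii d q i (normal_closure (sym_group q) \<pi>)))) \<and>
         (case_iv n d i \<alpha> j \<beta> \<longrightarrow> cong_gen S a b = cg n d (mat_iv d i)) \<and>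
         (\<forall>\<zeta>. case_v n i \<alpha> j \<beta> \<zeta> \<longrightarrow> cong_gen S a b = cg n d (mat_v d i \<zeta>)) \<and>
         (case_vi i \<alpha> j \<beta> \<longrightarrow> cong_gen S a b = cg n d (mat_vi d i j)) \<and>
         (case_vii i \<alpha> j \<beta> \<longrightarrow> cong_gen S a b = cg n d (mat_vii d i j))))
     \<and> cong_gen (TPM n d) None None = Id_on (carrier (TPM n d))
     \<and> {cong_gen (TPM n d) a b | a b. a \<in> carrier (TPM n d) \<and> b \<in> carrier (TPM n d)} =
         {Id_on (carrier (TPM n d))}
         \<union> {rees_cong (TPM n d) (Itw n d (rank \<alpha>) i \<union> Itw n d (rank \<beta>) j) | i \<alpha> j \<beta>.
              std_pair n d i \<alpha> j \<beta> \<and> case_ii n d i \<alpha> j \<beta>}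
         \<union> {rees_cong (TPM n d) (Itw n d (rank \<alpha>) i) | i \<alpha>. Some (i, \<alpha>) \<in> carrier (TPM n d)}
         \<union> {cg n d (mat_iii d (rank \<alpha>) i (normal_closure (sym_group (rank \<alpha>)) \<pi>)) | i \<alpha> j \<beta> \<pi>.
              std_pair n d i \<alpha> j \<beta> \<and> case_iii n d i \<alpha> j \<beta> \<and> perm_diff \<alpha> \<beta> \<pi>}
         \<union> {cg n d (mat_iv d i) | i \<alpha> j \<beta>. std_pair n d i \<alpha> j \<beta> \<and> case_iv n d i \<alpha> j \<beta>}
         \<union> {cg n d (mat_v d i \<zeta>) | i \<alpha> j \<beta> \<zeta>. std_pair n d i \<alpha> j \<beta> \<and> case_v n i \<alpha> j \<beta> \<zeta>}
         \<union> {cg n d (mat_vi d i j) | i \<alpha> j \<beta>. std_pair n d i \<alpha> j \<beta> \<and> case_vi i \<alpha> j \<beta>}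
         \<union> {cg n d (mat_vii d i j) | i \<alpha> j \<beta>. std_pair n d i \<alpha> j \<beta> \<and> case_vii i \<alpha> j \<beta>}"
  (is "?I \<and> ?II \<and> ?L = ?R")
proof (intro conjI)
  note n = assms
  note vals = cong_gen_self[OF n] cong_gen_case_ii[OF n] cong_gen_zero[OF n] std_case_iii[OF n] std_case_iv[OF n]
    std_case_v[OF n] std_case_vi[OF n] std_case_vii[OF n]
  show ?I
  proof (intro allI impI, elim conjE, hypsubst, unfold Let_def, intro conjI allI impI)
    fix i \<alpha> j \<beta> assume sp: "std_pair n d i \<alpha> j \<beta>"
    have c: "Some (i, \<alpha>) \<in> carrier (TPM n d)" using sp by (simp add: std_pair_def)
    show "cong_gen (TPM n d) (Some (i, \<alpha>)) (Some (j, \<beta>)) = Id_on (carrier (TPM n d))" if "Some (i, \<alpha>) = Some (j, \<beta>)"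
      unfolding that[symmetric] by (rule cong_gen_self[OF n c])
    show "cong_gen (TPM n d) (Some (i, \<alpha>)) None = rees_cong (TPM n d) (Itw n d (rank \<alpha>) i)"
      by (rule cong_gen_zero[OF n]) (use c in simp_all)
  qed (rule vals; assumption)+
  show ?II by (rule cong_gen_self[OF n None_carrier])
  show "?L = ?R"
  proof (intro Set.equalityI subsetI)
    fix \<rho> assume "\<rho> \<in> ?L"
    then obtain a b where r: "\<rho> = cong_gen (TPM n d) a b" and ab: "a \<in> carrier (TPM n d)" "b \<in> carrier (TPM n d)" by blast
    have std: "cong_gen (TPM n d) (Some (i, \<alpha>)) (Some (j, \<beta>)) \<in> ?R" if sp: "std_pair n d i \<alpha> j \<beta>" for i \<alpha> j \<beta>
    proof (cases rule: std_pair_cases[OF n sp])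
      case 1
      have "Some (j, \<beta>) \<in> carrier (TPM n d)" using sp by (simp add: std_pair_def)
      then have "cong_gen (TPM n d) (Some (i, \<alpha>)) (Some (j, \<beta>)) = Id_on (carrier (TPM n d))"
        using cong_gen_self[OF n] 1 by simp
      then show ?thesis by simp
    next
      case 2
      show ?thesis unfolding cong_gen_case_ii[OF n sp 2]
        by (rule UnI1, rule UnI1, rule UnI1, rule UnI1, rule UnI1, rule UnI1, rule UnI2, rule CollectI, intro exI conjI, rule refl, rule sp, rule 2)
    next
      case 3
      obtain \<pi> where p: "perm_diff \<alpha> \<beta> \<pi>" using std_case_iii(1)[OF n sp 3] by blast
      show ?thesis unfolding std_case_iii(2)[OF n sp 3 p]
        by (rule UnI1, rule UnI1, rule UnI1, rule UnI1, rule UnI2, rule CollectI, intro exI conjI, rule refl, rule sp, rule 3, rule p)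
    next
      case 4
      show ?thesis unfolding std_case_iv[OF n sp 4]
        by (rule UnI1, rule UnI1, rule UnI1, rule UnI2, rule CollectI, intro exI conjI, rule refl, rule sp, rule 4)
    next
      case (5 \<zeta>)
      show ?thesis unfolding std_case_v[OF n sp 5]
        by (rule UnI1, rule UnI1, rule UnI2, rule CollectI, intro exI conjI, rule refl, rule sp, rule 5)
    next
      case 6
      show ?thesis unfolding std_case_vi[OF n sp 6]
        by (rule UnI1, rule UnI2, rule CollectI, intro exI conjI, rule refl, rule sp, rule 6)
    next
      case 7
      show ?thesis unfolding std_case_vii[OF n sp 7]
        by (rule UnI2, rule CollectI, intro exI conjI, rule refl, rule sp, rule 7)
    qed
    have zero: "cong_gen (TPM n d) (Some (i, \<alpha>)) None \<in> ?R" if "Some (i, \<alpha>) \<in> carrier (TPM n d)" for i \<alpha>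
    proof -
      have a: "\<alpha> \<in> PP n" "i \<le> d" using that by simp_all
      show ?thesis
        unfolding cong_gen_zero[OF n a]
        by (rule UnI1, rule UnI1, rule UnI1, rule UnI1, rule UnI1, rule UnI2, rule CollectI, intro exI conjI, rule refl, rule that)
    qed
    show "\<rho> \<in> ?R"
    proof (cases "a = None \<or> b = None")
      case True
      then consider "a = None" "b = None" | i \<alpha> where "a = Some (i, \<alpha>)" "b = None" | i \<alpha> where "a = None" "b = Some (i, \<alpha>)"
        by (metis option.exhaust surj_pair)
      then show ?thesis
      proof cases
        case 1
        have "\<rho> = Id_on (carrier (TPM n d))" unfolding r 1 by (rule cong_gen_self[OF n None_carrier])
        then show ?thesis by simp
      next
        case (2 i \<alpha>)
        show ?thesis unfolding r 2 by (rule zero) (use ab 2 in simp)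
      next
        case (3 i \<alpha>)
        show ?thesis unfolding r 3 cong_gen_commute[of _ None] by (rule zero) (use ab 3 in simp)
      qed
    next
      case False
      then obtain i \<alpha> j \<beta> where e: "a = Some (i, \<alpha>)" "b = Some (j, \<beta>)" by (metis not_None_eq surj_pair)
      \<comment> \<open>A generated congruence does not depend on the order of the pair, and at
        least one of the two orders is standard.\<close>
      have "std_pair n d i \<alpha> j \<beta> \<or> std_pair n d j \<beta> i \<alpha>" using ab unfolding e std_pair_def by linarith
      then show ?thesis
      proof
        assume "std_pair n d i \<alpha> j \<beta>"
        then show ?thesis unfolding r e by (rule std)
      next
        assume "std_pair n d j \<beta> i \<alpha>"
        then show ?thesis unfolding r e cong_gen_commute[of _ "Some (i, \<alpha>)"] by (rule std)
      qed
    qed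
  next
    fix \<rho> assume R: "\<rho> \<in> ?R"
    have I: "cong_gen (TPM n d) a b \<in> ?L" if "a \<in> carrier (TPM n d)" "b \<in> carrier (TPM n d)" for a b
      using that by blast
    have std: "cong_gen (TPM n d) (Some (i, \<alpha>)) (Some (j, \<beta>)) \<in> ?L" if "std_pair n d i \<alpha> j \<beta>" for i \<alpha> j \<beta>
      using that unfolding std_pair_def by (intro I) blast+
    show "\<rho> \<in> ?L"
      using R
    proof (elim UnE CollectE exE conjE singletonE, goal_cases)
      case 1
      then show ?case using I[OF None_carrier None_carrier] cong_gen_self[OF n None_carrier] by metis
    next
      case (2 i \<alpha> j \<beta>)
      show ?case unfolding 2(1) cong_gen_case_ii[OF n 2(2,3), symmetric] by (rule std[OF 2(2)])
    next
      case (3 i \<alpha>)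
      have a: "\<alpha> \<in> PP n" "i \<le> d" using 3(2) by simp_all
      show ?case unfolding 3(1) cong_gen_zero[OF n a, symmetric] by (rule I[OF 3(2) None_carrier])
    next
      case (4 i \<alpha> j \<beta> \<pi>)
      show ?case unfolding 4(1) std_case_iii(2)[OF n 4(2-4), symmetric] by (rule std[OF 4(2)])
    next
      case (5 i \<alpha> j \<beta>)
      show ?case unfolding 5(1) std_case_iv[OF n 5(2,3), symmetric] by (rule std[OF 5(2)])
    next
      case (6 i \<alpha> j \<beta> \<zeta>)
      show ?case unfolding 6(1) std_case_v[OF n 6(2,3), symmetric] by (rule std[OF 6(2)])
    next
      case (7 i \<alpha> j \<beta>)
      show ?case unfolding 7(1) std_case_vi[OF n 7(2,3), symmetric] by (rule std[OF 7(2)])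
    next
      case (8 i \<alpha> j \<beta>)
      show ?case unfolding 8(1) std_case_vii[OF n 8(2,3), symmetric] by (rule std[OF 8(2)])
    qed
  qed
qed

end
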